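(* Let $(R,\mathfrak{m})$ be a two dimensional complete regular local ring and let $G$ be a finite group acting on $R$. Assume $|G|$ is a unit in $R$. Then $R^G$ is a normal Cohen-Macaulay domain of dimension two. Furthermore $R^G$ is of finite Cohen-Macaulay type.
   Context: $G$ acts on $R$ means that a group homomorphism $G\to\operatorname{Aut}(R)$ into the group of ring automorphisms of $R$ is given. $R^G=\{x\in R\mid\sigma(x)=x\text{ for all }\sigma\in G\}$. A (Henselian) Cohen-Macaulay local ring is of finite Cohen-Macaulay type (finite representation type) if it has, up to isomorphism, only finitely many indecomposable maximal Cohen-Macaulay modules. *)

theory Defs
  imports "HOL-Algebra.Algebra" "HOL-Library.Extended_Nat"
begin

section \<open>Group actions on rings and invariants\<close>

definition ring_Aut :: "('a, 'm) ring_scheme \<Rightarrow> ('a \<Rightarrow> 'a) monoid"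
  where "ring_Aut R = BijGroup (carrier R) \<lparr>carrier := ring_hom R R \<inter> Bij (carrier R)\<rparr>"

definition ring_action ::
  "('g, 'n) monoid_scheme \<Rightarrow> ('a, 'm) ring_scheme \<Rightarrow> ('g \<Rightarrow> 'a \<Rightarrow> 'a) \<Rightarrow> bool"
  where "ring_action G R \<phi> \<longleftrightarrow> \<phi> \<in> hom G (ring_Aut R)"

definition invariant_ring ::
  "('g, 'n) monoid_scheme \<Rightarrow> ('g \<Rightarrow> 'a \<Rightarrow> 'a) \<Rightarrow> ('a, 'm) ring_scheme \<Rightarrow> ('a, 'm) ring_scheme"
  where "invariant_ring G \<phi> R =
    R \<lparr>carrier := {x \<in> carrier R. \<forall>\<sigma> \<in> carrier G. \<phi> \<sigma> x = x}\<rparr>"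

section \<open>Local rings, dimension, regularity, completeness\<close>

definition local_ring :: "('a, 'm) ring_scheme \<Rightarrow> bool"
  where "local_ring R \<longleftrightarrow> cring R \<and> (\<exists>!I. maximalideal I R)"

definition max_ideal :: "('a, 'm) ring_scheme \<Rightarrow> 'a set"
  where "max_ideal R = (THE I. maximalideal I R)"

text \<open>The supremum of the lengths of chains of prime ideals. It is 0 on the zero ring, which
  is never local.\<close>

definition krull_dim :: "('a, 'm) ring_scheme \<Rightarrow> enat"
  where "krull_dim R = Sup {enat n | n. \<exists>P :: nat \<Rightarrow> 'a set.
    (\<forall>i\<le>n. primeideal (P i) R) \<and> (\<forall>i<n. P i \<subset> P (Suc i))}"

definition embedding_dim :: "('a, 'm) ring_scheme \<Rightarrow> enat"
  where "embedding_dim R =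
    Inf {enat (card A) | A. finite A \<and> A \<subseteq> carrier R \<and> Idl\<^bsub>R\<^esub> A = max_ideal R}"

definition regular_local_ring :: "('a, 'm) ring_scheme \<Rightarrow> bool"
  where "regular_local_ring R \<longleftrightarrow>
    local_ring R \<and> noetherian_ring R \<and> embedding_dim R = krull_dim R"

text \<open>Completeness for the \<open>I\<close>-adic topology: it is separated and every Cauchy sequence
  converges. Powers are taken in the semiring of ideals, so the 0th power is the whole ring.\<close>

definition adic_Cauchy :: "('a, 'm) ring_scheme \<Rightarrow> 'a set \<Rightarrow> (nat \<Rightarrow> 'a) \<Rightarrow> bool"
  where "adic_Cauchy R I s \<longleftrightarrow>
    (\<forall>n::nat. \<exists>N. \<forall>i\<ge>N. \<forall>j\<ge>N. s i \<ominus>\<^bsub>R\<^esub> s j \<in> I [^]\<^bsub>ideals_set R\<^esub> n)"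

definition adic_tendsto :: "('a, 'm) ring_scheme \<Rightarrow> 'a set \<Rightarrow> (nat \<Rightarrow> 'a) \<Rightarrow> 'a \<Rightarrow> bool"
  where "adic_tendsto R I s x \<longleftrightarrow>
    (\<forall>n::nat. \<exists>N. \<forall>i\<ge>N. s i \<ominus>\<^bsub>R\<^esub> x \<in> I [^]\<^bsub>ideals_set R\<^esub> n)"

definition adic_complete :: "('a, 'm) ring_scheme \<Rightarrow> 'a set \<Rightarrow> bool"
  where "adic_complete R I \<longleftrightarrow>
    (\<Inter>n::nat. I [^]\<^bsub>ideals_set R\<^esub> n) = {\<zero>\<^bsub>R\<^esub>} \<and>
    (\<forall>s. (\<forall>i. s i \<in> carrier R) \<and> adic_Cauchy R I s \<longrightarrow>
      (\<exists>x \<in> carrier R. adic_tendsto R I s x))"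

section \<open>Fields of fractions and normal domains\<close>

definition frac_rel :: "('a, 'm) ring_scheme \<Rightarrow> (('a \<times> 'a) \<times> ('a \<times> 'a)) set"
  where "frac_rel R = {((a, b), (c, d)).
    a \<in> carrier R \<and> b \<in> carrier R - {\<zero>\<^bsub>R\<^esub>} \<and> c \<in> carrier R \<and> d \<in> carrier R - {\<zero>\<^bsub>R\<^esub>} \<and>
    a \<otimes>\<^bsub>R\<^esub> d = c \<otimes>\<^bsub>R\<^esub> b}"

definition fraction :: "('a, 'm) ring_scheme \<Rightarrow> 'a \<Rightarrow> 'a \<Rightarrow> ('a \<times> 'a) set"
  where "fraction R a b = frac_rel R `` {(a, b)}"

definition frac_field :: "('a, 'm) ring_scheme \<Rightarrow> ('a \<times> 'a) set ring"
  where "frac_field R = \<lparr>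
    carrier = (carrier R \<times> (carrier R - {\<zero>\<^bsub>R\<^esub>})) // frac_rel R,
    monoid.mult = \<lambda>p q. \<Union>(a, b) \<in> p. \<Union>(c, d) \<in> q. fraction R (a \<otimes>\<^bsub>R\<^esub> c) (b \<otimes>\<^bsub>R\<^esub> d),
    one = fraction R \<one>\<^bsub>R\<^esub> \<one>\<^bsub>R\<^esub>,
    ring.zero = fraction R \<zero>\<^bsub>R\<^esub> \<one>\<^bsub>R\<^esub>,
    add = \<lambda>p q. \<Union>(a, b) \<in> p. \<Union>(c, d) \<in> q.
      fraction R (a \<otimes>\<^bsub>R\<^esub> d \<oplus>\<^bsub>R\<^esub> c \<otimes>\<^bsub>R\<^esub> b) (b \<otimes>\<^bsub>R\<^esub> d)\<rparr>"

definition integral_over :: "('a, 'm) ring_scheme \<Rightarrow> 'a set \<Rightarrow> 'a \<Rightarrow> bool"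
  where "integral_over L S x \<longleftrightarrow>
    (\<exists>p \<in> carrier (univ_poly L S). p \<noteq> [] \<and> lead_coeff p = \<one>\<^bsub>L\<^esub> \<and> ring.eval L p x = \<zero>\<^bsub>L\<^esub>)"

definition normal_domain :: "('a, 'm) ring_scheme \<Rightarrow> bool"
  where "normal_domain R \<longleftrightarrow> domain R \<and>
    (let S = (\<lambda>a. fraction R a \<one>\<^bsub>R\<^esub>) ` carrier R in
      \<forall>x \<in> carrier (frac_field R). integral_over (frac_field R) S x \<longrightarrow> x \<in> S)"

section \<open>Modules\<close>

definition submodule_span ::
  "('a, 'm) ring_scheme \<Rightarrow> ('a, 'b, 'n) module_scheme \<Rightarrow> 'b set \<Rightarrow> 'b set"
  where "submodule_span R M A = (\<lambda>N. submodule N R M) hull A"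

definition fin_gen_module :: "('a, 'm) ring_scheme \<Rightarrow> ('a, 'b, 'n) module_scheme \<Rightarrow> bool"
  where "fin_gen_module R M \<longleftrightarrow> module R M \<and>
    (\<exists>A. finite A \<and> A \<subseteq> carrier M \<and> submodule_span R M A = carrier M)"

definition indecomposable_module :: "('a, 'm) ring_scheme \<Rightarrow> ('a, 'b, 'n) module_scheme \<Rightarrow> bool"
  where "indecomposable_module R M \<longleftrightarrow> module R M \<and> carrier M \<noteq> {\<zero>\<^bsub>M\<^esub>} \<and>
    (\<forall>N1 N2. submodule N1 R M \<and> submodule N2 R M \<and>
       N1 \<inter> N2 = {\<zero>\<^bsub>M\<^esub>} \<and> N1 <+>\<^bsub>M\<^esub> N2 = carrier M \<longrightarrow>
       N1 = {\<zero>\<^bsub>M\<^esub>} \<or> N2 = {\<zero>\<^bsub>M\<^esub>})"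

text \<open>Isomorphisms ignore the fields \<open>mult\<close> and \<open>one\<close> that the record type \<open>module\<close> inherits
  from \<open>ring\<close> and that carry no meaning for a module.\<close>

definition module_iso ::
  "('a, 'm) ring_scheme \<Rightarrow> ('a, 'b, 'n) module_scheme \<Rightarrow> ('a, 'c, 'k) module_scheme \<Rightarrow> ('b \<Rightarrow> 'c) set"
  where "module_iso R M N = {f. bij_betw f (carrier M) (carrier N) \<and>
    (\<forall>x \<in> carrier M. \<forall>y \<in> carrier M. f (x \<oplus>\<^bsub>M\<^esub> y) = f x \<oplus>\<^bsub>N\<^esub> f y) \<and>
    (\<forall>a \<in> carrier R. \<forall>x \<in> carrier M. f (a \<odot>\<^bsub>M\<^esub> x) = a \<odot>\<^bsub>N\<^esub> f x)}"

definition self_module :: "('a, 'm) ring_scheme \<Rightarrow> ('a, 'a) module"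
  where "self_module R = \<lparr>carrier = carrier R, monoid.mult = monoid.mult R, one = one R,
    ring.zero = ring.zero R, add = add R, smult = monoid.mult R\<rparr>"

section \<open>Depth and Cohen-Macaulay rings and modules\<close>

text \<open>The submodule $(x_1, \dots, x_n) M$.\<close>

definition seq_mult ::
  "('a, 'm) ring_scheme \<Rightarrow> ('a, 'b, 'n) module_scheme \<Rightarrow> 'a list \<Rightarrow> 'b set"
  where "seq_mult R M xs = submodule_span R M {x \<odot>\<^bsub>M\<^esub> y | x y. x \<in> set xs \<and> y \<in> carrier M}"

text \<open>The second conjunct says, without forming quotient modules, that $x_{i+1}$ is a
  nonzerodivisor on $M/(x_1, \dots, x_i) M$; the last one that $M/(x_1, \dots, x_n) M \neq 0$.\<close>

definition regular_sequence ::
  "('a, 'm) ring_scheme \<Rightarrow> ('a, 'b, 'n) module_scheme \<Rightarrow> 'a list \<Rightarrow> bool"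
  where "regular_sequence R M xs \<longleftrightarrow> set xs \<subseteq> carrier R \<and>
    (\<forall>i < length xs. \<forall>y \<in> carrier M.
       xs ! i \<odot>\<^bsub>M\<^esub> y \<in> seq_mult R M (take i xs) \<longrightarrow> y \<in> seq_mult R M (take i xs)) \<and>
    seq_mult R M xs \<noteq> carrier M"

text \<open>Only meant for local \<open>R\<close> and nonzero finitely generated \<open>M\<close>; the zero module, which has no
  regular sequence at all, gets depth 0.\<close>

definition depth :: "('a, 'm) ring_scheme \<Rightarrow> ('a, 'b, 'n) module_scheme \<Rightarrow> enat"
  where "depth R M =
    Sup {enat (length xs) | xs. set xs \<subseteq> max_ideal R \<and> regular_sequence R M xs}"

definition CM_local_ring :: "('a, 'm) ring_scheme \<Rightarrow> bool"
  where "CM_local_ring R \<longleftrightarrow>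
    local_ring R \<and> noetherian_ring R \<and> depth R (self_module R) = krull_dim R"

definition MCM_module :: "('a, 'm) ring_scheme \<Rightarrow> ('a, 'b, 'n) module_scheme \<Rightarrow> bool"
  where "MCM_module R M \<longleftrightarrow> fin_gen_module R M \<and> depth R M = krull_dim R"

text \<open>HOL cannot quantify over the types of module elements inside a formula, so the type is a
  parameter: \<open>finite_CM_type TYPE('b) R\<close> speaks about the modules with elements in \<open>'b\<close>. The
  intended notion is the one with \<open>'b\<close> arbitrary. (Every finitely generated module is
  isomorphic to one with elements in \<open>(nat \<Rightarrow> 'a) set\<close>, a quotient of a free module of finite
  rank, so the instance at this type implies all others.)\<close>

definition finite_CM_type :: "'b itself \<Rightarrow> ('a, 'm) ring_scheme \<Rightarrow> bool"
  where "finite_CM_type (_ :: 'b itself) R \<longleftrightarrow> CM_local_ring R \<and>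
    (\<exists>\<M> :: ('a, 'b) module set. finite \<M> \<and>
      (\<forall>N \<in> \<M>. MCM_module R N \<and> indecomposable_module R N) \<and>
      (\<forall>M :: ('a, 'b) module. MCM_module R M \<and> indecomposable_module R M \<longrightarrow>
        (\<exists>N \<in> \<M>. module_iso R M N \<noteq> {})))"

end

theory Submission
  imports Defs
begin

text \<open>Let \<open>S\<close> be the ring of invariants, \<open>m\<close> the maximal ideal of \<open>R\<close>. Averaging over
  \<open>G\<close> is possible because \<open>|G|\<close> is invertible, and it transfers finiteness, primes and
  divisibility from \<open>R\<close> to \<open>S\<close>.

  The ring \<open>R\<close>: if \<open>m = (x, y)\<close>, an instance of Krull's principal ideal theorem
  (\<open>principal_ideal_theorem\<close>) makes \<open>R / x R\<close> a discrete valuation ring, and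
  \<open>R\<close> a domain in which \<open>x\<close> is prime. A finitely generated module on which
  \<open>x, y\<close> behave like a regular sequence is free (\<open>regular_imp_free\<close>); applied to ideals this
  shows that the nonmaximal primes of \<open>R\<close> are principal and that \<open>R\<close> is integrally closed.

  The ring \<open>S\<close>: \<open>R\<close> is a Noetherian \<open>S\<close>-module
  (\<open>R_noetherian_over_S\<close>). Going up gives \<open>dim S \<le> 2\<close>; conversely a prime
  \<open>x R\<close> cannot contain all of \<open>m \<inter> S\<close>. The norm of \<open>x\<close> and any element
  of \<open>m \<inter> S\<close> outside \<open>x R\<close> form a regular sequence, so \<open>S\<close> has depth
  two. A fraction integral over \<open>S\<close> lies in \<open>R\<close> and is invariant.

  Finite type: let \<open>M\<close> be an indecomposable maximal Cohen-Macaulay \<open>S\<close>-module. The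
  \<open>R\<close>-module \<open>H\<close> of \<open>S\<close>-linear maps \<open>M \<rightarrow> R\<close> is free
  over \<open>R\<close>, \<open>G\<close> acts on it, and \<open>M\<close> is recovered as the module of equivariant
  forms on \<open>H\<close> (\<open>reflexive\<close>), so the \<open>S\<close>-linear endomorphisms of
  \<open>M\<close> are the equivariant ones of \<open>H\<close>. Since \<open>H / m H\<close> is semisimple as a
  representation of \<open>G\<close> over \<open>R / m\<close>, and idempotents lift along the \<open>m\<close>-adic
  filtration by completeness, indecomposability makes \<open>H / m H\<close> simple, and the endomorphism ring of
  \<open>M\<close> local (\<open>M_endo_local\<close>). Averaging the coordinate functions of \<open>H\<close> writes
  the identity of \<open>M\<close> as a sum of maps that factor through \<open>R\<close>; by locality one of them is
  invertible, and \<open>M\<close> is a direct summand of the \<open>S\<close>-module \<open>R\<close>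
  (\<open>retract_of_R\<close>). As \<open>R\<close> is Noetherian over \<open>S\<close>, it splits into finitely many
  indecomposable summands, and by locality again \<open>M\<close> is isomorphic to one of them
  (\<open>finitely_many_summands\<close>).\<close>

section \<open>Spans, Nakayama's lemma and Noetherian modules\<close>

text \<open>The submodule \<open>I A\<close>, with coefficients restricted to \<open>I\<close>: for an ideal \<open>I\<close> and
  a generating set \<open>A\<close> of \<open>M\<close> this is \<open>I M\<close>.\<close>

inductive_set lin_span :: "('a, 'b, 'n) module_scheme \<Rightarrow> 'a set \<Rightarrow> 'b set \<Rightarrow> 'b set"
  for M (structure) and I A where
  zero: "\<zero> \<in> lin_span M I A"
| step: "[|z \<in> lin_span M I A; c \<in> I; a \<in> A|] ==> z \<oplus> c \<odot> a \<in> lin_span M I A"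

definition noetherian_module :: "('a, 'm) ring_scheme \<Rightarrow> ('a, 'b, 'n) module_scheme \<Rightarrow> bool"
  where "noetherian_module R M \<longleftrightarrow>
    (\<forall>N. submodule N R M \<longrightarrow> (\<exists>A. finite A \<and> A \<subseteq> N \<and> lin_span M (carrier R) A = N))"

lemma lin_span_mono:
  assumes "A \<subseteq> B" "I \<subseteq> J" "z \<in> lin_span M I A" shows "z \<in> lin_span M J B"
  using assms(3) by induction (use assms(1,2) in "auto intro: lin_span.intros")

lemma set_add_iff: "x \<in> N <+>\<^bsub>M\<^esub> L \<longleftrightarrow> (\<exists>p\<in>N. \<exists>q\<in>L. x = p \<oplus>\<^bsub>M\<^esub> q)"
  unfolding set_add_def' by auto

lemma set_addI: "p \<in> N ==> q \<in> L ==> p \<oplus>\<^bsub>M\<^esub> q \<in> N <+>\<^bsub>M\<^esub> L"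
  unfolding set_add_def' by auto

context module
begin

abbreviation M_add (infixl "\<oplus>\<^sub>M" 65) where "v \<oplus>\<^sub>M w \<equiv> v \<oplus>\<^bsub>M\<^esub> w"
abbreviation M_minus (infixl "\<ominus>\<^sub>M" 65) where "v \<ominus>\<^sub>M w \<equiv> v \<ominus>\<^bsub>M\<^esub> w"
abbreviation M_uminus ("\<ominus>\<^sub>M _" [81] 80) where "\<ominus>\<^sub>M v \<equiv> \<ominus>\<^bsub>M\<^esub> v"
abbreviation M_smult (infixl "\<odot>\<^sub>M" 70) where "r \<odot>\<^sub>M v \<equiv> r \<odot>\<^bsub>M\<^esub> v"
abbreviation M_zero ("\<zero>\<^sub>M") where "\<zero>\<^sub>M \<equiv> \<zero>\<^bsub>M\<^esub>"

lemma submodule_sub: "[|submodule N R M; v \<in> N; w \<in> N|] ==> v \<ominus>\<^sub>M w \<in> N"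
  by (simp add: a_minus_def submoduleE)

lemma submodule_0: "submodule N R M ==> \<zero>\<^sub>M \<in> N"
  using subgroup.one_closed[OF submodule.axioms(1)] by auto

lemma submodule_Int:
  assumes N: "submodule N R M" and L: "submodule L R M" shows "submodule (N \<inter> L) R M"
  by (rule submoduleI)
     (use submoduleE(1,3,4,5)[OF N] submoduleE(1,3,4,5)[OF L] submodule_0[OF N] submodule_0[OF L]
      in "simp_all add: le_infI1")

lemma lin_span_carrier:
  assumes "A \<subseteq> carrier M" "I \<subseteq> carrier R" shows "lin_span M I A \<subseteq> carrier M"
proof
  fix z assume "z \<in> lin_span M I A"
  then show "z \<in> carrier M"
    by induction (use assms in auto)
qed

lemma lin_span_minimal:
  assumes N: "submodule N R M" and "A \<subseteq> N" "I \<subseteq> carrier R" shows "lin_span M I A \<subseteq> N"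
proof
  fix z assume "z \<in> lin_span M I A"
  then show "z \<in> N"
    by induction (use assms(2,3) submoduleE(4,5)[OF N] submodule_0[OF N] in "simp_all add: subsetD")
qed

lemma lin_span_add:
  assumes A: "A \<subseteq> carrier M" "I \<subseteq> carrier R"
    and z: "z \<in> lin_span M I A" and w: "w \<in> lin_span M I A"
  shows "z \<oplus>\<^sub>M w \<in> lin_span M I A"
  using w
proof induction
  case zero
  then show ?case using z lin_span_carrier[OF A] by auto
next
  case (step w c a)
  have "z \<in> carrier M" "w \<in> carrier M" "c \<odot>\<^sub>M a \<in> carrier M"
    using z step lin_span_carrier[OF A] A by auto
  then have "z \<oplus>\<^sub>M (w \<oplus>\<^sub>M c \<odot>\<^sub>M a) = (z \<oplus>\<^sub>M w) \<oplus>\<^sub>M c \<odot>\<^sub>M a"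
    by (simp add: M.a_assoc)
  then show ?case using step lin_span.step by metis
qed

lemma lin_span_smult:
  assumes A: "A \<subseteq> carrier M" and I: "ideal I R"
    and r: "r \<in> carrier R" and w: "w \<in> lin_span M I A"
  shows "r \<odot>\<^sub>M w \<in> lin_span M I A"
  using w
proof induction
  case zero
  then show ?case using r lin_span.zero by simp
next
  case (step w c a)
  have Ic: "I \<subseteq> carrier R" using ideal.Icarr[OF I] by auto
  have "w \<in> carrier M" "c \<in> carrier R" "a \<in> carrier M"
    using step lin_span_carrier[OF A Ic] A Ic by auto
  then have "r \<odot>\<^sub>M (w \<oplus>\<^sub>M c \<odot>\<^sub>M a) = r \<odot>\<^sub>M w \<oplus>\<^sub>M (r \<otimes> c) \<odot>\<^sub>M a"
    using r by (simp add: smult_r_distr smult_assoc1)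
  moreover have "r \<otimes> c \<in> I" using ideal.I_l_closed[OF I] step r by auto
  ultimately show ?case using step lin_span.step by metis
qed

lemma lin_span_submodule:
  assumes A: "A \<subseteq> carrier M" and I: "ideal I R"
  shows "submodule (lin_span M I A) R M"
proof -
  have Ic: "I \<subseteq> carrier R" using ideal.Icarr[OF I] by auto
  show ?thesis
  proof (rule submoduleI)
    show "lin_span M I A \<subseteq> carrier M" using lin_span_carrier[OF A Ic] .
    show "\<zero>\<^sub>M \<in> lin_span M I A" by (rule lin_span.zero)
    fix a assume a: "a \<in> lin_span M I A"
    then have "a \<in> carrier M" using lin_span_carrier[OF A Ic] by auto
    then have "\<ominus>\<^sub>M a = (\<ominus> \<one>) \<odot>\<^sub>M a" by (simp add: smult_l_minus)
    then show "\<ominus>\<^sub>M a \<in> lin_span M I A" using lin_span_smult[OF A I _ a] by simp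
  qed (use lin_span_add[OF A Ic] lin_span_smult[OF A I] in auto)
qed

lemma lin_span_sub: "A \<subseteq> carrier M ==> submodule (lin_span M (carrier R) A) R M"
  using lin_span_submodule R.oneideal by blast

lemma lin_span_smult_gen:
  assumes "A \<subseteq> carrier M" "I \<subseteq> carrier R" "c \<in> I" "a \<in> A"
  shows "c \<odot>\<^sub>M a \<in> lin_span M I A"
proof -
  have "c \<odot>\<^sub>M a = \<zero>\<^sub>M \<oplus>\<^sub>M c \<odot>\<^sub>M a" using assms by (simp add: subsetD)
  then show ?thesis using assms lin_span.intros by metis
qed

lemma lin_span_incl:
  assumes "A \<subseteq> carrier M" shows "A \<subseteq> lin_span M (carrier R) A"
proof
  fix a assume a: "a \<in> A"
  then show "a \<in> lin_span M (carrier R) A"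
    using lin_span_smult_gen[OF assms _ R.one_closed a] assms by auto
qed

lemma lin_span_ideal_smult:
  assumes A: "A \<subseteq> carrier M" and I: "ideal I R" and c: "c \<in> I"
    and z: "z \<in> lin_span M (carrier R) A"
  shows "c \<odot>\<^sub>M z \<in> lin_span M I A"
  using z
proof induction
  case zero
  then show ?case using c ideal.Icarr[OF I] lin_span.zero by simp
next
  case (step w d a)
  have cc: "c \<in> carrier R" using c ideal.Icarr[OF I] by auto
  have "w \<in> carrier M" "a \<in> carrier M" using step lin_span_carrier[OF A] A by auto
  then have "c \<odot>\<^sub>M (w \<oplus>\<^sub>M d \<odot>\<^sub>M a) = c \<odot>\<^sub>M w \<oplus>\<^sub>M (c \<otimes> d) \<odot>\<^sub>M a"
    using cc step by (simp add: smult_r_distr smult_assoc1)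
  moreover have "c \<otimes> d \<in> I" using ideal.I_r_closed[OF I] step c by auto
  ultimately show ?case using step lin_span.step by metis
qed

lemma lin_span_lin_span:
  assumes A: "A \<subseteq> carrier M" and I: "ideal I R" and B: "B \<subseteq> lin_span M (carrier R) A"
  shows "lin_span M I B \<subseteq> lin_span M I A"
proof
  fix z assume "z \<in> lin_span M I B"
  then show "z \<in> lin_span M I A"
  proof induction
    case (step w d a)
    then show ?case
      using lin_span_ideal_smult[OF A I] B lin_span_add[OF A] ideal.Icarr[OF I] by blast
  qed (rule lin_span.zero)
qed

text \<open>The coefficient of one generator can be collected, which allows induction on the number of generators.\<close>

lemma lin_span_insert:
  assumes A: "A \<subseteq> carrier M" and v: "v \<in> carrier M" and I: "ideal I R"
    and z: "z \<in> lin_span M I (insert v A)"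
  shows "\<exists>c \<in> I. \<exists>w \<in> lin_span M I A. z = w \<oplus>\<^sub>M c \<odot>\<^sub>M v"
  using z
proof induction
  case zero
  have "\<zero> \<in> I" using additive_subgroup.zero_closed[OF ideal.axioms(1)[OF I]] .
  then show ?case using v lin_span.zero
    by (intro bexI[of _ "\<zero>"] bexI[of _ "\<zero>\<^sub>M"]) auto
next
  case (step z d a)
  have Ic: "I \<subseteq> carrier R" using ideal.Icarr[OF I] by auto
  obtain c w where cw: "c \<in> I" "w \<in> lin_span M I A" "z = w \<oplus>\<^sub>M c \<odot>\<^sub>M v"
    using step by blast
  have car: "w \<in> carrier M" "c \<in> carrier R" "d \<in> carrier R" "a \<in> carrier M"
    using cw step lin_span_carrier[OF A Ic] A v Ic by auto
  show ?case
  proof (cases "a = v")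
    case True
    have "z \<oplus>\<^sub>M d \<odot>\<^sub>M a = w \<oplus>\<^sub>M (c \<oplus> d) \<odot>\<^sub>M v"
      using car v True cw(3) by (simp add: smult_l_distr M.a_assoc)
    moreover have "c \<oplus> d \<in> I"
      using additive_subgroup.a_closed[OF ideal.axioms(1)[OF I]] cw step by auto
    ultimately show ?thesis using cw by blast
  next
    case False
    have "z \<oplus>\<^sub>M d \<odot>\<^sub>M a = (w \<oplus>\<^sub>M d \<odot>\<^sub>M a) \<oplus>\<^sub>M c \<odot>\<^sub>M v"
      using car v cw(3) by (simp add: M.a_ac)
    moreover have "w \<oplus>\<^sub>M d \<odot>\<^sub>M a \<in> lin_span M I A"
      using False step cw lin_span.step by (metis insertE)
    ultimately show ?thesis using cw by blast
  qed
qed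

lemma submodule_span_eq:
  assumes A: "A \<subseteq> carrier M" shows "submodule_span R M A = lin_span M (carrier R) A"
proof
  show "submodule_span R M A \<subseteq> lin_span M (carrier R) A"
    unfolding submodule_span_def hull_def using lin_span_incl[OF A] lin_span_sub[OF A] by blast
  show "lin_span M (carrier R) A \<subseteq> submodule_span R M A"
    unfolding submodule_span_def hull_def using lin_span_minimal by blast
qed

lemma submodule_set_add:
  assumes N: "submodule N R M" and L: "submodule L R M"
  shows "submodule (N <+>\<^bsub>M\<^esub> L) R M"
proof (rule submoduleI)
  have NL: "N \<subseteq> carrier M" "L \<subseteq> carrier M" using submoduleE(1) N L by auto
  show "N <+>\<^bsub>M\<^esub> L \<subseteq> carrier M" using NL by (auto simp: set_add_iff subsetD)
  have "\<zero>\<^sub>M \<oplus>\<^sub>M \<zero>\<^sub>M \<in> N <+>\<^bsub>M\<^esub> L"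
    by (rule set_addI[OF submodule_0[OF N] submodule_0[OF L]])
  then show "\<zero>\<^sub>M \<in> N <+>\<^bsub>M\<^esub> L" by simp
  fix a assume "a \<in> N <+>\<^bsub>M\<^esub> L"
  then obtain p q where pq: "p \<in> N" "q \<in> L" "a = p \<oplus>\<^sub>M q" by (auto simp: set_add_iff)
  have "\<ominus>\<^sub>M a = \<ominus>\<^sub>M p \<oplus>\<^sub>M \<ominus>\<^sub>M q" using pq NL by (simp add: M.minus_add subsetD)
  then show "\<ominus>\<^sub>M a \<in> N <+>\<^bsub>M\<^esub> L"
    using set_addI[OF submoduleE(3)[OF N pq(1)] submoduleE(3)[OF L pq(2)]] by simp
  { fix r assume r: "r \<in> carrier R"
    have "r \<odot>\<^sub>M a = r \<odot>\<^sub>M p \<oplus>\<^sub>M r \<odot>\<^sub>M q"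
      using pq NL r by (simp add: smult_r_distr subsetD)
    then show "r \<odot>\<^sub>M a \<in> N <+>\<^bsub>M\<^esub> L"
      using set_addI[OF submoduleE(4)[OF N r pq(1)] submoduleE(4)[OF L r pq(2)]] by simp }
  fix b assume "b \<in> N <+>\<^bsub>M\<^esub> L"
  then obtain p' q' where pq': "p' \<in> N" "q' \<in> L" "b = p' \<oplus>\<^sub>M q'" by (auto simp: set_add_iff)
  have "a \<oplus>\<^sub>M b = (p \<oplus>\<^sub>M p') \<oplus>\<^sub>M (q \<oplus>\<^sub>M q')"
    using pq pq' NL by (simp add: M.a_ac subsetD)
  then show "a \<oplus>\<^sub>M b \<in> N <+>\<^bsub>M\<^esub> L"
    using set_addI[OF submoduleE(5)[OF N pq(1) pq'(1)] submoduleE(5)[OF L pq(2) pq'(2)]] by simp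
qed

text \<open>Nakayama's lemma: a generator with coefficient \<open>1 - c\<close>, \<open>c \<in> m\<close>, can be eliminated, so
  that induction on the number of generators applies.\<close>

lemma nakayama:
  assumes m: "ideal m R" and unit: "\<And>c. c \<in> m ==> \<one> \<ominus> c \<in> Units R"
    and fin: "finite A" and A: "A \<subseteq> carrier M" and B: "submodule B R M"
    and sub: "A \<subseteq> B <+>\<^bsub>M\<^esub> lin_span M m A"
  shows "lin_span M (carrier R) A \<subseteq> B"
proof -
  note B_add = submoduleE(5)[OF B] and B_smult = submoduleE(4)[OF B]
  have mc: "m \<subseteq> carrier R" using ideal.Icarr[OF m] by auto
  have "A \<subseteq> B"
    using fin A sub
  proof (induction A)
    case (insert v A)
    have Av: "A \<subseteq> carrier M" "v \<in> carrier M" using insert by auto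
    let ?C = "B <+>\<^bsub>M\<^esub> lin_span M m A"
    have C: "submodule ?C R M" by (rule submodule_set_add[OF B lin_span_submodule[OF Av(1) m]])
    have decomp: "\<exists>c\<in>m. \<exists>w\<in>?C. z = w \<oplus>\<^sub>M c \<odot>\<^sub>M v" if "z \<in> insert v A" for z
    proof -
      obtain b u where bu: "b \<in> B" "u \<in> lin_span M m (insert v A)" "z = b \<oplus>\<^sub>M u"
        using insert.prems \<open>z \<in> insert v A\<close> by (auto simp: set_add_iff subset_iff)
      obtain c w where cw: "c \<in> m" "w \<in> lin_span M m A" "u = w \<oplus>\<^sub>M c \<odot>\<^sub>M v"
        using lin_span_insert[OF Av m bu(2)] by blast
      have "z = (b \<oplus>\<^sub>M w) \<oplus>\<^sub>M c \<odot>\<^sub>M v"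
        using bu cw Av mc lin_span_carrier[OF Av(1) mc] submoduleE(1)[OF B]
        by (simp add: M.a_assoc subsetD)
      then show ?thesis using cw(1) set_addI[OF bu(1) cw(2)] by blast
    qed
    obtain c w where cw: "c \<in> m" "w \<in> ?C" "v = w \<oplus>\<^sub>M c \<odot>\<^sub>M v" using decomp by blast
    have car: "c \<in> carrier R" "w \<in> carrier M" "c \<odot>\<^sub>M v \<in> carrier M"
      using cw mc submoduleE(1)[OF C] Av by auto
    have "(\<one> \<ominus> c) \<odot>\<^sub>M v = v \<ominus>\<^sub>M c \<odot>\<^sub>M v"
      using car Av by (simp add: R.minus_eq M.minus_eq smult_l_distr smult_l_minus)
    also have "\<dots> = w" using cw(3) car Av
      by (metis M.add.inv_solve_right' M.minus_eq)
    finally have w: "(\<one> \<ominus> c) \<odot>\<^sub>M v = w" .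
    have U: "\<one> \<ominus> c \<in> Units R" using unit cw by auto
    have "v = (inv (\<one> \<ominus> c) \<otimes> (\<one> \<ominus> c)) \<odot>\<^sub>M v" using U Av by simp
    also have "\<dots> = inv (\<one> \<ominus> c) \<odot>\<^sub>M w"
      using w U Av by (metis R.Units_closed R.Units_inv_closed smult_assoc1)
    finally have v: "v \<in> ?C" using submoduleE(4)[OF C _ cw(2)] U by auto
    have "A \<subseteq> ?C"
    proof
      fix a assume "a \<in> A"
      then obtain d u where "d \<in> m" "u \<in> ?C" "a = u \<oplus>\<^sub>M d \<odot>\<^sub>M v" using decomp by blast
      then show "a \<in> ?C"
        using submoduleE(5)[OF C] submoduleE(4)[OF C _ v] mc by (simp add: subsetD)
    qed
    then have AB: "A \<subseteq> B" using insert Av by blast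
    then have "lin_span M m A \<subseteq> B" by (rule lin_span_minimal[OF B _ mc])
    then have "?C \<subseteq> B" using B_add by (auto simp: set_add_iff subset_iff)
    then show ?case using v AB by auto
  qed simp
  then show ?thesis by (rule lin_span_minimal[OF B]) simp
qed

lemma noetherian_moduleE:
  assumes "noetherian_module R M" "submodule N R M"
  obtains A where "finite A" "A \<subseteq> N" "lin_span M (carrier R) A = N" "A \<subseteq> carrier M"
proof -
  obtain A where A: "finite A" "A \<subseteq> N" "lin_span M (carrier R) A = N"
    using assms unfolding noetherian_module_def by blast
  then show thesis using that submoduleE(1)[OF assms(2)] by blast
qed

text \<open>The form in which the lemma is used: \<open>N \<subseteq> B + m N\<close> implies \<open>N \<subseteq> B\<close>.\<close>

lemma nakayama_noetherian:
  assumes "ideal m R" "\<And>c. c \<in> m ==> \<one> \<ominus> c \<in> Units R" and noeth: "noetherian_module R M"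
    and N: "submodule N R M" and B: "submodule B R M"
    and sub: "N \<subseteq> B <+>\<^bsub>M\<^esub> lin_span M m N"
  shows "N \<subseteq> B"
proof -
  obtain A where A: "finite A" "A \<subseteq> N" "lin_span M (carrier R) A = N" "A \<subseteq> carrier M"
    using noetherian_moduleE[OF noeth N] .
  have "lin_span M m N \<subseteq> lin_span M m A"
    using lin_span_lin_span[OF A(4) assms(1)] A(3) by auto
  then have "B <+>\<^bsub>M\<^esub> lin_span M m N \<subseteq> B <+>\<^bsub>M\<^esub> lin_span M m A"
    unfolding set_add_def' by blast
  then have "A \<subseteq> B <+>\<^bsub>M\<^esub> lin_span M m A" using sub A(2) by blast
  from nakayama[OF assms(1,2) A(1,4) B this] show ?thesis using A(3) by simp
qed

lemma submodule_Union:
  assumes "C \<noteq> {}" and sub: "\<And>N. N \<in> C ==> submodule N R M"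
    and chain: "\<And>N L. N \<in> C ==> L \<in> C ==> N \<subseteq> L \<or> L \<subseteq> N"
  shows "submodule (\<Union>C) R M"
proof (rule submoduleI)
  show "\<Union>C \<subseteq> carrier M" using sub submoduleE(1) by blast
  show "\<zero>\<^sub>M \<in> \<Union>C" using assms(1) submodule_0[OF sub] by auto
  show "\<And>a. a \<in> \<Union>C ==> \<ominus>\<^sub>M a \<in> \<Union>C" using submoduleE(3)[OF sub] by blast
  show "\<And>a x. a \<in> carrier R ==> x \<in> \<Union>C ==> a \<odot>\<^sub>M x \<in> \<Union>C" using submoduleE(4)[OF sub] by blast
  fix a b assume "a \<in> \<Union>C" "b \<in> \<Union>C"
  then obtain N L where "a \<in> N" "b \<in> L" "N \<in> C" "L \<in> C" by blast
  then show "a \<oplus>\<^sub>M b \<in> \<Union>C" using chain[of N L] submoduleE(5)[OF sub] by blast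
qed

text \<open>The usual maximum condition. Zorn applies because the union of a chain is finitely generated, hence equal to a member
  of the chain.\<close>

lemma noetherian_max:
  assumes noeth: "noetherian_module R M" and "F \<noteq> {}" and sub: "\<And>N. N \<in> F ==> submodule N R M"
  shows "\<exists>N\<in>F. \<forall>L\<in>F. N \<subseteq> L \<longrightarrow> L = N"
proof (rule subset_Zorn_nonempty[OF assms(2)])
  fix C assume C: "C \<noteq> {}" "subset.chain F C"
  have CF: "C \<subseteq> F" and lin: "\<And>N L. N \<in> C ==> L \<in> C ==> N \<subseteq> L \<or> L \<subseteq> N"
    using C(2) unfolding subset.chain_def by auto
  have U: "submodule (\<Union>C) R M"
    by (rule submodule_Union[OF C(1)]) (use sub CF lin in "simp_all add: subsetD")
  obtain A where A: "finite A" "A \<subseteq> \<Union>C" "lin_span M (carrier R) A = \<Union>C"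
    using noetherian_moduleE[OF noeth U] .
  have "\<exists>N\<in>C. A \<subseteq> N" using A(1,2)
  proof (induction A)
    case (insert a A)
    then obtain N L where "N \<in> C" "A \<subseteq> N" "L \<in> C" "a \<in> L" by blast
    then show ?case using lin[of N L] by blast
  qed (use C(1) in blast)
  then obtain N where N: "N \<in> C" "A \<subseteq> N" by blast
  have "submodule N R M" using N(1) sub CF by blast
  from lin_span_minimal[OF this N(2)] have "lin_span M (carrier R) A \<subseteq> N" by simp
  then have "\<Union>C = N" using N A(3) by blast
  then show "\<Union>C \<in> F" using N CF by auto
qed

lemma noetherian_chain:
  assumes noeth: "noetherian_module R M" and sub: "\<And>k. submodule (N k) R M"
    and mono: "\<And>k. N k \<subseteq> N (Suc k)"
  obtains k where "\<And>l. l \<ge> k ==> N l = N k"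
proof -
  obtain k where k: "\<forall>L\<in>range N. N k \<subseteq> L \<longrightarrow> L = N k"
    using noetherian_max[OF noeth, of "range N"] sub by auto
  have "l \<ge> k ==> N l = N k" for l using k lift_Suc_mono_le[of N k l] mono by blast
  then show thesis using that by blast
qed

end

lemma self_module_simps [simp]:
  "carrier (self_module R) = carrier R" "add (self_module R) = add R"
  "smult (self_module R) = monoid.mult R" "ring.zero (self_module R) = ring.zero R"
  by (simp_all add: self_module_def)

context cring
begin

lemma self_module: "module R (self_module R)"
proof (rule moduleI)
  show "abelian_group (self_module R)"
    by (rule abelian_groupI) (auto simp: a_ac intro: bexI[of _ "\<ominus> _"] l_neg)
qed (auto simp: is_cring l_distr r_distr m_assoc)

lemma self_minus: "x \<in> carrier R ==> \<ominus>\<^bsub>self_module R\<^esub> x = \<ominus> x"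
  unfolding a_inv_def by (simp add: m_inv_def)

text \<open>Ideals are treated as submodules of \<open>R\<close>, so that the statements on spans and Noetherian modules apply to
  them.\<close>

lemma submodule_ideal: "submodule I R (self_module R) \<longleftrightarrow> ideal I R"
proof
  assume I: "submodule I R (self_module R)"
  note E = module.submoduleE[OF self_module I]
  show "ideal I R"
  proof (rule idealI)
    show "subgroup I (add_monoid R)"
      using E(1,3,5) module.submodule_0[OF self_module I]
      by (intro subgroup.intro) (auto simp: self_minus subsetD simp flip: a_inv_def)
    show "\<And>a x. a \<in> I ==> x \<in> carrier R ==> x \<otimes> a \<in> I" using E(4) by simp
    show "\<And>a x. a \<in> I ==> x \<in> carrier R ==> a \<otimes> x \<in> I" using E(1,4) m_comm by (metis self_module_simps(1,3) subsetD)
  qed (rule ring_axioms)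
next
  assume I: "ideal I R"
  then show "submodule I R (self_module R)"
    by (intro module.submoduleI[OF self_module])
       (auto simp: self_minus ideal.Icarr ideal.I_l_closed additive_subgroup.zero_closed
         additive_subgroup.a_closed additive_subgroup.a_inv_closed ideal.axioms(1))
qed

lemma genideal_eq_span:
  assumes A: "A \<subseteq> carrier R" shows "Idl A = lin_span (self_module R) (carrier R) A"
proof -
  interpret S: module R "self_module R" by (rule self_module)
  have A': "A \<subseteq> carrier (self_module R)" using A by simp
  show ?thesis
  proof
    show "Idl A \<subseteq> lin_span (self_module R) (carrier R) A"
      using genideal_minimal S.lin_span_sub[OF A'] S.lin_span_incl[OF A'] submodule_ideal by blast
    show "lin_span (self_module R) (carrier R) A \<subseteq> Idl A"
      using S.lin_span_minimal[of "Idl A" A "carrier R"] genideal_ideal[OF A] genideal_self[OF A]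
        submodule_ideal by blast
  qed
qed

lemma noetherian_ring_module:
  assumes "noetherian_ring R" shows "noetherian_module R (self_module R)"
  unfolding noetherian_module_def submodule_ideal
proof (intro allI impI)
  fix N assume "ideal N R"
  from noetherian_ring.finetely_gen[OF assms this]
  obtain A where A: "A \<subseteq> carrier R" "finite A" "N = Idl A" by blast
  then show "\<exists>A. finite A \<and> A \<subseteq> N \<and> lin_span (self_module R) (carrier R) A = N"
    using genideal_eq_span[OF A(1)] genideal_self[OF A(1)] by blast
qed

lemma noetherian_module_ring:
  assumes "noetherian_module R (self_module R)" shows "noetherian_ring R"
proof (rule noetherian_ringI)
  fix I assume I: "ideal I R"
  then obtain A where A: "finite A" "A \<subseteq> I" "lin_span (self_module R) (carrier R) A = I"
    using assms unfolding noetherian_module_def submodule_ideal by blast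
  then have "A \<subseteq> carrier R" using ideal.Icarr[OF I] by blast
  then show "\<exists>A\<subseteq>carrier R. finite A \<and> I = Idl A"
    using genideal_eq_span A by blast
qed

end

text \<open>Remove one generator \<open>v\<close> and treat the ideal of the \<open>v\<close>-coefficients separately.\<close>

lemma (in module) noetherian_fin_gen:
  assumes noeth: "noetherian_module R (self_module R)"
    and "finite A" "A \<subseteq> carrier M" "submodule N R M" "N \<subseteq> lin_span M (carrier R) A"
  shows "\<exists>B. finite B \<and> B \<subseteq> N \<and> lin_span M (carrier R) B = N"
  using assms(2-)
proof (induction A arbitrary: N)
  case empty
  have "lin_span M (carrier R) {} \<subseteq> {\<zero>\<^sub>M}"
  proof
    fix z show "z \<in> lin_span M (carrier R) {} ==> z \<in> {\<zero>\<^sub>M}"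
      by (induction rule: lin_span.induct) auto
  qed
  then have "N = {\<zero>\<^sub>M}" using empty submodule_0 by auto
  moreover have "lin_span M (carrier R) {} = {\<zero>\<^sub>M}"
    using \<open>_ \<subseteq> {\<zero>\<^sub>M}\<close> lin_span.zero by fast
  ultimately show ?case by blast
next
  case (insert v A)
  have Av: "A \<subseteq> carrier M" "v \<in> carrier M" using insert by auto
  note N = insert.prems(2)
  define I where "I = {c \<in> carrier R. \<exists>w\<in>lin_span M (carrier R) A. w \<oplus>\<^sub>M c \<odot>\<^sub>M v \<in> N}"
  have L: "submodule (lin_span M (carrier R) A) R M" by (rule lin_span_sub[OF Av(1)])
  have Lc: "lin_span M (carrier R) A \<subseteq> carrier M" by (rule submoduleE(1)[OF L])
  interpret S: module R "self_module R" by (rule R.self_module)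
  have "submodule I R (self_module R)"
  proof (rule S.submoduleI; (simp add: R.self_minus)?)
    show "I \<subseteq> carrier R" unfolding I_def by auto
    show "\<zero> \<in> I" unfolding I_def using submodule_0[OF N] Av
      by (auto intro!: bexI[of _ "\<zero>\<^sub>M"] lin_span.zero)
    have smult: "a \<otimes> c \<in> I" if "a \<in> carrier R" "c \<in> I" for a c
    proof -
      obtain w where w: "w \<in> lin_span M (carrier R) A" "w \<oplus>\<^sub>M c \<odot>\<^sub>M v \<in> N"
        using \<open>c \<in> I\<close> unfolding I_def by blast
      have "a \<odot>\<^sub>M (w \<oplus>\<^sub>M c \<odot>\<^sub>M v) = a \<odot>\<^sub>M w \<oplus>\<^sub>M (a \<otimes> c) \<odot>\<^sub>M v"
        using that Lc w(1) Av unfolding I_def by (auto simp: smult_r_distr smult_assoc1 subsetD)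
      then show ?thesis
        using submoduleE(4)[OF N that(1) w(2)] submoduleE(4)[OF L that(1) w(1)] that unfolding I_def by auto
    qed
    then show "\<And>a x. a \<in> carrier R ==> x \<in> I ==> a \<otimes> x \<in> I" .
    show "\<ominus>\<^bsub>self_module R\<^esub> a \<in> I" if "a \<in> I" for a
      using smult[of "\<ominus> \<one>" a] that R.self_minus[of a] unfolding I_def by (auto simp: R.l_minus)
    fix a b assume "a \<in> I" "b \<in> I"
    then obtain w u where w: "w \<in> lin_span M (carrier R) A" "w \<oplus>\<^sub>M a \<odot>\<^sub>M v \<in> N" "a \<in> carrier R"
       and u: "u \<in> lin_span M (carrier R) A" "u \<oplus>\<^sub>M b \<odot>\<^sub>M v \<in> N" "b \<in> carrier R"
      unfolding I_def by blast
    have "(w \<oplus>\<^sub>M a \<odot>\<^sub>M v) \<oplus>\<^sub>M (u \<oplus>\<^sub>M b \<odot>\<^sub>M v) = (w \<oplus>\<^sub>M u) \<oplus>\<^sub>M (a \<oplus> b) \<odot>\<^sub>M v"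
      using w u Lc Av by (simp add: smult_l_distr M.a_ac subsetD)
    then show "a \<oplus> b \<in> I"
      using submoduleE(5)[OF N w(2) u(2)] submoduleE(5)[OF L w(1) u(1)] w u unfolding I_def by auto
  qed
  then obtain C where C: "finite C" "C \<subseteq> I" "lin_span (self_module R) (carrier R) C = I"
    by (rule S.noetherian_moduleE[OF noeth])
  have "\<forall>c\<in>C. \<exists>z\<in>N. \<exists>w\<in>lin_span M (carrier R) A. z = w \<oplus>\<^sub>M c \<odot>\<^sub>M v" using C(2) unfolding I_def by blast
  then obtain f where f: "\<And>c. c \<in> C ==> f c \<in> N \<and> (\<exists>w\<in>lin_span M (carrier R) A. f c = w \<oplus>\<^sub>M c \<odot>\<^sub>M v)"
    by metis
  have "submodule (N \<inter> lin_span M (carrier R) A) R M"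
    by (rule submodule_Int[OF N L])
  then obtain B where B: "finite B" "B \<subseteq> N \<inter> lin_span M (carrier R) A"
      "lin_span M (carrier R) B = N \<inter> lin_span M (carrier R) A"
    using insert.IH[OF Av(1) _ Int_lower2, of N] by blast
  have fC: "f ` C \<subseteq> N" using f by auto
  let ?D = "B \<union> f ` C"
  have Dc: "?D \<subseteq> carrier M" using B fC submoduleE(1)[OF N] by auto
  have D: "submodule (lin_span M (carrier R) ?D) R M" using lin_span_sub[OF Dc] .
  have DN: "lin_span M (carrier R) ?D \<subseteq> N"
    by (rule lin_span_minimal[OF N]) (use fC B(2) in auto)
  have coeff: "\<exists>z \<in> lin_span M (carrier R) ?D. \<exists>w\<in>lin_span M (carrier R) A. z = w \<oplus>\<^sub>M c \<odot>\<^sub>M v"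
    if "c \<in> I" for c
    using that unfolding C(3)[symmetric]
  proof induction
    case zero
    show ?case using Av lin_span.zero by (intro bexI[of _ "\<zero>\<^sub>M"]) auto
  next
    case (step z c a)
    have "I \<subseteq> carrier R" unfolding I_def by auto
    then have car: "z \<in> carrier R" "c \<in> carrier R" "a \<in> carrier R" using step C by auto
    obtain p w where p: "p \<in> lin_span M (carrier R) ?D" "w \<in> lin_span M (carrier R) A"
      "p = w \<oplus>\<^sub>M z \<odot>\<^sub>M v" using step by blast
    obtain u where u: "u \<in> lin_span M (carrier R) A" "f a = u \<oplus>\<^sub>M a \<odot>\<^sub>M v" using f step by blast
    have "p \<oplus>\<^sub>M c \<odot>\<^sub>M f a = (w \<oplus>\<^sub>M c \<odot>\<^sub>M u) \<oplus>\<^sub>M (z \<oplus> c \<otimes> a) \<odot>\<^sub>M v"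
      using p u car Lc Av by (simp add: smult_l_distr smult_r_distr smult_assoc1 M.a_ac subsetD)
    moreover have "p \<oplus>\<^sub>M c \<odot>\<^sub>M f a \<in> lin_span M (carrier R) ?D"
      using p(1) car step by (intro lin_span.step) auto
    moreover have "w \<oplus>\<^sub>M c \<odot>\<^sub>M u \<in> lin_span M (carrier R) A"
      using submoduleE(4,5)[OF L] p u car by auto
    ultimately show ?case by auto
  qed
  have "N \<subseteq> lin_span M (carrier R) ?D"
  proof
    fix n assume n: "n \<in> N"
    then obtain c w where cw: "c \<in> carrier R" "w \<in> lin_span M (carrier R) A" "n = w \<oplus>\<^sub>M c \<odot>\<^sub>M v"
      using lin_span_insert[OF Av R.oneideal] insert.prems by blast
    then have "c \<in> I" using n unfolding I_def by auto
    then obtain z u where z: "z \<in> lin_span M (carrier R) ?D" "u \<in> lin_span M (carrier R) A" "z = u \<oplus>\<^sub>M c \<odot>\<^sub>M v"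
      using coeff by blast
    have car: "w \<in> carrier M" "u \<in> carrier M" "c \<odot>\<^sub>M v \<in> carrier M" using cw z Lc Av by auto
    have e1: "n \<ominus>\<^sub>M z = w \<ominus>\<^sub>M u"
      using car unfolding cw(3) z(3) by (simp add: M.minus_eq M.minus_add M.a_ac M.r_neg M.r_neg1)
    have "n \<ominus>\<^sub>M z \<in> N" using submodule_sub[OF N n] DN z by auto
    moreover have "n \<ominus>\<^sub>M z \<in> lin_span M (carrier R) A" using e1 submodule_sub[OF L] cw z by simp
    ultimately have "n \<ominus>\<^sub>M z \<in> lin_span M (carrier R) B" using B(3) by auto
    then have "n \<ominus>\<^sub>M z \<in> lin_span M (carrier R) ?D" by (rule lin_span_mono[rotated 2]) auto
    then have "(n \<ominus>\<^sub>M z) \<oplus>\<^sub>M z \<in> lin_span M (carrier R) ?D" using submoduleE(5)[OF D] z by auto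
    moreover have "(n \<ominus>\<^sub>M z) \<oplus>\<^sub>M z = n"
      using n z DN submoduleE(1)[OF N] by (simp add: M.minus_eq M.a_assoc M.l_neg subsetD)
    ultimately show "n \<in> lin_span M (carrier R) ?D" by simp
  qed
  then have "lin_span M (carrier R) ?D = N" using DN by auto
  moreover have "finite ?D" "?D \<subseteq> N" using B C fC by auto
  ultimately show ?case by (intro exI[of _ ?D]) simp
qed

section \<open>Prime ideals and local rings\<close>

context cring
begin

lemma mem_PIdl: "r \<in> PIdl a \<longleftrightarrow> (\<exists>c\<in>carrier R. r = c \<otimes> a)"
  unfolding cgenideal_def by blast

lemma ideal_max:
  assumes noeth: "noetherian_ring R" and I: "P I" and id: "\<And>J. P J ==> ideal J R"
  obtains Q where "P Q" "\<And>J. P J ==> Q \<subseteq> J ==> J = Q"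
proof -
  have "\<exists>Q\<in>Collect P. \<forall>J\<in>Collect P. Q \<subseteq> J \<longrightarrow> J = Q"
  proof (rule module.noetherian_max[OF self_module noetherian_ring_module[OF noeth]])
    show "Collect P \<noteq> {}" using I by auto
    show "\<And>J. J \<in> Collect P ==> submodule J R (self_module R)" using id by (simp add: submodule_ideal)
  qed
  then obtain Q where "P Q" "\<forall>J. P J \<longrightarrow> Q \<subseteq> J \<longrightarrow> J = Q" by auto
  then show thesis using that[of Q] by simp
qed

text \<open>An ideal that is maximal among those disjoint from the multiplicative set \<open>T\<close> is prime: enlarging it by
  \<open>a\<close> and by \<open>b\<close> gives elements of \<open>T\<close> whose product lies in it if
  \<open>a b\<close> does.\<close>

lemma prime_avoiding:
  assumes noeth: "noetherian_ring R" and I: "ideal I R"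
    and T1: "\<one> \<in> T" and Tm: "\<And>s t. s \<in> T ==> t \<in> T ==> s \<otimes> t \<in> T" and IT: "I \<inter> T = {}"
  obtains Q where "primeideal Q R" "I \<subseteq> Q" "Q \<inter> T = {}"
proof -
  obtain Q where Q: "ideal Q R \<and> I \<subseteq> Q \<and> Q \<inter> T = {}"
    and mx: "\<And>J. ideal J R \<and> I \<subseteq> J \<and> J \<inter> T = {} ==> Q \<subseteq> J ==> J = Q"
    by (rule ideal_max[OF noeth, of "\<lambda>J. ideal J R \<and> I \<subseteq> J \<and> J \<inter> T = {}" I]) (use I IT in auto)
  interpret Q: ideal Q R using Q by blast
  have "primeideal Q R"
  proof (rule primeidealI)
    show "ideal Q R" "cring R" by (rule Q.is_ideal, rule is_cring)
    show "carrier R \<noteq> Q" using T1 Q by blast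
    have hit: "\<exists>q\<in>Q. \<exists>r\<in>carrier R. q \<oplus> r \<otimes> a \<in> T" if a: "a \<in> carrier R" "a \<notin> Q" for a
    proof -
      let ?J = "Q <+>\<^bsub>R\<^esub> PIdl a"
      have J: "ideal ?J R" by (rule add_ideals[OF Q.is_ideal cgenideal_ideal[OF a(1)]])
      have "Q \<subseteq> ?J"
      proof
        fix q assume q: "q \<in> Q"
        have "q \<oplus> \<zero> \<in> ?J"
          by (rule set_addI[OF q]) (use a in "auto simp: mem_PIdl intro!: bexI[of _ \<zero>]")
        then show "q \<in> ?J" using q Q.Icarr by simp
      qed
      moreover have "\<zero> \<oplus> a \<in> ?J"
        by (rule set_addI[OF Q.zero_closed cgenideal_self[OF a(1)]])
      then have "a \<in> ?J" using a by simp
      ultimately have "?J \<noteq> Q" "I \<subseteq> ?J" using a Q by blast+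
      then have "?J \<inter> T \<noteq> {}" using mx[of ?J] J \<open>Q \<subseteq> ?J\<close> by blast
      then show ?thesis by (auto simp: set_add_iff mem_PIdl)
    qed
    fix a b assume a: "a \<in> carrier R" and b: "b \<in> carrier R" and ab: "a \<otimes> b \<in> Q"
    show "a \<in> Q \<or> b \<in> Q"
    proof (rule ccontr)
      assume "\<not> ?thesis"
      then obtain p r q s where
        p: "p \<in> Q" "r \<in> carrier R" "p \<oplus> r \<otimes> a \<in> T" and q: "q \<in> Q" "s \<in> carrier R" "q \<oplus> s \<otimes> b \<in> T"
        using hit[OF a] hit[OF b] by blast
      have "(p \<oplus> r \<otimes> a) \<otimes> (q \<oplus> s \<otimes> b) = (q \<oplus> s \<otimes> b) \<otimes> p \<oplus> ((r \<otimes> a) \<otimes> q \<oplus> (r \<otimes> s) \<otimes> (a \<otimes> b))"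
        using a b p q Q.Icarr by (simp add: l_distr r_distr m_ac a_ac)
      also have "\<dots> \<in> Q"
        using Q.I_l_closed[OF p(1), of "q \<oplus> s \<otimes> b"] Q.I_l_closed[OF q(1), of "r \<otimes> a"]
          Q.I_l_closed[OF ab, of "r \<otimes> s"] a b p(2) q(2) Q.Icarr[OF q(1)] by (intro Q.a_closed) auto
      finally show False using Tm[OF p(3) q(3)] Q by blast
    qed
  qed
  then show thesis using that Q by blast
qed

text \<open>Otherwise a prime over \<open>I\<close> can be chosen disjoint from the powers of \<open>a\<close>.\<close>

lemma power_in_ideal:
  assumes noeth: "noetherian_ring R" and I: "ideal I R" and a: "a \<in> carrier R"
    and pr: "\<And>Q. primeideal Q R ==> I \<subseteq> Q ==> a \<in> Q"
  obtains k :: nat where "a [^] k \<in> I"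
proof (rule ccontr)
  assume "\<not> thesis"
  then have no: "I \<inter> range (\<lambda>k::nat. a [^] k) = {}" using that by blast
  obtain Q where Q: "primeideal Q R" "I \<subseteq> Q" "Q \<inter> range (\<lambda>k::nat. a [^] k) = {}"
  proof (rule prime_avoiding[OF noeth I, of "range (\<lambda>k::nat. a [^] k)"])
    have "a [^] (0::nat) = \<one>" by simp
    then show "\<one> \<in> range (\<lambda>k::nat. a [^] k)" by (metis rangeI)
    show "I \<inter> range (\<lambda>k::nat. a [^] k) = {}" by (rule no)
    fix s t assume "s \<in> range (\<lambda>k::nat. a [^] k)" "t \<in> range (\<lambda>k::nat. a [^] k)"
    then show "s \<otimes> t \<in> range (\<lambda>k::nat. a [^] k)" using a nat_pow_mult[OF a] by (auto simp: image_iff)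
  qed
  have "a [^] (1::nat) = a" using a by simp
  then have "a \<notin> Q" using Q(3) by (metis disjoint_iff rangeI)
  then show False using pr Q by blast
qed

end

lemma (in primeideal) pow_mem:
  assumes "a \<in> carrier R" "a [^] (k::nat) \<in> I" shows "a \<in> I"
  using assms(2)
proof (induction k)
  case 0
  then show ?case using one_imp_carrier assms(1) by simp
next
  case (Suc k)
  then show ?case using I_prime[of "a [^] k" a] assms(1) by auto
qed

text \<open>A local Noetherian ring with a name for its maximal ideal, which enters through the invertibility of all elements
  outside it.\<close>

locale noetherian_local = cring R for R (structure) +
  fixes m
  assumes noeth: "noetherian_ring R" and m_max: "maximalideal m R"
    and unit: "\<And>x. x \<in> carrier R ==> x \<notin> m ==> x \<in> Units R"

lemma (in cring) noetherian_local_of_local: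
  assumes noeth: "noetherian_ring R" and m: "maximalideal m R" and uniq: "\<And>J. maximalideal J R ==> J = m"
  shows "noetherian_local R m"
proof (intro noetherian_local.intro noetherian_local_axioms.intro)
  show "cring R" by (rule is_cring)
  fix x assume x: "x \<in> carrier R" "x \<notin> m"
  show "x \<in> Units R"
  proof (rule ccontr)
    assume nu: "x \<notin> Units R"
    let ?P = "\<lambda>J. ideal J R \<and> J \<noteq> carrier R \<and> x \<in> J"
    have "\<one> \<notin> PIdl x" using nu x(1) m_comm unfolding mem_PIdl Units_def by auto
    then have "?P (PIdl x)" using cgenideal_ideal[OF x(1)] cgenideal_self[OF x(1)] by auto
    then obtain J where J: "?P J" "\<And>K. ?P K ==> J \<subseteq> K ==> K = J"
      using ideal_max[OF noeth, of ?P "PIdl x" thesis] by simp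
    have "maximalideal J R"
    proof (rule maximalidealI)
      fix K assume "ideal K R" "J \<subseteq> K" "K \<subseteq> carrier R"
      then show "K = J \<or> K = carrier R" using J by blast
    qed (use J in auto)
    then show False using uniq J x by blast
  qed
qed (use noeth m in simp_all)

context noetherian_local
begin

lemma m_ideal: "ideal m R" using m_max maximalideal.axioms(1) by blast

lemma m_prime: "primeideal m R" using maximalideal_prime[OF m_max] .

sublocale m: primeideal m R by (rule m_prime)

lemma m_carr: "x \<in> m ==> x \<in> carrier R" by (rule m.Icarr)

lemma one_notin_m: "\<one> \<notin> m" using m.one_imp_carrier m.I_notcarr by blast

lemma unit_notin_m: assumes "u \<in> Units R" shows "u \<notin> m"
proof
  assume "u \<in> m"
  from m.I_l_closed[OF this, of "inv u"] show False using one_notin_m assms by simp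
qed

lemma ideal_sub_m:
  assumes "ideal I R" "I \<noteq> carrier R" shows "I \<subseteq> m"
proof
  fix a assume a: "a \<in> I"
  interpret I: ideal I R by fact
  show "a \<in> m"
  proof (rule ccontr)
    assume "a \<notin> m"
    then have u: "a \<in> Units R" using unit a I.Icarr by blast
    from I.I_l_closed[OF a, of "inv a"] show False using u assms(2) I.one_imp_carrier by simp
  qed
qed

lemma prime_sub_m: "primeideal P R ==> P \<subseteq> m"
  using ideal_sub_m primeideal.axioms(1) primeideal.I_notcarr by metis

lemma one_minus_unit:
  assumes "c \<in> m" shows "\<one> \<ominus> c \<in> Units R"
proof (rule unit)
  show "\<one> \<ominus> c \<in> carrier R" using assms m_carr by simp
  show "\<one> \<ominus> c \<notin> m"
  proof
    assume "\<one> \<ominus> c \<in> m"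
    then have "(\<one> \<ominus> c) \<oplus> c \<in> m" using assms by simp
    moreover have "(\<one> \<ominus> c) \<oplus> c = \<one>" using assms m_carr by (simp add: minus_eq a_assoc l_neg)
    ultimately show False using one_notin_m by simp
  qed
qed

lemma max_unique: "maximalideal J R \<longleftrightarrow> J = m"
proof
  assume J: "maximalideal J R"
  then interpret J: maximalideal J R .
  show "J = m"
    using ideal_sub_m[OF J.is_ideal] J.I_notcarr J.I_maximal[OF m_ideal] m.I_notcarr m.a_subset by blast
qed (use m_max in simp)

lemma is_local: "local_ring R"
  unfolding local_ring_def using is_cring max_unique by blast

lemma max_ideal_eq: "max_ideal R = m"
  unfolding max_ideal_def using max_unique by simp

text \<open>Nakayama's lemma \<open>I \<subseteq> J + m I \<Longrightarrow> I \<subseteq> J\<close>, with the sum written out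
  elementwise.\<close>

lemma nakayama_ideal:
  assumes I: "ideal I R" and J: "ideal J R"
    and dec: "\<And>a. a \<in> I ==> \<exists>b\<in>J. \<exists>c\<in>m. \<exists>d\<in>I. a = b \<oplus> c \<otimes> d"
  shows "I \<subseteq> J"
proof -
  interpret S: module R "self_module R" by (rule self_module)
  have "I \<subseteq> J <+>\<^bsub>self_module R\<^esub> lin_span (self_module R) m I"
  proof
    fix a assume "a \<in> I"
    then obtain b c d where d: "b \<in> J" "c \<in> m" "d \<in> I" "a = b \<oplus> c \<otimes> d" using dec by blast
    have "c \<odot>\<^bsub>self_module R\<^esub> d \<in> lin_span (self_module R) m I"
      by (rule S.lin_span_smult_gen) (use d ideal.Icarr[OF I] m_carr in auto)
    from set_addI[OF d(1) this, of "self_module R"] show "a \<in> J <+>\<^bsub>self_module R\<^esub> lin_span (self_module R) m I"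
      using d(4) by simp
  qed
  then show ?thesis
    using S.nakayama_noetherian[OF m_ideal one_minus_unit noetherian_ring_module[OF noeth]]
      I J submodule_ideal by blast
qed

end

section \<open>Two-dimensional regular local rings\<close>

text \<open>Two generators of \<open>m\<close> and a chain of primes below \<open>m\<close> are all that is used of a regular
  local ring of dimension two. That \<open>P0\<close> is the zero ideal is a consequence.\<close>

locale regular_dim2 = noetherian_local +
  fixes x y P0 P1
  assumes x_m: "x \<in> m" and y_m: "y \<in> m"
    and m_gen: "\<And>a. a \<in> m ==> \<exists>b\<in>carrier R. \<exists>c\<in>carrier R. a = b \<otimes> x \<oplus> c \<otimes> y"
    and P0: "primeideal P0 R" and P1: "primeideal P1 R" and P01: "P0 \<subset> P1" and P1m: "P1 \<subset> m"
begin

sublocale P0: primeideal P0 R by (rule P0)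
sublocale P1: primeideal P1 R by (rule P1)

lemma x_carr [simp]: "x \<in> carrier R" and y_carr [simp]: "y \<in> carrier R"
  using x_m y_m m_carr by auto

text \<open>The roles of \<open>x\<close> and \<open>y\<close> are symmetric, so that properties of \<open>x\<close> hold for
  \<open>y\<close> as well.\<close>

lemma swap: "regular_dim2 R m y x P0 P1"
proof unfold_locales
  fix a assume "a \<in> m"
  then obtain b c where bc: "b \<in> carrier R" "c \<in> carrier R" "a = b \<otimes> x \<oplus> c \<otimes> y" using m_gen by blast
  then have "a = c \<otimes> y \<oplus> b \<otimes> x" by (simp add: a_comm)
  then show "\<exists>b\<in>carrier R. \<exists>c\<in>carrier R. a = b \<otimes> y \<oplus> c \<otimes> x" using bc by blast
qed (use x_m y_m P01 P1m in auto)

lemma not_both: assumes "primeideal P R" "P \<noteq> m" shows "x \<notin> P \<or> y \<notin> P"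
proof (rule ccontr)
  assume "\<not> ?thesis"
  then have xy: "x \<in> P" "y \<in> P" by auto
  interpret P: primeideal P R by fact
  have "m \<subseteq> P"
  proof
    fix a assume "a \<in> m"
    then obtain b c where "b \<in> carrier R" "c \<in> carrier R" "a = b \<otimes> x \<oplus> c \<otimes> y" using m_gen by blast
    then show "a \<in> P" using xy by (auto intro!: P.a_closed P.I_l_closed)
  qed
  then show False using prime_sub_m[OF assms(1)] assms(2) by blast
qed

text \<open>Induction on \<open>k\<close>: a cofactor of \<open>y^k\<close> that is not a unit lies in \<open>m\<close>, which
  \<open>x\<close> and \<open>y\<close> generate.\<close>

lemma y_expansion:
  assumes a: "a \<in> carrier R"
  shows "(\<exists>b\<in>carrier R. \<exists>c\<in>carrier R. a = x \<otimes> b \<oplus> y [^] (k::nat) \<otimes> c) \<or>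
    (\<exists>i<k. \<exists>b\<in>carrier R. \<exists>u\<in>Units R. a = x \<otimes> b \<oplus> y [^] i \<otimes> u)"
proof (induction k)
  case 0
  have "a = x \<otimes> \<zero> \<oplus> y [^] (0::nat) \<otimes> a" using a by simp
  then show ?case using a by blast
next
  case (Suc k)
  show ?case
  proof (cases "\<exists>i<k. \<exists>b\<in>carrier R. \<exists>u\<in>Units R. a = x \<otimes> b \<oplus> y [^] i \<otimes> u")
    case True
    then show ?thesis using less_SucI by metis
  next
    case False
    then obtain b c where bc: "b \<in> carrier R" "c \<in> carrier R" "a = x \<otimes> b \<oplus> y [^] k \<otimes> c"
      using Suc by blast
    show ?thesis
    proof (cases "c \<in> m")
      case True
      then obtain d e where de: "d \<in> carrier R" "e \<in> carrier R" "c = d \<otimes> x \<oplus> e \<otimes> y" using m_gen by blast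
      have "a = x \<otimes> (b \<oplus> y [^] k \<otimes> d) \<oplus> y [^] Suc k \<otimes> e"
        unfolding bc(3) de(3) using bc(1) de(1,2) by (simp add: r_distr m_ac a_ac)
      then show ?thesis using bc de by (metis m_closed a_closed nat_pow_closed y_carr)
    next
      case False
      then have "c \<in> Units R" using unit bc by blast
      then show ?thesis using bc by blast
    qed
  qed
qed

text \<open>The decisive consequence of dimension two, an instance of Krull's principal ideal theorem: \<open>m\<close> is not a
  minimal prime of \<open>x R + P0\<close>. Take \<open>q \<in> P1 - P0\<close> and let \<open>I n\<close> consist of
  the \<open>r\<close> that a power of \<open>x\<close> multiplies into \<open>q^n R + P0\<close>. If
  \<open>y^k \<in> x R + P0\<close>, then the ideals \<open>I n + x R\<close> become stationary; as \<open>x\<close>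
  can be cancelled in \<open>I n\<close>, Nakayama's lemma gives \<open>I n = I (n + 1)\<close>, and
  \<open>q^n \<in> I (n + 1)\<close> forces \<open>x \<in> P1\<close>.\<close>

lemma principal_ideal_theorem:
  assumes k: "y [^] (k::nat) = x \<otimes> a \<oplus> p" "a \<in> carrier R" "p \<in> P0" shows False
proof -
  obtain q where q: "q \<in> P1" "q \<notin> P0" using P01 by blast
  have qc: "q \<in> carrier R" using q P1.Icarr by blast
  have xP1: "x \<notin> P1"
  proof
    assume x: "x \<in> P1"
    then have "y [^] k \<in> P1" unfolding k(1) using k(2,3) P01 by (intro P1.a_closed P1.I_r_closed) auto
    then have "y \<in> P1" using P1.pow_mem y_carr by blast
    then show False using not_both[OF P1] P1m x by blast
  qed
  define I where "I n = {r \<in> carrier R. \<exists>j::nat. \<exists>c\<in>carrier R. \<exists>p\<in>P0. x [^] j \<otimes> r = q [^] (n::nat) \<otimes> c \<oplus> p}" for n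
  have Ic: "r \<in> I n ==> r \<in> carrier R" for r n unfolding I_def by blast
  have II: "r \<in> I n" if "r \<in> carrier R" "c \<in> carrier R" "p \<in> P0" "x [^] (j::nat) \<otimes> r = q [^] n \<otimes> c \<oplus> p" for r n c p j
    unfolding I_def using that by blast
  have IE: thesis if "r \<in> I n" "\<And>j c p. r \<in> carrier R ==> c \<in> carrier R ==> p \<in> P0 ==> p \<in> carrier R ==> x [^] (j::nat) \<otimes> r = q [^] n \<otimes> c \<oplus> p ==> thesis" for thesis r n
    using that P0.Icarr unfolding I_def by blast
  have I_smult: "b \<otimes> r \<in> I n" if r: "r \<in> I n" and b: "b \<in> carrier R" for b r n
    using r
  proof (rule IE)
    fix j :: nat and c p assume h: "r \<in> carrier R" "c \<in> carrier R" "p \<in> P0" "p \<in> carrier R" "x [^] j \<otimes> r = q [^] n \<otimes> c \<oplus> p"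
    have "x [^] j \<otimes> (b \<otimes> r) = b \<otimes> (x [^] j \<otimes> r)" using h b by (simp add: m_ac)
    also have "\<dots> = q [^] n \<otimes> (b \<otimes> c) \<oplus> b \<otimes> p"
      unfolding h(5) using h(1-4) b qc by (simp add: r_distr m_ac)
    finally show ?thesis using h b P0.I_l_closed by (intro II[of _ "b \<otimes> c" "b \<otimes> p" j]) auto
  qed
  have I_add: "r \<oplus> s \<in> I n" if r: "r \<in> I n" and s: "s \<in> I n" for r s n
    using r
  proof (rule IE)
    fix j :: nat and c p assume h: "r \<in> carrier R" "c \<in> carrier R" "p \<in> P0" "p \<in> carrier R" "x [^] j \<otimes> r = q [^] n \<otimes> c \<oplus> p"
    show ?thesis using s
    proof (rule IE)
      fix l :: nat and d p' assume h': "s \<in> carrier R" "d \<in> carrier R" "p' \<in> P0" "p' \<in> carrier R" "x [^] l \<otimes> s = q [^] n \<otimes> d \<oplus> p'"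
      have "x [^] (j + l) \<otimes> (r \<oplus> s) = x [^] l \<otimes> (x [^] j \<otimes> r) \<oplus> x [^] j \<otimes> (x [^] l \<otimes> s)"
        using h(1) h'(1) by (simp add: r_distr nat_pow_mult[symmetric] m_ac)
      also have "\<dots> = q [^] n \<otimes> (x [^] l \<otimes> c \<oplus> x [^] j \<otimes> d) \<oplus> (x [^] l \<otimes> p \<oplus> x [^] j \<otimes> p')"
        unfolding h(5) h'(5) using h(1-4) h'(1-4) qc by (simp add: r_distr m_ac a_ac)
      finally show ?thesis using h h'
        by (intro II[of _ "x [^] l \<otimes> c \<oplus> x [^] j \<otimes> d" "x [^] l \<otimes> p \<oplus> x [^] j \<otimes> p'" "j + l"])
           (auto intro!: P0.a_closed P0.I_l_closed)
    qed
  qed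
  have P0I: "r \<in> I n" if "r \<in> P0" for r n
    using that P0.Icarr[OF that] qc by (intro II[of r \<zero> r 0]) auto
  have I_ideal: "ideal (I n) R" for n
    unfolding submodule_ideal[symmetric]
  proof (rule module.submoduleI[OF self_module]; (simp add: self_minus)?)
    show "I n \<subseteq> carrier R" using Ic by blast
    show "\<zero> \<in> I n" by (rule P0I[OF P0.zero_closed])
    show "\<ominus>\<^bsub>self_module R\<^esub> r \<in> I n" if "r \<in> I n" for r
      using I_smult[OF that, of "\<ominus> \<one>"] Ic[OF that] by (simp add: self_minus l_minus)
  qed (use I_add I_smult in auto)
  have I_dec: "r \<in> I n" if "r \<in> I (Suc n)" for r n
    using that
  proof (rule IE)
    fix j :: nat and c p assume h: "r \<in> carrier R" "c \<in> carrier R" "p \<in> P0" "p \<in> carrier R" "x [^] j \<otimes> r = q [^] (Suc n) \<otimes> c \<oplus> p"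
    then show ?thesis using qc by (intro II[of r "q \<otimes> c" p j]) (auto simp: m_assoc)
  qed
  have I_x: "r \<in> I n" if "x \<otimes> r \<in> I n" "r \<in> carrier R" for r n
    using that(1)
  proof (rule IE)
    fix j :: nat and c p assume h: "c \<in> carrier R" "p \<in> P0" "x [^] j \<otimes> (x \<otimes> r) = q [^] n \<otimes> c \<oplus> p"
    then show ?thesis using that by (intro II[of r c p "Suc j"]) (auto simp: m_assoc)
  qed
  \<comment> \<open>\<open>B n\<close> stands for the ideal \<open>I n + x R\<close>. All these ideals contain \<open>y^k\<close>.\<close>
  define B where "B n r \<longleftrightarrow> (\<exists>s\<in>I n. \<exists>b\<in>carrier R. r = s \<oplus> x \<otimes> b)" for n r
  have BI: "B n (s \<oplus> x \<otimes> b)" if "s \<in> I n" "b \<in> carrier R" for n s b unfolding B_def using that by blast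
  have B_add: "B n (r \<oplus> s)" if "B n r" "B n s" for n r s
  proof -
    obtain r' b s' c where h: "r' \<in> I n" "b \<in> carrier R" "r = r' \<oplus> x \<otimes> b" "s' \<in> I n" "c \<in> carrier R" "s = s' \<oplus> x \<otimes> c"
      using \<open>B n r\<close> \<open>B n s\<close> unfolding B_def by blast
    have "r \<oplus> s = (r' \<oplus> s') \<oplus> x \<otimes> (b \<oplus> c)" using h Ic by (simp add: r_distr a_ac)
    then show ?thesis using BI[OF I_add] h by simp
  qed
  have B_smult: "B n (d \<otimes> r)" if "B n r" "d \<in> carrier R" for n r d
  proof -
    obtain r' b where h: "r' \<in> I n" "b \<in> carrier R" "r = r' \<oplus> x \<otimes> b" using \<open>B n r\<close> unfolding B_def by blast
    have "d \<otimes> r = d \<otimes> r' \<oplus> x \<otimes> (d \<otimes> b)" using h Ic that by (simp add: r_distr m_ac)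
    then show ?thesis using BI[OF I_smult] h that by simp
  qed
  have Bx: "B n (x \<otimes> b)" if "b \<in> carrier R" for n b
    using BI[OF P0I[OF P0.zero_closed] that] that by simp
  have Bk: "B n (y [^] k)" for n
  proof -
    have "y [^] k = p \<oplus> x \<otimes> a" unfolding k(1) using k(2,3) P0.Icarr by (simp add: a_comm)
    then show ?thesis using BI[OF P0I[OF k(3)] k(2)] by simp
  qed
  \<comment> \<open>\<open>B n\<close> is determined by the least power of \<open>y\<close> in it, and that exponent is at most \<open>k\<close>.\<close>
  define e where "e n = (LEAST i::nat. B n (y [^] i))" for n
  have e1: "B n (y [^] e n)" for n unfolding e_def using Bk by (rule LeastI)
  have e2: "e n \<le> i" if "B n (y [^] i)" for n i unfolding e_def using that by (rule Least_le)
  have B_dec: "B n r" if "B (Suc n) r" for n r using that I_dec unfolding B_def by blast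
  have "\<exists>n. e (Suc n) \<le> e n"
  proof (rule ccontr)
    assume "\<nexists>n. e (Suc n) \<le> e n"
    then have "Suc (e n) \<le> e (Suc n)" for n by (simp add: not_le Suc_le_eq)
    then have step: "e n < e (Suc n)" for n by (simp add: Suc_le_eq)
    have "n \<le> e n" for n
    proof (induction n)
      case (Suc n)
      then show ?case using step[of n] by linarith
    qed simp
    then have "Suc k \<le> e (Suc k)" .
    also have "\<dots> \<le> k" by (rule e2[OF Bk])
    finally show False by simp
  qed
  then obtain n where n: "e (Suc n) \<le> e n" by blast
  have y_down: "B n' (y [^] j)" if "B n' (y [^] i)" "i \<le> j" for n' and i j :: nat
  proof -
    have "y [^] j = y [^] (j - i) \<otimes> y [^] i" using that(2) by (simp add: nat_pow_mult)
    then show ?thesis using B_smult[OF that(1)] by simp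
  qed
  \<comment> \<open>Where the exponents agree, so do the ideals \<open>I n + x R\<close>.\<close>
  have BB: "B (Suc n) r" if r: "B n r" "r \<in> carrier R" for r
    using y_expansion[OF r(2), of k]
  proof (elim disjE exE bexE conjE)
    fix b c assume h: "b \<in> carrier R" "c \<in> carrier R" "r = x \<otimes> b \<oplus> y [^] k \<otimes> c"
    then show ?thesis using B_add[OF Bx[OF h(1)] B_smult[OF Bk h(2)]] by (simp add: m_comm)
  next
    fix i b u assume h: "i < k" "b \<in> carrier R" "u \<in> Units R" "r = x \<otimes> b \<oplus> y [^] i \<otimes> u"
    have "y [^] i = inv u \<otimes> (r \<oplus> x \<otimes> (\<ominus> b))"
    proof -
      have "r \<oplus> x \<otimes> (\<ominus> b) = y [^] i \<otimes> u"
        unfolding h(4) using h(2,3) Units_closed by (simp add: r_minus a_ac r_neg r_neg1 r_neg2)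
      then show ?thesis using h by (simp add: m_comm[of "y [^] i" u] m_assoc[symmetric] Units_closed)
    qed
    then have "B n (y [^] i)" using B_smult[OF B_add[OF r(1) Bx], of "\<ominus> b" "inv u"] h by simp
    then have "e (Suc n) \<le> i" using n e2 order_trans by blast
    then have "B (Suc n) (y [^] i)" using y_down[OF e1] by blast
    then show ?thesis unfolding h(4)
      using B_add[OF Bx[OF h(2)] B_smult[of "Suc n" "y [^] i" u]] h by (simp add: m_comm Units_closed)
  qed
  have "I n \<subseteq> I (Suc n)"
  proof (rule nakayama_ideal[OF I_ideal I_ideal])
    fix r assume r: "r \<in> I n"
    have "B n r" using BI[OF r zero_closed] Ic[OF r] by simp
    from BB[OF this Ic[OF r]] obtain s b where h: "s \<in> I (Suc n)" "b \<in> carrier R" "r = s \<oplus> x \<otimes> b"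
      unfolding B_def by blast
    have "x \<otimes> b = r \<oplus> (\<ominus> \<one>) \<otimes> s" using h Ic by (simp add: l_minus a_ac r_neg r_neg1 r_neg2)
    also have "\<dots> \<in> I n" using I_add[OF r I_smult[OF I_dec[OF h(1)]]] by simp
    finally have "b \<in> I n" using I_x h by blast
    then show "\<exists>b\<in>I (Suc n). \<exists>c\<in>m. \<exists>d\<in>I n. r = b \<oplus> c \<otimes> d" using h x_m by blast
  qed
  moreover have "q [^] n \<in> I n" using qc by (intro II[of _ \<one> \<zero> 0]) auto
  ultimately have "q [^] n \<in> I (Suc n)" by blast
  then show False
  proof (rule IE)
    fix j :: nat and c p assume h: "c \<in> carrier R" "p \<in> P0" "p \<in> carrier R" "x [^] j \<otimes> q [^] n = q [^] (Suc n) \<otimes> c \<oplus> p"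
    have "q [^] n \<otimes> (x [^] j \<ominus> q \<otimes> c) = x [^] j \<otimes> q [^] n \<ominus> q [^] (Suc n) \<otimes> c"
      using h(1) qc by (simp add: minus_eq r_distr r_minus m_ac)
    also have "\<dots> = p" unfolding h(4) using h(1,3) qc by (simp add: minus_eq a_ac r_neg r_neg1 r_neg2)
    finally have "q [^] n \<otimes> (x [^] j \<ominus> q \<otimes> c) \<in> P0" using h by simp
    moreover have "q [^] n \<notin> P0" using P0.pow_mem[OF qc] q by blast
    ultimately have "x [^] j \<ominus> q \<otimes> c \<in> P0" using P0.I_prime qc h by (metis m_closed minus_closed nat_pow_closed x_carr)
    then have "(x [^] j \<ominus> q \<otimes> c) \<oplus> q \<otimes> c \<in> P1"
      using P01 q h(1) by (intro P1.a_closed P1.I_r_closed) auto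
    moreover have "(x [^] j \<ominus> q \<otimes> c) \<oplus> q \<otimes> c = x [^] j" using qc h(1) by (simp add: minus_eq a_assoc l_neg)
    ultimately show False using P1.pow_mem[OF x_carr] xP1 by simp
  qed
qed

lemma y_pow_notin_x: "a \<in> carrier R ==> y [^] (k::nat) \<noteq> x \<otimes> a"
  using principal_ideal_theorem[of k a \<zero>] P0.zero_closed by force

text \<open>Krull's intersection theorem for the principal maximal ideal of \<open>R / x R\<close>.\<close>

lemma separated_mod_x:
  assumes r: "r \<in> carrier R" and all: "\<And>n::nat. \<exists>b\<in>carrier R. \<exists>c\<in>carrier R. r = x \<otimes> b \<oplus> y [^] n \<otimes> c"
  shows "\<exists>b\<in>carrier R. r = x \<otimes> b"
proof -
  define xR where "xR = {x \<otimes> b | b. b \<in> carrier R}"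
  have xR: "ideal xR R"
  proof -
    have "xR = PIdl x" unfolding xR_def cgenideal_def by (rule Collect_cong) (metis m_comm x_carr)
    then show ?thesis using cgenideal_ideal by simp
  qed
  interpret xR: ideal xR R by (rule xR)
  \<comment> \<open>The annihilators of \<open>y^n\<close> modulo \<open>x\<close> are stationary from some \<open>N\<close> on.\<close>
  define K where "K n = {t \<in> carrier R. y [^] (n::nat) \<otimes> t \<in> xR}" for n
  have K_ideal: "ideal (K n) R" for n
    unfolding submodule_ideal[symmetric]
  proof (rule module.submoduleI[OF self_module]; (simp add: self_minus)?)
    show "K n \<subseteq> carrier R" "\<zero> \<in> K n" unfolding K_def by auto
    show smult: "a \<otimes> t \<in> K n" if "a \<in> carrier R" "t \<in> K n" for a t
      using that xR.I_l_closed[of "y [^] n \<otimes> t" a] unfolding K_def by (simp add: m_lcomm[of "y [^] n"])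
    show "\<ominus>\<^bsub>self_module R\<^esub> t \<in> K n" if "t \<in> K n" for t
      using smult[of "\<ominus> \<one>" t] that unfolding K_def by (simp add: self_minus l_minus)
    show "s \<oplus> t \<in> K n" if "s \<in> K n" "t \<in> K n" for s t
      using that unfolding K_def by (simp add: r_distr)
  qed
  have K_mono: "K n \<subseteq> K (Suc n)" for n
  proof
    fix t assume t: "t \<in> K n"
    have "y [^] (Suc n) \<otimes> t = y \<otimes> (y [^] n \<otimes> t)" using t unfolding K_def by (simp add: m_ac)
    then show "t \<in> K (Suc n)" using t xR.I_l_closed[of "y [^] n \<otimes> t" y] unfolding K_def by simp
  qed
  obtain N where N: "\<And>l. l \<ge> N ==> K l = K N"
    using module.noetherian_chain[OF self_module noetherian_ring_module[OF noeth], of K] K_ideal K_mono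
    unfolding submodule_ideal by metis
  define L where "L n = {s. \<exists>a\<in>xR. \<exists>c\<in>carrier R. s = a \<oplus> y [^] (n::nat) \<otimes> c}" for n
  have L_ideal: "ideal (L n) R" for n
  proof -
    have "PIdl (y [^] n) = {y [^] n \<otimes> c | c. c \<in> carrier R}"
      unfolding cgenideal_def by (rule Collect_cong) (metis m_comm nat_pow_closed y_carr)
    then have "L n = xR <+>\<^bsub>R\<^esub> PIdl (y [^] n)"
      unfolding L_def by (auto simp: set_add_iff; blast)
    then show ?thesis using add_ideals[OF xR cgenideal_ideal[of "y [^] n"]] by simp
  qed
  \<comment> \<open>\<open>J\<close> consists of the \<open>t\<close> for which \<open>y^N t\<close> is divisible by all powers of \<open>y\<close> modulo \<open>x\<close>. By the choice of \<open>N\<close>, \<open>J\<close> lies in \<open>K N + y J\<close>.\<close>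
  define J where "J = {t \<in> carrier R. \<forall>n. y [^] N \<otimes> t \<in> L n}"
  have J_ideal: "ideal J R"
    unfolding submodule_ideal[symmetric]
  proof (rule module.submoduleI[OF self_module]; (simp add: self_minus)?)
    show "J \<subseteq> carrier R" "\<zero> \<in> J"
      unfolding J_def using additive_subgroup.zero_closed[OF ideal.axioms(1)[OF L_ideal]] by auto
    show smult: "a \<otimes> t \<in> J" if "a \<in> carrier R" "t \<in> J" for a t
      using that ideal.I_l_closed[OF L_ideal, of "y [^] N \<otimes> t" _ a] unfolding J_def
      by (simp add: m_lcomm[of "y [^] N"])
    show "\<ominus>\<^bsub>self_module R\<^esub> t \<in> J" if "t \<in> J" for t
      using smult[of "\<ominus> \<one>" t] that unfolding J_def by (simp add: self_minus l_minus)
    show "s \<oplus> t \<in> J" if "s \<in> J" "t \<in> J" for s t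
      using that additive_subgroup.a_closed[OF ideal.axioms(1)[OF L_ideal]] unfolding J_def by (simp add: r_distr)
  qed
  have "J \<subseteq> K N"
  proof (rule nakayama_ideal[OF J_ideal K_ideal])
    fix t assume t: "t \<in> J"
    then have tc: "t \<in> carrier R" unfolding J_def by blast
    have ex: "\<exists>c\<in>carrier R. \<exists>a\<in>xR. y [^] N \<otimes> t = a \<oplus> y [^] (N + Suc n) \<otimes> c" for n
      using t unfolding J_def L_def by blast
    then obtain t0 a0 where t0: "t0 \<in> carrier R" "a0 \<in> xR" "y [^] N \<otimes> t = a0 \<oplus> y [^] (N + Suc 0) \<otimes> t0" by blast
    note Xc = xR.Icarr
    have "y [^] N \<otimes> (t \<ominus> y \<otimes> t0) = y [^] N \<otimes> t \<ominus> y [^] (N + Suc 0) \<otimes> t0"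
      using t0(1) tc by (simp add: minus_eq r_distr r_minus m_ac)
    also have "\<dots> = a0" unfolding t0(3) using Xc[OF t0(2)] t0(1) by (simp add: minus_eq a_ac r_neg r_neg1 r_neg2)
    finally have k: "t \<ominus> y \<otimes> t0 \<in> K N" using t0 tc unfolding K_def by simp
    have "t0 \<in> J" unfolding J_def
    proof (intro CollectI conjI allI t0(1))
      fix n
      obtain s a where s: "s \<in> carrier R" "a \<in> xR" "y [^] N \<otimes> t = a \<oplus> y [^] (N + Suc n) \<otimes> s" using ex by blast
      have e: "a0 \<oplus> y [^] (N + Suc 0) \<otimes> t0 = a \<oplus> y [^] (N + Suc n) \<otimes> s" using s t0 by simp
      have "y [^] (Suc N) \<otimes> (t0 \<ominus> y [^] n \<otimes> s) = y [^] (N + Suc 0) \<otimes> t0 \<ominus> y [^] (N + Suc n) \<otimes> s"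
        using t0(1) s(1) by (simp add: minus_eq r_distr r_minus nat_pow_mult[symmetric] m_ac)
      also have "\<dots> = (a0 \<oplus> y [^] (N + Suc 0) \<otimes> t0) \<ominus> a0 \<ominus> y [^] (N + Suc n) \<otimes> s"
        using t0(1) s(1) Xc[OF t0(2)] by (simp add: minus_eq a_ac r_neg r_neg1 r_neg2)
      also have "\<dots> = a \<ominus> a0" unfolding e
        using t0(1) s(1) Xc[OF t0(2)] Xc[OF s(2)] by (simp add: minus_eq a_ac r_neg r_neg1 r_neg2)
      also have "\<dots> \<in> xR" using s t0 by (simp add: minus_eq)
      finally have "t0 \<ominus> y [^] n \<otimes> s \<in> K (Suc N)" using t0 s unfolding K_def by simp
      then have "y [^] N \<otimes> (t0 \<ominus> y [^] n \<otimes> s) \<in> xR" using N[of "Suc N"] unfolding K_def by auto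
      moreover have "y [^] N \<otimes> t0 = y [^] N \<otimes> (t0 \<ominus> y [^] n \<otimes> s) \<oplus> y [^] n \<otimes> (y [^] N \<otimes> s)"
      proof -
        have "t0 = (t0 \<ominus> y [^] n \<otimes> s) \<oplus> y [^] n \<otimes> s" using t0 s by (simp add: minus_eq a_assoc l_neg)
        then have "y [^] N \<otimes> t0 = y [^] N \<otimes> ((t0 \<ominus> y [^] n \<otimes> s) \<oplus> y [^] n \<otimes> s)" by simp
        also have "\<dots> = y [^] N \<otimes> (t0 \<ominus> y [^] n \<otimes> s) \<oplus> y [^] n \<otimes> (y [^] N \<otimes> s)"
          using t0(1) s(1) by (subst r_distr) (simp_all add: m_lcomm)
        finally show ?thesis .
      qed
      ultimately show "y [^] N \<otimes> t0 \<in> L n" unfolding L_def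
        by (intro CollectI bexI[of _ "y [^] N \<otimes> (t0 \<ominus> y [^] n \<otimes> s)"] bexI[of _ "y [^] N \<otimes> s"])
           (use s(1) in simp_all)
    qed
    moreover have "t = (t \<ominus> y \<otimes> t0) \<oplus> y \<otimes> t0" using t0 tc by (simp add: minus_eq a_assoc l_neg)
    ultimately show "\<exists>b\<in>K N. \<exists>c\<in>m. \<exists>d\<in>J. t = b \<oplus> c \<otimes> d" using k y_m by blast
  qed
  moreover
  obtain b t where bt: "b \<in> carrier R" "t \<in> carrier R" "r = x \<otimes> b \<oplus> y [^] N \<otimes> t" using all by blast
  have bX: "x \<otimes> b \<in> xR" unfolding xR_def using bt by blast
  have "t \<in> J" unfolding J_def
  proof (intro CollectI conjI allI bt(2))
    fix n :: nat
    obtain b' c where c: "b' \<in> carrier R" "c \<in> carrier R" "r = x \<otimes> b' \<oplus> y [^] n \<otimes> c" using all[of n] by auto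
    have "x \<otimes> (b' \<ominus> b) \<in> xR" unfolding xR_def using bt c by blast
    moreover have "y [^] N \<otimes> t = r \<ominus> x \<otimes> b" unfolding bt(3) using bt by (simp add: minus_eq a_ac r_neg r_neg1 r_neg2)
    then have "y [^] N \<otimes> t = x \<otimes> (b' \<ominus> b) \<oplus> y [^] n \<otimes> c"
      unfolding c(3) using bt(1) c(1,2) by (simp add: minus_eq r_distr r_minus a_ac(1) a_comm[of "y [^] n \<otimes> c"])
    ultimately show "y [^] N \<otimes> t \<in> L n" unfolding L_def using c by blast
  qed
  ultimately have "y [^] N \<otimes> t \<in> xR" unfolding K_def by blast
  then have "r \<in> xR" unfolding bt(3) using bX by simp
  then show ?thesis unfolding xR_def by blast
qed

text \<open>Hence \<open>R / x R\<close> is a discrete valuation ring with uniformizer \<open>y\<close>.\<close>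

lemma y_valuation:
  assumes a: "a \<in> carrier R" "\<not> (\<exists>b\<in>carrier R. a = x \<otimes> b)"
  obtains i :: nat and b u where "b \<in> carrier R" "u \<in> Units R" "a = x \<otimes> b \<oplus> y [^] i \<otimes> u"
proof -
  obtain n :: nat where "\<not> (\<exists>b\<in>carrier R. \<exists>c\<in>carrier R. a = x \<otimes> b \<oplus> y [^] n \<otimes> c)"
    using separated_mod_x[OF a(1)] a(2) by blast
  then have "\<exists>i<n. \<exists>b\<in>carrier R. \<exists>u\<in>Units R. a = x \<otimes> b \<oplus> y [^] i \<otimes> u"
    using y_expansion[OF a(1), of n] by argo
  then show thesis by (elim exE bexE conjE) (rule that)
qed

lemma solve_y_pow:
  assumes "a = x \<otimes> b \<oplus> y [^] (i::nat) \<otimes> u" "b \<in> carrier R" "u \<in> Units R" "a \<in> carrier R"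
  shows "y [^] i = inv u \<otimes> (a \<oplus> x \<otimes> (\<ominus> b))"
proof -
  have "a \<oplus> x \<otimes> (\<ominus> b) = y [^] i \<otimes> u"
    unfolding assms(1) using assms(2,3) Units_closed by (simp add: r_minus a_ac r_neg r_neg1 r_neg2)
  then show ?thesis using assms(3) by (simp add: m_comm[of "y [^] i" u] m_assoc[symmetric] Units_closed)
qed

text \<open>If neither factor is divisible by \<open>x\<close>, then modulo \<open>x\<close> both are units times powers of
  \<open>y\<close>, and so is the product; but no power of \<open>y\<close> is divisible by \<open>x\<close>.\<close>

lemma x_prime:
  assumes ab: "a \<in> carrier R" "b \<in> carrier R" "c \<in> carrier R" "a \<otimes> b = x \<otimes> c"
  shows "(\<exists>d\<in>carrier R. a = x \<otimes> d) \<or> (\<exists>d\<in>carrier R. b = x \<otimes> d)"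
proof (rule ccontr)
  assume no: "\<not> ?thesis"
  obtain i :: nat and d u where i: "d \<in> carrier R" "u \<in> Units R" "a = x \<otimes> d \<oplus> y [^] i \<otimes> u"
    by (rule y_valuation[OF ab(1)]) (use no in simp_all)
  obtain j :: nat and e v where j: "e \<in> carrier R" "v \<in> Units R" "b = x \<otimes> e \<oplus> y [^] j \<otimes> v"
    by (rule y_valuation[OF ab(2)]) (use no in simp_all)
  have c: "u \<in> carrier R" "v \<in> carrier R" using i j Units_closed by auto
  have "a \<otimes> b = x \<otimes> (d \<otimes> b \<oplus> (y [^] i \<otimes> u) \<otimes> e) \<oplus> y [^] (i + j) \<otimes> (u \<otimes> v)"
    unfolding i(3) using i(1) j(1) c ab(2) unfolding j(3)
    by (simp add: l_distr r_distr nat_pow_mult[symmetric] m_ac a_ac)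
  then have "x \<otimes> c = x \<otimes> (d \<otimes> b \<oplus> (y [^] i \<otimes> u) \<otimes> e) \<oplus> y [^] (i + j) \<otimes> (u \<otimes> v)" using ab by simp
  from solve_y_pow[OF this] have
    "y [^] (i + j) = inv (u \<otimes> v) \<otimes> (x \<otimes> c \<oplus> x \<otimes> (\<ominus> (d \<otimes> b \<oplus> (y [^] i \<otimes> u) \<otimes> e)))"
    using i j c ab by simp
  also have "\<dots> = x \<otimes> (inv (u \<otimes> v) \<otimes> (c \<oplus> \<ominus> (d \<otimes> b \<oplus> (y [^] i \<otimes> u) \<otimes> e)))"
    using i j c ab by (simp add: r_distr m_ac)
  finally show False using y_pow_notin_x i j c ab by simp
qed

lemma P0_sub_x: assumes a: "a \<in> P0" shows "\<exists>b\<in>carrier R. a = x \<otimes> b"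
proof (rule ccontr)
  assume no: "\<not> ?thesis"
  obtain i :: nat and b u where i: "b \<in> carrier R" "u \<in> Units R" "a = x \<otimes> b \<oplus> y [^] i \<otimes> u"
    by (rule y_valuation[OF P0.Icarr[OF a] no])
  have "y [^] i = x \<otimes> (inv u \<otimes> (\<ominus> b)) \<oplus> inv u \<otimes> a"
    unfolding solve_y_pow[OF i(3,1,2) P0.Icarr[OF a]]
    using i(1,2) P0.Icarr[OF a] by (simp add: r_distr m_lcomm[of "inv u" x] a_comm)
  moreover have "inv u \<otimes> a \<in> P0" "inv u \<otimes> (\<ominus> b) \<in> carrier R" using i(1,2) P0.I_l_closed[OF a] by auto
  ultimately show False using principal_ideal_theorem by blast
qed

lemma x_notin_P0: "x \<notin> P0"
proof
  assume x: "x \<in> P0"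
  obtain q where q: "q \<in> P1" "q \<notin> P0" using P01 by blast
  have no: "\<not> (\<exists>b\<in>carrier R. q = x \<otimes> b)" using q(2) P0.I_r_closed[OF x] by blast
  obtain i :: nat and b u where i: "b \<in> carrier R" "u \<in> Units R" "q = x \<otimes> b \<oplus> y [^] i \<otimes> u"
    by (rule y_valuation[OF P1.Icarr[OF q(1)] no])
  have xP1: "x \<in> P1" using x P01 by blast
  have "y [^] i = inv u \<otimes> (q \<oplus> x \<otimes> (\<ominus> b))" by (rule solve_y_pow[OF i(3,1,2) P1.Icarr[OF q(1)]])
  also have "\<dots> \<in> P1"
    by (intro P1.I_l_closed P1.a_closed P1.I_r_closed xP1 q(1)) (use i(1,2) in simp_all)
  finally have "y \<in> P1" by (rule P1.pow_mem[OF y_carr])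
  then show False using not_both[OF P1] P1m xP1 by blast
qed

text \<open>\<open>P0 \<subseteq> x R\<close> and \<open>x \<notin> P0\<close> give \<open>P0 = x P0\<close>, so that
  \<open>P0 = 0\<close>.\<close>

lemma is_domain: "domain R"
proof -
  have "P0 \<subseteq> {\<zero>}"
  proof (rule nakayama_ideal[OF P0.is_ideal zeroideal])
    fix a assume a: "a \<in> P0"
    then obtain b where b: "b \<in> carrier R" "a = x \<otimes> b" using P0_sub_x by blast
    then have "b \<in> P0" using P0.I_prime a x_notin_P0 x_carr by blast
    moreover have "a = \<zero> \<oplus> x \<otimes> b" using b by simp
    ultimately show "\<exists>b\<in>{\<zero>}. \<exists>c\<in>m. \<exists>d\<in>P0. a = b \<oplus> c \<otimes> d" using x_m by blast
  qed
  then have "P0 = {\<zero>}" using P0.zero_closed by blast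
  then show ?thesis using zeroprimeideal_domainI P0 is_cring by simp
qed

end

sublocale regular_dim2 \<subseteq> dom: domain R by (rule is_domain)

context regular_dim2
begin

lemma x_nonzero: "x \<noteq> \<zero>" using x_notin_P0 P0.zero_closed by blast

lemma PIdl_x_prime: "primeideal (PIdl x) R"
proof (rule primeidealI)
  show "ideal (PIdl x) R" by (rule cgenideal_ideal) simp
  show "cring R" by (rule is_cring)
  have "PIdl x \<subseteq> m" using cgenideal_minimal[OF m_ideal x_m] .
  then show "carrier R \<noteq> PIdl x" using one_notin_m by blast
  fix a b assume "a \<in> carrier R" "b \<in> carrier R" "a \<otimes> b \<in> PIdl x"
  then obtain c where c: "a \<in> carrier R" "b \<in> carrier R" "c \<in> carrier R" "a \<otimes> b = x \<otimes> c"
    using m_comm unfolding mem_PIdl by (metis x_carr)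
  have "d \<in> carrier R ==> x \<otimes> d \<in> PIdl x" for d using m_comm[of x d] unfolding mem_PIdl by auto
  then show "a \<in> PIdl x \<or> b \<in> PIdl x" using x_prime[OF c] by blast
qed

lemma y_notin_x: "y \<notin> PIdl x"
proof
  assume "y \<in> PIdl x"
  then obtain c where "c \<in> carrier R" "y = x \<otimes> c" using m_comm unfolding mem_PIdl by auto
  then show False using y_pow_notin_x[of c 1] by simp
qed

text \<open>Krull's intersection theorem for the powers of \<open>x\<close>.\<close>

lemma separated_x:
  assumes r: "r \<in> carrier R" and all: "\<And>n::nat. \<exists>c\<in>carrier R. r = x [^] n \<otimes> c" shows "r = \<zero>"
proof -
  define J where "J = {r \<in> carrier R. \<forall>n::nat. \<exists>c\<in>carrier R. r = x [^] n \<otimes> c}"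
  have JE: "\<exists>c\<in>carrier R. r = x [^] (n::nat) \<otimes> c" if "r \<in> J" for r n using that unfolding J_def by blast
  have J: "ideal J R"
    unfolding submodule_ideal[symmetric]
  proof (rule module.submoduleI[OF self_module]; (simp add: self_minus)?)
    show "J \<subseteq> carrier R" unfolding J_def by blast
    show "\<zero> \<in> J" unfolding J_def by (auto intro!: bexI[of _ \<zero>])
    show smult: "a \<otimes> t \<in> J" if "a \<in> carrier R" "t \<in> J" for a t
      unfolding J_def
    proof (intro CollectI conjI allI)
      show "a \<otimes> t \<in> carrier R" using that unfolding J_def by blast
      fix n :: nat
      obtain c where "c \<in> carrier R" "t = x [^] n \<otimes> c" using JE[OF \<open>t \<in> J\<close>, of n] by blast
      then show "\<exists>c\<in>carrier R. a \<otimes> t = x [^] n \<otimes> c" using that by (intro bexI[of _ "a \<otimes> c"]) (auto simp: m_ac)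
    qed
    show "\<ominus>\<^bsub>self_module R\<^esub> t \<in> J" if "t \<in> J" for t
      using smult[of "\<ominus> \<one>" t] that unfolding J_def by (simp add: self_minus l_minus)
    show "s \<oplus> t \<in> J" if "s \<in> J" "t \<in> J" for s t
      unfolding J_def
    proof (intro CollectI conjI allI)
      show "s \<oplus> t \<in> carrier R" using that unfolding J_def by blast
      fix n :: nat
      obtain c d where "c \<in> carrier R" "t = x [^] n \<otimes> c" "d \<in> carrier R" "s = x [^] n \<otimes> d"
        using JE[OF \<open>s \<in> J\<close>, of n] JE[OF \<open>t \<in> J\<close>, of n] by blast
      then show "\<exists>c\<in>carrier R. s \<oplus> t = x [^] n \<otimes> c" by (intro bexI[of _ "d \<oplus> c"]) (auto simp: r_distr)
    qed
  qed
  have "J \<subseteq> {\<zero>}"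
  proof (rule nakayama_ideal[OF J zeroideal])
    fix a assume a: "a \<in> J"
    obtain b where b: "b \<in> carrier R" "a = x \<otimes> b" using JE[OF a, of 1] by auto
    have "b \<in> J" unfolding J_def
    proof (intro CollectI conjI allI b(1))
      fix n :: nat
      obtain c where c: "c \<in> carrier R" "a = x [^] (Suc n) \<otimes> c" using JE[OF a, of "Suc n"] by blast
      then have "x \<otimes> b = x \<otimes> (x [^] n \<otimes> c)" using b by (simp add: m_ac)
      then have "b = x [^] n \<otimes> c" using dom.m_lcancel[OF x_nonzero] b c by simp
      then show "\<exists>c\<in>carrier R. b = x [^] n \<otimes> c" using c by blast
    qed
    moreover have "a = \<zero> \<oplus> x \<otimes> b" using b by simp
    ultimately show "\<exists>b\<in>{\<zero>}. \<exists>c\<in>m. \<exists>d\<in>J. a = b \<oplus> c \<otimes> d" using x_m by blast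
  qed
  moreover have "r \<in> J" unfolding J_def using r all by blast
  ultimately show ?thesis by blast
qed

end

section \<open>Bases\<close>

definition basis :: "('a, 'm) ring_scheme \<Rightarrow> ('a, 'b, 'n) module_scheme \<Rightarrow> 'b set \<Rightarrow> bool"
  where "basis R M A \<longleftrightarrow> finite A \<and> A \<subseteq> carrier M \<and> lin_span M (carrier R) A = carrier M \<and>
    (\<forall>c. c \<in> A \<rightarrow> carrier R \<longrightarrow> (\<Oplus>\<^bsub>M\<^esub>a\<in>A. c a \<odot>\<^bsub>M\<^esub> a) = \<zero>\<^bsub>M\<^esub> \<longrightarrow> (\<forall>a\<in>A. c a = \<zero>\<^bsub>R\<^esub>))"

lemma (in module) lin_span_finsum:
  assumes "finite A" "A \<subseteq> carrier M" "ideal I R" "z \<in> lin_span M I A"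
  shows "\<exists>c. c \<in> A \<rightarrow> I \<and> z = (\<Oplus>\<^bsub>M\<^esub>a\<in>A. c a \<odot>\<^sub>M a)"
  using assms(1,2,4)
proof (induction A arbitrary: z)
  case empty
  have "z = \<zero>\<^sub>M" using empty(2) by (induction rule: lin_span.induct) auto
  then show ?case by simp
next
  case (insert v A)
  have Av: "A \<subseteq> carrier M" "v \<in> carrier M" using insert by auto
  have Ic: "i \<in> I ==> i \<in> carrier R" for i using ideal.Icarr[OF assms(3)] .
  obtain d w where d: "d \<in> I" "w \<in> lin_span M I A" "z = w \<oplus>\<^sub>M d \<odot>\<^sub>M v"
    using lin_span_insert[OF Av assms(3) insert.prems(2)] by blast
  obtain c where c: "c \<in> A \<rightarrow> I" "w = (\<Oplus>\<^bsub>M\<^esub>a\<in>A. c a \<odot>\<^sub>M a)" using insert.IH[OF Av(1) d(2)] by blast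
  let ?c = "c(v := d)"
  have cc: "(\<lambda>a. c a \<odot>\<^sub>M a) \<in> A \<rightarrow> carrier M" using c(1) Ic Av by (auto simp: Pi_iff subset_iff)
  have "(\<Oplus>\<^bsub>M\<^esub>a\<in>insert v A. ?c a \<odot>\<^sub>M a) = ?c v \<odot>\<^sub>M v \<oplus>\<^sub>M (\<Oplus>\<^bsub>M\<^esub>a\<in>A. ?c a \<odot>\<^sub>M a)"
    by (rule M.finsum_insert) (use insert.hyps c(1) d(1) Ic Av in "auto simp: Pi_iff subset_iff")
  also have "(\<Oplus>\<^bsub>M\<^esub>a\<in>A. ?c a \<odot>\<^sub>M a) = (\<Oplus>\<^bsub>M\<^esub>a\<in>A. c a \<odot>\<^sub>M a)"
    by (rule M.finsum_cong') (use insert.hyps cc in "auto simp: Pi_iff")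
  finally have "z = (\<Oplus>\<^bsub>M\<^esub>a\<in>insert v A. ?c a \<odot>\<^sub>M a)"
    unfolding d(3) using c(2) M.finsum_closed[OF cc] Ic[OF d(1)] Av by (simp add: M.a_comm)
  moreover have "?c \<in> insert v A \<rightarrow> I" using c(1) d(1) by auto
  ultimately show ?case by blast
qed

lemma (in module) finsum_lin_span:
  assumes A: "finite B" "B \<subseteq> A" "A \<subseteq> carrier M" and I: "ideal I R" and c: "c \<in> B \<rightarrow> I"
  shows "(\<Oplus>\<^bsub>M\<^esub>a\<in>B. c a \<odot>\<^sub>M a) \<in> lin_span M I A"
  using A(1,2) c
proof (induction B)
  case empty
  then show ?case using lin_span.zero by simp
next
  case (insert v B)
  have Ic: "i \<in> I ==> i \<in> carrier R" for i using ideal.Icarr[OF I] .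
  have cc: "(\<lambda>a. c a \<odot>\<^sub>M a) \<in> B \<rightarrow> carrier M" "c v \<odot>\<^sub>M v \<in> carrier M" using insert A(3) Ic by (auto simp: Pi_iff subset_iff)
  have "(\<Oplus>\<^bsub>M\<^esub>a\<in>insert v B. c a \<odot>\<^sub>M a) = (\<Oplus>\<^bsub>M\<^esub>a\<in>B. c a \<odot>\<^sub>M a) \<oplus>\<^sub>M c v \<odot>\<^sub>M v"
    using insert.hyps cc by (simp add: M.finsum_insert M.a_comm)
  then show ?case using insert lin_span.step[of _ M I A] by auto
qed

text \<open>Take a generating set with as few elements as possible. In a nontrivial relation one can first cancel powers of
  \<open>x\<close> and then, modulo \<open>x\<close>, powers of \<open>y\<close>, until some coefficient is a unit.\<close>

lemma (in regular_dim2) regular_imp_free: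
  fixes H (structure)
  assumes H: "module R H" and fin: "finite A0" "A0 \<subseteq> carrier H" "lin_span H (carrier R) A0 = carrier H"
    and x0: "\<And>h. h \<in> carrier H ==> x \<odot>\<^bsub>H\<^esub> h = \<zero>\<^bsub>H\<^esub> ==> h = \<zero>\<^bsub>H\<^esub>"
    and yx: "\<And>e w v. w \<in> carrier H ==> v \<in> carrier H ==> y [^]\<^bsub>R\<^esub> (e::nat) \<odot>\<^bsub>H\<^esub> w = x \<odot>\<^bsub>H\<^esub> v ==>
      \<exists>w'\<in>carrier H. w = x \<odot>\<^bsub>H\<^esub> w'"
  shows "\<exists>A. basis R H A"
proof -
  interpret H: module R H by (rule H)
  let ?P = "\<lambda>A. finite A \<and> A \<subseteq> carrier H \<and> lin_span H (carrier R) A = carrier H"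
  define A where "A = arg_min card ?P"
  have A: "?P A" unfolding A_def by (rule arg_min_natI[of ?P A0]) (use fin in simp)
  have A_min: "card A \<le> card B" if "?P B" for B unfolding A_def by (rule arg_min_nat_le) (use that in simp)
  have finA: "finite A" and Ac: "A \<subseteq> carrier H" and spanA: "lin_span H (carrier R) A = carrier H" using A by auto
  let ?s = "\<lambda>c. \<Oplus>\<^bsub>H\<^esub>a\<in>A. c a \<odot>\<^bsub>H\<^esub> a"
  have car: "(\<lambda>a. c a \<odot>\<^bsub>H\<^esub> a) \<in> A \<rightarrow> carrier H" if "c \<in> A \<rightarrow> carrier R" for c
    using that Ac by (auto simp: Pi_iff subset_iff)
  have s_carr: "?s c \<in> carrier H" if "c \<in> A \<rightarrow> carrier R" for c using H.finsum_closed[OF car[OF that]] .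
  have s_smult: "?s (\<lambda>a. r \<otimes>\<^bsub>R\<^esub> c a) = r \<odot>\<^bsub>H\<^esub> ?s c" if "c \<in> A \<rightarrow> carrier R" "r \<in> carrier R" for c r
  proof -
    have "r \<odot>\<^bsub>H\<^esub> ?s c = (\<Oplus>\<^bsub>H\<^esub>a\<in>A. r \<odot>\<^bsub>H\<^esub> (c a \<odot>\<^bsub>H\<^esub> a))"
      by (rule H.finsum_smult_ldistr[OF finA that(2) car[OF that(1)]])
    also have "\<dots> = ?s (\<lambda>a. r \<otimes>\<^bsub>R\<^esub> c a)"
      by (rule H.finsum_cong') (use that Ac in "auto simp: H.smult_assoc1 Pi_iff subset_iff")
    finally show ?thesis by simp
  qed
  have s_add: "?s (\<lambda>a. c a \<oplus>\<^bsub>R\<^esub> d a) = ?s c \<oplus>\<^bsub>H\<^esub> ?s d" if "c \<in> A \<rightarrow> carrier R" "d \<in> A \<rightarrow> carrier R" for c d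
  proof -
    have "?s c \<oplus>\<^bsub>H\<^esub> ?s d = (\<Oplus>\<^bsub>H\<^esub>a\<in>A. c a \<odot>\<^bsub>H\<^esub> a \<oplus>\<^bsub>H\<^esub> d a \<odot>\<^bsub>H\<^esub> a)"
      by (rule H.finsum_addf[symmetric]) (use that Ac in "auto simp: Pi_iff subset_iff")
    also have "\<dots> = ?s (\<lambda>a. c a \<oplus>\<^bsub>R\<^esub> d a)"
      by (rule H.finsum_cong') (use that Ac in "auto simp: H.smult_l_distr Pi_iff subset_iff")
    finally show ?thesis by simp
  qed
  have s_E: "\<exists>c. c \<in> A \<rightarrow> carrier R \<and> h = ?s c" if "h \<in> carrier H" for h
    using H.lin_span_finsum[OF finA Ac oneideal] that spanA by blast
  \<comment> \<open>A relation with a unit coefficient would make one generator superfluous.\<close>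
  have no_unit: False if c: "c \<in> A \<rightarrow> carrier R" "?s c = \<zero>\<^bsub>H\<^esub>" and a: "a \<in> A" "c a \<in> Units R" for c a
  proof -
    let ?B = "A - {a}"
    have B: "?B \<subseteq> carrier H" using Ac by auto
    note spB = H.lin_span_sub[OF B]
    have cB: "c \<in> ?B \<rightarrow> carrier R" using c by auto
    have sB: "(\<Oplus>\<^bsub>H\<^esub>a\<in>?B. c a \<odot>\<^bsub>H\<^esub> a) \<in> lin_span H (carrier R) ?B" (is "?t \<in> _")
      by (rule H.finsum_lin_span[OF _ order_refl B oneideal cB]) (use finA in auto)
    have tc: "?t \<in> carrier H" using sB H.submoduleE(1)[OF spB] by blast
    have ac: "a \<in> carrier H" "c a \<in> carrier R" using a Ac c by auto
    have "?s c = (\<Oplus>\<^bsub>H\<^esub>a\<in>insert a ?B. c a \<odot>\<^bsub>H\<^esub> a)" using a by (simp add: insert_absorb)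
    also have "\<dots> = c a \<odot>\<^bsub>H\<^esub> a \<oplus>\<^bsub>H\<^esub> ?t"
      by (rule H.finsum_insert) (use finA ac cB B in "auto simp: Pi_iff subset_iff")
    finally have "c a \<odot>\<^bsub>H\<^esub> a = \<ominus>\<^bsub>H\<^esub> ?t" using c(2) tc ac by (metis H.minus_equality H.smult_closed)
    then have ca: "c a \<odot>\<^bsub>H\<^esub> a \<in> lin_span H (carrier R) ?B" using H.submoduleE(3)[OF spB sB] by simp
    have "inv\<^bsub>R\<^esub> c a \<odot>\<^bsub>H\<^esub> (c a \<odot>\<^bsub>H\<^esub> a) = a" using ac a(2) by (simp add: H.smult_assoc1[symmetric])
    then have "a \<in> lin_span H (carrier R) ?B" using H.submoduleE(4)[OF spB _ ca, of "inv\<^bsub>R\<^esub> c a"] a(2) by simp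
    then have "A \<subseteq> lin_span H (carrier R) ?B" using H.lin_span_incl[OF B] by blast
    from H.lin_span_minimal[OF spB this order_refl]
    have "carrier H \<subseteq> lin_span H (carrier R) ?B" using spanA by simp
    then have "?P ?B" using H.submoduleE(1)[OF spB] finA B by auto
    from A_min[OF this] show False using a finA by (metis card_Diff1_less not_le)
  qed
  \<comment> \<open>Write the coefficients as \<open>x b + y^e c\<close> with one \<open>c\<close> a unit and \<open>e\<close> minimal. Then \<open>y^e \<Sum>c a\<close> is divisible by \<open>x\<close>, hence so is \<open>\<Sum>c a\<close>, which gives a relation with a unit coefficient.\<close>
  have no_mod_x: "\<forall>a\<in>A. \<exists>b\<in>carrier R. d a = x \<otimes>\<^bsub>R\<^esub> b" if d: "d \<in> A \<rightarrow> carrier R" "?s d = \<zero>\<^bsub>H\<^esub>" for d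
  proof (rule ccontr)
    assume "\<not> ?thesis"
    then obtain a1 where a1: "a1 \<in> A" "\<not> (\<exists>b\<in>carrier R. d a1 = x \<otimes>\<^bsub>R\<^esub> b)" by blast
    let ?E = "\<lambda>i::nat. \<exists>a\<in>A. \<exists>b\<in>carrier R. \<exists>u\<in>Units R. d a = x \<otimes>\<^bsub>R\<^esub> b \<oplus>\<^bsub>R\<^esub> y [^]\<^bsub>R\<^esub> i \<otimes>\<^bsub>R\<^esub> u"
    have dc: "a \<in> A ==> d a \<in> carrier R" for a using d by auto
    have "\<exists>i. ?E i" by (rule y_valuation[OF dc[OF a1(1)] a1(2)]) (use a1(1) in blast)
    define e where "e = (LEAST i. ?E i)"
    have "?E e" unfolding e_def by (rule LeastI_ex) fact
    then obtain a b0 u where a: "a \<in> A" "b0 \<in> carrier R" "u \<in> Units R"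
      "d a = x \<otimes>\<^bsub>R\<^esub> b0 \<oplus>\<^bsub>R\<^esub> y [^]\<^bsub>R\<^esub> e \<otimes>\<^bsub>R\<^esub> u" by blast
    have emin: "\<not> ?E i" if "i < e" for i using that not_less_Least unfolding e_def by blast
    have "\<exists>b\<in>carrier R. \<exists>c\<in>carrier R. d a' = x \<otimes>\<^bsub>R\<^esub> b \<oplus>\<^bsub>R\<^esub> y [^]\<^bsub>R\<^esub> e \<otimes>\<^bsub>R\<^esub> c" if "a' \<in> A" for a'
      using y_expansion[OF dc[OF that], of e] emin that by blast
    then obtain b c where bc: "\<And>a'. a' \<in> A ==> b a' \<in> carrier R \<and> c a' \<in> carrier R \<and>
        d a' = x \<otimes>\<^bsub>R\<^esub> b a' \<oplus>\<^bsub>R\<^esub> y [^]\<^bsub>R\<^esub> e \<otimes>\<^bsub>R\<^esub> c a'" by metis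
    let ?b = "b(a := b0)" let ?c = "c(a := u)"
    have uc: "u \<in> carrier R" using a by auto
    have b': "?b \<in> A \<rightarrow> carrier R" "?c \<in> A \<rightarrow> carrier R" using bc a uc by auto
    have "?s d = ?s (\<lambda>a. x \<otimes>\<^bsub>R\<^esub> ?b a \<oplus>\<^bsub>R\<^esub> y [^]\<^bsub>R\<^esub> e \<otimes>\<^bsub>R\<^esub> ?c a)"
      by (rule H.finsum_cong') (use bc a uc Ac in "auto simp: subset_iff")
    also have "\<dots> = ?s (\<lambda>a. x \<otimes>\<^bsub>R\<^esub> ?b a) \<oplus>\<^bsub>H\<^esub> ?s (\<lambda>a. y [^]\<^bsub>R\<^esub> e \<otimes>\<^bsub>R\<^esub> ?c a)"
      by (rule s_add) (use bc a uc in auto)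
    also have "\<dots> = x \<odot>\<^bsub>H\<^esub> ?s ?b \<oplus>\<^bsub>H\<^esub> y [^]\<^bsub>R\<^esub> e \<odot>\<^bsub>H\<^esub> ?s ?c"
      by (simp only: s_smult[OF b'(1) x_carr] s_smult[OF b'(2) nat_pow_closed[OF y_carr]])
    finally have "x \<odot>\<^bsub>H\<^esub> ?s ?b \<oplus>\<^bsub>H\<^esub> y [^]\<^bsub>R\<^esub> e \<odot>\<^bsub>H\<^esub> ?s ?c = \<zero>\<^bsub>H\<^esub>" using d by simp
    then have "y [^]\<^bsub>R\<^esub> e \<odot>\<^bsub>H\<^esub> ?s ?c = \<ominus>\<^bsub>H\<^esub> (x \<odot>\<^bsub>H\<^esub> ?s ?b)"
      using s_carr[OF b'(1)] s_carr[OF b'(2)] by (intro H.minus_equality[symmetric]) (auto simp: H.a_comm)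
    also have "\<dots> = x \<odot>\<^bsub>H\<^esub> (\<ominus>\<^bsub>H\<^esub> ?s ?b)" using s_carr[OF b'(1)] by (simp add: H.smult_r_minus)
    finally obtain w where w: "w \<in> carrier H" "?s ?c = x \<odot>\<^bsub>H\<^esub> w"
      using yx[OF s_carr[OF b'(2)], of "\<ominus>\<^bsub>H\<^esub> ?s ?b" e] s_carr[OF b'(1)] by auto
    obtain f where f: "f \<in> A \<rightarrow> carrier R" "w = ?s f" using s_E w by blast
    have mx: "\<ominus>\<^bsub>R\<^esub> x \<in> carrier R" by simp
    have f': "(\<lambda>a. \<ominus>\<^bsub>R\<^esub> x \<otimes>\<^bsub>R\<^esub> f a) \<in> A \<rightarrow> carrier R" using f by auto
    have "?s (\<lambda>a. ?c a \<oplus>\<^bsub>R\<^esub> (\<ominus>\<^bsub>R\<^esub> x) \<otimes>\<^bsub>R\<^esub> f a) = ?s ?c \<oplus>\<^bsub>H\<^esub> (\<ominus>\<^bsub>R\<^esub> x) \<odot>\<^bsub>H\<^esub> w"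
      by (simp only: s_add[OF b'(2) f'] s_smult[OF f(1) mx] f(2))
    also have "\<dots> = \<zero>\<^bsub>H\<^esub>" using w by (simp add: H.smult_l_minus H.r_neg)
    finally have "?s (\<lambda>a. ?c a \<oplus>\<^bsub>R\<^esub> (\<ominus>\<^bsub>R\<^esub> x) \<otimes>\<^bsub>R\<^esub> f a) = \<zero>\<^bsub>H\<^esub>" .
    moreover have "?c a \<oplus>\<^bsub>R\<^esub> (\<ominus>\<^bsub>R\<^esub> x) \<otimes>\<^bsub>R\<^esub> f a \<in> Units R"
    proof (rule unit)
      have fa: "f a \<in> carrier R" using f a by auto
      then show "?c a \<oplus>\<^bsub>R\<^esub> (\<ominus>\<^bsub>R\<^esub> x) \<otimes>\<^bsub>R\<^esub> f a \<in> carrier R" using uc by simp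
      show "?c a \<oplus>\<^bsub>R\<^esub> (\<ominus>\<^bsub>R\<^esub> x) \<otimes>\<^bsub>R\<^esub> f a \<notin> m"
      proof
        assume "?c a \<oplus>\<^bsub>R\<^esub> (\<ominus>\<^bsub>R\<^esub> x) \<otimes>\<^bsub>R\<^esub> f a \<in> m"
        then have "(u \<oplus>\<^bsub>R\<^esub> (\<ominus>\<^bsub>R\<^esub> x) \<otimes>\<^bsub>R\<^esub> f a) \<oplus>\<^bsub>R\<^esub> x \<otimes>\<^bsub>R\<^esub> f a \<in> m"
          using m.I_r_closed[OF x_m fa] by simp
        moreover have "(u \<oplus>\<^bsub>R\<^esub> (\<ominus>\<^bsub>R\<^esub> x) \<otimes>\<^bsub>R\<^esub> f a) \<oplus>\<^bsub>R\<^esub> x \<otimes>\<^bsub>R\<^esub> f a = u"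
          using uc fa by (simp add: a_assoc l_minus l_neg)
        ultimately show False using unit_notin_m a by simp
      qed
    qed
    moreover have "(\<lambda>a. ?c a \<oplus>\<^bsub>R\<^esub> (\<ominus>\<^bsub>R\<^esub> x) \<otimes>\<^bsub>R\<^esub> f a) \<in> A \<rightarrow> carrier R"
      using bc uc f by (auto simp: Pi_iff)
    ultimately show False using no_unit a(1) by blast
  qed
  have xpow: "\<exists>d. d \<in> A \<rightarrow> carrier R \<and> ?s d = \<zero>\<^bsub>H\<^esub> \<and> (\<forall>a\<in>A. c a = x [^]\<^bsub>R\<^esub> (n::nat) \<otimes>\<^bsub>R\<^esub> d a)"
    if c: "c \<in> A \<rightarrow> carrier R" "?s c = \<zero>\<^bsub>H\<^esub>" for c n
  proof (induction n)
    case 0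
    then show ?case using c by (intro exI[of _ c]) (auto simp: Pi_iff)
  next
    case (Suc n)
    then obtain d where d: "d \<in> A \<rightarrow> carrier R" "?s d = \<zero>\<^bsub>H\<^esub>" "\<forall>a\<in>A. c a = x [^]\<^bsub>R\<^esub> n \<otimes>\<^bsub>R\<^esub> d a" by blast
    obtain b where b: "\<And>a. a \<in> A ==> b a \<in> carrier R \<and> d a = x \<otimes>\<^bsub>R\<^esub> b a" using no_mod_x[OF d(1,2)] by metis
    have b': "b \<in> A \<rightarrow> carrier R" using b by auto
    have "x \<odot>\<^bsub>H\<^esub> ?s b = ?s (\<lambda>a. x \<otimes>\<^bsub>R\<^esub> b a)" using s_smult[OF b' x_carr] by simp
    also have "\<dots> = ?s d" by (rule H.finsum_cong') (use b d Ac in auto)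
    finally have "?s b = \<zero>\<^bsub>H\<^esub>" using x0 s_carr[OF b'] d by simp
    then show ?case using b' b d by (intro exI[of _ b]) (auto simp: m_assoc)
  qed
  have "\<forall>a\<in>A. c a = \<zero>\<^bsub>R\<^esub>" if c: "c \<in> A \<rightarrow> carrier R" "?s c = \<zero>\<^bsub>H\<^esub>" for c
  proof
    fix a assume a: "a \<in> A"
    show "c a = \<zero>\<^bsub>R\<^esub>"
    proof (rule separated_x)
      show "c a \<in> carrier R" using c a by auto
      fix n :: nat
      obtain d where "d \<in> A \<rightarrow> carrier R" "\<forall>a\<in>A. c a = x [^]\<^bsub>R\<^esub> n \<otimes>\<^bsub>R\<^esub> d a" using xpow[OF c] by blast
      then show "\<exists>d\<in>carrier R. c a = x [^]\<^bsub>R\<^esub> n \<otimes>\<^bsub>R\<^esub> d" using a by auto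
    qed
  qed
  then show ?thesis unfolding basis_def using A by blast
qed

lemma lin_span_restrict: "lin_span (M\<lparr>carrier := N\<rparr>) I A = lin_span M I A"
proof (intro equalityI subsetI)
  fix z assume "z \<in> lin_span (M\<lparr>carrier := N\<rparr>) I A"
  then show "z \<in> lin_span M I A"
    by induction (simp_all add: lin_span.zero lin_span.step)
next
  fix z assume "z \<in> lin_span M I A"
  then show "z \<in> lin_span (M\<lparr>carrier := N\<rparr>) I A"
  proof induction
    case zero
    then show ?case using lin_span.zero[of "M\<lparr>carrier := N\<rparr>" I A] by simp
  next
    case (step z c a)
    then show ?case using lin_span.step[of z "M\<lparr>carrier := N\<rparr>" I A c a] by simp
  qed
qed

context regular_dim2
begin

text \<open>Two elements of an ideal are always linearly dependent, so a free ideal is principal.\<close>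

lemma regular_ideal_principal:
  assumes J: "ideal J R"
    and yx: "\<And>e w v. w \<in> J ==> v \<in> J ==> y [^] (e::nat) \<otimes> w = x \<otimes> v ==> \<exists>w'\<in>J. w = x \<otimes> w'"
  shows "\<exists>z\<in>J. J = PIdl z"
proof -
  let ?H = "(self_module R)\<lparr>carrier := J\<rparr>"
  interpret S: module R "self_module R" by (rule self_module)
  have sub: "submodule J R (self_module R)" using J submodule_ideal by simp
  have H: "module R ?H" by (rule submodule.submodule_is_module[OF sub self_module])
  interpret H: module R ?H by (rule H)
  note Jc = ideal.Icarr[OF J]
  obtain A0 where A0: "finite A0" "A0 \<subseteq> J" "lin_span (self_module R) (carrier R) A0 = J"
    by (rule S.noetherian_moduleE[OF noetherian_ring_module[OF noeth] sub])
  have "\<exists>A. basis R ?H A"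
  proof (rule regular_imp_free[OF H A0(1)])
    show "A0 \<subseteq> carrier ?H" "lin_span ?H (carrier R) A0 = carrier ?H" using A0 by (auto simp: lin_span_restrict)
    show "h = \<zero>\<^bsub>?H\<^esub>" if "h \<in> carrier ?H" "x \<odot>\<^bsub>?H\<^esub> h = \<zero>\<^bsub>?H\<^esub>" for h
      using that Jc x_nonzero dom.integral_iff by simp
  qed (use yx in auto)
  then obtain A where A: "basis R ?H A" by blast
  have finA: "finite A" and AJ: "A \<subseteq> J" and spanA: "lin_span (self_module R) (carrier R) A = J"
    using A unfolding basis_def by (auto simp: lin_span_restrict)
  have uniq: "p = q" if pq: "p \<in> A" "q \<in> A" for p q
  proof (rule ccontr)
    assume ne: "p \<noteq> q"
    define B where "B = A - {p, q}"
    have AB: "A = insert p (insert q B)" "finite B" "p \<notin> insert q B" "q \<notin> B"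
      unfolding B_def using pq ne finA by auto
    have c: "p \<in> carrier R" "q \<in> carrier R" "p \<in> J" "q \<in> J" using pq AJ Jc by auto
    let ?c = "\<lambda>a. if a = p then q else if a = q then \<ominus> p else \<zero>"
    have cA: "?c \<in> A \<rightarrow> carrier R" using c by auto
    have car: "?c a \<otimes> a \<in> J" if "a \<in> A" for a
      using that AJ c ideal.I_l_closed[OF J] by auto
    have zero: "(\<Oplus>\<^bsub>?H\<^esub>a\<in>B. ?c a \<otimes> a) = \<zero>"
    proof -
      have "(\<Oplus>\<^bsub>?H\<^esub>a\<in>B. ?c a \<otimes> a) = (\<Oplus>\<^bsub>?H\<^esub>a\<in>B. \<zero>\<^bsub>?H\<^esub>)"
        by (rule H.finsum_cong') (use AB AJ Jc H.zero_closed in "auto simp: subset_iff")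
      also have "\<dots> = \<zero>\<^bsub>?H\<^esub>" by (rule H.finsum_zero)
      finally show ?thesis by simp
    qed
    have "(\<Oplus>\<^bsub>?H\<^esub>a\<in>A. ?c a \<odot>\<^bsub>?H\<^esub> a) = (\<Oplus>\<^bsub>?H\<^esub>a\<in>insert p (insert q B). ?c a \<otimes> a)"
      unfolding AB(1)[symmetric] by simp
    also have "\<dots> = ?c p \<otimes> p \<oplus>\<^bsub>?H\<^esub> (\<Oplus>\<^bsub>?H\<^esub>a\<in>insert q B. ?c a \<otimes> a)"
      by (rule H.finsum_insert) (use AB car[of p] car pq in "auto simp: Pi_iff simp del: if_split")
    also have "(\<Oplus>\<^bsub>?H\<^esub>a\<in>insert q B. ?c a \<otimes> a) = ?c q \<otimes> q \<oplus>\<^bsub>?H\<^esub> (\<Oplus>\<^bsub>?H\<^esub>a\<in>B. ?c a \<otimes> a)"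
      by (rule H.finsum_insert) (use AB car[unfolded AB(1)] in "auto simp del: if_split")
    finally have "(\<Oplus>\<^bsub>?H\<^esub>a\<in>A. ?c a \<odot>\<^bsub>?H\<^esub> a) = \<zero>\<^bsub>?H\<^esub>"
      unfolding zero using c ne by (simp add: l_minus m_comm[of q p] r_neg)
    then have "\<forall>a\<in>A. ?c a = \<zero>" using A cA unfolding basis_def by blast
    then have "q = \<zero>" "\<ominus> p = \<zero>" using pq ne by (auto split: if_splits)
    then show False using ne c minus_minus[of p] by simp
  qed
  obtain z where z: "z \<in> J" "A \<subseteq> {z}"
  proof (cases "A = {}")
    case True
    then show ?thesis using that[of \<zero>] additive_subgroup.zero_closed[OF ideal.axioms(1)[OF J]] by simp
  next
    case False
    then show ?thesis using that uniq AJ by blast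
  qed
  have P: "ideal (PIdl z) R" using cgenideal_ideal z Jc by blast
  have "J \<subseteq> PIdl z"
    unfolding spanA[symmetric]
    by (rule S.lin_span_minimal) (use P submodule_ideal z cgenideal_self Jc in auto)
  then show ?thesis using cgenideal_minimal[OF J z(1)] z by blast
qed

lemma x_divides:
  assumes "w \<in> carrier R" "v \<in> carrier R" "y [^] (e::nat) \<otimes> w = x \<otimes> v"
  shows "\<exists>w'\<in>carrier R. w = x \<otimes> w'"
  using x_prime[OF _ assms(1,2,3)] y_pow_notin_x by auto

text \<open>\<open>x\<close> or \<open>y\<close> lies outside \<open>P\<close> and can be cancelled in it, so that
  \<open>P\<close> is free.\<close>

lemma nonmaximal_prime_principal:
  assumes P: "primeideal P R" "P \<noteq> m" shows "\<exists>z\<in>P. P = PIdl z"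
proof -
  interpret P: primeideal P R by (rule P)
  interpret sw: regular_dim2 R m y x P0 P1 by (rule swap)
  have "x \<notin> P \<or> y \<notin> P" by (rule not_both[OF P])
  then show ?thesis
  proof
    assume x: "x \<notin> P"
    show ?thesis
    proof (rule regular_ideal_principal[OF P.is_ideal])
      fix e w v assume h: "w \<in> P" "v \<in> P" "y [^] (e::nat) \<otimes> w = x \<otimes> v"
      then obtain w' where "w' \<in> carrier R" "w = x \<otimes> w'" using x_divides P.Icarr by blast
      then show "\<exists>w'\<in>P. w = x \<otimes> w'" using P.I_prime[of x w'] h x by auto
    qed
  next
    assume y: "y \<notin> P"
    show ?thesis
    proof (rule sw.regular_ideal_principal[OF P.is_ideal])
      fix e w v assume h: "w \<in> P" "v \<in> P" "x [^] (e::nat) \<otimes> w = y \<otimes> v"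
      then obtain w' where "w' \<in> carrier R" "w = y \<otimes> w'" using sw.x_divides P.Icarr by blast
      then show "\<exists>w'\<in>P. w = y \<otimes> w'" using P.I_prime[of y w'] h y by auto
    qed
  qed
qed

text \<open>If multiplication by \<open>a / b\<close> maps the set \<open>I\<close> into itself, it also maps
  \<open>J = {r. r I \<subseteq> d R}\<close> (a copy of the dual of \<open>I\<close>) into itself; but
  \<open>J\<close> is principal.\<close>

lemma integrally_closed:
  assumes a: "a \<in> carrier R" and b: "b \<in> carrier R" "b \<noteq> \<zero>" and I: "I \<subseteq> carrier R" and d: "d \<in> I" "d \<noteq> \<zero>"
    and ab: "\<And>i. i \<in> I ==> \<exists>i'\<in>I. a \<otimes> i = b \<otimes> i'"
  shows "\<exists>c\<in>carrier R. a = b \<otimes> c"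
proof -
  define J where "J = {r \<in> carrier R. \<forall>i\<in>I. \<exists>s\<in>carrier R. r \<otimes> i = d \<otimes> s}"
  have JE: "\<exists>s\<in>carrier R. r \<otimes> i = d \<otimes> s" if "r \<in> J" "i \<in> I" for r i using that unfolding J_def by blast
  have JI: "r \<in> J" if "r \<in> carrier R" "\<And>i. i \<in> I ==> i \<in> carrier R ==> \<exists>s\<in>carrier R. r \<otimes> i = d \<otimes> s" for r
    unfolding J_def using that I by blast
  have Jc: "r \<in> J ==> r \<in> carrier R" for r unfolding J_def by blast
  have dc: "d \<in> carrier R" using d I by blast
  have J: "ideal J R"
    unfolding submodule_ideal[symmetric]
  proof (rule module.submoduleI[OF self_module]; (simp add: self_minus)?)
    show "J \<subseteq> carrier R" using Jc by blast
    show "\<zero> \<in> J" by (rule JI) (use dc in "auto intro!: bexI[of _ \<zero>]")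
    show smult: "r \<otimes> t \<in> J" if r: "r \<in> carrier R" and t: "t \<in> J" for r t
    proof (rule JI)
      show "r \<otimes> t \<in> carrier R" using r Jc[OF t] by simp
      fix i assume i: "i \<in> I" "i \<in> carrier R"
      then obtain s where "s \<in> carrier R" "t \<otimes> i = d \<otimes> s" using JE[OF t] by blast
      then have "r \<otimes> t \<otimes> i = d \<otimes> (r \<otimes> s)" using r Jc[OF t] i dc by (simp add: m_assoc m_lcomm)
      then show "\<exists>s\<in>carrier R. r \<otimes> t \<otimes> i = d \<otimes> s" using r \<open>s \<in> carrier R\<close> by blast
    qed
    show "\<ominus>\<^bsub>self_module R\<^esub> t \<in> J" if "t \<in> J" for t
      using smult[of "\<ominus> \<one>" t] that Jc[OF that] by (simp add: self_minus l_minus)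
    show "r \<oplus> t \<in> J" if r: "r \<in> J" and t: "t \<in> J" for r t
    proof (rule JI)
      show "r \<oplus> t \<in> carrier R" using Jc r t by simp
      fix i assume i: "i \<in> I" "i \<in> carrier R"
      then obtain s s' where "s \<in> carrier R" "t \<otimes> i = d \<otimes> s" "s' \<in> carrier R" "r \<otimes> i = d \<otimes> s'"
        using JE[OF t i(1)] JE[OF r i(1)] by blast
      then have "(r \<oplus> t) \<otimes> i = d \<otimes> (s' \<oplus> s)" using Jc r t i dc by (simp add: l_distr r_distr)
      then show "\<exists>s\<in>carrier R. (r \<oplus> t) \<otimes> i = d \<otimes> s" using \<open>s \<in> carrier R\<close> \<open>s' \<in> carrier R\<close> by blast
    qed
  qed
  have "\<exists>z\<in>J. J = PIdl z"
  proof (rule regular_ideal_principal[OF J])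
    fix e :: nat and w v assume h: "w \<in> J" "v \<in> J" "y [^] e \<otimes> w = x \<otimes> v"
    then obtain w' where w': "w' \<in> carrier R" "w = x \<otimes> w'" using x_divides Jc by blast
    have "x \<otimes> (y [^] e \<otimes> w') = x \<otimes> v" using h w' by (simp add: m_lcomm)
    then have v: "y [^] e \<otimes> w' = v" using dom.m_lcancel[OF x_nonzero] Jc h w' by simp
    have "w' \<in> J"
    proof (rule JI[OF w'(1)])
      fix i assume i: "i \<in> I" "i \<in> carrier R"
      obtain s where s: "s \<in> carrier R" "w \<otimes> i = d \<otimes> s" using JE[OF h(1) i(1)] by blast
      obtain t where t: "t \<in> carrier R" "v \<otimes> i = d \<otimes> t" using JE[OF h(2) i(1)] by blast
      have "d \<otimes> (y [^] e \<otimes> s) = y [^] e \<otimes> (w \<otimes> i)" using s dc by (simp add: m_lcomm)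
      also have "\<dots> = x \<otimes> (v \<otimes> i)" unfolding w'(2) v[symmetric] using w'(1) i by (simp add: m_assoc m_lcomm)
      also have "\<dots> = d \<otimes> (x \<otimes> t)" using t dc by (simp add: m_lcomm)
      finally have "y [^] e \<otimes> s = x \<otimes> t" using dom.m_lcancel[OF d(2) dc] s t by simp
      then obtain s' where s': "s' \<in> carrier R" "s = x \<otimes> s'" using x_divides s t by blast
      have "x \<otimes> (w' \<otimes> i) = x \<otimes> (d \<otimes> s')" using s(2) w' i s' dc by (simp add: m_assoc m_lcomm)
      then have "w' \<otimes> i = d \<otimes> s'" using dom.m_lcancel[OF x_nonzero] w' i s' dc by simp
      then show "\<exists>s\<in>carrier R. w' \<otimes> i = d \<otimes> s" using s' by blast
    qed
    then show "\<exists>w'\<in>J. w = x \<otimes> w'" using w' by blast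
  qed
  then obtain z where z: "z \<in> J" "J = PIdl z" by blast
  have zc: "z \<in> carrier R" using z Jc by blast
  have "d \<in> J" by (rule JI[OF dc]) auto
  then have z0: "z \<noteq> \<zero>" using d(2) unfolding z(2) mem_PIdl by auto
  obtain i' where i': "i' \<in> I" "a \<otimes> d = b \<otimes> i'" using ab d by blast
  obtain s where s: "s \<in> carrier R" "z \<otimes> i' = d \<otimes> s" using JE[OF z(1) i'(1)] by blast
  have i'c: "i' \<in> carrier R" using i' I by blast
  have "d \<otimes> (a \<otimes> z) = z \<otimes> (a \<otimes> d)" using a dc zc by (simp add: m_ac)
  also have "\<dots> = b \<otimes> (z \<otimes> i')" unfolding i'(2) using b zc i'c by (simp add: m_lcomm)
  also have "\<dots> = d \<otimes> (b \<otimes> s)" unfolding s(2) using b dc s by (simp add: m_lcomm)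
  finally have az: "a \<otimes> z = b \<otimes> s" using dom.m_lcancel[OF d(2) dc] a b zc s by simp
  \<comment> \<open>\<open>a z = b s\<close> for the generator \<open>z\<close> of \<open>J\<close>. It remains to see that \<open>s\<close> is again in \<open>J\<close>, that is, a multiple of \<open>z\<close>.\<close>
  have "s \<in> J"
  proof (rule JI[OF s(1)])
    fix i assume i: "i \<in> I" "i \<in> carrier R"
    obtain i2 where i2: "i2 \<in> I" "a \<otimes> i = b \<otimes> i2" using ab i by blast
    obtain t where t: "t \<in> carrier R" "z \<otimes> i2 = d \<otimes> t" using JE[OF z(1) i2(1)] by blast
    have i2c: "i2 \<in> carrier R" using i2 I by blast
    have "b \<otimes> (s \<otimes> i) = (a \<otimes> z) \<otimes> i" unfolding az using b s i by (simp add: m_assoc)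
    also have "\<dots> = z \<otimes> (a \<otimes> i)" using a zc i by (simp add: m_ac)
    also have "\<dots> = b \<otimes> (z \<otimes> i2)" unfolding i2(2) using b zc i2c by (simp add: m_lcomm)
    finally have "s \<otimes> i = d \<otimes> t" unfolding t(2) using dom.m_lcancel[OF b(2) b(1)] s i dc t by simp
    then show "\<exists>t\<in>carrier R. s \<otimes> i = d \<otimes> t" using t by blast
  qed
  then obtain t where t: "t \<in> carrier R" "s = t \<otimes> z" unfolding z(2) mem_PIdl by blast
  have "z \<otimes> a = z \<otimes> (b \<otimes> t)" using az t a b zc by (simp add: m_ac)
  then have "a = b \<otimes> t" using dom.m_lcancel[OF z0 zc] a b t by simp
  then show ?thesis using t by blast
qed

end

section \<open>Krull dimension\<close>

lemma enat_Inf_mem: "A \<noteq> {} ==> Inf A \<in> (A :: enat set)"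
  unfolding Inf_enat_def by (auto intro: LeastI)

text \<open>The supremum over the lengths of chains is attained, being a finite element of \<open>enat\<close>.\<close>

lemma krull_dim_chain:
  assumes "krull_dim R = 2"
  obtains P0 P1 P2 where "primeideal P0 R" "primeideal P1 R" "primeideal P2 R" "P0 \<subset> P1" "P1 \<subset> P2"
proof -
  let ?S = "{enat n | n. \<exists>P :: nat \<Rightarrow> _ set. (\<forall>i\<le>n. primeideal (P i) R) \<and> (\<forall>i<n. P i \<subset> P (Suc i))}"
  have "\<exists>n. enat n \<in> ?S \<and> 2 \<le> n"
  proof (rule ccontr)
    assume no: "\<not> ?thesis"
    have "Sup ?S \<le> enat 1"
    proof (rule Sup_least)
      fix e assume e: "e \<in> ?S"
      then obtain n where n: "e = enat n" by blast
      then have "n < 2" using no e not_le by blast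
      then show "e \<le> enat 1" using n by simp
    qed
    moreover have "Sup ?S = enat 2" using assms unfolding krull_dim_def by (simp add: numeral_eq_enat)
    ultimately show False by simp
  qed
  then obtain n and P :: "nat \<Rightarrow> _" where n: "2 \<le> n" and P: "\<And>i. i \<le> n ==> primeideal (P i) R" "\<And>i. i < n ==> P i \<subset> P (Suc i)"
    by blast
  show thesis
    using that[of "P 0" "P 1" "P 2"] P(1)[of 0] P(1)[of 1] P(1)[of 2] P(2)[of 0] P(2)[of 1] n
    by (simp add: numeral_2_eq_2)
qed

lemma krull_dim_no_chain:
  assumes "krull_dim R = 2" "primeideal P0 R" "primeideal P1 R" "primeideal P2 R" "primeideal P3 R"
    "P0 \<subset> P1" "P1 \<subset> P2" "P2 \<subset> P3"
  shows False
proof -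
  let ?P = "\<lambda>i::nat. if i = 0 then P0 else if i = 1 then P1 else if i = 2 then P2 else P3"
  have "enat 3 \<le> krull_dim R"
    unfolding krull_dim_def
  proof (rule Sup_upper, intro CollectI exI[of _ "3::nat"] conjI exI[of _ ?P] allI impI refl)
    show "primeideal (?P i) R" for i using assms(2-5) by simp
    show "?P i \<subset> ?P (Suc i)" if "i < 3" for i :: nat
    proof -
      consider "i = 0" | "i = 1" | "i = 2" using \<open>i < 3\<close> by linarith
      then show ?thesis by cases (use assms(6-8) in simp_all)
    qed
  qed
  then show False using assms(1) by (simp add: numeral_eq_enat)
qed

lemma krull_dim_eq_2:
  assumes "primeideal P0 R" "primeideal P1 R" "primeideal P2 R" "P0 \<subset> P1" "P1 \<subset> P2"
    and no: "\<And>Q0 Q1 Q2 Q3. primeideal Q0 R ==> primeideal Q1 R ==> primeideal Q2 R ==> primeideal Q3 R ==>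
      Q0 \<subset> Q1 ==> Q1 \<subset> Q2 ==> Q2 \<subset> Q3 ==> False"
  shows "krull_dim R = 2"
proof (rule antisym)
  let ?S = "{enat n | n. \<exists>P :: nat \<Rightarrow> _ set. (\<forall>i\<le>n. primeideal (P i) R) \<and> (\<forall>i<n. P i \<subset> P (Suc i))}"
  have "Sup ?S \<le> enat 2"
  proof (rule Sup_least)
    fix e assume "e \<in> ?S"
    then obtain n and P :: "nat \<Rightarrow> _" where n: "e = enat n" and P: "\<And>i. i \<le> n ==> primeideal (P i) R" "\<And>i. i < n ==> P i \<subset> P (Suc i)"
      by blast
    have "n \<le> 2"
    proof (rule ccontr)
      assume "\<not> n \<le> 2"
      then show False
        using no[of "P 0" "P 1" "P 2" "P 3"] P(1)[of 0] P(1)[of 1] P(1)[of 2] P(1)[of 3] P(2)[of 0] P(2)[of 1] P(2)[of 2]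
        by (simp add: numeral_2_eq_2 numeral_3_eq_3)
    qed
    then show "e \<le> enat 2" using n by simp
  qed
  then show "krull_dim R \<le> 2" unfolding krull_dim_def by (simp add: numeral_eq_enat)
  let ?P = "\<lambda>i::nat. if i = 0 then P0 else if i = 1 then P1 else P2"
  have "enat 2 \<le> krull_dim R"
    unfolding krull_dim_def
  proof (rule Sup_upper, intro CollectI exI[of _ "2::nat"] conjI exI[of _ ?P] allI impI refl)
    show "primeideal (?P i) R" for i using assms(1-3) by simp
    show "?P i \<subset> ?P (Suc i)" if "i < 2" for i :: nat
    proof -
      consider "i = 0" | "i = 1" using \<open>i < 2\<close> by linarith
      then show ?thesis by cases (use assms(4,5) in simp_all)
    qed
  qed
  then show "2 \<le> krull_dim R" by (simp add: numeral_eq_enat)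
qed

text \<open>\<open>embedding_dim R = 2\<close> provides the two generators, and \<open>krull_dim R = 2\<close> the primes; the top
  of a chain of length two may be replaced by \<open>m\<close>.\<close>

lemma regular_local_dim2:
  fixes R (structure)
  assumes reg: "regular_local_ring R" and m: "maximalideal m R" and dim: "krull_dim R = 2"
  obtains x y P0 P1 where "regular_dim2 R m x y P0 P1"
proof -
  have R: "cring R" "noetherian_ring R" "\<And>J. maximalideal J R ==> J = m" and emb: "embedding_dim R = 2"
    using reg m dim unfolding regular_local_ring_def local_ring_def by auto
  interpret cring R by (rule R)
  interpret noetherian_local R m by (rule noetherian_local_of_local[OF R(2) m R(3)])
  let ?S = "{enat (card A) | A. finite A \<and> A \<subseteq> carrier R \<and> Idl A = max_ideal R}"
  have "?S \<noteq> {}"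
  proof
    assume "?S = {}"
    then have "embedding_dim R = \<infinity>" unfolding embedding_dim_def by (simp add: Inf_enat_def)
    then show False using emb by simp
  qed
  then have "embedding_dim R \<in> ?S" unfolding embedding_dim_def by (rule enat_Inf_mem)
  then obtain A where A: "card A = 2" "A \<subseteq> carrier R" "Idl A = m"
    unfolding emb max_ideal_eq by (auto simp: numeral_eq_enat)
  then obtain x y where xy: "A = {x, y}" by (auto simp: card_2_iff)
  have c: "x \<in> carrier R" "y \<in> carrier R" using A xy by auto
  interpret S: module R "self_module R" by (rule self_module)
  obtain P0 P1 P2 where P: "primeideal P0 R" "primeideal P1 R" "primeideal P2 R" "P0 \<subset> P1" "P1 \<subset> P2"
    by (rule krull_dim_chain[OF dim])
  have "regular_dim2 R m x y P0 P1"
  proof (intro regular_dim2.intro regular_dim2_axioms.intro)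
    show "noetherian_local R m" by unfold_locales
    show "x \<in> m" "y \<in> m" using genideal_self[OF A(2)] A(3) xy by auto
    fix a assume "a \<in> m"
    then have "a \<in> lin_span (self_module R) (carrier R) (insert x {y})"
      using genideal_eq_span[OF A(2)] A(3) xy by simp
    then obtain b w where b: "b \<in> carrier R" "w \<in> lin_span (self_module R) (carrier R) (insert y {})" "a = w \<oplus> b \<otimes> x"
      using S.lin_span_insert[of "{y}" x "carrier R" a] c oneideal by auto
    then obtain c' w' where w': "c' \<in> carrier R" "w' \<in> lin_span (self_module R) (carrier R) {}" "w = w' \<oplus> c' \<otimes> y"
      using S.lin_span_insert[of "{}" y "carrier R" w] c oneideal by auto
    have "w' = \<zero>" using w'(2) by (induction rule: lin_span.induct) auto
    then have "a = b \<otimes> x \<oplus> c' \<otimes> y" using b w' c by (simp add: a_comm)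
    then show "\<exists>b\<in>carrier R. \<exists>c\<in>carrier R. a = b \<otimes> x \<oplus> c \<otimes> y" using b w' by blast
  next
    show "P0 \<subset> P1" "P1 \<subset> m" using P(4,5) prime_sub_m[OF P(3)] by auto
  qed (rule P(1) | rule P(2))+
  then show thesis using that by blast
qed

section \<open>Modules of functions\<close>

text \<open>The module \<open>R^I\<close>, with extensional functions so that equality is pointwise. The \<open>ring\<close>
  fields that every module record carries get arbitrary values.\<close>

definition fun_module :: "('a, 'm) ring_scheme \<Rightarrow> 'i set \<Rightarrow> ('a, 'i \<Rightarrow> 'a) module"
  where "fun_module R I = \<lparr>carrier = I \<rightarrow>\<^sub>E carrier R, monoid.mult = (\<lambda>f g. f), one = (\<lambda>i\<in>I. \<zero>\<^bsub>R\<^esub>),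
    ring.zero = (\<lambda>i\<in>I. \<zero>\<^bsub>R\<^esub>), add = (\<lambda>f g. \<lambda>i\<in>I. f i \<oplus>\<^bsub>R\<^esub> g i), smult = (\<lambda>r f. \<lambda>i\<in>I. r \<otimes>\<^bsub>R\<^esub> f i)\<rparr>"

lemma fun_module_simps [simp]:
  "carrier (fun_module R I) = I \<rightarrow>\<^sub>E carrier R"
  "\<zero>\<^bsub>fun_module R I\<^esub> = (\<lambda>i\<in>I. \<zero>\<^bsub>R\<^esub>)"
  "f \<oplus>\<^bsub>fun_module R I\<^esub> g = (\<lambda>i\<in>I. f i \<oplus>\<^bsub>R\<^esub> g i)"
  "r \<odot>\<^bsub>fun_module R I\<^esub> f = (\<lambda>i\<in>I. r \<otimes>\<^bsub>R\<^esub> f i)"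
  unfolding fun_module_def by simp_all

context module
begin

lemma noetherian_finite_subset:
  assumes noeth: "noetherian_module R M" and A: "A \<subseteq> carrier M"
  obtains B where "finite B" "B \<subseteq> A" "lin_span M (carrier R) B = lin_span M (carrier R) A"
proof -
  let ?F = "{lin_span M (carrier R) B | B. finite B \<and> B \<subseteq> A}"
  have "\<exists>N\<in>?F. \<forall>L\<in>?F. N \<subseteq> L \<longrightarrow> L = N"
  proof (rule noetherian_max[OF noeth])
    show "?F \<noteq> {}" by blast
    show "submodule N R M" if "N \<in> ?F" for N using that lin_span_sub A by blast
  qed
  then obtain N where N: "N \<in> ?F" "\<forall>L\<in>?F. N \<subseteq> L \<longrightarrow> L = N" ..
  obtain B where B: "finite B" "B \<subseteq> A" "N = lin_span M (carrier R) B" using N(1) by blast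
  have mx: "L = lin_span M (carrier R) B" if "L \<in> ?F" "lin_span M (carrier R) B \<subseteq> L" for L
    using bspec[OF N(2) that(1)] that(2) unfolding B(3) by (rule mp)
  have Bc: "B \<subseteq> carrier M" using A B by blast
  have "A \<subseteq> lin_span M (carrier R) B"
  proof
    fix a assume a: "a \<in> A"
    let ?L = "lin_span M (carrier R) (insert a B)"
    have "?L \<in> ?F" using a B by blast
    moreover have "lin_span M (carrier R) B \<subseteq> ?L" using lin_span_mono[OF subset_insertI order_refl] by (rule subsetI)
    ultimately have "?L = lin_span M (carrier R) B" by (rule mx)
    moreover have "a \<in> ?L" using lin_span_incl[of "insert a B"] Bc a A by blast
    ultimately show "a \<in> lin_span M (carrier R) B" by simp
  qed
  then have "lin_span M (carrier R) A \<subseteq> lin_span M (carrier R) B"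
    by (rule lin_span_minimal[OF lin_span_sub[OF Bc]]) simp
  moreover have "lin_span M (carrier R) B \<subseteq> lin_span M (carrier R) A"
    using lin_span_mono[OF B(2) order_refl] by blast
  ultimately show thesis using that[OF B(1,2)] by simp
qed

text \<open>Lift finitely many generators of the image.\<close>

lemma noetherian_inj:
  fixes V (structure)
  assumes V: "module R V" "noetherian_module R V"
    and f: "\<And>z. z \<in> carrier M ==> f z \<in> carrier V" "inj_on f (carrier M)"
    and add: "\<And>z w. z \<in> carrier M ==> w \<in> carrier M ==> f (z \<oplus>\<^sub>M w) = f z \<oplus>\<^bsub>V\<^esub> f w"
    and smult: "\<And>r z. r \<in> carrier R ==> z \<in> carrier M ==> f (r \<odot>\<^sub>M z) = r \<odot>\<^bsub>V\<^esub> f z"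
  shows "noetherian_module R M"
  unfolding noetherian_module_def
proof (intro allI impI)
  fix N assume N: "submodule N R M"
  interpret V: module R V by (rule V)
  note Nc = submoduleE(1)[OF N]
  have fN: "f ` N \<subseteq> carrier V" using f(1) Nc by blast
  obtain B where B: "finite B" "B \<subseteq> f ` N" "lin_span V (carrier R) B = lin_span V (carrier R) (f ` N)"
    by (rule V.noetherian_finite_subset[OF V(2) fN])
  obtain A where A: "finite A" "A \<subseteq> N" "B = f ` A" using finite_subset_image[OF B(1,2)] by blast
  have Ac: "A \<subseteq> carrier M" using A Nc by blast
  have f0: "f \<zero>\<^sub>M = \<zero>\<^bsub>V\<^esub>"
    using smult[of "\<zero>\<^bsub>R\<^esub>" "\<zero>\<^sub>M"] f(1)[of "\<zero>\<^sub>M"] by simp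
  have lift: "\<exists>w\<in>lin_span M (carrier R) A. z = f w" if "z \<in> lin_span V (carrier R) (f ` A)" for z
    using that
  proof induction
    case zero
    then show ?case using f0 lin_span.zero by metis
  next
    case (step z c b)
    then obtain w a where w: "w \<in> lin_span M (carrier R) A" "z = f w" "a \<in> A" "b = f a" by blast
    have "w \<in> carrier M" "a \<in> carrier M" using w Ac lin_span_carrier[OF Ac order_refl] by auto
    then have "z \<oplus>\<^bsub>V\<^esub> c \<odot>\<^bsub>V\<^esub> b = f (w \<oplus>\<^sub>M c \<odot>\<^sub>M a)" using w step by (simp add: add smult)
    moreover have "w \<oplus>\<^sub>M c \<odot>\<^sub>M a \<in> lin_span M (carrier R) A" using w step by (intro lin_span.step)
    ultimately show ?case by blast
  qed
  have "N \<subseteq> lin_span M (carrier R) A"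
  proof
    fix z assume z: "z \<in> N"
    have "f z \<in> lin_span V (carrier R) (f ` A)" using V.lin_span_incl[OF fN] z B(3) A(3) by blast
    then obtain w where w: "w \<in> lin_span M (carrier R) A" "f z = f w" using lift by blast
    then have "z = w" using f(2) z Nc lin_span_carrier[OF Ac order_refl] unfolding inj_on_def by blast
    then show "z \<in> lin_span M (carrier R) A" using w by simp
  qed
  moreover have "lin_span M (carrier R) A \<subseteq> N" by (rule lin_span_minimal[OF N A(2)]) simp
  ultimately show "\<exists>A. finite A \<and> A \<subseteq> N \<and> lin_span M (carrier R) A = N" using A by blast
qed

end

context cring
begin

lemma fun_module: "module R (fun_module R I)"
proof (rule moduleI)
  show "abelian_group (fun_module R I)"
  proof (rule abelian_groupI)
    fix f assume "f \<in> carrier (fun_module R I)"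
    then show "\<exists>g\<in>carrier (fun_module R I). g \<oplus>\<^bsub>fun_module R I\<^esub> f = \<zero>\<^bsub>fun_module R I\<^esub>"
      by (intro bexI[of _ "\<lambda>i\<in>I. \<ominus> f i"]) (auto simp: PiE_iff l_neg)
  qed (auto simp: PiE_iff extensional_def a_ac intro!: restrict_ext)
qed (auto simp: PiE_iff extensional_def l_distr r_distr m_assoc is_cring intro!: restrict_ext)

text \<open>\<open>R^I\<close> is spanned by the unit vectors.\<close>

lemma fun_module_noetherian:
  assumes noeth: "noetherian_ring R" and I: "finite I"
  shows "noetherian_module R (fun_module R I)"
proof -
  let ?V = "fun_module R I"
  interpret V: module R ?V by (rule fun_module)
  define e where "e i = (\<lambda>j\<in>I. if j = i then \<one> else \<zero>)" for i
  have ec: "e ` I \<subseteq> carrier ?V" unfolding e_def by auto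
  have span: "(\<lambda>i\<in>I. if i \<in> J then f i else \<zero>) \<in> lin_span ?V (carrier R) (e ` I)"
    if "J \<subseteq> I" "f \<in> carrier ?V" for f J
  proof -
    have "finite J" using that I finite_subset by blast
    then show ?thesis using \<open>J \<subseteq> I\<close>
    proof (induction J)
      case empty
      then show ?case using lin_span.zero[of ?V "carrier R" "e ` I"]
        by (simp only: fun_module_simps empty_iff if_False)
    next
      case (insert j J)
      have "(\<lambda>i\<in>I. if i \<in> insert j J then f i else \<zero>) =
          (\<lambda>i\<in>I. if i \<in> J then f i else \<zero>) \<oplus>\<^bsub>?V\<^esub> f j \<odot>\<^bsub>?V\<^esub> e j"
        unfolding fun_module_simps
        by (rule restrict_ext) (use insert that(2) in "auto simp: e_def PiE_iff")
      moreover have "\<dots> \<in> lin_span ?V (carrier R) (e ` I)"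
        by (rule lin_span.step[OF insert.IH]) (use insert.prems that(2) in auto)
      ultimately show ?case by (simp only:)
    qed
  qed
  have "carrier ?V \<subseteq> lin_span ?V (carrier R) (e ` I)"
  proof
    fix f assume f: "f \<in> carrier ?V"
    then have "f = (\<lambda>i\<in>I. if i \<in> I then f i else \<zero>)" by (auto simp: PiE_iff extensional_def fun_eq_iff)
    then show "f \<in> lin_span ?V (carrier R) (e ` I)" using span[OF order_refl f] by simp
  qed
  then have all: "N \<subseteq> lin_span ?V (carrier R) (e ` I)" if "submodule N R ?V" for N
    using V.submoduleE(1)[OF that] by (rule order_trans[rotated])
  show ?thesis unfolding noetherian_module_def
    using V.noetherian_fin_gen[OF noetherian_ring_module[OF noeth] finite_imageI[OF I] ec _ all] by blast
qed

end

section \<open>Finite group actions and invariants\<close>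

locale finite_action = cring R + G: group G for R (structure) and G +
  fixes \<phi> :: "_ \<Rightarrow> 'a \<Rightarrow> 'a"
  assumes fin: "finite (carrier G)" and act: "ring_action G R \<phi>"
    and order_unit: "add_pow R (order G) \<one> \<in> Units R"
begin

abbreviation S where "S \<equiv> invariant_ring G \<phi> R"

lemma S_simps [simp]: "monoid.mult S = monoid.mult R" "add S = add R" "one S = \<one>" "ring.zero S = \<zero>"
  unfolding invariant_ring_def by simp_all

lemma S_iff: "s \<in> carrier S \<longleftrightarrow> s \<in> carrier R \<and> (\<forall>g\<in>carrier G. \<phi> g s = s)"
  unfolding invariant_ring_def by simp

lemma S_carr: "s \<in> carrier S ==> s \<in> carrier R" and S_inv: "s \<in> carrier S ==> g \<in> carrier G ==> \<phi> g s = s"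
  unfolding S_iff by auto

lemma act_Aut: "g \<in> carrier G ==> \<phi> g \<in> ring_hom R R \<and> \<phi> g \<in> Bij (carrier R)"
  using act unfolding ring_action_def hom_def ring_Aut_def by auto

lemma act_hom: "g \<in> carrier G ==> \<phi> g \<in> ring_hom R R" using act_Aut by blast

lemma act_closed [simp]: "g \<in> carrier G ==> z \<in> carrier R ==> \<phi> g z \<in> carrier R"
  using ring_hom_closed[OF act_hom] .

lemma act_mult: "g \<in> carrier G ==> z \<in> carrier R ==> w \<in> carrier R ==> \<phi> g (z \<otimes> w) = \<phi> g z \<otimes> \<phi> g w"
  using ring_hom_mult[OF act_hom] .

lemma act_add: "g \<in> carrier G ==> z \<in> carrier R ==> w \<in> carrier R ==> \<phi> g (z \<oplus> w) = \<phi> g z \<oplus> \<phi> g w"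
  using ring_hom_add[OF act_hom] .

lemma act_one [simp]: "g \<in> carrier G ==> \<phi> g \<one> = \<one>"
  using ring_hom_one[OF act_hom] .

lemma act_zero [simp]: "g \<in> carrier G ==> \<phi> g \<zero> = \<zero>"
  using ring_hom_zero[OF act_hom] ring_axioms by blast

lemma act_minus: assumes "g \<in> carrier G" "z \<in> carrier R" shows "\<phi> g (\<ominus> z) = \<ominus> \<phi> g z"
proof -
  have "\<phi> g (\<ominus> z) \<oplus> \<phi> g z = \<zero>" using act_add[of g "\<ominus> z" z] assms by (simp add: l_neg)
  then show ?thesis using assms sum_zero_eq_neg by simp
qed

lemma act_comp: assumes "g \<in> carrier G" "h \<in> carrier G" "z \<in> carrier R"
  shows "\<phi> (g \<otimes>\<^bsub>G\<^esub> h) z = \<phi> g (\<phi> h z)"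
proof -
  have "\<phi> (g \<otimes>\<^bsub>G\<^esub> h) = compose (carrier R) (\<phi> g) (\<phi> h)"
    using act act_Aut assms unfolding ring_action_def hom_def ring_Aut_def BijGroup_def by auto
  then show ?thesis using assms by (simp add: compose_def)
qed

lemma act_id: assumes "z \<in> carrier R" shows "\<phi> \<one>\<^bsub>G\<^esub> z = z"
proof -
  have "inj_on (\<phi> \<one>\<^bsub>G\<^esub>) (carrier R)" using act_Aut[OF G.one_closed] unfolding Bij_def bij_betw_def by blast
  moreover have "\<phi> \<one>\<^bsub>G\<^esub> (\<phi> \<one>\<^bsub>G\<^esub> z) = \<phi> \<one>\<^bsub>G\<^esub> z" using act_comp[of "\<one>\<^bsub>G\<^esub>" "\<one>\<^bsub>G\<^esub>" z] assms by simp
  ultimately show ?thesis using assms unfolding inj_on_def by simp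
qed

lemma act_inv [simp]: assumes "g \<in> carrier G" "z \<in> carrier R"
  shows "\<phi> (inv\<^bsub>G\<^esub> g) (\<phi> g z) = z" "\<phi> g (\<phi> (inv\<^bsub>G\<^esub> g) z) = z"
  using assms act_comp[symmetric] act_id by simp_all

lemma act_pow: "g \<in> carrier G ==> z \<in> carrier R ==> \<phi> g (z [^] (n::nat)) = \<phi> g z [^] n"
  by (induction n) (auto simp: act_mult)

lemma act_finsum:
  assumes g: "g \<in> carrier G" and "finite A" "f \<in> A \<rightarrow> carrier R"
  shows "\<phi> g (\<Oplus>i\<in>A. f i) = (\<Oplus>i\<in>A. \<phi> g (f i))"
  using assms(2,3)
proof (induction A)
  case (insert a A)
  have "(\<Oplus>i\<in>insert a A. f i) = f a \<oplus> (\<Oplus>i\<in>A. f i)"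
    "(\<Oplus>i\<in>insert a A. \<phi> g (f i)) = \<phi> g (f a) \<oplus> (\<Oplus>i\<in>A. \<phi> g (f i))"
    by (rule finsum_insert; use insert g in "auto simp: Pi_iff")+
  moreover have "(\<Oplus>i\<in>A. f i) \<in> carrier R" using insert by (intro finsum_closed) auto
  ultimately show ?case using insert g by (simp add: act_add)
qed (use g in simp)

lemma act_finprod:
  assumes g: "g \<in> carrier G" and "finite A" "f \<in> A \<rightarrow> carrier R"
  shows "\<phi> g (\<Otimes>i\<in>A. f i) = (\<Otimes>i\<in>A. \<phi> g (f i))"
  using assms(2,3)
proof (induction A)
  case (insert a A)
  have "(\<Otimes>i\<in>insert a A. f i) = f a \<otimes> (\<Otimes>i\<in>A. f i)"
    "(\<Otimes>i\<in>insert a A. \<phi> g (f i)) = \<phi> g (f a) \<otimes> (\<Otimes>i\<in>A. \<phi> g (f i))"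
    by (rule finprod_insert; use insert g in "auto simp: Pi_iff")+
  moreover have "(\<Otimes>i\<in>A. f i) \<in> carrier R" using insert by (intro finprod_closed) auto
  ultimately show ?case using insert g by (simp add: act_mult)
qed (use g in simp)

lemma left_translate: assumes "h \<in> carrier G"
  shows "inj_on ((\<otimes>\<^bsub>G\<^esub>) h) (carrier G)" "(\<otimes>\<^bsub>G\<^esub>) h ` carrier G = carrier G"
  using G.inj_on_multc assms G.surj_const_mult by (auto simp: inj_on_def)

lemma finsum_translate:
  assumes h: "h \<in> carrier G" and f: "f \<in> carrier G \<rightarrow> carrier R"
  shows "(\<Oplus>g\<in>carrier G. f (h \<otimes>\<^bsub>G\<^esub> g)) = (\<Oplus>g\<in>carrier G. f g)"
  using finsum_reindex[of f "(\<otimes>\<^bsub>G\<^esub>) h" "carrier G"] left_translate[OF h] f by simp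

lemma finprod_translate:
  assumes h: "h \<in> carrier G" and f: "f \<in> carrier G \<rightarrow> carrier R"
  shows "(\<Otimes>g\<in>carrier G. f (h \<otimes>\<^bsub>G\<^esub> g)) = (\<Otimes>g\<in>carrier G. f g)"
  using finprod_reindex[of f "(\<otimes>\<^bsub>G\<^esub>) h" "carrier G"] left_translate[OF h] f by simp

lemma S_subring: "subring (carrier S) R"
  by (rule subringI) (auto simp: S_iff act_add act_mult act_minus)

lemma S_cring: "cring S"
proof -
  have "subcring (carrier S) R" by (rule subcringI'[OF S_subring])
  then have "cring (R\<lparr>carrier := carrier S\<rparr>)" using subcring_iff S_carr by blast
  then show ?thesis unfolding invariant_ring_def by simp
qed

sublocale S: cring S by (rule S_cring)

lemma S_minus [simp]: assumes "s \<in> carrier S" shows "\<ominus>\<^bsub>S\<^esub> s = \<ominus> s"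
proof (rule sum_zero_eq_neg)
  show "\<ominus>\<^bsub>S\<^esub> s \<in> carrier R" "s \<in> carrier R" using assms S_carr S.a_inv_closed by auto
  show "\<ominus>\<^bsub>S\<^esub> s \<oplus> s = \<zero>" using S.l_neg[OF assms] by simp
qed

lemma S_pow [simp]: "s [^]\<^bsub>S\<^esub> (n::nat) = s [^] n"
  by (induction n) simp_all

lemma S_a_closed: "s \<in> carrier S ==> t \<in> carrier S ==> s \<oplus> t \<in> carrier S"
  and S_m_closed: "s \<in> carrier S ==> t \<in> carrier S ==> s \<otimes> t \<in> carrier S"
  and S_one: "\<one> \<in> carrier S" and S_zero: "\<zero> \<in> carrier S"
  using S.a_closed S.m_closed S.one_closed S.zero_closed by simp_all

lemma S_Units: assumes s: "s \<in> carrier S" "s \<in> Units R" shows "s \<in> Units S" "inv s \<in> carrier S"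
proof -
  have c: "s \<in> carrier R" "inv s \<in> carrier R" using s by auto
  have "\<phi> g (inv s) = inv s" if g: "g \<in> carrier G" for g
  proof -
    have "s \<otimes> \<phi> g (inv s) = \<phi> g (s \<otimes> inv s)" using c g S_inv[OF s(1)] by (simp add: act_mult del: Units_r_inv)
    also have "\<dots> = \<one>" using s g by simp
    finally show ?thesis using comm_inv_char[of s "\<phi> g (inv s)"] c g by simp
  qed
  then show i: "inv s \<in> carrier S" unfolding S_iff using c by blast
  show "s \<in> Units S" unfolding Units_def using s i c by (auto intro!: bexI[of _ "inv s"])
qed

text \<open>The inverse of the group order in \<open>R\<close>.\<close>

definition \<nu> where "\<nu> = inv (add_pow R (order G) \<one>)"

definition avg where "avg f = \<nu> \<otimes> (\<Oplus>g\<in>carrier G. f g)"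

lemma \<nu>_carr [simp]: "\<nu> \<in> carrier R" unfolding \<nu>_def using order_unit by simp

lemma \<nu>_S: "\<nu> \<in> carrier S"
proof -
  have "add_pow R (n::nat) \<one> \<in> carrier S" for n
    by (induction n) (auto simp: S_zero S_one intro: S_a_closed)
  then show ?thesis unfolding \<nu>_def using S_Units(2) order_unit by blast
qed

lemma avg_closed [simp]: "f \<in> carrier G \<rightarrow> carrier R ==> avg f \<in> carrier R"
  unfolding avg_def by simp

lemma avg_const: assumes "z \<in> carrier R" shows "avg (\<lambda>g. z) = z"
proof -
  have "(\<Oplus>g\<in>carrier G. z) = add_pow R (card (carrier G)) z" using assms by (rule add.finprod_const)
  also have "\<dots> = add_pow R (order G) \<one> \<otimes> z" using assms add_pow_ldistr[of \<one> z] unfolding order_def by simp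
  finally show ?thesis unfolding avg_def \<nu>_def using order_unit assms by (simp add: m_assoc[symmetric])
qed

lemma avg_cong: "(\<And>g. g \<in> carrier G ==> f g = f' g) ==> f' \<in> carrier G \<rightarrow> carrier R ==> avg f = avg f'"
  unfolding avg_def by (auto intro!: arg_cong2[where f = "(\<otimes>)"] finsum_cong')

lemma avg_add: assumes "f \<in> carrier G \<rightarrow> carrier R" "f' \<in> carrier G \<rightarrow> carrier R"
  shows "avg (\<lambda>g. f g \<oplus> f' g) = avg f \<oplus> avg f'"
  unfolding avg_def using assms by (simp add: finsum_addf r_distr)

lemma avg_smult: assumes "f \<in> carrier G \<rightarrow> carrier R" "r \<in> carrier R"
  shows "avg (\<lambda>g. r \<otimes> f g) = r \<otimes> avg f"
proof -
  have "(\<Oplus>g\<in>carrier G. r \<otimes> f g) = r \<otimes> (\<Oplus>g\<in>carrier G. f g)"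
    using finsum_rdistr[OF fin assms(2,1)] by simp
  then show ?thesis unfolding avg_def using assms by (simp add: m_lcomm)
qed

text \<open>Translation by \<open>h\<close> permutes the group, and \<open>h\<close> fixes the inverse of its order.\<close>

lemma act_avg:
  assumes h: "h \<in> carrier G" and f: "f \<in> carrier G \<rightarrow> carrier R"
    and eq: "\<And>g. g \<in> carrier G ==> \<phi> h (f g) = f' (h \<otimes>\<^bsub>G\<^esub> g)" and f': "f' \<in> carrier G \<rightarrow> carrier R"
  shows "\<phi> h (avg f) = avg f'"
proof -
  have "\<phi> h (avg f) = \<nu> \<otimes> (\<Oplus>g\<in>carrier G. \<phi> h (f g))"
    unfolding avg_def using S_inv[OF \<nu>_S h] h f fin by (simp add: act_mult act_finsum)
  also have "(\<Oplus>g\<in>carrier G. \<phi> h (f g)) = (\<Oplus>g\<in>carrier G. f' (h \<otimes>\<^bsub>G\<^esub> g))"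
    by (rule finsum_cong') (use eq f' h in auto)
  also have "\<dots> = (\<Oplus>g\<in>carrier G. f' g)" by (rule finsum_translate[OF h f'])
  finally show ?thesis unfolding avg_def .
qed

text \<open>The Reynolds operator.\<close>

definition reynolds where "reynolds z = avg (\<lambda>g. \<phi> g z)"

lemma reynolds_S: assumes "z \<in> carrier R" shows "reynolds z \<in> carrier S"
  unfolding S_iff reynolds_def using assms by (auto intro!: act_avg simp: act_comp)

lemma reynolds_id: "s \<in> carrier S ==> reynolds s = s"
  unfolding reynolds_def using avg_cong[of "\<lambda>g. \<phi> g s" "\<lambda>g. s"] avg_const S_carr S_inv by simp

lemma reynolds_add: "z \<in> carrier R ==> w \<in> carrier R ==> reynolds (z \<oplus> w) = reynolds z \<oplus> reynolds w"
  unfolding reynolds_def using avg_add[of "\<lambda>g. \<phi> g z" "\<lambda>g. \<phi> g w"] avg_cong[of "\<lambda>g. \<phi> g (z \<oplus> w)" "\<lambda>g. \<phi> g z \<oplus> \<phi> g w"]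
  by (simp add: act_add)

lemma reynolds_smult: assumes "s \<in> carrier S" "z \<in> carrier R" shows "reynolds (s \<otimes> z) = s \<otimes> reynolds z"
  unfolding reynolds_def using assms S_carr[OF assms(1)]
  by (subst avg_smult[symmetric]) (auto intro!: avg_cong simp: act_mult S_inv)

lemma reynolds_closed [simp]: "z \<in> carrier R ==> reynolds z \<in> carrier R"
  using reynolds_S S_carr by blast

lemma reynolds_zero [simp]: "reynolds \<zero> = \<zero>" by (rule reynolds_id[OF S_zero])

lemma RS_module: "module S (self_module R)"
proof (rule moduleI)
  show "abelian_group (self_module R)" using module.axioms(2)[OF self_module] by simp
qed (auto simp: S_cring S_carr l_distr r_distr m_assoc)

sublocale RS: module S "self_module R"
  rewrites "carrier (self_module R) = carrier R" and "add (self_module R) = add R"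
    and "smult (self_module R) = monoid.mult R" and "ring.zero (self_module R) = \<zero>"
  by (rule RS_module) simp_all

text \<open>For an \<open>S\<close>-submodule \<open>N\<close> of \<open>R\<close>, the \<open>R\<close>-submodule of
  \<open>R\<^sup>G\<close> spanned by the vectors \<open>(g n)\<close>, \<open>n \<in> N\<close>, is spanned by
  finitely many of them; averaging the coefficients of such a linear combination after applying
  \<open>g\<inverse>\<close> in the component of \<open>g\<close> makes them invariant.\<close>

lemma R_noetherian_over_S:
  assumes noeth: "noetherian_ring R" shows "noetherian_module S (self_module R)"
  unfolding noetherian_module_def
proof (intro allI impI)
  fix N assume N: "submodule N S (self_module R)"
  have Nc: "N \<subseteq> carrier R" using module.submoduleE(1)[OF RS_module N] by simp
  let ?V = "fun_module R (carrier G)"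
  interpret V: module R ?V by (rule fun_module)
  define v where "v n = (\<lambda>g\<in>carrier G. \<phi> g n)" for n
  have vN: "v ` N \<subseteq> carrier ?V" unfolding v_def using Nc by auto
  obtain B where B: "finite B" "B \<subseteq> v ` N" "lin_span ?V (carrier R) B = lin_span ?V (carrier R) (v ` N)"
    by (rule V.noetherian_finite_subset[OF fun_module_noetherian[OF noeth fin] vN])
  obtain A where A: "finite A" "A \<subseteq> N" "B = v ` A" using finite_subset_image[OF B(1,2)] by blast
  have Ac: "A \<subseteq> carrier R" using A Nc by blast
  \<comment> \<open>\<open>T\<close> retracts \<open>R^G\<close> to \<open>R\<close>: it maps the vector \<open>(g n)\<close> back to \<open>n\<close>.\<close>
  define T where "T f = avg (\<lambda>g. \<phi> (inv\<^bsub>G\<^esub> g) (f g))" for f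
  have Tspan: "T f \<in> lin_span (self_module R) (carrier S) A" if "f \<in> lin_span ?V (carrier R) (v ` A)" for f
    using that
  proof induction
    case zero
    have "T \<zero>\<^bsub>?V\<^esub> = avg (\<lambda>g. \<zero>)" unfolding T_def by (rule avg_cong) auto
    then show ?case using avg_const[of \<zero>] lin_span.zero[of "self_module R" "carrier S" A]
      by (simp del: fun_module_simps)
  next
    case (step f c w)
    then obtain a where a: "a \<in> A" "w = v a" by blast
    have ac: "a \<in> carrier R" using a Ac by blast
    have "v ` A \<subseteq> carrier ?V" using vN A by blast
    then have fc: "f \<in> carrier ?V" using V.lin_span_carrier[OF _ order_refl] step by blast
    let ?d = "avg (\<lambda>g. \<phi> (inv\<^bsub>G\<^esub> g) c)"
    have dS: "?d \<in> carrier S" unfolding S_iff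
    proof (intro conjI ballI)
      show "?d \<in> carrier R" using step by auto
      fix h assume h: "h \<in> carrier G"
      let ?f' = "\<lambda>g. \<phi> g c"
      have "inj_on (\<lambda>g. inv\<^bsub>G\<^esub> g) (carrier G)" using G.inv_inj by simp
      moreover have "(\<lambda>g. inv\<^bsub>G\<^esub> g) ` carrier G = carrier G"
      proof (intro equalityI subsetI)
        fix g assume "g \<in> carrier G"
        then show "g \<in> (\<lambda>g. inv\<^bsub>G\<^esub> g) ` carrier G" by (intro image_eqI[of _ _ "inv\<^bsub>G\<^esub> g"]) auto
      qed auto
      ultimately have "?d = avg ?f'"
        unfolding avg_def using finsum_reindex[of ?f' "\<lambda>g. inv\<^bsub>G\<^esub> g" "carrier G"] step by simp
      also have "\<dots> = reynolds c" unfolding reynolds_def ..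
      finally show "\<phi> h ?d = ?d" using S_inv[OF reynolds_S h] step by simp
    qed
    have "T (f \<oplus>\<^bsub>?V\<^esub> c \<odot>\<^bsub>?V\<^esub> w) = avg (\<lambda>g. \<phi> (inv\<^bsub>G\<^esub> g) (f g) \<oplus> a \<otimes> \<phi> (inv\<^bsub>G\<^esub> g) c)"
      unfolding T_def
      by (rule avg_cong) (use fc step ac in "auto simp: a(2) v_def act_add act_mult m_comm PiE_iff")
    also have "\<dots> = T f \<oplus> a \<otimes> ?d"
      unfolding T_def using fc step ac by (subst avg_add) (auto simp: PiE_iff avg_smult)
    also have "\<dots> = T f \<oplus> ?d \<otimes> a" using ac dS S_carr by (simp add: m_comm)
    also have "\<dots> \<in> lin_span (self_module R) (carrier S) A"
      using lin_span.step[OF step.IH dS a(1)] by simp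
    finally show ?case .
  qed
  have "N \<subseteq> lin_span (self_module R) (carrier S) A"
  proof
    fix n assume n: "n \<in> N"
    have nc: "n \<in> carrier R" using n Nc by blast
    have "v n \<in> lin_span ?V (carrier R) (v ` A)" using V.lin_span_incl[OF vN] n B(3) A(3) by blast
    then have "T (v n) \<in> lin_span (self_module R) (carrier S) A" by (rule Tspan)
    moreover have "T (v n) = avg (\<lambda>g. n)" unfolding T_def v_def by (rule avg_cong) (use nc in auto)
    ultimately show "n \<in> lin_span (self_module R) (carrier S) A" using avg_const nc by simp
  qed
  moreover have "lin_span (self_module R) (carrier S) A \<subseteq> N"
    by (rule module.lin_span_minimal[OF RS_module N A(2)]) simp
  ultimately show "\<exists>A. finite A \<and> A \<subseteq> N \<and> lin_span (self_module R) (carrier S) A = N" using A by blast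
qed

lemma S_noetherian:
  assumes noeth: "noetherian_ring R" shows "noetherian_ring S"
proof (rule S.noetherian_module_ring)
  interpret SS: module S "self_module S" by (rule S.self_module)
  show "noetherian_module S (self_module S)"
  proof (rule SS.noetherian_inj[OF RS_module R_noetherian_over_S[OF noeth], of "\<lambda>s. s"])
  qed (auto simp: S_carr)
qed

end

section \<open>Regular sequences and depth\<close>

context module
begin

lemma seq_mult_span:
  assumes "set xs \<subseteq> carrier R"
  shows "seq_mult R M xs = lin_span M (carrier R) {r \<odot>\<^sub>M v | r v. r \<in> set xs \<and> v \<in> carrier M}"
  unfolding seq_mult_def by (rule submodule_span_eq) (use assms in auto)

lemma mult_submodule:
  assumes a: "a \<in> carrier R" shows "submodule {a \<odot>\<^sub>M v | v. v \<in> carrier M} R M"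
proof (rule submoduleI)
  show "\<zero>\<^sub>M \<in> {a \<odot>\<^sub>M v | v. v \<in> carrier M}" using a by (auto intro!: exI[of _ "\<zero>\<^sub>M"])
  fix z assume "z \<in> {a \<odot>\<^sub>M v | v. v \<in> carrier M}"
  then obtain v where v: "v \<in> carrier M" "z = a \<odot>\<^sub>M v" by blast
  show "\<ominus>\<^sub>M z \<in> {a \<odot>\<^sub>M v | v. v \<in> carrier M}"
    using a v by (auto intro!: exI[of _ "\<ominus>\<^sub>M v"] simp: smult_r_minus)
  show "r \<odot>\<^sub>M z \<in> {a \<odot>\<^sub>M v | v. v \<in> carrier M}" if "r \<in> carrier R" for r
    using a v that by (auto intro!: exI[of _ "r \<odot>\<^sub>M v"] simp: smult_assoc1[symmetric] m_comm)
  fix w assume "w \<in> {a \<odot>\<^sub>M v | v. v \<in> carrier M}"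
  then obtain u where u: "u \<in> carrier M" "w = a \<odot>\<^sub>M u" by blast
  show "z \<oplus>\<^sub>M w \<in> {a \<odot>\<^sub>M v | v. v \<in> carrier M}"
    using a v u by (auto intro!: exI[of _ "v \<oplus>\<^sub>M u"] simp: smult_r_distr)
qed (use a in auto)

lemma seq_mult_single:
  assumes a: "a \<in> carrier R" shows "seq_mult R M [a] = {a \<odot>\<^sub>M v | v. v \<in> carrier M}"
proof -
  have "lin_span M (carrier R) {a \<odot>\<^sub>M v | v. v \<in> carrier M} = {a \<odot>\<^sub>M v | v. v \<in> carrier M}"
    using lin_span_minimal[OF mult_submodule[OF a] order_refl order_refl] lin_span_incl[of "{a \<odot>\<^sub>M v | v. v \<in> carrier M}"] a
    by blast
  then show ?thesis using seq_mult_span[of "[a]"] a by simp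
qed

lemma seq_mult_Nil: "seq_mult R M [] = {\<zero>\<^sub>M}"
proof -
  have "submodule {\<zero>\<^sub>M} R M" by (rule submoduleI) auto
  from lin_span_minimal[OF this, of "{}" "carrier R"] have "lin_span M (carrier R) {} \<subseteq> {\<zero>\<^sub>M}" by simp
  then show ?thesis using seq_mult_span[of "[]"] lin_span.zero by fastforce
qed

lemma regular_sequence_Cons2:
  assumes reg: "regular_sequence R M (a # b # xs)"
  shows "a \<in> carrier R" "b \<in> carrier R" "v \<in> carrier M ==> a \<odot>\<^sub>M v = \<zero>\<^sub>M ==> v = \<zero>\<^sub>M"
    "v \<in> carrier M ==> u \<in> carrier M ==> b \<odot>\<^sub>M v = a \<odot>\<^sub>M u ==> \<exists>w\<in>carrier M. v = a \<odot>\<^sub>M w"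
proof -
  have r: "(a # b # xs) ! i \<odot>\<^sub>M v \<in> seq_mult R M (take i (a # b # xs)) ==> v \<in> seq_mult R M (take i (a # b # xs))"
    if "i < length (a # b # xs)" "v \<in> carrier M" for i v
    using reg that unfolding regular_sequence_def by blast
  show ab: "a \<in> carrier R" "b \<in> carrier R" using reg unfolding regular_sequence_def by auto
  show "v \<in> carrier M ==> a \<odot>\<^sub>M v = \<zero>\<^sub>M ==> v = \<zero>\<^sub>M" using r[of 0 v] by (simp add: seq_mult_Nil)
  show "v \<in> carrier M ==> u \<in> carrier M ==> b \<odot>\<^sub>M v = a \<odot>\<^sub>M u ==> \<exists>w\<in>carrier M. v = a \<odot>\<^sub>M w"
    using r[of 1 v] by (auto simp: seq_mult_single[OF ab(1)])
qed

end

text \<open>The supremum in the definition of depth is attained, so some regular sequence has at least two members.\<close>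

lemma depth_ge_2:
  assumes "depth R M = 2"
  obtains a b xs where "set (a # b # xs) \<subseteq> max_ideal R" "regular_sequence R M (a # b # xs)"
proof -
  let ?S = "{enat (length xs) | xs. set xs \<subseteq> max_ideal R \<and> regular_sequence R M xs}"
  have "\<exists>xs. set xs \<subseteq> max_ideal R \<and> regular_sequence R M xs \<and> 2 \<le> length xs"
  proof (rule ccontr)
    assume no: "\<not> ?thesis"
    have "Sup ?S \<le> enat 1"
    proof (rule Sup_least)
      fix e assume "e \<in> ?S"
      then obtain xs where xs: "e = enat (length xs)" "set xs \<subseteq> max_ideal R" "regular_sequence R M xs" by blast
      then have "length xs < 2" using no not_le by blast
      then show "e \<le> enat 1" using xs by simp
    qed
    then show False using assms unfolding depth_def by (simp add: numeral_eq_enat)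
  qed
  then obtain xs where xs: "set xs \<subseteq> max_ideal R" "regular_sequence R M xs" "2 \<le> length xs" by blast
  then obtain a b ys where "xs = a # b # ys" by (cases xs; cases "tl xs") auto
  then show thesis using that xs by blast
qed

text \<open>The zero ideal is prime, so the assumption bounds the dimension by two.\<close>

locale dim2_domain = noetherian_local + domain +
  assumes no_chain: "[|primeideal p R; primeideal q R; primeideal r R; {\<zero>} \<subset> p; p \<subset> q; q \<subset> r|] ==> False"
begin

lemma between: "[|primeideal p R; primeideal q R; {\<zero>} \<subset> p; p \<subset> q|] ==> q = m"
  using no_chain[OF _ _ m_prime] prime_sub_m by blast

text \<open>If \<open>p \<noteq> m\<close>, then \<open>p\<close> is minimal over \<open>a\<close>, as the dimension is at most
  two. But a prime over \<open>a\<close> that avoids all \<open>s b^k\<close> with \<open>s \<notin> p\<close> exists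
  because \<open>b\<close> is regular modulo \<open>a\<close>, and it lies strictly between \<open>0\<close> and
  \<open>p\<close>.\<close>

lemma regular_pair_prime:
  assumes a: "a \<in> carrier R" "a \<noteq> \<zero>" and b: "b \<in> carrier R"
    and reg: "\<And>s t. s \<in> carrier R ==> t \<in> carrier R ==> b \<otimes> s = a \<otimes> t ==> \<exists>w\<in>carrier R. s = a \<otimes> w"
    and p: "primeideal p R" "a \<in> p" "b \<in> p"
  shows "p = m"
proof (rule ccontr)
  assume pm: "p \<noteq> m"
  interpret p: primeideal p R by (rule p)
  have one: "\<one> \<notin> p" using p.one_imp_carrier p.I_notcarr by blast
  define T where "T = {s \<otimes> b [^] (k::nat) | s k. s \<in> carrier R \<and> s \<notin> p}"
  have TI: "s \<otimes> b [^] (k::nat) \<in> T" if "s \<in> carrier R" "s \<notin> p" for s k unfolding T_def using that by blast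
  have red: "\<exists>w\<in>carrier R. s = a \<otimes> w" if "s \<in> carrier R" "t \<in> carrier R" "s \<otimes> b [^] (k::nat) = t \<otimes> a" for s t k
    using that
  proof (induction k arbitrary: t)
    case 0
    then show ?case by (intro bexI[of _ t]) (auto simp: m_comm a)
  next
    case (Suc k)
    have "b \<otimes> (s \<otimes> b [^] k) = a \<otimes> t" using Suc a b by (simp add: m_ac)
    then obtain w where "w \<in> carrier R" "s \<otimes> b [^] k = a \<otimes> w" using reg[of "s \<otimes> b [^] k" t] Suc b by auto
    then show ?case using Suc.IH[of w] Suc.prems a by (simp add: m_comm)
  qed
  obtain q where q: "primeideal q R" "PIdl a \<subseteq> q" "q \<inter> T = {}"
  proof (rule prime_avoiding[OF noeth cgenideal_ideal[OF a(1)], of T])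
    show "\<one> \<in> T" using TI[of \<one> 0] one by simp
    fix s t assume "s \<in> T" "t \<in> T"
    then obtain s' k t' l where h: "s' \<in> carrier R" "s' \<notin> p" "s = s' \<otimes> b [^] (k::nat)" "t' \<in> carrier R" "t' \<notin> p" "t = t' \<otimes> b [^] (l::nat)"
      unfolding T_def by blast
    have "s \<otimes> t = (s' \<otimes> t') \<otimes> b [^] (k + l)" using h b by (simp add: nat_pow_mult[symmetric] m_ac)
    moreover have "s' \<otimes> t' \<notin> p" using p.I_prime h by blast
    ultimately show "s \<otimes> t \<in> T" using TI h by simp
  next
    show "PIdl a \<inter> T = {}"
    proof (rule ccontr)
      assume "PIdl a \<inter> T \<noteq> {}"
      then obtain s k t where h: "s \<in> carrier R" "s \<notin> p" "t \<in> carrier R" "s \<otimes> b [^] (k::nat) = t \<otimes> a"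
        unfolding T_def by (auto simp: mem_PIdl)
      then obtain w where "w \<in> carrier R" "s = a \<otimes> w" using red by blast
      then show False using h(2) p.I_r_closed[OF p(2)] by blast
    qed
  qed
  interpret q: primeideal q R by (rule q)
  have "z \<in> p" if "z \<in> q" for z
  proof (rule ccontr)
    assume "z \<notin> p"
    then show False using TI[of z 0] q.Icarr[OF that] that q(3) by auto
  qed
  moreover have "b \<in> T" using TI[of \<one> 1] one b by simp
  ultimately have "q \<subset> p" using p(3) q(3) by blast
  moreover have "{\<zero>} \<subset> q" using q.zero_closed q(2) cgenideal_self[OF a(1)] a(2) by blast
  ultimately show False using between q(1) p(1) pm by blast
qed

text \<open>By the previous lemma \<open>m\<close> is the only prime that contains the first two members \<open>a, b\<close>, so
  some power of a third member \<open>c\<close> lies in \<open>(a, b)\<close>; cancelling \<open>c\<close> repeatedly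
  yields \<open>1 \<in> (a, b)\<close>.\<close>

lemma self_regular_length:
  assumes reg: "regular_sequence R (self_module R) xs" and xs: "set xs \<subseteq> m"
  shows "length xs \<le> 2"
proof (rule ccontr)
  assume "\<not> length xs \<le> 2"
  then obtain a b c ys where eq: "xs = a # b # c # ys"
    by (cases xs; cases "tl xs"; cases "tl (tl xs)") auto
  interpret S: module R "self_module R" by (rule self_module)
  note ab = S.regular_sequence_Cons2[OF reg[unfolded eq]]
  have c: "c \<in> carrier R" using xs eq m_carr by auto
  let ?I = "seq_mult R (self_module R) [a, b]"
  have r: "c \<otimes> v \<in> ?I ==> v \<in> ?I" if "v \<in> carrier R" for v
    using reg that unfolding regular_sequence_def eq by (auto dest!: spec[of _ "2::nat"] simp: numeral_2_eq_2)
  let ?A = "{r \<odot>\<^bsub>self_module R\<^esub> v | r v. r \<in> set [a, b] \<and> v \<in> carrier (self_module R)}"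
  have Ac: "?A \<subseteq> carrier (self_module R)" using ab(1,2) by auto
  have I: "?I = lin_span (self_module R) (carrier R) ?A" by (rule S.seq_mult_span) (use ab in auto)
  have I_ideal: "ideal ?I R" using S.lin_span_sub[OF Ac] I submodule_ideal by simp
  have abI: "r \<in> ?I" if "r \<in> set [a, b]" for r
  proof -
    have "r \<odot>\<^bsub>self_module R\<^esub> \<one> \<in> ?A" using that by fastforce
    from subsetD[OF S.lin_span_incl[OF Ac] this] show ?thesis using that ab(1,2) unfolding I by auto
  qed
  have Im: "?I \<subseteq> m"
    unfolding I by (rule S.lin_span_minimal)
      (use m_ideal submodule_ideal xs eq m.I_r_closed in auto)
  have a0: "a \<noteq> \<zero>" using ab(3)[of \<one>] by auto
  have reg2: "\<exists>w\<in>carrier R. s = a \<otimes> w" if "s \<in> carrier R" "t \<in> carrier R" "b \<otimes> s = a \<otimes> t" for s t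
    using ab(4)[of s t] that by simp
  obtain k where k: "c [^] (k::nat) \<in> ?I"
  proof (rule power_in_ideal[OF noeth I_ideal c])
    fix Q assume Q: "primeideal Q R" "?I \<subseteq> Q"
    have "a \<in> Q" "b \<in> Q" using Q(2) abI by auto
    have "Q = m"
    proof (rule regular_pair_prime[OF ab(1) a0 ab(2)])
      show "primeideal Q R" "a \<in> Q" "b \<in> Q" by fact+
    qed (rule reg2)
    then show "c \<in> Q" using xs eq by auto
  qed
  have "\<one> \<in> ?I" using k
  proof (induction k)
    case (Suc k)
    then show ?case using r[of "c [^] k"] c by (simp add: m_comm)
  qed simp
  then show False using Im one_notin_m by blast
qed

lemma self_depth:
  assumes a: "a \<in> m" "a \<noteq> \<zero>" and b: "b \<in> m"
    and reg: "\<And>s t. s \<in> carrier R ==> t \<in> carrier R ==> b \<otimes> s = a \<otimes> t ==> \<exists>w\<in>carrier R. s = a \<otimes> w"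
  shows "depth R (self_module R) = 2"
proof -
  interpret S: module R "self_module R" by (rule self_module)
  have c: "a \<in> carrier R" "b \<in> carrier R" using a b m_carr by auto
  have "regular_sequence R (self_module R) [a, b]"
    unfolding regular_sequence_def
  proof (intro conjI allI impI ballI)
    show "set [a, b] \<subseteq> carrier R" using c by simp
    fix i v assume i: "i < length [a, b]" and v: "v \<in> carrier (self_module R)"
      and h: "[a, b] ! i \<odot>\<^bsub>self_module R\<^esub> v \<in> seq_mult R (self_module R) (take i [a, b])"
    from i consider "i = 0" | "i = 1" by fastforce
    then show "v \<in> seq_mult R (self_module R) (take i [a, b])"
    proof cases
      case 1
      then show ?thesis using h v c a(2) integral_iff by (auto simp: S.seq_mult_Nil)
    next
      case 2
      then show ?thesis using h v reg[of v] by (auto simp: S.seq_mult_single[OF c(1)])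
    qed
  next
    have "seq_mult R (self_module R) [a, b] \<subseteq> m"
    proof -
      have "lin_span (self_module R) (carrier R)
          {r \<odot>\<^bsub>self_module R\<^esub> v | r v. r \<in> set [a, b] \<and> v \<in> carrier (self_module R)} \<subseteq> m"
        by (rule S.lin_span_minimal) (use a b m_ideal submodule_ideal m.I_r_closed in auto)
      then show ?thesis using S.seq_mult_span[of "[a, b]"] c by simp
    qed
    then show "seq_mult R (self_module R) [a, b] \<noteq> carrier (self_module R)" using one_notin_m by auto
  qed
  then have "enat (length [a, b]) \<le> depth R (self_module R)"
    unfolding depth_def using a b max_ideal_eq by (intro Sup_upper) (auto intro!: exI[of _ "[a, b]"])
  moreover have "depth R (self_module R) \<le> enat 2"
    unfolding depth_def
  proof (rule Sup_least)
    fix e assume "e \<in> {enat (length xs) |xs. set xs \<subseteq> max_ideal R \<and> regular_sequence R (self_module R) xs}"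
    then show "e \<le> enat 2" using self_regular_length max_ideal_eq by auto
  qed
  ultimately have "depth R (self_module R) = enat 2" by (simp add: numeral_2_eq_2 antisym)
  then show ?thesis by (simp add: numeral_eq_enat)
qed

end

section \<open>The ring of invariants\<close>

lemma (in primeideal) finprod_mem:
  assumes "finite A" "f \<in> A \<rightarrow> carrier R" "(\<Otimes>i\<in>A. f i) \<in> I"
  shows "\<exists>i\<in>A. f i \<in> I"
  using assms
proof (induction A)
  case empty
  then show ?case using one_imp_carrier I_notcarr by simp
next
  case (insert a A)
  have "(\<Otimes>i\<in>insert a A. f i) = f a \<otimes> (\<Otimes>i\<in>A. f i)"
    by (rule finprod_insert) (use insert in auto)
  moreover have "f a \<in> carrier R" "(\<Otimes>i\<in>A. f i) \<in> carrier R" using insert by auto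
  ultimately show ?case using insert I_prime[of "f a" "\<Otimes>i\<in>A. f i"] by auto
qed

lemma (in cring) finprod_mem_ideal:
  assumes I: "ideal I R" and "finite A" "a \<in> A" "f \<in> A \<rightarrow> carrier R" "f a \<in> I"
  shows "(\<Otimes>i\<in>A. f i) \<in> I"
proof -
  have "(\<Otimes>i\<in>A. f i) = (\<Otimes>i\<in>insert a (A - {a}). f i)" using assms by (simp add: insert_absorb)
  also have "\<dots> = f a \<otimes> (\<Otimes>i\<in>A - {a}. f i)" by (rule finprod_insert) (use assms in auto)
  also have "\<dots> \<in> I"
    by (rule ideal.I_r_closed[OF I assms(5)], rule finprod_closed) (use assms in auto)
  finally show ?thesis .
qed

text \<open>Expand the product modulo \<open>I\<close>.\<close>

lemma (in cring) finprod_minus_mod: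
  assumes I: "ideal I R" and s: "s \<in> carrier R" and "finite A" "f \<in> A \<rightarrow> I"
  shows "\<exists>w\<in>I. (\<Otimes>i\<in>A. s \<ominus> f i) = s [^] (card A) \<oplus> w"
  using assms(3,4)
proof (induction A)
  case empty
  then show ?case using additive_subgroup.zero_closed[OF ideal.axioms(1)[OF I]] by (auto intro: bexI[of _ \<zero>])
next
  case (insert a A)
  interpret I: ideal I R by (rule I)
  obtain w where w: "w \<in> I" "(\<Otimes>i\<in>A. s \<ominus> f i) = s [^] (card A) \<oplus> w" using insert by auto
  have fa: "f a \<in> I" "f a \<in> carrier R" "w \<in> carrier R" using insert I.Icarr w by auto
  have "(\<Otimes>i\<in>insert a A. s \<ominus> f i) = (s \<ominus> f a) \<otimes> (\<Otimes>i\<in>A. s \<ominus> f i)"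
    by (rule finprod_insert) (use insert s I.Icarr in "auto simp: Pi_iff")
  also have "\<dots> = s [^] card (insert a A) \<oplus> (s \<otimes> w \<oplus> (\<ominus> f a) \<otimes> (s [^] (card A) \<oplus> w))"
    unfolding w(2) using s fa insert.hyps by (simp add: minus_eq l_distr r_distr m_ac a_ac)
  finally have "(\<Otimes>i\<in>insert a A. s \<ominus> f i) = \<dots>" .
  moreover have "s \<otimes> w \<oplus> (\<ominus> f a) \<otimes> (s [^] (card A) \<oplus> w) \<in> I"
    by (intro I.a_closed I.I_l_closed w(1) s I.I_r_closed[OF I.a_inv_closed[OF fa(1)]] a_closed nat_pow_closed fa)
  ultimately show ?case by blast
qed

locale regular_action = finite_action + regular_dim2 +
  assumes dim: "krull_dim R = 2"
begin

definition mS where "mS = m \<inter> carrier S"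

lemma act_m: assumes g: "g \<in> carrier G" and z: "z \<in> m" shows "\<phi> g z \<in> m"
proof (rule ccontr)
  have zc: "z \<in> carrier R" using z m_carr by blast
  assume "\<phi> g z \<notin> m"
  then have u: "\<phi> g z \<in> Units R" using unit g zc by simp
  have "\<phi> (inv\<^bsub>G\<^esub> g) (\<phi> g z \<otimes> inv (\<phi> g z)) = z \<otimes> \<phi> (inv\<^bsub>G\<^esub> g) (inv (\<phi> g z))"
    using g zc u by (simp add: act_mult del: Units_r_inv)
  then have "z \<otimes> \<phi> (inv\<^bsub>G\<^esub> g) (inv (\<phi> g z)) = \<one>" using u g by simp
  moreover have "z \<otimes> \<phi> (inv\<^bsub>G\<^esub> g) (inv (\<phi> g z)) \<in> m" using m.I_r_closed[OF z] g u by simp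
  ultimately show False using one_notin_m by simp
qed

lemma contract_ideal:
  assumes I: "ideal I R" shows "ideal (I \<inter> carrier S) S"
proof -
  interpret I: ideal I R by (rule I)
  show ?thesis
    unfolding S.submodule_ideal[symmetric]
  proof (rule module.submoduleI[OF S.self_module])
    show "\<ominus>\<^bsub>self_module S\<^esub> a \<in> I \<inter> carrier S" if "a \<in> I \<inter> carrier S" for a
      using that S.a_inv_closed[of a] by (simp add: S.self_minus)
    show "r \<odot>\<^bsub>self_module S\<^esub> a \<in> I \<inter> carrier S" if "r \<in> carrier S" "a \<in> I \<inter> carrier S" for r a
      using that by (simp add: S_m_closed I.I_l_closed S_carr)
  qed (use S_zero S_a_closed in auto)
qed

lemma contract_prime:
  assumes P: "primeideal P R" shows "primeideal (P \<inter> carrier S) S"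
proof -
  interpret P: primeideal P R by (rule P)
  show ?thesis
  proof (rule primeidealI)
    show "ideal (P \<inter> carrier S) S" by (rule contract_ideal[OF P.is_ideal])
    show "cring S" by (rule S_cring)
    have "\<one> \<notin> P" using P.one_imp_carrier P.I_notcarr by blast
    then show "carrier S \<noteq> P \<inter> carrier S" using S_one by blast
  qed (use P.I_prime S_carr in auto)
qed

lemma mS_max: "maximalideal mS S"
proof (rule maximalidealI)
  show "ideal mS S" unfolding mS_def by (rule contract_ideal[OF m_ideal])
  show "carrier S \<noteq> mS" using one_notin_m S_one unfolding mS_def by blast
  fix J assume J: "ideal J S" "mS \<subseteq> J" "J \<subseteq> carrier S"
  interpret J: ideal J S by (rule J)
  show "J = mS \<or> J = carrier S"
  proof (rule ccontr)
    assume "\<not> ?thesis"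
    then obtain s where s: "s \<in> J" "s \<notin> mS" "J \<noteq> carrier S" using J by blast
    have sS: "s \<in> carrier S" "s \<in> carrier R" using s J(3) S_carr by auto
    then have u: "s \<in> Units R" using unit s unfolding mS_def by blast
    from S_Units(2)[OF sS(1) u] have "inv s \<otimes> s \<in> J" using J.I_l_closed[OF s(1)] by simp
    then have "\<one>\<^bsub>S\<^esub> \<in> J" using u by simp
    then show False using J.one_imp_carrier s by blast
  qed
qed

sublocale Sl: noetherian_local S mS
proof (intro noetherian_local.intro noetherian_local_axioms.intro)
  show "s \<in> Units S" if "s \<in> carrier S" "s \<notin> mS" for s
    using S_Units(1)[OF that(1)] unit S_carr that unfolding mS_def by blast
qed (rule S_cring S_noetherian[OF noeth] mS_max)+

sublocale Sd: domain S
proof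
  show "\<one>\<^bsub>S\<^esub> \<noteq> \<zero>\<^bsub>S\<^esub>" by simp
  show "a = \<zero>\<^bsub>S\<^esub> \<or> b = \<zero>\<^bsub>S\<^esub>" if "a \<otimes>\<^bsub>S\<^esub> b = \<zero>\<^bsub>S\<^esub>" "a \<in> carrier S" "b \<in> carrier S" for a b
    using that dom.integral S_carr by simp
qed

text \<open>For an ideal \<open>q\<close> of \<open>S\<close> the contraction of \<open>q R\<close> is \<open>q\<close>: apply the
  Reynolds operator to a linear combination that happens to be invariant.\<close>

lemma extended_ideal:
  assumes q: "ideal q S"
  defines "I \<equiv> lin_span (self_module R) (carrier R) q"
  shows "ideal I R" "q \<subseteq> I" "z \<in> I ==> z \<in> carrier S ==> z \<in> q" "z \<in> I ==> g \<in> carrier G ==> \<phi> g z \<in> I"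
proof -
  interpret q: ideal q S by (rule q)
  interpret M: module R "self_module R" by (rule self_module)
  have qc: "q \<subseteq> carrier (self_module R)" using q.Icarr S_carr by auto
  show I: "ideal I R" unfolding I_def using M.lin_span_sub[OF qc] submodule_ideal by simp
  show "q \<subseteq> I" unfolding I_def by (rule M.lin_span_incl[OF qc])
  have Ic: "z \<in> I ==> z \<in> carrier R" for z using ideal.Icarr[OF I] .
  have "reynolds z \<in> q" if "z \<in> I" for z
    using that unfolding I_def
  proof induction
    case zero
    then show ?case using q.zero_closed by simp
  next
    case (step z c a)
    have z: "z \<in> carrier R" using step Ic I_def by simp
    have a: "a \<in> carrier S" "a \<in> carrier R" using step q.Icarr S_carr by auto
    have "reynolds (z \<oplus> c \<otimes> a) = reynolds z \<oplus> a \<otimes> reynolds c"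
      using z a step reynolds_smult[OF a(1)] by (simp add: reynolds_add m_comm[of c a])
    also have "\<dots> \<in> q" using q.a_closed[OF step.IH q.I_r_closed[OF step.hyps(3) reynolds_S[OF step.hyps(2)]]] by simp
    finally show ?case by simp
  qed
  then show "z \<in> I ==> z \<in> carrier S ==> z \<in> q" using reynolds_id by metis
  show "\<phi> g z \<in> I" if "z \<in> I" "g \<in> carrier G"
    using that(1) unfolding I_def
  proof induction
    case zero
    then show ?case using that(2) lin_span.zero[of "self_module R"] by simp
  next
    case (step z c a)
    have z: "z \<in> carrier R" using step Ic I_def by simp
    have a: "a \<in> carrier S" "a \<in> carrier R" using step q.Icarr S_carr by auto
    have "\<phi> g (z \<oplus> c \<otimes> a) = \<phi> g z \<oplus> \<phi> g c \<otimes> a"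
      using z a step that(2) S_inv by (simp add: act_add act_mult)
    then show ?case using lin_span.step[OF step.IH, of "\<phi> g c" a] step that(2) by simp
  qed
qed

text \<open>Going up. If \<open>s = p + z\<close> with \<open>s\<close> invariant, \<open>p \<in> P\<close> and
  \<open>z \<in> q R\<close>, then the invariant element \<open>\<Prod>(s - g z)\<close> lies in \<open>P\<close>,
  hence in \<open>q\<close>, and it is congruent to a power of \<open>s\<close> modulo \<open>q R\<close>.\<close>

lemma going_up:
  assumes P: "primeideal P R" and q: "primeideal q S" and sub: "P \<inter> carrier S \<subseteq> q"
  obtains Q where "primeideal Q R" "P \<subseteq> Q" "Q \<inter> carrier S = q"
proof -
  interpret P: primeideal P R by (rule P)
  interpret q: primeideal q S by (rule q)
  define I where "I = lin_span (self_module R) (carrier R) q"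
  note ext = extended_ideal[OF q.is_ideal, folded I_def]
  interpret I: ideal I R by (rule ext(1))
  have J: "ideal (P <+>\<^bsub>R\<^esub> I) R" by (rule add_ideals[OF P.is_ideal ext(1)])
  have in_q: "s \<in> q" if s: "s \<in> carrier S" "s = p \<oplus> z" "p \<in> P" "z \<in> I" for s p z
  proof -
    have c: "s \<in> carrier R" "z \<in> carrier R" "p \<in> carrier R" using s S_carr I.Icarr P.Icarr by auto
    let ?t = "\<Otimes>g\<in>carrier G. s \<ominus> \<phi> g z"
    have fR: "(\<lambda>g. s \<ominus> \<phi> g z) \<in> carrier G \<rightarrow> carrier R" using c by auto
    have "s \<ominus> \<phi> \<one>\<^bsub>G\<^esub> z = p" unfolding act_id[OF c(2)] s(2) using c by (simp add: minus_eq a_assoc r_neg)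
    then have tP: "?t \<in> P" using finprod_mem_ideal[OF P.is_ideal fin G.one_closed fR] s(3) by simp
    have "?t \<in> carrier S" unfolding S_iff
    proof (intro conjI ballI)
      show "?t \<in> carrier R" using fR by simp
      fix h assume h: "h \<in> carrier G"
      have "\<phi> h ?t = (\<Otimes>g\<in>carrier G. \<phi> h (s \<ominus> \<phi> g z))" by (rule act_finprod[OF h fin fR])
      also have "\<dots> = (\<Otimes>g\<in>carrier G. s \<ominus> \<phi> (h \<otimes>\<^bsub>G\<^esub> g) z)"
        by (rule finprod_cong') (use h c S_inv[OF s(1)] in "auto simp: minus_eq act_add act_minus act_comp")
      also have "\<dots> = ?t" by (rule finprod_translate[OF h fR])
      finally show "\<phi> h ?t = ?t" .
    qed
    then have tq: "?t \<in> q" using tP sub by blast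
    have fI: "(\<lambda>g. \<phi> g z) \<in> carrier G \<rightarrow> I" using ext(4)[OF s(4)] by blast
    obtain w where w: "w \<in> I" "?t = s [^] card (carrier G) \<oplus> w"
      using finprod_minus_mod[OF ext(1) c(1) fin fI] by blast
    have "s [^] card (carrier G) = ?t \<ominus> w" unfolding w(2) using c I.Icarr[OF w(1)] by (simp add: minus_eq a_assoc r_neg)
    also have "\<dots> \<in> I" using ext(2) tq w(1) by (auto simp: minus_eq)
    finally have "s [^] card (carrier G) \<in> q" using ext(3) S.nat_pow_closed[OF s(1)] by simp
    then show "s \<in> q" using q.pow_mem[of s] s(1) by simp
  qed
  obtain Q where Q: "primeideal Q R" "P <+>\<^bsub>R\<^esub> I \<subseteq> Q" "Q \<inter> (carrier S - q) = {}"
  proof (rule prime_avoiding[OF noeth J, of "carrier S - q"])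
    show "\<one> \<in> carrier S - q" using q.one_imp_carrier q.I_notcarr S_one by auto
    show "s \<otimes> t \<in> carrier S - q" if "s \<in> carrier S - q" "t \<in> carrier S - q" for s t
      using that q.I_prime S_m_closed by auto
    show "(P <+>\<^bsub>R\<^esub> I) \<inter> (carrier S - q) = {}" using in_q by (auto simp: set_add_iff)
  qed
  have "P \<subseteq> Q" "I \<subseteq> Q"
  proof -
    show "P \<subseteq> Q"
    proof
      fix p assume p: "p \<in> P"
      then show "p \<in> Q" using set_addI[OF p I.zero_closed, of R] Q(2) P.Icarr by auto
    qed
    show "I \<subseteq> Q"
    proof
      fix z assume z: "z \<in> I"
      then show "z \<in> Q" using set_addI[OF P.zero_closed z, of R] Q(2) I.Icarr by auto
    qed
  qed
  moreover have "Q \<inter> carrier S = q" using Q(3) \<open>I \<subseteq> Q\<close> ext(2) q.Icarr by auto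
  ultimately show thesis using that Q(1) by blast
qed

text \<open>A chain of primes of \<open>S\<close> lifts to one of the same length in \<open>R\<close>.\<close>

lemma S_no_chain:
  assumes "primeideal q0 S" "primeideal q1 S" "primeideal q2 S" "primeideal q3 S" "q0 \<subset> q1" "q1 \<subset> q2" "q2 \<subset> q3"
  shows False
proof -
  have z: "primeideal {\<zero>} R" by (rule dom.zeroprimeideal)
  have "{\<zero>} \<inter> carrier S \<subseteq> q0" using additive_subgroup.zero_closed[OF ideal.axioms(1)[OF primeideal.axioms(1)[OF assms(1)]]] by auto
  then obtain Q0 where Q0: "primeideal Q0 R" "Q0 \<inter> carrier S = q0" using going_up[OF z assms(1)] by metis
  obtain Q1 where Q1: "primeideal Q1 R" "Q0 \<subseteq> Q1" "Q1 \<inter> carrier S = q1"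
    by (rule going_up[OF Q0(1) assms(2)]) (use Q0 assms(5) in auto)
  obtain Q2 where Q2: "primeideal Q2 R" "Q1 \<subseteq> Q2" "Q2 \<inter> carrier S = q2"
    by (rule going_up[OF Q1(1) assms(3)]) (use Q1 assms(6) in auto)
  obtain Q3 where Q3: "primeideal Q3 R" "Q2 \<subseteq> Q3" "Q3 \<inter> carrier S = q3"
    by (rule going_up[OF Q2(1) assms(4)]) (use Q2 assms(7) in auto)
  have "Q0 \<subset> Q1" "Q1 \<subset> Q2" "Q2 \<subset> Q3" using Q0 Q1 Q2 Q3 assms(5-7) by blast+
  then show False using krull_dim_no_chain[OF dim Q0(1) Q1(1) Q2(1) Q3(1)] by blast
qed

sublocale Sdim: dim2_domain S mS
proof
  show False if "primeideal p S" "primeideal q S" "primeideal r S" "{\<zero>\<^bsub>S\<^esub>} \<subset> p" "p \<subset> q" "q \<subset> r" for p q r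
    using S_no_chain[OF Sd.zeroprimeideal that] .
qed

text \<open>The norm of \<open>z\<close>, the product over its orbit counted with multiplicity.\<close>

definition gnorm where "gnorm z = (\<Otimes>g\<in>carrier G. \<phi> g z)"

lemma gnorm_S: assumes z: "z \<in> carrier R" shows "gnorm z \<in> carrier S"
  unfolding S_iff
proof (intro conjI ballI)
  have f: "(\<lambda>g. \<phi> g z) \<in> carrier G \<rightarrow> carrier R" using z by auto
  then show "gnorm z \<in> carrier R" unfolding gnorm_def by simp
  fix h assume h: "h \<in> carrier G"
  have "\<phi> h (gnorm z) = (\<Otimes>g\<in>carrier G. \<phi> (h \<otimes>\<^bsub>G\<^esub> g) z)"
    unfolding gnorm_def act_finprod[OF h fin f] by (rule finprod_cong') (use h z in "auto simp: act_comp")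
  then show "\<phi> h (gnorm z) = gnorm z" using finprod_translate[OF h f] unfolding gnorm_def by simp
qed

lemma gnorm_mem: assumes I: "ideal I R" and z: "z \<in> I" shows "gnorm z \<in> I"
proof -
  have zc: "z \<in> carrier R" using ideal.Icarr[OF I z] .
  show ?thesis unfolding gnorm_def
    by (rule finprod_mem_ideal[OF I fin G.one_closed]) (use z zc act_id in auto)
qed

lemma gnorm_factor: assumes "primeideal P R" "z \<in> carrier R" "gnorm z \<in> P" shows "\<exists>g\<in>carrier G. \<phi> g z \<in> P"
  using primeideal.finprod_mem[OF assms(1) fin, of "\<lambda>g. \<phi> g z"] assms unfolding gnorm_def by auto

lemma gnorm_x: "gnorm x \<in> mS" "gnorm x \<noteq> \<zero>"
proof -
  show "gnorm x \<in> mS" unfolding mS_def using gnorm_mem[OF m_ideal x_m] gnorm_S by simp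
  show "gnorm x \<noteq> \<zero>"
  proof
    assume "gnorm x = \<zero>"
    then obtain g where g: "g \<in> carrier G" "\<phi> g x = \<zero>" using gnorm_factor[OF dom.zeroprimeideal x_carr] by auto
    then show False using act_inv(1)[of g x] x_nonzero by simp
  qed
qed

text \<open>By the pigeonhole principle some \<open>g\<close> would move two of the elements \<open>x + y\<^sup>k\<close> into
  \<open>x R\<close>, and then all of \<open>m\<close>.\<close>

lemma mS_not_in_x: "\<not> mS \<subseteq> PIdl x"
proof
  assume sub: "mS \<subseteq> PIdl x"
  interpret P: primeideal "PIdl x" R by (rule PIdl_x_prime)
  let ?z = "\<lambda>k::nat. x \<oplus> y [^] (Suc k)"
  have "\<exists>g\<in>carrier G. \<phi> g (?z k) \<in> PIdl x" for k
  proof (rule gnorm_factor[OF PIdl_x_prime])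
    have "y [^] (Suc k) \<in> m" using m.I_l_closed[OF y_m, of "y [^] k"] by simp
    then have "?z k \<in> m" using m.a_closed[OF x_m] by blast
    then have "gnorm (?z k) \<in> mS" unfolding mS_def using gnorm_mem[OF m_ideal] gnorm_S by simp
    then show "gnorm (?z k) \<in> PIdl x" using sub by blast
  qed simp
  then obtain \<gamma> where \<gamma>: "\<And>k. \<gamma> k \<in> carrier G" "\<And>k. \<phi> (\<gamma> k) (?z k) \<in> PIdl x" by metis
  have "\<not> inj \<gamma>"
  proof
    assume "inj \<gamma>"
    moreover have "finite (range \<gamma>)" using finite_subset[OF _ fin, of "range \<gamma>"] \<gamma>(1) by blast
    ultimately show False using finite_imageD infinite_UNIV_nat by blast
  qed
  then obtain k l where kl: "\<gamma> k = \<gamma> l" "k < l" unfolding inj_def by (metis nat_neq_iff)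
  define g where "g = \<gamma> k"
  have g: "g \<in> carrier G" "\<phi> g (?z k) \<in> PIdl x" "\<phi> g (?z l) \<in> PIdl x" using \<gamma>(1)[of k] \<gamma>(2)[of k] \<gamma>(2)[of l] kl unfolding g_def by simp_all
  define d where "d = l - k"
  have "Suc l = Suc k + d" using kl d_def by simp
  then have yl: "y [^] (Suc l) = y [^] (Suc k) \<otimes> y [^] d" using nat_pow_mult[of y "Suc k" d] by simp
  have "d > 0" using kl d_def by simp
  then have "y [^] d \<in> m" using m.I_l_closed[OF y_m, of "y [^] (d - 1)"] by (cases d) simp_all
  then have u: "\<phi> g (\<one> \<ominus> y [^] d) \<notin> PIdl x"
  proof -
    have "\<one> \<ominus> y [^] d \<notin> m" using \<open>y [^] d \<in> m\<close> one_minus_unit unit_notin_m by blast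
    then have "\<phi> g (\<one> \<ominus> y [^] d) \<notin> m" using act_m[of "inv\<^bsub>G\<^esub> g" "\<phi> g (\<one> \<ominus> y [^] d)"] g(1) by auto
    then show ?thesis using prime_sub_m[OF PIdl_x_prime] by blast
  qed
  have "\<phi> g (y [^] (Suc k)) \<otimes> \<phi> g (\<one> \<ominus> y [^] d) = \<phi> g (?z k) \<ominus> \<phi> g (?z l)"
  proof -
    have "y [^] (Suc k) \<otimes> (\<one> \<ominus> y [^] d) = ?z k \<ominus> ?z l"
      unfolding yl by (simp add: minus_eq r_distr r_minus minus_add a_ac r_neg r_neg1 r_neg2 del: nat_pow_Suc)
    moreover have "\<phi> g (y [^] (Suc k)) \<otimes> \<phi> g (\<one> \<ominus> y [^] d) = \<phi> g (y [^] (Suc k) \<otimes> (\<one> \<ominus> y [^] d))"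
      by (rule act_mult[symmetric]) (use g(1) in simp_all)
    moreover have "\<phi> g (u \<ominus> v) = \<phi> g u \<ominus> \<phi> g v" if "u \<in> carrier R" "v \<in> carrier R" for u v
      using g(1) that by (simp add: minus_eq act_add act_minus)
    then have "\<phi> g (?z k \<ominus> ?z l) = \<phi> g (?z k) \<ominus> \<phi> g (?z l)" by simp
    ultimately show ?thesis by simp
  qed
  also have "\<dots> \<in> PIdl x" using g by (simp add: minus_eq)
  finally have yk: "\<phi> g (y [^] (Suc k)) \<in> PIdl x" using P.I_prime u g(1) by (metis act_closed minus_closed nat_pow_closed one_closed y_carr)
  then have gy: "\<phi> g y \<in> PIdl x" using P.pow_mem[of "\<phi> g y" "Suc k"] g(1) act_pow[OF g(1) y_carr, of "Suc k"] by (simp del: nat_pow_Suc)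
  have "\<phi> g x = \<phi> g (?z k) \<ominus> \<phi> g (y [^] (Suc k))"
    using g(1) by (simp add: act_add minus_eq a_assoc r_neg del: nat_pow_Suc)
  also have "\<dots> \<in> PIdl x" using g yk by (simp add: minus_eq del: nat_pow_Suc)
  finally have gx: "\<phi> g x \<in> PIdl x" .
  have "\<phi> (inv\<^bsub>G\<^esub> g) y \<in> m" using act_m[OF _ y_m] g(1) by simp
  then obtain b c where bc: "b \<in> carrier R" "c \<in> carrier R" "\<phi> (inv\<^bsub>G\<^esub> g) y = b \<otimes> x \<oplus> c \<otimes> y" using m_gen by blast
  have "y = \<phi> g (\<phi> (inv\<^bsub>G\<^esub> g) y)" using g(1) by simp
  also have "\<dots> = \<phi> g b \<otimes> \<phi> g x \<oplus> \<phi> g c \<otimes> \<phi> g y" unfolding bc(3) using bc(1,2) g(1) by (simp add: act_add act_mult)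
  also have "\<dots> \<in> PIdl x" using gx gy g(1) bc by (intro P.a_closed P.I_l_closed) auto
  finally show False using y_notin_x by blast
qed

text \<open>The contractions of \<open>0 \<subset> x R \<subset> m\<close> are distinct: the first two differ by the norm of
  \<open>x\<close>, the last two by the previous lemma.\<close>

lemma S_krull_dim: "krull_dim S = 2"
proof (rule krull_dim_eq_2)
  show "primeideal {\<zero>} S" using Sd.zeroprimeideal by simp
  show "primeideal (PIdl x \<inter> carrier S) S" by (rule contract_prime[OF PIdl_x_prime])
  show "primeideal mS S" by (rule Sl.m_prime)
  have "gnorm x \<in> PIdl x \<inter> carrier S"
    using gnorm_mem[OF cgenideal_ideal cgenideal_self] gnorm_S by simp
  moreover have "\<zero> \<in> PIdl x \<inter> carrier S"
    using additive_subgroup.zero_closed[OF ideal.axioms(1)[OF cgenideal_ideal]] S_zero by simp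
  ultimately show "{\<zero>} \<subset> PIdl x \<inter> carrier S" using gnorm_x(2) by blast
  show "PIdl x \<inter> carrier S \<subset> mS"
    using mS_not_in_x prime_sub_m[OF PIdl_x_prime] unfolding mS_def by blast
qed (rule S_no_chain)

text \<open>\<open>gnorm x\<close> and any \<open>b \<in> mS\<close> outside \<open>x R\<close> form a regular sequence: the prime
  factors \<open>g x\<close> of \<open>gnorm x\<close> do not divide the invariant element \<open>b\<close>.\<close>

lemma S_depth: "depth S (self_module S) = 2"
proof -
  obtain b where b: "b \<in> mS" "b \<notin> PIdl x" using mS_not_in_x by blast
  have bS: "b \<in> carrier S" "b \<in> carrier R" using b S_carr unfolding mS_def by auto
  \<comment> \<open>\<open>b\<close> is invariant and not divisible by \<open>x\<close>, hence not by any of the primes \<open>g x\<close>, which can be split off one at a time.\<close>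
  have cancel: "\<exists>r\<in>carrier R. s = (\<Otimes>g\<in>A. \<phi> g x) \<otimes> r"
    if "finite A" "A \<subseteq> carrier G" "s \<in> carrier R" "t \<in> carrier R" "b \<otimes> s = (\<Otimes>g\<in>A. \<phi> g x) \<otimes> t" for A s t
    using that
  proof (induction A arbitrary: s t)
    case empty
    then show ?case by auto
  next
    case (insert h A)
    let ?p = "\<Otimes>g\<in>A. \<phi> g x"
    have h: "h \<in> carrier G" using insert by simp
    have pc: "?p \<in> carrier R" using insert by (intro finprod_closed) auto
    have ph: "(\<Otimes>g\<in>insert h A. \<phi> g x) = \<phi> h x \<otimes> ?p" by (rule finprod_insert) (use insert in auto)
    have e: "b \<otimes> s = \<phi> h x \<otimes> (?p \<otimes> t)" using insert.prems pc h unfolding ph by (simp add: m_assoc)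
    have "\<phi> (inv\<^bsub>G\<^esub> h) (b \<otimes> s) = x \<otimes> \<phi> (inv\<^bsub>G\<^esub> h) (?p \<otimes> t)" unfolding e using h pc insert.prems by (simp add: act_mult)
    moreover have "\<phi> (inv\<^bsub>G\<^esub> h) (b \<otimes> s) = b \<otimes> \<phi> (inv\<^bsub>G\<^esub> h) s"
      using S_inv[OF bS(1)] h bS insert.prems(2) by (simp add: act_mult)
    ultimately have "b \<otimes> \<phi> (inv\<^bsub>G\<^esub> h) s = x \<otimes> \<phi> (inv\<^bsub>G\<^esub> h) (?p \<otimes> t)" by simp
    moreover have "\<not> (\<exists>d\<in>carrier R. b = x \<otimes> d)"
      using b(2) m_comm unfolding mem_PIdl by (metis x_carr)
    ultimately obtain d where d: "d \<in> carrier R" "\<phi> (inv\<^bsub>G\<^esub> h) s = x \<otimes> d"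
      using x_prime[of b "\<phi> (inv\<^bsub>G\<^esub> h) s" "\<phi> (inv\<^bsub>G\<^esub> h) (?p \<otimes> t)"] bS h insert.prems pc by auto
    have s: "s = \<phi> h x \<otimes> \<phi> h d"
      using act_inv(2)[OF h insert.prems(2)] d h by (simp add: act_mult)
    have hx: "\<phi> h x \<noteq> \<zero>"
    proof
      assume "\<phi> h x = \<zero>"
      then have "\<phi> (inv\<^bsub>G\<^esub> h) (\<phi> h x) = \<phi> (inv\<^bsub>G\<^esub> h) \<zero>" by simp
      then show False using x_nonzero h by simp
    qed
    have "\<phi> h x \<otimes> (b \<otimes> \<phi> h d) = \<phi> h x \<otimes> (?p \<otimes> t)" using e s bS h d by (simp add: m_lcomm)
    then have "b \<otimes> \<phi> h d = ?p \<otimes> t" using dom.m_lcancel[OF hx] bS h d pc insert.prems by simp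
    then obtain r where r: "r \<in> carrier R" "\<phi> h d = ?p \<otimes> r" using insert.IH[of "\<phi> h d" t] insert.prems h d by auto
    have "s = (\<Otimes>g\<in>insert h A. \<phi> g x) \<otimes> r" unfolding ph s r(2) using r h pc by (simp add: m_assoc)
    then show ?case using r by blast
  qed
  show ?thesis
  proof (rule Sdim.self_depth[of "gnorm x" b])
    show "gnorm x \<in> mS" "gnorm x \<noteq> \<zero>\<^bsub>S\<^esub>" "b \<in> mS" using gnorm_x b by auto
    fix s t assume st: "s \<in> carrier S" "t \<in> carrier S" "b \<otimes>\<^bsub>S\<^esub> s = gnorm x \<otimes>\<^bsub>S\<^esub> t"
    have c: "s \<in> carrier R" "t \<in> carrier R" "gnorm x \<in> carrier R" using st S_carr gnorm_S[OF x_carr] by auto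
    obtain r where r: "r \<in> carrier R" "s = gnorm x \<otimes> r"
      using cancel[OF fin order_refl c(1,2)] st unfolding gnorm_def by auto
    \<comment> \<open>The quotient of two invariants is invariant.\<close>
    have "r \<in> carrier S" unfolding S_iff
    proof (intro conjI ballI r(1))
      fix g assume g: "g \<in> carrier G"
      have "gnorm x \<otimes> \<phi> g r = \<phi> g s"
        unfolding r(2) using S_inv[OF gnorm_S[OF x_carr] g] g r c by (simp add: act_mult)
      also have "\<dots> = gnorm x \<otimes> r" using S_inv[OF st(1) g] r by simp
      finally show "\<phi> g r = r" using dom.m_lcancel[OF gnorm_x(2) c(3)] g r by simp
    qed
    then show "\<exists>w\<in>carrier S. s = gnorm x \<otimes>\<^bsub>S\<^esub> w" using r by auto
  qed
qed

lemma S_CM: "CM_local_ring S"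
  unfolding CM_local_ring_def S_depth S_krull_dim using Sl.is_local Sl.noeth by simp

end

section \<open>Fields of fractions and normality\<close>

context domain
begin

lemma frac_rel_iff: "((a, b), (c, d)) \<in> frac_rel R \<longleftrightarrow>
    a \<in> carrier R \<and> b \<in> carrier R - {\<zero>} \<and> c \<in> carrier R \<and> d \<in> carrier R - {\<zero>} \<and> a \<otimes> d = c \<otimes> b"
  unfolding frac_rel_def by simp

lemma frac_rel_trans:
  assumes "((a, b), (c, d)) \<in> frac_rel R" "((c, d), (e, f)) \<in> frac_rel R" shows "((a, b), (e, f)) \<in> frac_rel R"
proof -
  have c: "a \<in> carrier R" "b \<in> carrier R" "c \<in> carrier R" "d \<in> carrier R" "e \<in> carrier R" "f \<in> carrier R"
    "d \<noteq> \<zero>" "a \<otimes> d = c \<otimes> b" "c \<otimes> f = e \<otimes> d" using assms unfolding frac_rel_iff by auto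
  have "d \<otimes> (a \<otimes> f) = (a \<otimes> d) \<otimes> f" using c(1-6) by (simp add: m_ac)
  also have "\<dots> = (c \<otimes> f) \<otimes> b" unfolding c(8) using c(1-6) by (simp add: m_ac)
  also have "\<dots> = d \<otimes> (e \<otimes> b)" unfolding c(9) using c(1-6) by (simp add: m_ac)
  finally have "a \<otimes> f = e \<otimes> b" using m_lcancel[OF c(7) c(4)] c(1-6) by simp
  then show ?thesis using assms unfolding frac_rel_iff by simp
qed

lemma frac_rel_sym: "((a, b), (c, d)) \<in> frac_rel R ==> ((c, d), (a, b)) \<in> frac_rel R"
  unfolding frac_rel_iff by auto

lemma mem_fraction: "(c, d) \<in> fraction R a b \<longleftrightarrow> ((a, b), (c, d)) \<in> frac_rel R"
  unfolding fraction_def by simp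

lemma fraction_eq_iff:
  assumes "a \<in> carrier R" "b \<in> carrier R" "b \<noteq> \<zero>" "c \<in> carrier R" "d \<in> carrier R" "d \<noteq> \<zero>"
  shows "fraction R a b = fraction R c d \<longleftrightarrow> a \<otimes> d = c \<otimes> b"
proof
  assume eq: "fraction R a b = fraction R c d"
  have "(c, d) \<in> fraction R c d" unfolding mem_fraction frac_rel_iff using assms by simp
  then show "a \<otimes> d = c \<otimes> b" unfolding eq[symmetric] mem_fraction frac_rel_iff by simp
next
  assume "a \<otimes> d = c \<otimes> b"
  then have r: "((a, b), (c, d)) \<in> frac_rel R" unfolding frac_rel_iff using assms by simp
  have "(e, f) \<in> fraction R a b \<longleftrightarrow> (e, f) \<in> fraction R c d" for e f
    unfolding mem_fraction using r frac_rel_sym[OF r] frac_rel_trans by blast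
  then show "fraction R a b = fraction R c d" by auto
qed

lemma fraction_carrier: "a \<in> carrier R ==> b \<in> carrier R ==> b \<noteq> \<zero> ==> fraction R a b \<in> carrier (frac_field R)"
  unfolding frac_field_def fraction_def by (auto intro: quotientI)

lemma frac_field_E:
  assumes "p \<in> carrier (frac_field R)"
  obtains a b where "a \<in> carrier R" "b \<in> carrier R" "b \<noteq> \<zero>" "p = fraction R a b"
  using assms unfolding frac_field_def fraction_def by (auto elim!: quotientE)

text \<open>The operations on the field of fractions are defined as unions over representatives, all terms of which agree.\<close>

lemma union_fraction:
  assumes ab: "a \<in> carrier R" "b \<in> carrier R" "b \<noteq> \<zero>" and cd: "c \<in> carrier R" "d \<in> carrier R" "d \<noteq> \<zero>"
    and F: "\<And>a' b' c' d'. ((a, b), (a', b')) \<in> frac_rel R ==> ((c, d), (c', d')) \<in> frac_rel R ==> F a' b' c' d' = F a b c d"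
  shows "(\<Union>(a', b') \<in> fraction R a b. \<Union>(c', d') \<in> fraction R c d. F a' b' c' d') = F a b c d"
proof -
  have m: "(a, b) \<in> fraction R a b" "(c, d) \<in> fraction R c d" unfolding mem_fraction frac_rel_iff using ab cd by auto
  have "F a' b' c' d' = F a b c d" if "(a', b') \<in> fraction R a b" "(c', d') \<in> fraction R c d" for a' b' c' d'
    using F that unfolding mem_fraction by blast
  then show ?thesis using m by fast
qed

lemma fraction_mult:
  assumes ab: "a \<in> carrier R" "b \<in> carrier R" "b \<noteq> \<zero>" and cd: "c \<in> carrier R" "d \<in> carrier R" "d \<noteq> \<zero>"
  shows "fraction R a b \<otimes>\<^bsub>frac_field R\<^esub> fraction R c d = fraction R (a \<otimes> c) (b \<otimes> d)"
proof -
  have "fraction R (a' \<otimes> c') (b' \<otimes> d') = fraction R (a \<otimes> c) (b \<otimes> d)"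
    if "((a, b), (a', b')) \<in> frac_rel R" "((c, d), (c', d')) \<in> frac_rel R" for a' b' c' d'
  proof -
    have h: "a' \<in> carrier R" "b' \<in> carrier R" "c' \<in> carrier R" "d' \<in> carrier R" "b' \<noteq> \<zero>" "d' \<noteq> \<zero>"
      "a \<otimes> b' = a' \<otimes> b" "c \<otimes> d' = c' \<otimes> d" using that unfolding frac_rel_iff by auto
    have "(a' \<otimes> c') \<otimes> (b \<otimes> d) = (a' \<otimes> b) \<otimes> (c' \<otimes> d)" using h(1-4) ab cd by (simp add: m_ac)
    also have "\<dots> = (a \<otimes> c) \<otimes> (b' \<otimes> d')" unfolding h(7,8)[symmetric] using h(1-4) ab cd by (simp add: m_ac)
    finally show ?thesis using h ab cd integral_iff by (subst fraction_eq_iff) auto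
  qed
  then show ?thesis using union_fraction[OF ab cd, of "\<lambda>a b c d. fraction R (a \<otimes> c) (b \<otimes> d)"] unfolding frac_field_def by simp
qed

lemma fraction_add:
  assumes ab: "a \<in> carrier R" "b \<in> carrier R" "b \<noteq> \<zero>" and cd: "c \<in> carrier R" "d \<in> carrier R" "d \<noteq> \<zero>"
  shows "fraction R a b \<oplus>\<^bsub>frac_field R\<^esub> fraction R c d = fraction R (a \<otimes> d \<oplus> c \<otimes> b) (b \<otimes> d)"
proof -
  have "fraction R (a' \<otimes> d' \<oplus> c' \<otimes> b') (b' \<otimes> d') = fraction R (a \<otimes> d \<oplus> c \<otimes> b) (b \<otimes> d)"
    if "((a, b), (a', b')) \<in> frac_rel R" "((c, d), (c', d')) \<in> frac_rel R" for a' b' c' d'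
  proof -
    have h: "a' \<in> carrier R" "b' \<in> carrier R" "c' \<in> carrier R" "d' \<in> carrier R" "b' \<noteq> \<zero>" "d' \<noteq> \<zero>"
      "a \<otimes> b' = a' \<otimes> b" "c \<otimes> d' = c' \<otimes> d" using that unfolding frac_rel_iff by auto
    have "(a' \<otimes> d' \<oplus> c' \<otimes> b') \<otimes> (b \<otimes> d) = (a' \<otimes> b) \<otimes> (d' \<otimes> d) \<oplus> (c' \<otimes> d) \<otimes> (b' \<otimes> b)"
      using h(1-4) ab cd by (simp add: l_distr r_distr m_ac)
    also have "\<dots> = (a \<otimes> d \<oplus> c \<otimes> b) \<otimes> (b' \<otimes> d')"
      unfolding h(7,8)[symmetric] using h(1-4) ab cd by (simp add: l_distr r_distr m_ac)
    finally show ?thesis using h ab cd integral_iff by (subst fraction_eq_iff) auto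
  qed
  then show ?thesis
    using union_fraction[OF ab cd, of "\<lambda>a b c d. fraction R (a \<otimes> d \<oplus> c \<otimes> b) (b \<otimes> d)"] unfolding frac_field_def by simp
qed

lemma frac_field_simps: "\<one>\<^bsub>frac_field R\<^esub> = fraction R \<one> \<one>" "\<zero>\<^bsub>frac_field R\<^esub> = fraction R \<zero> \<one>"
  unfolding frac_field_def by simp_all

lemma frac_field_ring: "ring (frac_field R)"
proof (rule ringI)
  let ?L = "frac_field R"
  show "abelian_group ?L"
  proof (rule abelian_groupI)
    fix p q assume p: "p \<in> carrier ?L" and q: "q \<in> carrier ?L"
    obtain a b where ab: "a \<in> carrier R" "b \<in> carrier R" "b \<noteq> \<zero>" "p = fraction R a b" using frac_field_E[OF p] .
    obtain c d where cd: "c \<in> carrier R" "d \<in> carrier R" "d \<noteq> \<zero>" "q = fraction R c d" using frac_field_E[OF q] .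
    have bd: "b \<otimes> d \<noteq> \<zero>" using ab cd integral_iff by simp
    show "p \<oplus>\<^bsub>?L\<^esub> q \<in> carrier ?L" using ab cd bd by (simp add: fraction_add fraction_carrier)
    show "p \<oplus>\<^bsub>?L\<^esub> q = q \<oplus>\<^bsub>?L\<^esub> p" using ab cd by (simp add: fraction_add a_comm m_comm)
    show "\<zero>\<^bsub>?L\<^esub> \<oplus>\<^bsub>?L\<^esub> p = p" using ab by (simp add: frac_field_simps fraction_add)
    show "\<exists>p'\<in>carrier ?L. p' \<oplus>\<^bsub>?L\<^esub> p = \<zero>\<^bsub>?L\<^esub>"
    proof
      show "fraction R (\<ominus> a) b \<in> carrier ?L" using ab by (simp add: fraction_carrier)
      show "fraction R (\<ominus> a) b \<oplus>\<^bsub>?L\<^esub> p = \<zero>\<^bsub>?L\<^esub>"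
        using ab integral_iff by (simp add: frac_field_simps fraction_add fraction_eq_iff l_minus l_neg)
    qed
    fix r assume r: "r \<in> carrier ?L"
    obtain e f where ef: "e \<in> carrier R" "f \<in> carrier R" "f \<noteq> \<zero>" "r = fraction R e f" using frac_field_E[OF r] .
    show "(p \<oplus>\<^bsub>?L\<^esub> q) \<oplus>\<^bsub>?L\<^esub> r = p \<oplus>\<^bsub>?L\<^esub> (q \<oplus>\<^bsub>?L\<^esub> r)"
      using ab cd ef integral_iff by (simp add: fraction_add l_distr r_distr m_ac a_ac)
  next
    show "\<zero>\<^bsub>?L\<^esub> \<in> carrier ?L" by (simp add: frac_field_simps fraction_carrier)
  qed
  show "Group.monoid ?L"
  proof (rule monoidI)
    fix p q assume p: "p \<in> carrier ?L" and q: "q \<in> carrier ?L"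
    obtain a b where ab: "a \<in> carrier R" "b \<in> carrier R" "b \<noteq> \<zero>" "p = fraction R a b" using frac_field_E[OF p] .
    obtain c d where cd: "c \<in> carrier R" "d \<in> carrier R" "d \<noteq> \<zero>" "q = fraction R c d" using frac_field_E[OF q] .
    show "p \<otimes>\<^bsub>?L\<^esub> q \<in> carrier ?L" using ab cd integral_iff by (simp add: fraction_mult fraction_carrier)
    show "\<one>\<^bsub>?L\<^esub> \<otimes>\<^bsub>?L\<^esub> p = p" "p \<otimes>\<^bsub>?L\<^esub> \<one>\<^bsub>?L\<^esub> = p" using ab by (simp_all add: frac_field_simps fraction_mult)
    fix r assume r: "r \<in> carrier ?L"
    obtain e f where ef: "e \<in> carrier R" "f \<in> carrier R" "f \<noteq> \<zero>" "r = fraction R e f" using frac_field_E[OF r] .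
    show "(p \<otimes>\<^bsub>?L\<^esub> q) \<otimes>\<^bsub>?L\<^esub> r = p \<otimes>\<^bsub>?L\<^esub> (q \<otimes>\<^bsub>?L\<^esub> r)"
      using ab cd ef integral_iff by (simp add: fraction_mult m_ac)
  next
    show "\<one>\<^bsub>?L\<^esub> \<in> carrier ?L" by (simp add: frac_field_simps fraction_carrier)
  qed
  fix p q r assume p: "p \<in> carrier ?L" and q: "q \<in> carrier ?L" and r: "r \<in> carrier ?L"
  obtain a b where ab: "a \<in> carrier R" "b \<in> carrier R" "b \<noteq> \<zero>" "p = fraction R a b" using frac_field_E[OF p] .
  obtain c d where cd: "c \<in> carrier R" "d \<in> carrier R" "d \<noteq> \<zero>" "q = fraction R c d" using frac_field_E[OF q] .
  obtain e f where ef: "e \<in> carrier R" "f \<in> carrier R" "f \<noteq> \<zero>" "r = fraction R e f" using frac_field_E[OF r] .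
  show "(p \<oplus>\<^bsub>?L\<^esub> q) \<otimes>\<^bsub>?L\<^esub> r = p \<otimes>\<^bsub>?L\<^esub> r \<oplus>\<^bsub>?L\<^esub> q \<otimes>\<^bsub>?L\<^esub> r"
    using ab cd ef integral_iff by (simp add: fraction_mult fraction_add fraction_eq_iff l_distr r_distr m_ac)
  show "r \<otimes>\<^bsub>?L\<^esub> (p \<oplus>\<^bsub>?L\<^esub> q) = r \<otimes>\<^bsub>?L\<^esub> p \<oplus>\<^bsub>?L\<^esub> r \<otimes>\<^bsub>?L\<^esub> q"
    using ab cd ef integral_iff by (simp add: fraction_mult fraction_add fraction_eq_iff l_distr r_distr m_ac)
qed

end

text \<open>If the list \<open>s\<^sub>1, \<dots>, s\<^sub>n\<close> is a polynomial with leading coefficient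
  \<open>s\<^sub>1\<close>, then this is \<open>b\<^sup>n\<close> times its value at \<open>a / b\<close>.\<close>

primrec cleared_value :: "('a, 'm) ring_scheme \<Rightarrow> 'a \<Rightarrow> 'a \<Rightarrow> 'a list \<Rightarrow> 'a" where
  "cleared_value R a b [] = \<zero>\<^bsub>R\<^esub>"
| "cleared_value R a b (s # ss) = b \<otimes>\<^bsub>R\<^esub> (s \<otimes>\<^bsub>R\<^esub> a [^]\<^bsub>R\<^esub> length ss \<oplus>\<^bsub>R\<^esub> cleared_value R a b ss)"

lemma (in domain) cleared_value_closed:
  "a \<in> carrier R ==> b \<in> carrier R ==> set ss \<subseteq> carrier R ==> cleared_value R a b ss \<in> carrier R"
  by (induction ss) auto

lemma (in domain) pow_nonzero: "b \<in> carrier R ==> b \<noteq> \<zero> ==> b [^] (n::nat) \<noteq> \<zero>"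
  by (induction n) (auto simp: integral_iff)

lemma (in domain) eval_fraction:
  assumes a: "a \<in> carrier R" and b: "b \<in> carrier R" "b \<noteq> \<zero>" and ss: "set ss \<subseteq> carrier R"
  shows "ring.eval (frac_field R) (map (\<lambda>s. fraction R s \<one>) ss) (fraction R a b) =
    fraction R (cleared_value R a b ss) (b [^] length ss)"
proof -
  interpret L: ring "frac_field R" by (rule frac_field_ring)
  note b0 = pow_nonzero[OF b]
  have pow: "fraction R a b [^]\<^bsub>frac_field R\<^esub> (n::nat) = fraction R (a [^] n) (b [^] n)" for n
    by (induction n) (use a b b0 in "simp_all add: frac_field_simps fraction_mult")
  show ?thesis using ss
  proof (induction ss)
    case Nil
    then show ?case by (simp add: frac_field_simps)
  next
    case (Cons s ss)
    let ?v = "cleared_value R a b ss" and ?n = "length ss"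
    have c: "s \<in> carrier R" "?v \<in> carrier R" using Cons cleared_value_closed[OF a b(1)] by auto
    have "ring.eval (frac_field R) (map (\<lambda>s. fraction R s \<one>) (s # ss)) (fraction R a b) =
        fraction R s \<one> \<otimes>\<^bsub>frac_field R\<^esub> fraction R (a [^] ?n) (b [^] ?n) \<oplus>\<^bsub>frac_field R\<^esub> fraction R ?v (b [^] ?n)"
      using Cons by (simp add: pow)
    also have "\<dots> = fraction R (s \<otimes> a [^] ?n \<otimes> b [^] ?n \<oplus> ?v \<otimes> b [^] ?n) (b [^] ?n \<otimes> b [^] ?n)"
      using c a b b0 by (simp add: fraction_mult fraction_add)
    also have "\<dots> = fraction R (cleared_value R a b (s # ss)) (b [^] length (s # ss))"
      using c a b b0 integral_iff by (subst fraction_eq_iff) (simp_all add: l_distr r_distr m_ac)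
    finally show ?case .
  qed
qed

text \<open>An equation of integral dependence of degree \<open>n\<close> for \<open>a / b\<close> makes the ideal generated by
  the \<open>a^i b^{n - 1 - i}\<close>, \<open>i < n\<close>, of \<open>R\<close> stable under multiplication by
  \<open>a / b\<close>. So \<open>a / b\<close> lies in \<open>R\<close>, and as a quotient of invariants in
  \<open>S\<close>.\<close>

lemma (in regular_action) S_normal: "normal_domain S"
  unfolding normal_domain_def Let_def
proof (intro conjI ballI impI Sd.domain_axioms)
  let ?T = "(\<lambda>a. fraction S a \<one>\<^bsub>S\<^esub>) ` carrier S"
  fix q assume q: "q \<in> carrier (frac_field S)" and int: "integral_over (frac_field S) ?T q"
  interpret L: ring "frac_field S" by (rule Sd.frac_field_ring)
  obtain a b where ab: "a \<in> carrier S" "b \<in> carrier S" "b \<noteq> \<zero>\<^bsub>S\<^esub>" "q = fraction S a b"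
    using Sd.frac_field_E[OF q] .
  obtain p where p: "p \<in> carrier (univ_poly (frac_field S) ?T)" "p \<noteq> []" "lead_coeff p = \<one>\<^bsub>frac_field S\<^esub>"
    "L.eval p q = \<zero>\<^bsub>frac_field S\<^esub>" using int unfolding integral_over_def by blast
  have "set (tl p) \<subseteq> ?T" using p(1,2) unfolding univ_poly_carrier[symmetric] polynomial_def
    by (auto dest: list.set_sel(2))
  then obtain ss where ss: "tl p = map (\<lambda>s. fraction S s \<one>\<^bsub>S\<^esub>) ss" "set ss \<subseteq> carrier S"
  proof (induction "tl p" arbitrary: thesis p)
    case Nil
    then show ?case by (metis empty_subsetI list.set(1) list.simps(8))
  next
    case (Cons c cs)
    obtain ss where "cs = map (\<lambda>s. fraction S s \<one>\<^bsub>S\<^esub>) ss" "set ss \<subseteq> carrier S"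
      using Cons.hyps(1)[of "undefined # cs"] Cons.prems(2) Cons.hyps(2)[symmetric] by auto
    moreover obtain s where "s \<in> carrier S" "c = fraction S s \<one>\<^bsub>S\<^esub>" using Cons.prems(2) Cons.hyps(2)[symmetric] by auto
    ultimately show ?case using Cons.prems(1)[of "s # ss"] Cons.hyps(2)[symmetric] by simp
  qed
  let ?n = "length ss"
  have "p = map (\<lambda>s. fraction S s \<one>\<^bsub>S\<^esub>) (\<one>\<^bsub>S\<^esub> # ss)"
    using p(2,3) ss(1) by (cases p) (simp_all add: Sd.frac_field_simps)
  moreover have ss1: "set (\<one>\<^bsub>S\<^esub> # ss) \<subseteq> carrier S" using ss S_one by simp
  ultimately have "fraction S (cleared_value S a b (\<one>\<^bsub>S\<^esub> # ss)) (b [^]\<^bsub>S\<^esub> length (\<one>\<^bsub>S\<^esub> # ss)) = fraction S \<zero>\<^bsub>S\<^esub> \<one>\<^bsub>S\<^esub>"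
    using Sd.eval_fraction[OF ab(1-3) ss1] p(4) ab(4) by (simp add: Sd.frac_field_simps)
  then have "cleared_value S a b (\<one>\<^bsub>S\<^esub> # ss) = \<zero>"
    using Sd.fraction_eq_iff[of "cleared_value S a b (\<one>\<^bsub>S\<^esub> # ss)" "b [^]\<^bsub>S\<^esub> length (\<one>\<^bsub>S\<^esub> # ss)" "\<zero>\<^bsub>S\<^esub>" "\<one>\<^bsub>S\<^esub>"]
      Sd.cleared_value_closed[OF ab(1,2) ss1] Sd.pow_nonzero[OF ab(2,3), of "Suc ?n"] ab S_zero S_one
      S.nat_pow_closed[OF ab(2), of "Suc ?n"] S.m_closed
    by (simp add: S_carr)
  moreover have cS: "cleared_value S a b ss \<in> carrier S" by (rule Sd.cleared_value_closed[OF ab(1,2) ss(2)])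
  moreover have aS: "a [^] ?n \<in> carrier S" using S.nat_pow_closed[OF ab(1)] by simp
  ultimately have z: "a [^] ?n \<oplus> cleared_value S a b ss = \<zero>"
    using Sd.integral[of b "a [^] ?n \<oplus> cleared_value S a b ss"] ab S_a_closed S_carr by simp
  \<comment> \<open>Index \<open>i < n\<close> makes the truncated subtraction \<open>n - 1 - i\<close> harmless, also for \<open>n = 0\<close>, where the set is empty.\<close>
  define gen where "gen n = {a [^] i \<otimes> b [^] (n - 1 - i) | i. i < n}" for n :: nat
  define I where "I n = lin_span (self_module R) (carrier R) (gen n)" for n :: nat
  interpret M: module R "self_module R" by (rule self_module)
  have c: "a \<in> carrier R" "b \<in> carrier R" using ab S_carr by auto
  have gc: "gen n \<subseteq> carrier (self_module R)" for n unfolding gen_def using c by auto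
  have genI: "gen n \<subseteq> I n" for n unfolding I_def by (rule M.lin_span_incl[OF gc])
  have I_ideal: "ideal (I n) R" for n unfolding I_def using M.lin_span_sub[OF gc] submodule_ideal by simp
  note Ic = ideal.Icarr[OF I_ideal]
  have bI: "b \<otimes> z \<in> I (Suc n)" if "z \<in> I n" for z n
    using that unfolding I_def
  proof induction
    case zero
    then show ?case using c lin_span.zero[of "self_module R"] by simp
  next
    case (step z r g)
    have zc: "z \<in> carrier R" using step Ic I_def by simp
    obtain i where i: "i < n" "g = a [^] i \<otimes> b [^] (n - 1 - i)" using step unfolding gen_def by blast
    have "Suc n - 1 - i = Suc (n - 1 - i)" using i by simp
    then have "b \<otimes> g = a [^] i \<otimes> b [^] (Suc n - 1 - i)" using i c by (simp add: m_ac)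
    then have bg: "b \<otimes> g \<in> gen (Suc n)" unfolding gen_def using i less_SucI by blast
    have "b \<otimes> (z \<oplus> r \<otimes> g) = b \<otimes> z \<oplus> r \<otimes> (b \<otimes> g)" using zc step c i by (simp add: r_distr m_lcomm)
    then show ?case using lin_span.step[OF step.IH step.hyps(2) bg] by simp
  qed
  \<comment> \<open>Every monomial of the value of a polynomial of smaller degree has a factor \<open>b\<close>.\<close>
  have clear: "\<exists>e\<in>I (length us). cleared_value S a b us = b \<otimes> e" if "set us \<subseteq> carrier S" for us
    using that
  proof (induction us)
    case Nil
    then show ?case using c lin_span.zero[of "self_module R"] unfolding I_def by (auto intro!: bexI[of _ \<zero>])
  next
    case (Cons u us)
    then obtain e where e: "e \<in> I (length us)" "cleared_value S a b us = b \<otimes> e" by auto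
    have "a [^] length us \<otimes> b [^] (Suc (length us) - 1 - length us) \<in> gen (Suc (length us))"
      unfolding gen_def by blast
    then have "a [^] length us \<in> I (Suc (length us))" using genI c by auto
    then have "u \<otimes> a [^] length us \<in> I (Suc (length us))" using ideal.I_l_closed[OF I_ideal] Cons S_carr by simp
    then have "u \<otimes> a [^] length us \<oplus> b \<otimes> e \<in> I (Suc (length us))"
      using additive_subgroup.a_closed[OF ideal.axioms(1)[OF I_ideal]] bI[OF e(1)] by blast
    then show ?case using e(2) by auto
  qed
  obtain e where e: "e \<in> I ?n" "cleared_value S a b ss = b \<otimes> e" using clear[OF ss(2)] by blast
  have an: "a [^] ?n = b \<otimes> (\<ominus> e)"
    using sum_zero_eq_neg[of "a [^] ?n" "b \<otimes> e"] z e c Ic[OF e(1)] by (simp add: r_minus)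
  have e': "\<ominus> e \<in> I ?n" using additive_subgroup.a_inv_closed[OF ideal.axioms(1)[OF I_ideal] e(1)] .
  have n0: "?n \<noteq> 0"
  proof
    assume n0: "?n = 0"
    then have "cleared_value S a b ss = \<zero>" by simp
    then show False using z n0 by simp
  qed
  have "\<exists>c\<in>carrier R. a = b \<otimes> c"
  proof (rule integrally_closed[OF c, of "I ?n" "b [^] (?n - 1)"])
    show "b \<noteq> \<zero>" "I ?n \<subseteq> carrier R" using ab Ic by auto
    show "b [^] (?n - 1) \<noteq> \<zero>" using dom.pow_nonzero c ab by simp
    have "a [^] (0::nat) \<otimes> b [^] (?n - 1 - 0) \<in> gen ?n" unfolding gen_def using n0 by blast
    then show "b [^] (?n - 1) \<in> I ?n" using genI c by auto
    fix i assume "i \<in> I ?n"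
    then show "\<exists>i'\<in>I ?n. a \<otimes> i = b \<otimes> i'"
      unfolding I_def
    proof induction
      case zero
      then show ?case using c lin_span.zero[of "self_module R"] by (auto intro!: bexI[of _ \<zero>])
    next
      case (step z r g)
      then obtain z' where z': "z' \<in> I ?n" "a \<otimes> z = b \<otimes> z'" unfolding I_def by blast
      have zc: "z \<in> carrier R" "r \<in> carrier R" "z' \<in> carrier R" using step z' Ic I_def by auto
      obtain i where i: "i < ?n" "g = a [^] i \<otimes> b [^] (?n - 1 - i)" using step unfolding gen_def by blast
      have "\<exists>g'\<in>I ?n. a \<otimes> g = b \<otimes> g'"
      proof (cases "Suc i < ?n")
        case True
        have "?n - 1 - i = Suc (?n - 1 - Suc i)" using True by simp
        then have "a \<otimes> g = b \<otimes> (a [^] (Suc i) \<otimes> b [^] (?n - 1 - Suc i))" unfolding i(2) using c by (simp add: m_ac)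
        moreover have "a [^] (Suc i) \<otimes> b [^] (?n - 1 - Suc i) \<in> I ?n" using genI True unfolding gen_def by blast
        ultimately show ?thesis by blast
      next
        case False
        then have "?n = Suc i" using i by simp
        then have "a \<otimes> g = a [^] ?n" unfolding i(2) using c by (simp add: m_comm)
        then show ?thesis using an e' by auto
      qed
      then obtain g' where g': "g' \<in> I ?n" "a \<otimes> g = b \<otimes> g'" by blast
      have gg: "g \<in> carrier R" "g' \<in> carrier R" using i c g' Ic by auto
      have "a \<otimes> (z \<oplus> r \<otimes> g) = a \<otimes> z \<oplus> r \<otimes> (a \<otimes> g)" using zc gg c by (simp add: r_distr m_lcomm)
      also have "\<dots> = b \<otimes> (z' \<oplus> r \<otimes> g')" unfolding z'(2) g'(2) using zc gg c by (simp add: r_distr m_lcomm)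
      finally have "a \<otimes> (z \<oplus> r \<otimes> g) = b \<otimes> (z' \<oplus> r \<otimes> g')" .
      moreover have "z' \<oplus> r \<otimes> g' \<in> I ?n"
        using additive_subgroup.a_closed[OF ideal.axioms(1)[OF I_ideal] z'(1) ideal.I_l_closed[OF I_ideal g'(1) zc(2)]] .
      ultimately show ?case unfolding I_def by auto
    qed
  qed
  then obtain r where r: "r \<in> carrier R" "a = b \<otimes> r" by blast
  have b0: "b \<noteq> \<zero>" using ab by simp
  have "r \<in> carrier S" unfolding S_iff
  proof (intro conjI ballI r(1))
    fix g assume g: "g \<in> carrier G"
    have "b \<otimes> \<phi> g r = \<phi> g a" unfolding r(2) using S_inv[OF ab(2) g] g r(1) c by (simp add: act_mult)
    also have "\<dots> = b \<otimes> r" using S_inv[OF ab(1) g] r by simp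
    finally show "\<phi> g r = r" using dom.m_lcancel[OF b0 c(2)] g r by simp
  qed
  moreover have "q = fraction S r \<one>\<^bsub>S\<^esub>"
    unfolding ab(4) using Sd.fraction_eq_iff[OF ab(1-3), of r "\<one>\<^bsub>S\<^esub>"] \<open>r \<in> carrier S\<close> r c S_one m_comm[of b r] by simp
  ultimately show "q \<in> ?T" by blast
qed

section \<open>Maximal Cohen-Macaulay modules\<close>

text \<open>Linear forms on a submodule \<open>N\<close> of \<open>M\<close>, as they arise when forms are extended step by step.\<close>

definition linear_on :: "('a, 'm) ring_scheme \<Rightarrow> ('a, 'b, 'n) module_scheme \<Rightarrow> 'b set \<Rightarrow> ('b \<Rightarrow> 'a) \<Rightarrow> bool"
  where "linear_on R M N f \<longleftrightarrow> (\<forall>z\<in>N. f z \<in> carrier R) \<and>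
    (\<forall>z\<in>N. \<forall>w\<in>N. f (z \<oplus>\<^bsub>M\<^esub> w) = f z \<oplus>\<^bsub>R\<^esub> f w) \<and>
    (\<forall>r\<in>carrier R. \<forall>z\<in>N. f (r \<odot>\<^bsub>M\<^esub> z) = r \<otimes>\<^bsub>R\<^esub> f z)"

text \<open>Extend a form from \<open>R u\<close> one generator at a time, multiplying it by a nonzero scalar whenever the new
  generator is dependent on the previous ones.\<close>

lemma (in module) separating_form:
  assumes dom: "domain R" and tf: "\<And>r v. r \<in> carrier R ==> v \<in> carrier M ==> r \<noteq> \<zero> ==> r \<odot>\<^sub>M v = \<zero>\<^sub>M ==> v = \<zero>\<^sub>M"
    and u: "u \<in> carrier M" "u \<noteq> \<zero>\<^sub>M" and "finite A" "A \<subseteq> carrier M"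
  shows "\<exists>f. linear_on R M (lin_span M (carrier R) (insert u A)) f \<and> f u \<noteq> \<zero>"
  using assms(5,6)
proof (induction A)
  case empty
  interpret domain R by (rule dom)
  let ?L = "lin_span M (carrier R) {u}"
  have LE: "\<exists>c\<in>carrier R. z = c \<odot>\<^sub>M u" if z: "z \<in> ?L" for z
  proof -
    obtain c w where c: "c \<in> carrier R" "w \<in> lin_span M (carrier R) {}" "z = w \<oplus>\<^sub>M c \<odot>\<^sub>M u"
      using lin_span_insert[of "{}" u "carrier R" z] z u R.oneideal by auto
    have "w = \<zero>\<^sub>M" using c(2) by (induction rule: lin_span.induct) auto
    then show ?thesis using c u by auto
  qed
  have uniq: "c = d" if "c \<in> carrier R" "d \<in> carrier R" "c \<odot>\<^sub>M u = d \<odot>\<^sub>M u" for c d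
  proof (rule ccontr)
    assume ne: "c \<noteq> d"
    have "(c \<ominus> d) \<odot>\<^sub>M u = c \<odot>\<^sub>M u \<oplus>\<^sub>M (\<ominus>\<^sub>M (d \<odot>\<^sub>M u))"
      using that u by (simp add: R.minus_eq smult_l_distr smult_l_minus)
    also have "\<dots> = \<zero>\<^sub>M" using that u by (simp add: M.r_neg)
    finally have "c \<ominus> d = \<zero>" using tf[of "c \<ominus> d" u] that u by auto
    then show False using ne that by (simp add: R.r_right_minus_eq)
  qed
  \<comment> \<open>The form on \<open>R u\<close> that takes the value \<open>1\<close> at \<open>u\<close>.\<close>
  define f where "f z = (THE c. c \<in> carrier R \<and> z = c \<odot>\<^sub>M u)" for z
  have f: "f (c \<odot>\<^sub>M u) = c" if "c \<in> carrier R" for c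
    unfolding f_def by (rule the_equality) (use that uniq in auto)
  have "linear_on R M ?L f"
    unfolding linear_on_def
  proof (intro conjI ballI)
    fix z assume "z \<in> ?L"
    then obtain c where c: "c \<in> carrier R" "z = c \<odot>\<^sub>M u" using LE by blast
    show "f z \<in> carrier R" using c f by simp
    show "f (r \<odot>\<^sub>M z) = r \<otimes> f z" if "r \<in> carrier R" for r
      using c f u that by (simp add: smult_assoc1[symmetric])
    fix w assume "w \<in> ?L"
    then obtain d where d: "d \<in> carrier R" "w = d \<odot>\<^sub>M u" using LE by blast
    show "f (z \<oplus>\<^sub>M w) = f z \<oplus> f w" using c d f u by (simp add: smult_l_distr[symmetric])
  qed
  moreover have "f u = \<one>" using f[of \<one>] u by simp
  ultimately show ?case by auto
next
  case (insert v A)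
  interpret domain R by (rule dom)
  let ?L = "lin_span M (carrier R) (insert u A)" and ?L' = "lin_span M (carrier R) (insert u (insert v A))"
  have Av: "insert u A \<subseteq> carrier M" "v \<in> carrier M" "insert u (insert v A) \<subseteq> carrier M" using insert u by auto
  have L: "submodule ?L R M" and L': "submodule ?L' R M" using lin_span_sub Av by auto
  note Lc = submoduleE(1)[OF L] note L'c = submoduleE(1)[OF L']
  have uL: "u \<in> ?L" "u \<in> ?L'" using lin_span_incl[OF Av(1)] lin_span_incl[OF Av(3)] by auto
  obtain f where f: "linear_on R M ?L f" "f u \<noteq> \<zero>" using insert by auto
  have fc: "f z \<in> carrier R" and fa: "f (z \<oplus>\<^sub>M w) = f z \<oplus> f w" and fs: "f (r \<odot>\<^sub>M z) = r \<otimes> f z"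
    if "z \<in> ?L" "w \<in> ?L" "r \<in> carrier R" for z w r using f(1) that unfolding linear_on_def by auto
  have L'E: "\<exists>w\<in>?L. \<exists>c\<in>carrier R. z = w \<oplus>\<^sub>M c \<odot>\<^sub>M v" if "z \<in> ?L'" for z
    using lin_span_insert[OF Av(1,2) R.oneideal, of z] that by (auto simp: insert_commute)
  show ?case
  proof (cases "\<exists>t\<in>carrier R. t \<noteq> \<zero> \<and> t \<odot>\<^sub>M v \<in> ?L")
    case True
    then obtain t where t: "t \<in> carrier R" "t \<noteq> \<zero>" "t \<odot>\<^sub>M v \<in> ?L" by blast
    have tL: "t \<odot>\<^sub>M z \<in> ?L" if z: "z \<in> ?L'" for z
    proof -
      obtain w c where wc: "w \<in> ?L" "c \<in> carrier R" "z = w \<oplus>\<^sub>M c \<odot>\<^sub>M v" using L'E z by blast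
      have "w \<in> carrier M" using wc Lc by blast
      then have "t \<odot>\<^sub>M z = t \<odot>\<^sub>M w \<oplus>\<^sub>M c \<odot>\<^sub>M (t \<odot>\<^sub>M v)"
        unfolding wc(3) using wc(2) t Av by (simp add: smult_r_distr smult_assoc1[symmetric] m_comm)
      then show ?thesis using submoduleE(5)[OF L submoduleE(4)[OF L t(1) wc(1)] submoduleE(4)[OF L wc(2) t(3)]] by simp
    qed
    have "linear_on R M ?L' (\<lambda>z. f (t \<odot>\<^sub>M z))"
      unfolding linear_on_def
    proof (intro conjI ballI)
      fix z assume z: "z \<in> ?L'"
      have zc: "z \<in> carrier M" using z L'c by blast
      show "f (t \<odot>\<^sub>M z) \<in> carrier R" using fc[OF tL[OF z] tL[OF z] t(1)] .
      show "f (t \<odot>\<^sub>M (r \<odot>\<^sub>M z)) = r \<otimes> f (t \<odot>\<^sub>M z)" if "r \<in> carrier R" for r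
        using fs[OF tL[OF z] tL[OF z] that] t(1) zc that by (simp add: smult_assoc1[symmetric] m_comm)
      fix w assume w: "w \<in> ?L'"
      have wc: "w \<in> carrier M" using w L'c by blast
      show "f (t \<odot>\<^sub>M (z \<oplus>\<^sub>M w)) = f (t \<odot>\<^sub>M z) \<oplus> f (t \<odot>\<^sub>M w)"
        using fa[OF tL[OF z] tL[OF w] t(1)] t(1) zc wc by (simp add: smult_r_distr)
    qed
    moreover have "f (t \<odot>\<^sub>M u) \<noteq> \<zero>" using fs[OF uL(1) uL(1) t(1)] f(2) t fc[OF uL(1) uL(1) t(1)] integral_iff by simp
    ultimately show ?thesis by blast
  next
    case False
    have uniq: "w = w'" if h: "w \<in> ?L" "w' \<in> ?L" "c \<in> carrier R" "c' \<in> carrier R" "w \<oplus>\<^sub>M c \<odot>\<^sub>M v = w' \<oplus>\<^sub>M c' \<odot>\<^sub>M v" for w w' c c'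
    proof -
      have wc: "w \<in> carrier M" "w' \<in> carrier M" using h Lc by auto
      have "(c \<ominus> c') \<odot>\<^sub>M v = (w \<oplus>\<^sub>M c \<odot>\<^sub>M v) \<oplus>\<^sub>M (\<ominus>\<^sub>M (w \<oplus>\<^sub>M c' \<odot>\<^sub>M v))"
        using h(3,4) wc Av by (simp add: R.minus_eq smult_l_distr smult_l_minus M.minus_add M.a_ac M.r_neg M.r_neg1 M.r_neg2)
      also have "\<dots> = w' \<ominus>\<^sub>M w"
        unfolding h(5) using h(3,4) wc Av by (simp add: M.minus_eq M.minus_add M.a_ac M.r_neg M.r_neg1 M.r_neg2)
      also have "\<dots> \<in> ?L" by (rule submodule_sub[OF L h(2,1)])
      finally have "c \<ominus> c' = \<zero>" using False R.minus_closed[OF h(3,4)] by blast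
      then have "c = c'" using h(3,4) by (simp add: R.r_right_minus_eq)
      then show "w = w'" using h wc Av by simp
    qed
    define f' where "f' z = f (THE w. w \<in> ?L \<and> (\<exists>c\<in>carrier R. z = w \<oplus>\<^sub>M c \<odot>\<^sub>M v))" for z
    have f': "f' (w \<oplus>\<^sub>M c \<odot>\<^sub>M v) = f w" if "w \<in> ?L" "c \<in> carrier R" for w c
    proof -
      have "(THE w'. w' \<in> ?L \<and> (\<exists>c'\<in>carrier R. w \<oplus>\<^sub>M c \<odot>\<^sub>M v = w' \<oplus>\<^sub>M c' \<odot>\<^sub>M v)) = w"
        by (rule the_equality) (use that uniq in blast)+
      then show ?thesis unfolding f'_def by simp
    qed
    have "linear_on R M ?L' f'"
      unfolding linear_on_def
    proof (intro conjI ballI)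
      fix z assume z: "z \<in> ?L'"
      obtain w c where w: "w \<in> ?L" "c \<in> carrier R" "z = w \<oplus>\<^sub>M c \<odot>\<^sub>M v" using L'E z by blast
      have wc: "w \<in> carrier M" using w Lc by blast
      show "f' z \<in> carrier R" using w f' fc by auto
      show "f' (r \<odot>\<^sub>M z) = r \<otimes> f' z" if r: "r \<in> carrier R" for r
      proof -
        have "r \<odot>\<^sub>M z = r \<odot>\<^sub>M w \<oplus>\<^sub>M (r \<otimes> c) \<odot>\<^sub>M v" unfolding w(3) using r wc w(2) Av by (simp add: smult_r_distr smult_assoc1)
        then show ?thesis using f'[OF submoduleE(4)[OF L r w(1)], of "r \<otimes> c"] f'[OF w(1,2)] fs[OF w(1,1) r] w r by simp
      qed
      fix z' assume z': "z' \<in> ?L'"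
      obtain w' c' where w': "w' \<in> ?L" "c' \<in> carrier R" "z' = w' \<oplus>\<^sub>M c' \<odot>\<^sub>M v" using L'E z' by blast
      have wc': "w' \<in> carrier M" using w' Lc by blast
      have "z \<oplus>\<^sub>M z' = (w \<oplus>\<^sub>M w') \<oplus>\<^sub>M (c \<oplus> c') \<odot>\<^sub>M v"
        unfolding w(3) w'(3) using wc wc' w(2) w'(2) Av by (simp add: smult_l_distr M.a_ac)
      then show "f' (z \<oplus>\<^sub>M z') = f' z \<oplus> f' z'"
        using f'[OF submoduleE(5)[OF L w(1) w'(1)], of "c \<oplus> c'"] f'[OF w(1,2)] f'[OF w'(1,2)] fa[OF w(1) w'(1) w(2)] w w' by simp
    qed
    moreover have "f' u = f u" using f'[OF uL(1), of \<zero>] Av u by simp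
    ultimately show ?thesis using f(2) by auto
  qed
qed

text \<open>A finitely generated module of depth at least two: \<open>a\<close> is injective on \<open>M\<close>, and
  \<open>b\<close> is injective on \<open>M / a M\<close>, written without quotients.\<close>

locale depth2_module = dim2_domain R m + M: module R M for R (structure) and m and M +
  fixes a b
  assumes fg: "fin_gen_module R M" and a_m: "a \<in> m" and b_m: "b \<in> m"
    and a_inj: "v \<in> carrier M ==> a \<odot>\<^bsub>M\<^esub> v = \<zero>\<^bsub>M\<^esub> ==> v = \<zero>\<^bsub>M\<^esub>"
    and b_reg: "v \<in> carrier M ==> u \<in> carrier M ==> b \<odot>\<^bsub>M\<^esub> v = a \<odot>\<^bsub>M\<^esub> u ==> \<exists>w\<in>carrier M. v = a \<odot>\<^bsub>M\<^esub> w"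

lemma (in dim2_domain) MCM_depth2:
  assumes dim: "krull_dim R = 2" and M: "MCM_module R M"
  obtains a b where "depth2_module R m M a b"
proof -
  have fg: "fin_gen_module R M" and d: "depth R M = 2" using M dim unfolding MCM_module_def by auto
  then have mod: "module R M" unfolding fin_gen_module_def by simp
  obtain a b xs where s: "set (a # b # xs) \<subseteq> max_ideal R" "regular_sequence R M (a # b # xs)" by (rule depth_ge_2[OF d])
  have "depth2_module R m M a b"
    using module.regular_sequence_Cons2[OF mod s(2)] s(1) max_ideal_eq fg mod
    by (intro depth2_module.intro depth2_module_axioms.intro dim2_domain_axioms) auto
  then show thesis using that by blast
qed

context depth2_module
begin

lemma a_carr [simp]: "a \<in> carrier R" and b_carr [simp]: "b \<in> carrier R" using a_m b_m m_carr by auto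

lemma generators:
  obtains A where "finite A" "A \<subseteq> carrier M" "lin_span M (carrier R) A = carrier M"
  using fg M.submodule_span_eq unfolding fin_gen_module_def by metis

lemma M_noetherian: "noetherian_module R M"
proof -
  obtain A where A: "finite A" "A \<subseteq> carrier M" "lin_span M (carrier R) A = carrier M" by (rule generators)
  show ?thesis unfolding noetherian_module_def
  proof (intro allI impI)
    fix N assume N: "submodule N R M"
    then have "N \<subseteq> lin_span M (carrier R) A" using M.submoduleE(1) A(3) by simp
    then show "\<exists>B. finite B \<and> B \<subseteq> N \<and> lin_span M (carrier R) B = N"
      by (rule M.noetherian_fin_gen[OF noetherian_ring_module[OF noeth] A(1,2) N])
  qed
qed

lemma a_cancel:
  assumes "v \<in> carrier M" "w \<in> carrier M" "a \<odot>\<^bsub>M\<^esub> v = a \<odot>\<^bsub>M\<^esub> w" shows "v = w"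
proof -
  have "a \<odot>\<^bsub>M\<^esub> (v \<ominus>\<^bsub>M\<^esub> w) = \<zero>\<^bsub>M\<^esub>"
    using assms by (simp add: M.minus_eq M.smult_r_distr M.smult_r_minus M.r_neg)
  then have z: "v \<ominus>\<^bsub>M\<^esub> w = \<zero>\<^bsub>M\<^esub>" using a_inj assms by simp
  have "v = (v \<ominus>\<^bsub>M\<^esub> w) \<oplus>\<^bsub>M\<^esub> w" using assms by (simp add: M.minus_eq M.a_assoc M.l_neg)
  then show ?thesis unfolding z using assms by simp
qed

lemma b_pow_regular:
  assumes "v \<in> carrier M" "u \<in> carrier M" "b [^] (l::nat) \<odot>\<^bsub>M\<^esub> v = a \<odot>\<^bsub>M\<^esub> u"
  shows "\<exists>w\<in>carrier M. v = a \<odot>\<^bsub>M\<^esub> w"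
  using assms
proof (induction l arbitrary: u)
  case (Suc l)
  have "b \<odot>\<^bsub>M\<^esub> (b [^] l \<odot>\<^bsub>M\<^esub> v) = a \<odot>\<^bsub>M\<^esub> u" using Suc.prems by (simp add: M.smult_assoc1[symmetric] m_comm)
  then obtain w where "w \<in> carrier M" "b [^] l \<odot>\<^bsub>M\<^esub> v = a \<odot>\<^bsub>M\<^esub> w" using b_reg[of "b [^] l \<odot>\<^bsub>M\<^esub> v" u] Suc.prems by auto
  then show ?case using Suc by blast
qed auto

lemma pow_regular:
  assumes "v \<in> carrier M" "u \<in> carrier M" "b [^] (l::nat) \<odot>\<^bsub>M\<^esub> v = a [^] (k::nat) \<odot>\<^bsub>M\<^esub> u"
  shows "\<exists>w\<in>carrier M. v = a [^] k \<odot>\<^bsub>M\<^esub> w"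
  using assms
proof (induction k arbitrary: v u)
  case 0
  then show ?case by auto
next
  case (Suc k)
  have e: "a [^] (Suc k) \<odot>\<^bsub>M\<^esub> w = a \<odot>\<^bsub>M\<^esub> (a [^] k \<odot>\<^bsub>M\<^esub> w)" if "w \<in> carrier M" for w
    using that by (simp add: M.smult_assoc1[symmetric] m_comm)
  obtain w where w: "w \<in> carrier M" "v = a \<odot>\<^bsub>M\<^esub> w"
    using b_pow_regular[of v "a [^] k \<odot>\<^bsub>M\<^esub> u" l] Suc.prems e by auto
  have "a \<odot>\<^bsub>M\<^esub> (b [^] l \<odot>\<^bsub>M\<^esub> w) = b [^] l \<odot>\<^bsub>M\<^esub> v" unfolding w(2) using w(1) by (simp add: M.smult_assoc1[symmetric] m_comm)
  also have "\<dots> = a \<odot>\<^bsub>M\<^esub> (a [^] k \<odot>\<^bsub>M\<^esub> u)" using Suc.prems e by simp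
  finally have eq: "b [^] l \<odot>\<^bsub>M\<^esub> w = a [^] k \<odot>\<^bsub>M\<^esub> u"
    by (rule a_cancel[rotated 2]) (use Suc.prems(2) w(1) in simp_all)
  then obtain w' where w': "w' \<in> carrier M" "w = a [^] k \<odot>\<^bsub>M\<^esub> w'"
    using Suc.IH[OF w(1) Suc.prems(2) eq] by blast
  have "v = a [^] (Suc k) \<odot>\<^bsub>M\<^esub> w'" unfolding e[OF w'(1)] w(2) w'(2) ..
  then show ?case using w'(1) by blast
qed

text \<open>Otherwise some \<open>v \<noteq> 0\<close> has a nonzero annihilator, and a maximal annihilator \<open>p\<close> of
  this kind is prime. As \<open>a \<notin> p\<close>, only \<open>m\<close> contains \<open>p + a R\<close>, so that a
  power of \<open>b\<close> maps \<open>T = {v. p v = 0}\<close> into \<open>a M\<close>. Regularity of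
  \<open>b\<close> modulo \<open>a\<close> then gives \<open>T = a T\<close>, contradicting Nakayama's lemma.\<close>

lemma torsion_free:
  assumes v: "v \<in> carrier M" and s: "s \<in> carrier R" "s \<noteq> \<zero>" "s \<odot>\<^bsub>M\<^esub> v = \<zero>\<^bsub>M\<^esub>"
  shows "v = \<zero>\<^bsub>M\<^esub>"
proof (rule ccontr)
  assume v0: "v \<noteq> \<zero>\<^bsub>M\<^esub>"
  define ann where "ann u = {r \<in> carrier R. r \<odot>\<^bsub>M\<^esub> u = \<zero>\<^bsub>M\<^esub>}" for u
  have ann_ideal: "ideal (ann u) R" if u: "u \<in> carrier M" for u
    unfolding submodule_ideal[symmetric]
    by (rule module.submoduleI[OF self_module])
       (use u in "auto simp: ann_def self_minus M.smult_l_distr M.smult_l_minus M.smult_assoc1")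
  let ?P = "\<lambda>J. \<exists>u\<in>carrier M. u \<noteq> \<zero>\<^bsub>M\<^esub> \<and> J = ann u \<and> s \<in> J"
  obtain p where p: "?P p" and mx: "\<And>J. ?P J ==> p \<subseteq> J ==> J = p"
  proof (rule ideal_max[OF noeth, of ?P "ann v"])
    show "?P (ann v)" using v v0 s unfolding ann_def by blast
    show "ideal J R" if "?P J" for J using that ann_ideal by blast
  qed (rule that)
  obtain u where u: "u \<in> carrier M" "u \<noteq> \<zero>\<^bsub>M\<^esub>" "p = ann u" "s \<in> p" using p by blast
  have p_prime: "primeideal p R"
  proof (rule primeidealI)
    show "ideal p R" "cring R" using ann_ideal u is_cring by auto
    have "\<one> \<notin> p" using u unfolding ann_def by simp
    then show "carrier R \<noteq> p" by blast
    fix c d assume cd: "c \<in> carrier R" "d \<in> carrier R" "c \<otimes> d \<in> p"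
    show "c \<in> p \<or> d \<in> p"
    proof (rule disjCI)
      assume "d \<notin> p"
      then have du: "d \<odot>\<^bsub>M\<^esub> u \<noteq> \<zero>\<^bsub>M\<^esub>" "d \<odot>\<^bsub>M\<^esub> u \<in> carrier M" using cd u unfolding ann_def by auto
      have sub: "p \<subseteq> ann (d \<odot>\<^bsub>M\<^esub> u)"
      proof
        fix r assume r: "r \<in> p"
        then have rc: "r \<in> carrier R" "r \<odot>\<^bsub>M\<^esub> u = \<zero>\<^bsub>M\<^esub>" using u(3) unfolding ann_def by auto
        have "r \<odot>\<^bsub>M\<^esub> (d \<odot>\<^bsub>M\<^esub> u) = d \<odot>\<^bsub>M\<^esub> (r \<odot>\<^bsub>M\<^esub> u)"
          using u(1) cd(2) rc(1) by (simp add: M.smult_assoc1[symmetric] m_comm)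
        then show "r \<in> ann (d \<odot>\<^bsub>M\<^esub> u)" using rc cd unfolding ann_def by simp
      qed
      then have "ann (d \<odot>\<^bsub>M\<^esub> u) = p" using mx[of "ann (d \<odot>\<^bsub>M\<^esub> u)"] du u(4) by blast
      moreover have "c \<in> ann (d \<odot>\<^bsub>M\<^esub> u)" using cd u unfolding ann_def by (simp add: M.smult_assoc1)
      ultimately show "c \<in> p" by simp
    qed
  qed
  interpret p: primeideal p R by (rule p_prime)
  have ap: "a \<notin> p" using a_inj[OF u(1)] u(2) unfolding u(3) ann_def by blast
  let ?I = "p <+>\<^bsub>R\<^esub> PIdl a"
  have I: "ideal ?I R" by (rule add_ideals[OF p.is_ideal cgenideal_ideal]) simp
  have pI: "p \<subseteq> ?I"
  proof
    fix r assume r: "r \<in> p"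
    have "r \<oplus> \<zero> \<in> ?I" by (rule set_addI[OF r]) (rule additive_subgroup.zero_closed[OF ideal.axioms(1)[OF cgenideal_ideal]], simp)
    then show "r \<in> ?I" using p.Icarr[OF r] by simp
  qed
  have aI: "a \<in> ?I" using set_addI[OF p.zero_closed cgenideal_self[OF a_carr], of R] by simp
  obtain k where k: "b [^] (k::nat) \<in> ?I"
  proof (rule power_in_ideal[OF noeth I b_carr])
    fix Q assume Q: "primeideal Q R" "?I \<subseteq> Q"
    have "{\<zero>} \<subset> p" using p.zero_closed u(4) s(2) by blast
    moreover have "p \<subset> Q" using pI aI ap Q(2) by blast
    ultimately show "b \<in> Q" using between[OF p_prime Q(1)] b_m by simp
  qed
  obtain q c where q: "q \<in> p" "c \<in> carrier R" "b [^] k = q \<oplus> c \<otimes> a"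
    using k by (auto simp: set_add_iff mem_PIdl)
  define T where "T = {t \<in> carrier M. \<forall>r\<in>p. r \<odot>\<^bsub>M\<^esub> t = \<zero>\<^bsub>M\<^esub>}"
  have TE: "t \<in> carrier M" "r \<in> p ==> r \<odot>\<^bsub>M\<^esub> t = \<zero>\<^bsub>M\<^esub>" if "t \<in> T" for t r using that unfolding T_def by auto
  have T: "submodule T R M"
  proof (rule M.submoduleI)
    show "r \<odot>\<^bsub>M\<^esub> t \<in> T" if r: "r \<in> carrier R" and t: "t \<in> T" for r t
    proof -
      have "z \<odot>\<^bsub>M\<^esub> (r \<odot>\<^bsub>M\<^esub> t) = r \<odot>\<^bsub>M\<^esub> (z \<odot>\<^bsub>M\<^esub> t)" if "z \<in> p" for z
        using r TE(1)[OF t] p.Icarr[OF that] by (simp add: M.smult_assoc1[symmetric] m_comm)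
      then show ?thesis using r TE[OF t] unfolding T_def by simp
    qed
  qed (use p.Icarr in "auto simp: T_def M.smult_r_distr M.smult_r_minus")
  have zero_sub: "submodule {\<zero>\<^bsub>M\<^esub>} R M" by (rule M.submoduleI) auto
  have "T \<subseteq> {\<zero>\<^bsub>M\<^esub>} <+>\<^bsub>M\<^esub> lin_span M m T"
  proof
    fix t assume t: "t \<in> T"
    note tc = TE(1)[OF t]
    have "b [^] k \<odot>\<^bsub>M\<^esub> t = q \<odot>\<^bsub>M\<^esub> t \<oplus>\<^bsub>M\<^esub> a \<odot>\<^bsub>M\<^esub> (c \<odot>\<^bsub>M\<^esub> t)"
      unfolding q(3) using q(2) p.Icarr[OF q(1)] tc by (simp add: M.smult_l_distr M.smult_assoc1[symmetric] m_comm)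
    then have "b [^] k \<odot>\<^bsub>M\<^esub> t = a \<odot>\<^bsub>M\<^esub> (c \<odot>\<^bsub>M\<^esub> t)" using TE(2)[OF t q(1)] q(2) tc by simp
    then obtain w where w: "w \<in> carrier M" "t = a \<odot>\<^bsub>M\<^esub> w" using b_pow_regular[OF tc, of "c \<odot>\<^bsub>M\<^esub> t"] q(2) tc by auto
    have "r \<odot>\<^bsub>M\<^esub> w = \<zero>\<^bsub>M\<^esub>" if r: "r \<in> p" for r
    proof (rule a_inj)
      show "r \<odot>\<^bsub>M\<^esub> w \<in> carrier M" using w p.Icarr[OF r] by simp
      have "a \<odot>\<^bsub>M\<^esub> (r \<odot>\<^bsub>M\<^esub> w) = r \<odot>\<^bsub>M\<^esub> t" unfolding w(2) using w(1) p.Icarr[OF r] by (simp add: M.smult_assoc1[symmetric] m_comm)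
      then show "a \<odot>\<^bsub>M\<^esub> (r \<odot>\<^bsub>M\<^esub> w) = \<zero>\<^bsub>M\<^esub>" using TE(2)[OF t r] by simp
    qed
    then have "w \<in> T" unfolding T_def using w by simp
    then have "a \<odot>\<^bsub>M\<^esub> w \<in> lin_span M m T"
      using M.lin_span_smult_gen[of T m a w] M.submoduleE(1)[OF T] m_carr a_m by blast
    from set_addI[of "\<zero>\<^bsub>M\<^esub>" "{\<zero>\<^bsub>M\<^esub>}", OF _ this, of M] show "t \<in> {\<zero>\<^bsub>M\<^esub>} <+>\<^bsub>M\<^esub> lin_span M m T" using w tc by simp
  qed
  from M.nakayama_noetherian[OF m_ideal _ M_noetherian T zero_sub this]
  have "T \<subseteq> {\<zero>\<^bsub>M\<^esub>}" using one_minus_unit by simp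
  moreover have "u \<in> T" unfolding T_def u(3) ann_def using u(1) by simp
  ultimately show False using u(2) by blast
qed

lemma enough_forms:
  assumes u: "u \<in> carrier M" "u \<noteq> \<zero>\<^bsub>M\<^esub>"
  shows "\<exists>f. linear_on R M (carrier M) f \<and> f u \<noteq> \<zero>"
proof -
  obtain A where A: "finite A" "A \<subseteq> carrier M" "lin_span M (carrier R) A = carrier M" by (rule generators)
  have "lin_span M (carrier R) (insert u A) = carrier M"
    using M.lin_span_carrier[of "insert u A" "carrier R"] lin_span_mono[of A "insert u A" "carrier R" "carrier R"] A u by blast
  then show ?thesis using M.separating_form[OF domain_axioms torsion_free u A(1,2)] by auto
qed

end

section \<open>Free modules: coordinates and elimination\<close>

lemma (in module) basis_coordinates:
  assumes A: "basis R M A"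
  obtains \<kappa> where "\<And>a. a \<in> A ==> linear_on R M (carrier M) (\<kappa> a)"
    "\<And>v. v \<in> carrier M ==> v = (\<Oplus>\<^bsub>M\<^esub>a\<in>A. \<kappa> a v \<odot>\<^sub>M a)"
    "\<And>c a. c \<in> A \<rightarrow> carrier R ==> a \<in> A ==> \<kappa> a (\<Oplus>\<^bsub>M\<^esub>a\<in>A. c a \<odot>\<^sub>M a) = c a"
proof -
  have fin: "finite A" and Ac: "A \<subseteq> carrier M" and span: "lin_span M (carrier R) A = carrier M"
    and ind: "\<And>c. c \<in> A \<rightarrow> carrier R ==> (\<Oplus>\<^bsub>M\<^esub>a\<in>A. c a \<odot>\<^sub>M a) = \<zero>\<^sub>M ==> (\<forall>a\<in>A. c a = \<zero>)"
    using A unfolding basis_def by auto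
  let ?s = "\<lambda>c. \<Oplus>\<^bsub>M\<^esub>a\<in>A. c a \<odot>\<^sub>M a"
  have car: "(\<lambda>a. c a \<odot>\<^sub>M a) \<in> A \<rightarrow> carrier M" if "c \<in> A \<rightarrow> carrier R" for c
    using that Ac by (auto simp: Pi_iff subset_iff)
  have sc: "?s c \<in> carrier M" if "c \<in> A \<rightarrow> carrier R" for c using M.finsum_closed[OF car[OF that]] .
  have s_smult: "?s (\<lambda>a. r \<otimes> c a) = r \<odot>\<^sub>M ?s c" if "c \<in> A \<rightarrow> carrier R" "r \<in> carrier R" for c r
  proof -
    have "r \<odot>\<^sub>M ?s c = (\<Oplus>\<^bsub>M\<^esub>a\<in>A. r \<odot>\<^sub>M (c a \<odot>\<^sub>M a))"
      by (rule finsum_smult_ldistr[OF fin that(2) car[OF that(1)]])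
    also have "\<dots> = ?s (\<lambda>a. r \<otimes> c a)"
      by (rule M.finsum_cong') (use that Ac in "auto simp: smult_assoc1 Pi_iff subset_iff")
    finally show ?thesis by simp
  qed
  have s_add: "?s (\<lambda>a. c a \<oplus> d a) = ?s c \<oplus>\<^sub>M ?s d" if "c \<in> A \<rightarrow> carrier R" "d \<in> A \<rightarrow> carrier R" for c d
  proof -
    have "?s c \<oplus>\<^sub>M ?s d = (\<Oplus>\<^bsub>M\<^esub>a\<in>A. c a \<odot>\<^sub>M a \<oplus>\<^sub>M d a \<odot>\<^sub>M a)"
      by (rule M.finsum_addf[symmetric]) (use that Ac in "auto simp: Pi_iff subset_iff")
    also have "\<dots> = ?s (\<lambda>a. c a \<oplus> d a)"
      by (rule M.finsum_cong') (use that Ac in "auto simp: smult_l_distr Pi_iff subset_iff")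
    finally show ?thesis by simp
  qed
  have uniq: "c a = d a" if c: "c \<in> A \<rightarrow> carrier R" "d \<in> A \<rightarrow> carrier R" "?s c = ?s d" "a \<in> A" for c d a
  proof -
    let ?e = "\<lambda>a. c a \<oplus> (\<ominus> \<one>) \<otimes> d a"
    have d': "(\<lambda>a. (\<ominus> \<one>) \<otimes> d a) \<in> A \<rightarrow> carrier R" and e: "?e \<in> A \<rightarrow> carrier R" using c(1,2) by (auto simp: Pi_iff)
    have "?s ?e = ?s c \<oplus>\<^sub>M (\<ominus> \<one>) \<odot>\<^sub>M ?s d"
      by (simp only: s_add[OF c(1) d'] s_smult[OF c(2) R.a_inv_closed[OF R.one_closed]])
    also have "\<dots> = \<zero>\<^sub>M" unfolding c(3) using sc[OF c(2)] by (simp add: smult_l_minus M.r_neg)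
    finally have "c a \<oplus> (\<ominus> \<one>) \<otimes> d a = \<zero>" using ind[OF e] c(4) by blast
    moreover have "c a \<in> carrier R" "d a \<in> carrier R" using c by auto
    ultimately show ?thesis by (simp add: R.l_minus R.minus_eq[symmetric] R.r_right_minus_eq)
  qed
  have "\<forall>v\<in>carrier M. \<exists>c. c \<in> A \<rightarrow> carrier R \<and> v = ?s c"
  proof
    fix v assume "v \<in> carrier M"
    then show "\<exists>c. c \<in> A \<rightarrow> carrier R \<and> v = ?s c" using lin_span_finsum[OF fin Ac R.oneideal, of v] span by simp
  qed
  from bchoice[OF this] obtain k where "\<forall>v\<in>carrier M. k v \<in> A \<rightarrow> carrier R \<and> v = ?s (k v)" ..
  then have k: "\<And>v. v \<in> carrier M ==> k v \<in> A \<rightarrow> carrier R" "\<And>v. v \<in> carrier M ==> v = ?s (k v)"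
    by simp_all
  have ks: "k (?s c) a = c a" if "c \<in> A \<rightarrow> carrier R" "a \<in> A" for c a
    using uniq[OF k(1)[OF sc[OF that(1)]] that(1) _ that(2)] k(2)[OF sc[OF that(1)]] by simp
  show thesis
  proof (rule that[of "\<lambda>a v. k v a"])
    fix a assume a: "a \<in> A"
    show "linear_on R M (carrier M) (\<lambda>v. k v a)"
      unfolding linear_on_def
    proof (intro conjI ballI)
      fix v assume v: "v \<in> carrier M"
      show "k v a \<in> carrier R" using k(1)[OF v] a by auto
      show "k (r \<odot>\<^sub>M v) a = r \<otimes> k v a" if r: "r \<in> carrier R" for r
      proof -
        have "r \<odot>\<^sub>M v = ?s (\<lambda>a. r \<otimes> k v a)" using s_smult[OF k(1)[OF v] r] k(2)[OF v] by simp
        then show ?thesis using ks[of "\<lambda>a. r \<otimes> k v a" a] k(1)[OF v] r a by (simp add: Pi_iff)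
      qed
      fix w assume w: "w \<in> carrier M"
      have "v \<oplus>\<^sub>M w = ?s (\<lambda>a. k v a \<oplus> k w a)" using s_add[OF k(1)[OF v] k(1)[OF w]] k(2)[OF v] k(2)[OF w] by simp
      then show "k (v \<oplus>\<^sub>M w) a = k v a \<oplus> k w a"
        using ks[of "\<lambda>a. k v a \<oplus> k w a" a] k(1)[OF v] k(1)[OF w] a by (simp add: Pi_iff)
    qed
  qed (use k ks in blast)+
qed

text \<open>Gaussian elimination over the localization at \<open>I\<close>, with denominators cleared. A vector \<open>n0\<close>
  whose entry at \<open>v\<close> is outside \<open>I\<close> serves as pivot for the coordinate \<open>v\<close>.\<close>

lemma (in primeideal) elimination:
  assumes "finite B" "submodule N R (fun_module R B)"
  shows "(\<exists>c\<in>B \<rightarrow> carrier R. (\<exists>b\<in>B. c b \<notin> I) \<and> (\<forall>n\<in>N. (\<Oplus>b\<in>B. c b \<otimes> n b) \<in> I)) \<or>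
    (\<exists>d\<in>carrier R. d \<notin> I \<and> (\<forall>w\<in>B \<rightarrow>\<^sub>E carrier R. (\<lambda>b\<in>B. d \<otimes> w b) \<in> N))"
  using assms
proof (induction B arbitrary: N)
  case empty
  interpret V: module R "fun_module R {}" by (rule fun_module)
  have "\<one> \<notin> I" using one_imp_carrier I_notcarr by blast
  moreover have "(\<lambda>b\<in>{}. \<zero>) \<in> N" using V.submodule_0[OF empty] by (simp only: fun_module_simps)
  then have "(\<lambda>b\<in>{}. \<one> \<otimes> w b) \<in> N" for w by (simp add: restrict_def)
  ultimately show ?case by blast
next
  case (insert v B)
  let ?V' = "fun_module R (insert v B)"
  interpret V': module R ?V' by (rule fun_module)
  interpret V: module R "fun_module R B" by (rule fun_module)
  note N = insert.prems
  have Nc: "f \<in> insert v B \<rightarrow>\<^sub>E carrier R" if "f \<in> N" for f using V'.submoduleE(1)[OF N] that by auto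
  have Nadd: "(\<lambda>b\<in>insert v B. f b \<oplus> g b) \<in> N" if "f \<in> N" "g \<in> N" for f g
    using V'.submoduleE(5)[OF N that] by (simp only: fun_module_simps)
  have Nsm: "(\<lambda>b\<in>insert v B. r \<otimes> f b) \<in> N" if "f \<in> N" "r \<in> carrier R" for f r
    using V'.submoduleE(4)[OF N that(2,1)] by (simp only: fun_module_simps)
  have one: "\<one> \<notin> I" using one_imp_carrier I_notcarr by blast
  show ?case
  proof (cases "\<forall>n\<in>N. n v \<in> I")
    case True
    let ?c = "\<lambda>b. if b = v then \<one> else \<zero>"
    have "(\<Oplus>b\<in>insert v B. ?c b \<otimes> n b) \<in> I" if n: "n \<in> N" for n
    proof -
      have nc: "n b \<in> carrier R" if "b \<in> insert v B" for b using Nc[OF n] that by auto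
      have "(\<Oplus>b\<in>insert v B. ?c b \<otimes> n b) = ?c v \<otimes> n v \<oplus> (\<Oplus>b\<in>B. ?c b \<otimes> n b)"
        by (rule finsum_insert) (use insert.hyps nc in auto)
      also have "(\<Oplus>b\<in>B. ?c b \<otimes> n b) = (\<Oplus>b\<in>B. \<zero>)" by (rule finsum_cong') (use insert.hyps nc in auto)
      finally show ?thesis using True n nc by simp
    qed
    then show ?thesis using one by (intro disjI1 bexI[of _ ?c]) auto
  next
    case False
    then obtain n0 where n0: "n0 \<in> N" "n0 v \<notin> I" by blast
    define t where "t = n0 v"
    have n0c: "n0 b \<in> carrier R" if "b \<in> insert v B" for b using Nc[OF n0(1)] that by auto
    have t: "t \<in> carrier R" "t \<notin> I" using n0 n0c unfolding t_def by auto
    \<comment> \<open>\<open>N'\<close> is the part of \<open>N\<close> with vanishing coordinate at \<open>v\<close>.\<close>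
    define N' where "N' = {n' \<in> B \<rightarrow>\<^sub>E carrier R. n'(v := \<zero>) \<in> N}"
    have N'I: "n' \<in> N'" if "n' \<in> B \<rightarrow>\<^sub>E carrier R" "n'(v := \<zero>) \<in> N" for n' using that unfolding N'_def by blast
    have N'E: "n' \<in> B \<rightarrow>\<^sub>E carrier R" "n'(v := \<zero>) \<in> N" if "n' \<in> N'" for n' using that unfolding N'_def by auto
    have upd: "(\<lambda>b\<in>B. f b)(v := \<zero>) = (\<lambda>b\<in>insert v B. if b = v then \<zero> else f b)" for f
      using insert.hyps by (auto simp: fun_eq_iff)
    have smult': "(\<lambda>b\<in>B. r \<otimes> f b) \<in> N'" if "r \<in> carrier R" "f \<in> N'" for r f
    proof (rule N'I)
      show "(\<lambda>b\<in>B. r \<otimes> f b) \<in> B \<rightarrow>\<^sub>E carrier R" using that(1) N'E(1)[OF that(2)] by auto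
      have "(\<lambda>b\<in>B. r \<otimes> f b)(v := \<zero>) = (\<lambda>b\<in>insert v B. r \<otimes> (f(v := \<zero>)) b)"
        unfolding upd by (rule restrict_ext) (use that(1) in auto)
      then show "(\<lambda>b\<in>B. r \<otimes> f b)(v := \<zero>) \<in> N" using Nsm[OF N'E(2)[OF that(2)] that(1)] by simp
    qed
    have "submodule N' R (fun_module R B)"
    proof (rule V.submoduleI)
      show "N' \<subseteq> carrier (fun_module R B)" using N'E by auto
      have "(\<lambda>b\<in>B. \<zero>)(v := \<zero>) = (\<lambda>b\<in>insert v B. \<zero>)" unfolding upd by (rule restrict_ext) auto
      then have "(\<lambda>b\<in>B. \<zero>)(v := \<zero>) \<in> N" using V'.submodule_0[OF N] by (simp only: fun_module_simps)
      then have "(\<lambda>b\<in>B. \<zero>) \<in> N'" by (intro N'I) auto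
      then show "\<zero>\<^bsub>fun_module R B\<^esub> \<in> N'" by (simp only: fun_module_simps)
      show "r \<odot>\<^bsub>fun_module R B\<^esub> f \<in> N'" if "r \<in> carrier R" "f \<in> N'" for r f
        using smult'[OF that] by (simp only: fun_module_simps)
      show "\<ominus>\<^bsub>fun_module R B\<^esub> f \<in> N'" if f: "f \<in> N'" for f
      proof -
        have fc: "f \<in> carrier (fun_module R B)" using N'E(1)[OF f] by simp
        have "(\<ominus> \<one>) \<odot>\<^bsub>fun_module R B\<^esub> f = \<ominus>\<^bsub>fun_module R B\<^esub> f" using V.smult_l_minus[OF one_closed fc] V.smult_one[OF fc] by simp
        moreover have "(\<ominus> \<one>) \<odot>\<^bsub>fun_module R B\<^esub> f \<in> N'" using smult'[of "\<ominus> \<one>", OF _ f] by (simp only: fun_module_simps a_inv_closed one_closed)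
        ultimately show ?thesis by simp
      qed
      show "f \<oplus>\<^bsub>fun_module R B\<^esub> g \<in> N'" if f: "f \<in> N'" and g: "g \<in> N'" for f g
      proof -
        have "(\<lambda>b\<in>B. f b \<oplus> g b)(v := \<zero>) = (\<lambda>b\<in>insert v B. (f(v := \<zero>)) b \<oplus> (g(v := \<zero>)) b)"
          unfolding upd by (rule restrict_ext) auto
        then have "(\<lambda>b\<in>B. f b \<oplus> g b) \<in> N'"
          using Nadd[OF N'E(2)[OF f] N'E(2)[OF g]] N'E(1)[OF f] N'E(1)[OF g] by (intro N'I) auto
        then show ?thesis by (simp only: fun_module_simps)
      qed
    qed
    from insert.IH[OF this] show ?thesis
    proof
      assume "\<exists>c\<in>B \<rightarrow> carrier R. (\<exists>b\<in>B. c b \<notin> I) \<and> (\<forall>n\<in>N'. (\<Oplus>b\<in>B. c b \<otimes> n b) \<in> I)"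
      then obtain c b0 where c: "c \<in> B \<rightarrow> carrier R" "b0 \<in> B" "c b0 \<notin> I" "\<And>n. n \<in> N' ==> (\<Oplus>b\<in>B. c b \<otimes> n b) \<in> I" by blast
      have cc: "b \<in> B ==> c b \<in> carrier R" for b using c by auto
      define s where "s = (\<Oplus>b\<in>B. c b \<otimes> n0 b)"
      have s: "s \<in> carrier R" unfolding s_def using cc n0c by auto
      let ?c = "\<lambda>b. if b = v then \<ominus> s else t \<otimes> c b"
      have ?thesis if "\<And>n. n \<in> N ==> (\<Oplus>b\<in>insert v B. ?c b \<otimes> n b) \<in> I"
      proof -
        have "t \<otimes> c b0 \<notin> I" using I_prime[OF t(1) cc[OF c(2)]] t c by blast
        then show ?thesis using that c(2) insert.hyps(2) cc s t(1) by (intro disjI1 bexI[of _ ?c]) (auto intro!: bexI[of _ b0])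
      qed
      moreover have "(\<Oplus>b\<in>insert v B. ?c b \<otimes> n b) \<in> I" if n: "n \<in> N" for n
      proof -
        have nc: "n b \<in> carrier R" if "b \<in> insert v B" for b using Nc[OF n] that by auto
        let ?n' = "\<lambda>b\<in>B. t \<otimes> n b \<oplus> (\<ominus> n v) \<otimes> n0 b"
        have "?n'(v := \<zero>) = (\<lambda>b\<in>insert v B. (\<lambda>b\<in>insert v B. t \<otimes> n b) b \<oplus> (\<lambda>b\<in>insert v B. (\<ominus> n v) \<otimes> n0 b) b)"
          unfolding upd by (rule restrict_ext) (use nc t n0c in "auto simp: t_def[symmetric] l_minus r_minus m_comm r_neg")
        moreover have "\<dots> \<in> N" by (intro Nadd Nsm n n0(1) t(1)) (use nc in auto)
        ultimately have "?n' \<in> N'" using nc n0c t(1) by (intro N'I) auto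
        then have i: "(\<Oplus>b\<in>B. c b \<otimes> ?n' b) \<in> I" by (rule c(4))
        have "(\<Oplus>b\<in>B. c b \<otimes> ?n' b) = (\<Oplus>b\<in>B. t \<otimes> c b \<otimes> n b \<oplus> (\<ominus> n v) \<otimes> (c b \<otimes> n0 b))"
          by (rule finsum_cong') (use cc nc n0c t in "auto simp: r_distr m_ac")
        also have "\<dots> = (\<Oplus>b\<in>B. t \<otimes> c b \<otimes> n b) \<oplus> (\<Oplus>b\<in>B. (\<ominus> n v) \<otimes> (c b \<otimes> n0 b))"
          by (rule finsum_addf) (use cc nc n0c t in auto)
        also have "(\<Oplus>b\<in>B. (\<ominus> n v) \<otimes> (c b \<otimes> n0 b)) = (\<ominus> n v) \<otimes> s"
          unfolding s_def by (rule finsum_rdistr[symmetric]) (use insert.hyps cc nc n0c in auto)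
        finally have i': "(\<Oplus>b\<in>B. t \<otimes> c b \<otimes> n b) \<oplus> (\<ominus> n v) \<otimes> s \<in> I" using i by simp
        have "(\<Oplus>b\<in>insert v B. ?c b \<otimes> n b) = ?c v \<otimes> n v \<oplus> (\<Oplus>b\<in>B. ?c b \<otimes> n b)"
          by (rule finsum_insert) (use insert.hyps nc cc s t(1) in auto)
        also have "(\<Oplus>b\<in>B. ?c b \<otimes> n b) = (\<Oplus>b\<in>B. t \<otimes> c b \<otimes> n b)"
          by (rule finsum_cong') (use insert.hyps nc cc t(1) in auto)
        also have "?c v \<otimes> n v = (\<ominus> n v) \<otimes> s" using s nc by (simp add: l_minus r_minus m_comm)
        also have "(\<ominus> n v) \<otimes> s \<oplus> (\<Oplus>b\<in>B. t \<otimes> c b \<otimes> n b) = (\<Oplus>b\<in>B. t \<otimes> c b \<otimes> n b) \<oplus> (\<ominus> n v) \<otimes> s"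
          by (rule a_comm) (use s nc cc t(1) in auto)
        finally show ?thesis using i' by simp
      qed
      ultimately show ?thesis by blast
    next
      assume "\<exists>d\<in>carrier R. d \<notin> I \<and> (\<forall>w\<in>B \<rightarrow>\<^sub>E carrier R. (\<lambda>b\<in>B. d \<otimes> w b) \<in> N')"
      then obtain d where d: "d \<in> carrier R" "d \<notin> I" "\<And>w. w \<in> B \<rightarrow>\<^sub>E carrier R ==> (\<lambda>b\<in>B. d \<otimes> w b) \<in> N'" by blast
      have "(\<lambda>b\<in>insert v B. t \<otimes> d \<otimes> w b) \<in> N" if w: "w \<in> insert v B \<rightarrow>\<^sub>E carrier R" for w
      proof -
        have wc: "w b \<in> carrier R" if "b \<in> insert v B" for b using w that by auto
        let ?u = "\<lambda>b\<in>B. t \<otimes> w b \<oplus> (\<ominus> w v) \<otimes> n0 b"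
        have "?u \<in> B \<rightarrow>\<^sub>E carrier R" using wc n0c t(1) by auto
        then have u: "(\<lambda>b\<in>B. d \<otimes> ?u b)(v := \<zero>) \<in> N" using N'E(2)[OF d(3)] by blast
        have "(\<lambda>b\<in>insert v B. t \<otimes> d \<otimes> w b) =
            (\<lambda>b\<in>insert v B. ((\<lambda>b\<in>B. d \<otimes> ?u b)(v := \<zero>)) b \<oplus> (\<lambda>b\<in>insert v B. d \<otimes> w v \<otimes> n0 b) b)"
        proof (rule restrict_ext)
          fix b assume b: "b \<in> insert v B"
          show "t \<otimes> d \<otimes> w b = ((\<lambda>b\<in>B. d \<otimes> ?u b)(v := \<zero>)) b \<oplus> (\<lambda>b\<in>insert v B. d \<otimes> w v \<otimes> n0 b) b"
          proof (cases "b = v")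
            case True
            then show ?thesis using d(1) t(1) wc[of v] n0c[of v] by (simp add: t_def m_ac)
          next
            case False
            then have bB: "b \<in> B" using b by simp
            have "d \<otimes> (t \<otimes> w b \<oplus> (\<ominus> w v) \<otimes> n0 b) \<oplus> d \<otimes> w v \<otimes> n0 b = t \<otimes> d \<otimes> w b"
              using d(1) t(1) wc[OF b] wc[of v] n0c[OF b] by (simp add: r_distr l_minus r_minus m_ac a_assoc l_neg)
            then show ?thesis using False bB by simp
          qed
        qed
        also have "\<dots> \<in> N" by (intro Nadd u Nsm n0(1)) (use d(1) wc in auto)
        finally show ?thesis .
      qed
      moreover have "t \<otimes> d \<notin> I" using I_prime[OF t(1) d(1)] t(2) d(2) by blast
      ultimately show ?thesis
        by (intro disjI2 bexI[of _ "t \<otimes> d"] conjI ballI) (use t(1) d(1) in "simp_all del: restrict_apply")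
    qed
  qed
qed

section \<open>Duality over the ring of invariants\<close>

text \<open>A nonzero maximal Cohen-Macaulay module over \<open>S\<close>, given by a regular sequence \<open>a, b\<close> in the
  maximal ideal of \<open>S\<close>.\<close>

locale invariant_MCM = regular_action R G \<phi> m x y P0 P1 +
  D: depth2_module "invariant_ring G \<phi> R" "m \<inter> carrier (invariant_ring G \<phi> R)" M a b
  for R :: "('a, 'r) ring_scheme" (structure) and G :: "('g, 'h) monoid_scheme" and \<phi> m x y P0 P1
    and M :: "('a, 'b, 'k) module_scheme" and a b +
  assumes nonzero: "carrier M \<noteq> {\<zero>\<^bsub>M\<^esub>}"

context invariant_MCM
begin

text \<open>The \<open>S\<close>-linear maps from \<open>M\<close> to \<open>R\<close>. They form an \<open>R\<close>-submodule
  \<open>H\<close> of \<open>R^M\<close>.\<close>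

definition Hom where "Hom = {h \<in> carrier M \<rightarrow>\<^sub>E carrier R.
  (\<forall>z\<in>carrier M. \<forall>w\<in>carrier M. h (z \<oplus>\<^bsub>M\<^esub> w) = h z \<oplus> h w) \<and>
  (\<forall>s\<in>carrier S. \<forall>z\<in>carrier M. h (s \<odot>\<^bsub>M\<^esub> z) = s \<otimes> h z)}"

definition H where "H = (fun_module R (carrier M))\<lparr>carrier := Hom\<rparr>"

abbreviation H_add (infixl "\<oplus>\<^sub>H" 65) where "v \<oplus>\<^sub>H w \<equiv> v \<oplus>\<^bsub>H\<^esub> w"
abbreviation H_minus (infixl "\<ominus>\<^sub>H" 65) where "v \<ominus>\<^sub>H w \<equiv> v \<ominus>\<^bsub>H\<^esub> w"
abbreviation H_uminus ("\<ominus>\<^sub>H _" [81] 80) where "\<ominus>\<^sub>H v \<equiv> \<ominus>\<^bsub>H\<^esub> v"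
abbreviation H_smult (infixl "\<odot>\<^sub>H" 70) where "r \<odot>\<^sub>H v \<equiv> r \<odot>\<^bsub>H\<^esub> v"
abbreviation H_zero ("\<zero>\<^sub>H") where "\<zero>\<^sub>H \<equiv> \<zero>\<^bsub>H\<^esub>"

text \<open>The conjugation action on maps, as \<open>M\<close> carries the trivial action of \<open>G\<close>. It is semilinear
  over \<open>R\<close>.\<close>

definition act_form where "act_form g h = (\<lambda>u\<in>carrier M. \<phi> g (h u))"

lemma Hom_closed [simp]: "h \<in> Hom ==> u \<in> carrier M ==> h u \<in> carrier R"
  and Hom_add: "h \<in> Hom ==> u \<in> carrier M ==> v \<in> carrier M ==> h (u \<oplus>\<^bsub>M\<^esub> v) = h u \<oplus> h v"
  and Hom_smult: "h \<in> Hom ==> s \<in> carrier S ==> u \<in> carrier M ==> h (s \<odot>\<^bsub>M\<^esub> u) = s \<otimes> h u"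
  unfolding Hom_def by auto

lemma Hom_ext: "h \<in> Hom ==> h' \<in> Hom ==> (\<And>u. u \<in> carrier M ==> h u = h' u) ==> h = h'"
  unfolding Hom_def by (rule extensionalityI[of _ "carrier M"]) (auto simp: PiE_iff)

lemma HomI:
  assumes "\<And>u. u \<in> carrier M ==> f u \<in> carrier R"
    "\<And>u v. u \<in> carrier M ==> v \<in> carrier M ==> f (u \<oplus>\<^bsub>M\<^esub> v) = f u \<oplus> f v"
    "\<And>s u. s \<in> carrier S ==> u \<in> carrier M ==> f (s \<odot>\<^bsub>M\<^esub> u) = s \<otimes> f u"
  shows "(\<lambda>u\<in>carrier M. f u) \<in> Hom"
  unfolding Hom_def using assms by auto

lemma H_carrier [simp]: "carrier H = Hom" unfolding H_def by simp

lemma H_apply [simp]: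
  "u \<in> carrier M ==> \<zero>\<^sub>H u = \<zero>"
  "u \<in> carrier M ==> (h \<oplus>\<^sub>H h') u = h u \<oplus> h' u"
  "u \<in> carrier M ==> (r \<odot>\<^sub>H h) u = r \<otimes> h u"
  unfolding H_def by simp_all

lemma H_module: "module R H"
proof -
  let ?V = "fun_module R (carrier M)"
  interpret V: module R ?V by (rule fun_module)
  have c: "f \<in> Hom ==> f \<in> carrier ?V" for f unfolding Hom_def by simp
  have smult: "r \<odot>\<^bsub>?V\<^esub> f \<in> Hom" if "r \<in> carrier R" "f \<in> Hom" for r f
    unfolding fun_module_simps
    by (rule HomI) (use that in "simp_all add: Hom_add Hom_smult r_distr m_lcomm S_carr")
  have "submodule Hom R ?V"
  proof (rule V.submoduleI)
    show "Hom \<subseteq> carrier ?V" using c by blast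
    show "\<zero>\<^bsub>?V\<^esub> \<in> Hom" unfolding fun_module_simps by (rule HomI) (simp_all add: S_carr)
    show "\<ominus>\<^bsub>?V\<^esub> f \<in> Hom" if "f \<in> Hom" for f
      using smult[of "\<ominus> \<one>" f] V.smult_l_minus[OF one_closed c[OF that]] V.smult_one[OF c[OF that]] that by simp
    show "f \<oplus>\<^bsub>?V\<^esub> g \<in> Hom" if "f \<in> Hom" "g \<in> Hom" for f g
      unfolding fun_module_simps
      by (rule HomI) (use that in "simp_all add: Hom_add Hom_smult r_distr a_ac S_carr")
  qed (rule smult)
  from submodule.submodule_is_module[OF this fun_module] show ?thesis unfolding H_def .
qed

sublocale H: module R H by (rule H_module)

lemma H_closed [simp]:
  "h \<in> Hom ==> h' \<in> Hom ==> h \<oplus>\<^sub>H h' \<in> Hom" "r \<in> carrier R ==> h \<in> Hom ==> r \<odot>\<^sub>H h \<in> Hom" "\<zero>\<^sub>H \<in> Hom"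
  using H.M.a_closed H.smult_closed H.M.zero_closed by simp_all

lemma H_finsum_apply:
  assumes "finite A" "f \<in> A \<rightarrow> Hom" "u \<in> carrier M"
  shows "(\<Oplus>\<^bsub>H\<^esub>i\<in>A. f i) u = (\<Oplus>i\<in>A. f i u)"
  using assms(1,2)
proof (induction A)
  case (insert a A)
  have "(\<Oplus>\<^bsub>H\<^esub>i\<in>insert a A. f i) = f a \<oplus>\<^sub>H (\<Oplus>\<^bsub>H\<^esub>i\<in>A. f i)" by (rule H.M.finsum_insert) (use insert in auto)
  moreover have "(\<Oplus>i\<in>insert a A. f i u) = f a u \<oplus> (\<Oplus>i\<in>A. f i u)"
    by (rule finsum_insert) (use insert assms(3) in "auto simp: Pi_iff")
  ultimately show ?case using insert assms(3) by simp
qed (use assms(3) in simp)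

lemma act_form_apply [simp]: "u \<in> carrier M ==> act_form g h u = \<phi> g (h u)"
  unfolding act_form_def by simp

lemma act_form_closed [simp]: "g \<in> carrier G ==> h \<in> Hom ==> act_form g h \<in> Hom"
  unfolding act_form_def by (rule HomI) (simp_all add: Hom_add Hom_smult act_add act_mult S_inv S_carr)

lemma act_form_add: "g \<in> carrier G ==> h \<in> Hom ==> h' \<in> Hom ==> act_form g (h \<oplus>\<^sub>H h') = act_form g h \<oplus>\<^sub>H act_form g h'"
  by (rule Hom_ext) (simp_all add: act_add)

lemma act_form_smult: "g \<in> carrier G ==> h \<in> Hom ==> r \<in> carrier R ==> act_form g (r \<odot>\<^sub>H h) = \<phi> g r \<odot>\<^sub>H act_form g h"
  by (rule Hom_ext) (simp_all add: act_mult)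

lemma act_form_inv [simp]: "g \<in> carrier G ==> h \<in> Hom ==> act_form g (act_form (inv\<^bsub>G\<^esub> g) h) = h"
  "g \<in> carrier G ==> h \<in> Hom ==> act_form (inv\<^bsub>G\<^esub> g) (act_form g h) = h"
  by (rule Hom_ext; simp)+

lemma act_form_comp: "g \<in> carrier G ==> g' \<in> carrier G ==> h \<in> Hom ==> act_form (g \<otimes>\<^bsub>G\<^esub> g') h = act_form g (act_form g' h)"
  by (rule Hom_ext) (simp_all add: act_comp)

lemma a_S [simp]: "a \<in> carrier S" "b \<in> carrier S" "a \<in> carrier R" "b \<in> carrier R"
  and ab_m: "a \<in> m" "b \<in> m"
  using D.a_m D.b_m S_carr by auto

lemma a_nonzero: "a \<noteq> \<zero>"
proof
  assume a0: "a = \<zero>"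
  have "v = \<zero>\<^bsub>M\<^esub>" if "v \<in> carrier M" for v using D.a_inj[OF that] D.M.smult_l_null[OF that] a0 by simp
  then show False using nonzero D.M.M.zero_closed by blast
qed

lemma Hom_separates:
  assumes u: "u \<in> carrier M" and all: "\<And>h. h \<in> Hom ==> h u = \<zero>" shows "u = \<zero>\<^bsub>M\<^esub>"
proof (rule ccontr)
  assume "u \<noteq> \<zero>\<^bsub>M\<^esub>"
  then obtain f where f: "linear_on S M (carrier M) f" "f u \<noteq> \<zero>" using D.enough_forms[OF u] by auto
  have "(\<lambda>v\<in>carrier M. f v) \<in> Hom"
    by (rule HomI) (use f(1) S_carr in "auto simp: linear_on_def")
  from all[OF this] show False using f u by simp
qed

lemma Hom_zero: "h \<in> Hom ==> h \<zero>\<^bsub>M\<^esub> = \<zero>"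
  using Hom_smult[of h "\<zero>" "\<zero>\<^bsub>M\<^esub>"] S_zero D.M.smult_l_null[of "\<zero>\<^bsub>M\<^esub>"] by simp

lemma Hom_minus: assumes "h \<in> Hom" "u \<in> carrier M" shows "h (\<ominus>\<^bsub>M\<^esub> u) = \<ominus> h u"
proof -
  have "h (\<ominus>\<^bsub>M\<^esub> u \<oplus>\<^bsub>M\<^esub> u) = \<zero>" using assms Hom_zero by (simp add: D.M.M.l_neg)
  then show ?thesis using assms sum_zero_eq_neg by (simp add: Hom_add)
qed

lemma Hom_eqI:
  assumes u: "u \<in> carrier M" "v \<in> carrier M" and all: "\<And>h. h \<in> Hom ==> h u = h v" shows "u = v"
proof -
  have "u \<ominus>\<^bsub>M\<^esub> v = \<zero>\<^bsub>M\<^esub>"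
  proof (rule Hom_separates)
    fix h assume h: "h \<in> Hom"
    show "h (u \<ominus>\<^bsub>M\<^esub> v) = \<zero>" using h u all[OF h] by (simp add: D.M.M.minus_eq Hom_add Hom_minus r_neg)
  qed (use u in simp)
  moreover have "u = (u \<ominus>\<^bsub>M\<^esub> v) \<oplus>\<^bsub>M\<^esub> v" using u by (simp add: D.M.M.minus_eq D.M.M.a_assoc D.M.M.l_neg)
  ultimately show ?thesis using u by simp
qed

text \<open>Over a domain the pointwise quotient of a form by a scalar is again linear.\<close>

lemma Hom_divide:
  assumes h: "h \<in> Hom" and r: "r \<in> carrier R" and dv: "\<And>u. u \<in> carrier M ==> \<exists>c\<in>carrier R. h u = r \<otimes> c"
  shows "\<exists>h'\<in>Hom. h = r \<odot>\<^sub>H h'"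
proof (cases "r = \<zero>")
  case True
  have "h = r \<odot>\<^sub>H \<zero>\<^sub>H" by (rule Hom_ext) (use True dv h in "fastforce+")
  then show ?thesis using H_closed(3) by blast
next
  case False
  have "\<forall>u\<in>carrier M. \<exists>c. c \<in> carrier R \<and> h u = r \<otimes> c" using dv by blast
  from bchoice[OF this] obtain f where "\<forall>u\<in>carrier M. f u \<in> carrier R \<and> h u = r \<otimes> f u" ..
  then have f: "f u \<in> carrier R" "r \<otimes> f u = h u" if "u \<in> carrier M" for u using that by auto
  have f': "(\<lambda>u\<in>carrier M. f u) \<in> Hom"
  proof (rule HomI)
    fix u assume u: "u \<in> carrier M"
    show "f u \<in> carrier R" using f u by simp
    show "f (s \<odot>\<^bsub>M\<^esub> u) = s \<otimes> f u" if s: "s \<in> carrier S" for s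
    proof -
      have su: "s \<odot>\<^bsub>M\<^esub> u \<in> carrier M" "s \<in> carrier R" using s u S_carr by auto
      have "r \<otimes> f (s \<odot>\<^bsub>M\<^esub> u) = s \<otimes> h u" using f(2)[OF su(1)] s u h by (simp add: Hom_smult)
      also have "\<dots> = r \<otimes> (s \<otimes> f u)" unfolding f(2)[OF u, symmetric] using f(1)[OF u] su r by (simp add: m_lcomm)
      finally show ?thesis using dom.m_lcancel[OF False r f(1)[OF su(1)]] m_closed[OF su(2) f(1)[OF u]] by simp
    qed
    fix v assume v: "v \<in> carrier M"
    have uv: "u \<oplus>\<^bsub>M\<^esub> v \<in> carrier M" using u v by simp
    have "r \<otimes> f (u \<oplus>\<^bsub>M\<^esub> v) = h u \<oplus> h v" using f(2)[OF uv] u v h by (simp add: Hom_add)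
    also have "\<dots> = r \<otimes> (f u \<oplus> f v)"
      unfolding f(2)[OF u, symmetric] f(2)[OF v, symmetric] using f(1)[OF u] f(1)[OF v] r by (simp add: r_distr)
    finally show "f (u \<oplus>\<^bsub>M\<^esub> v) = f u \<oplus> f v"
      using dom.m_lcancel[OF False r f(1)[OF uv]] a_closed[OF f(1)[OF u] f(1)[OF v]] by simp
  qed
  have "h = r \<odot>\<^sub>H (\<lambda>u\<in>carrier M. f u)" by (rule Hom_ext) (use h f' r f in simp_all)
  then show ?thesis using f' by blast
qed

text \<open>A form is determined by its values on finitely many generators of \<open>M\<close>, so that \<open>H\<close> embeds
  into some \<open>R^n\<close>.\<close>

lemma H_noetherian: "noetherian_module R H"
proof -
  obtain A where A: "finite A" "A \<subseteq> carrier M" "lin_span M (carrier S) A = carrier M" by (rule D.generators)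
  show ?thesis
  proof (rule H.noetherian_inj[OF fun_module fun_module_noetherian[OF noeth A(1)], of "\<lambda>h. restrict h A"])
    show "inj_on (\<lambda>h. restrict h A) (carrier H)"
    proof (rule inj_onI)
      fix h h' assume h: "h \<in> carrier H" "h' \<in> carrier H" and eq: "restrict h A = restrict h' A"
      have eqA: "h c = h' c" if "c \<in> A" for c using eq that by (metis restrict_apply')
      show "h = h'"
      proof (rule Hom_ext)
        fix u assume "u \<in> carrier M"
        then have "u \<in> lin_span M (carrier S) A" using A(3) by simp
        then show "h u = h' u"
        proof induction
          case zero
          then show ?case using h Hom_zero[of h] Hom_zero[of h'] by simp
        next
          case (step z c w)
          have "z \<in> carrier M" "w \<in> carrier M" using step A by auto
          then show ?case using step h eqA by (simp add: Hom_add Hom_smult)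
        qed
      qed (use h in simp_all)
    qed
  next
    fix z assume "z \<in> carrier H" then show "restrict z A \<in> carrier (fun_module R A)" using A(2) by auto
  next
    fix z w assume "z \<in> carrier H" "w \<in> carrier H"
    show "restrict (z \<oplus>\<^sub>H w) A = restrict z A \<oplus>\<^bsub>fun_module R A\<^esub> restrict w A"
      unfolding fun_module_simps by (rule restrict_ext) (use A(2) in auto)
  next
    fix r z assume "r \<in> carrier R" "z \<in> carrier H"
    show "restrict (r \<odot>\<^sub>H z) A = r \<odot>\<^bsub>fun_module R A\<^esub> restrict z A"
      unfolding fun_module_simps by (rule restrict_ext) (use A(2) in auto)
  qed
qed

text \<open>Divisibility in \<open>H\<close> is decided by the values in \<open>R\<close>, where \<open>x, y\<close> is a regular
  sequence.\<close>

lemma H_free: "\<exists>B. basis R H B"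
proof -
  obtain A where A: "finite A" "A \<subseteq> carrier H" "lin_span H (carrier R) A = carrier H"
    by (rule H.noetherian_moduleE[OF H_noetherian H.carrier_is_submodule])
  show ?thesis
  proof (rule regular_imp_free[OF H_module A])
    fix h assume h: "h \<in> carrier H" "x \<odot>\<^sub>H h = \<zero>\<^sub>H"
    show "h = \<zero>\<^sub>H"
    proof (rule Hom_ext)
      fix u assume u: "u \<in> carrier M"
      have "x \<otimes> h u = \<zero>" using arg_cong[OF h(2), of "\<lambda>f. f u"] u by simp
      then show "h u = \<zero>\<^sub>H u" using dom.integral_iff x_nonzero h u by simp
    qed (use h in simp_all)
  next
    fix e :: nat and w v assume h: "w \<in> carrier H" "v \<in> carrier H" "y [^] e \<odot>\<^sub>H w = x \<odot>\<^sub>H v"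
    have "\<exists>w'\<in>Hom. w = x \<odot>\<^sub>H w'"
    proof (rule Hom_divide)
      fix u assume u: "u \<in> carrier M"
      have "y [^] e \<otimes> w u = x \<otimes> v u" using arg_cong[OF h(3), of "\<lambda>f. f u"] u by simp
      then show "\<exists>c\<in>carrier R. w u = x \<otimes> c" by (rule x_divides[rotated 2]) (use h u in simp_all)
    qed (use h in simp_all)
    then show "\<exists>w'\<in>carrier H. w = x \<odot>\<^sub>H w'" by simp
  qed
qed

definition B where "B = (SOME B. basis R H B)"

lemma B_basis: "basis R H B" unfolding B_def using H_free by (rule someI_ex)

lemma B_finite: "finite B" and B_Hom: "B \<subseteq> Hom" and B_span: "lin_span H (carrier R) B = Hom"
  using B_basis unfolding basis_def by simp_all

definition coordinates where "coordinates \<kappa> \<longleftrightarrow> (\<forall>e\<in>B. linear_on R H Hom (\<kappa> e)) \<and>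
  (\<forall>h\<in>Hom. h = (\<Oplus>\<^bsub>H\<^esub>e\<in>B. \<kappa> e h \<odot>\<^sub>H e)) \<and>
  (\<forall>c e. c \<in> B \<rightarrow> carrier R \<longrightarrow> e \<in> B \<longrightarrow> \<kappa> e (\<Oplus>\<^bsub>H\<^esub>e\<in>B. c e \<odot>\<^sub>H e) = c e)"

definition coord where "coord = (SOME \<kappa>. coordinates \<kappa>)"

lemma coord: "coordinates coord"
  unfolding coord_def
proof (rule someI_ex[of coordinates])
  obtain \<kappa> where \<kappa>: "\<And>e. e \<in> B ==> linear_on R H (carrier H) (\<kappa> e)"
    "\<And>h. h \<in> carrier H ==> h = (\<Oplus>\<^bsub>H\<^esub>e\<in>B. \<kappa> e h \<odot>\<^sub>H e)"
    "\<And>c e. c \<in> B \<rightarrow> carrier R ==> e \<in> B ==> \<kappa> e (\<Oplus>\<^bsub>H\<^esub>e\<in>B. c e \<odot>\<^sub>H e) = c e"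
  proof (rule H.basis_coordinates[OF B_basis])
  qed (rule that)
  show "\<exists>\<kappa>. coordinates \<kappa>"
    unfolding coordinates_def
  proof (intro exI[of _ \<kappa>] conjI ballI allI impI)
    show "linear_on R H Hom (\<kappa> e)" if "e \<in> B" for e using \<kappa>(1)[OF that] by simp
    show "h = (\<Oplus>\<^bsub>H\<^esub>e\<in>B. \<kappa> e h \<odot>\<^sub>H e)" if "h \<in> Hom" for h by (rule \<kappa>(2)) (use that in simp)
  qed (rule \<kappa>(3))
qed

lemma coord_linear: "e \<in> B ==> linear_on R H Hom (coord e)"
  and coord_sum: "h \<in> Hom ==> h = (\<Oplus>\<^bsub>H\<^esub>e\<in>B. coord e h \<odot>\<^sub>H e)"
  and coord_of_sum: "c \<in> B \<rightarrow> carrier R ==> e \<in> B ==> coord e (\<Oplus>\<^bsub>H\<^esub>e\<in>B. c e \<odot>\<^sub>H e) = c e"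
  using coord unfolding coordinates_def by simp_all

lemma coord_closed [simp]: "e \<in> B ==> h \<in> Hom ==> coord e h \<in> carrier R"
  and coord_add: "e \<in> B ==> h \<in> Hom ==> h' \<in> Hom ==> coord e (h \<oplus>\<^sub>H h') = coord e h \<oplus> coord e h'"
  and coord_smult: "e \<in> B ==> h \<in> Hom ==> r \<in> carrier R ==> coord e (r \<odot>\<^sub>H h) = r \<otimes> coord e h"
  using coord_linear unfolding linear_on_def by auto

lemma B_Hom' [simp]: "c \<in> B ==> c \<in> Hom" using B_Hom by blast

lemma linear_coord:
  assumes l: "linear_on R H Hom l" and h: "h \<in> Hom"
  shows "l h = (\<Oplus>c\<in>B. coord c h \<otimes> l c)"
proof -
  have lc: "l h \<in> carrier R" "l (h \<oplus>\<^sub>H h') = l h \<oplus> l h'" "l (r \<odot>\<^sub>H h) = r \<otimes> l h"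
    if "h \<in> Hom" "h' \<in> Hom" "r \<in> carrier R" for h h' r using l that unfolding linear_on_def by auto
  have l0: "l \<zero>\<^sub>H = \<zero>" using lc(3)[of "\<zero>\<^sub>H" "\<zero>\<^sub>H" \<zero>] lc(1)[of "\<zero>\<^sub>H" "\<zero>\<^sub>H" \<zero>] H.smult_l_null[of "\<zero>\<^sub>H"] by simp
  have "l (\<Oplus>\<^bsub>H\<^esub>c\<in>A. coord c h \<odot>\<^sub>H c) = (\<Oplus>c\<in>A. coord c h \<otimes> l c)" if "A \<subseteq> B" for A
    using finite_subset[OF that B_finite] that
  proof (induction A)
    case empty
    then show ?case using l0 by simp
  next
    case (insert c A)
    have "(\<Oplus>\<^bsub>H\<^esub>c\<in>insert c A. coord c h \<odot>\<^sub>H c) = coord c h \<odot>\<^sub>H c \<oplus>\<^sub>H (\<Oplus>\<^bsub>H\<^esub>c\<in>A. coord c h \<odot>\<^sub>H c)"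
      by (rule H.M.finsum_insert) (use insert h in auto)
    moreover have "(\<Oplus>c\<in>insert c A. coord c h \<otimes> l c) = coord c h \<otimes> l c \<oplus> (\<Oplus>c\<in>A. coord c h \<otimes> l c)"
      by (rule finsum_insert) (use insert h lc(1)[OF B_Hom' B_Hom' zero_closed] in auto)
    moreover have "(\<Oplus>\<^bsub>H\<^esub>c\<in>A. coord c h \<odot>\<^sub>H c) \<in> carrier H" by (rule H.M.finsum_closed) (use insert h in auto)
    ultimately show ?case using insert h lc[of c c] lc(2)[of "coord c h \<odot>\<^sub>H c" "\<Oplus>\<^bsub>H\<^esub>c\<in>A. coord c h \<odot>\<^sub>H c" \<zero>]
      lc(3)[of c c "coord c h"] by simp
  qed
  from this[of B] show ?thesis using coord_sum[OF h] by simp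
qed

lemma ev_linear: "u \<in> carrier M ==> linear_on R H Hom (\<lambda>h. h u)"
  unfolding linear_on_def by simp

section \<open>Reflexivity\<close>

text \<open>The image of \<open>u\<close> under \<open>M \<rightarrow> Hom(H, R)\<close>, where the dual of \<open>H\<close> is
  identified with \<open>R^B\<close> by the basis.\<close>

definition \<epsilon> where "\<epsilon> u = (\<lambda>c\<in>B. c u)"

definition N where "N = lin_span (fun_module R B) (carrier R) (\<epsilon> ` carrier M)"

lemma \<epsilon>_carrier: "\<epsilon> ` carrier M \<subseteq> carrier (fun_module R B)" unfolding \<epsilon>_def by auto

lemma N_submodule: "submodule N R (fun_module R B)"
  unfolding N_def by (rule module.lin_span_sub[OF fun_module \<epsilon>_carrier])

text \<open>The \<open>R\<close>-submodule \<open>N\<close> of \<open>R\<^sup>B\<close> generated by the image of \<open>M\<close>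
  has finite colength. Otherwise the ideal of all \<open>d\<close> with \<open>d R\<^sup>B \<subseteq> N\<close> lies
  in a prime \<open>\<pi> R \<noteq> m\<close>, elimination produces a form \<open>\<Sum>c\<^sub>b b\<close> on
  \<open>M\<close> with values in \<open>\<pi> R\<close>, and dividing it by \<open>\<pi>\<close> contradicts the
  independence of the basis.\<close>

lemma power_into_N:
  assumes e: "e \<in> m"
  shows "\<exists>k::nat. \<forall>w\<in>B \<rightarrow>\<^sub>E carrier R. (\<lambda>c\<in>B. e [^] k \<otimes> w c) \<in> N"
proof -
  let ?V = "fun_module R B"
  interpret V: module R ?V by (rule fun_module)
  define J where "J = {d \<in> carrier R. \<forall>w\<in>carrier ?V. d \<odot>\<^bsub>?V\<^esub> w \<in> N}"
  note Nadd = V.submoduleE(5)[OF N_submodule] and Nsm = V.submoduleE(4)[OF N_submodule] and Nmin = V.submoduleE(3)[OF N_submodule]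
  have J: "ideal J R"
    unfolding submodule_ideal[symmetric]
  proof (rule module.submoduleI[OF self_module])
    show "J \<subseteq> carrier (self_module R)" unfolding J_def by auto
    show "\<zero>\<^bsub>self_module R\<^esub> \<in> J" unfolding J_def using V.smult_l_null V.submodule_0[OF N_submodule] by (simp del: fun_module_simps)
    show "\<ominus>\<^bsub>self_module R\<^esub> d \<in> J" if "d \<in> J" for d
      using that Nmin unfolding J_def by (simp add: self_minus V.smult_l_minus del: fun_module_simps)
    show "d \<oplus>\<^bsub>self_module R\<^esub> d' \<in> J" if "d \<in> J" "d' \<in> J" for d d'
      using that Nadd unfolding J_def by (simp add: V.smult_l_distr del: fun_module_simps)
    show "r \<odot>\<^bsub>self_module R\<^esub> d \<in> J" if "r \<in> carrier (R)" "d \<in> J" for d r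
      using that Nsm unfolding J_def by (simp add: V.smult_assoc1 del: fun_module_simps)
  qed
  have ec: "e \<in> carrier R" using e m_carr by blast
  obtain k where k: "e [^] (k::nat) \<in> J"
  proof (rule power_in_ideal[OF noeth J ec])
    fix Q assume Q: "primeideal Q R" "J \<subseteq> Q"
    interpret Q: primeideal Q R by (rule Q(1))
    show "e \<in> Q"
    proof (cases "Q = m")
      case True
      then show ?thesis using e by simp
    next
      case False
      then obtain \<pi> where \<pi>: "\<pi> \<in> Q" "Q = PIdl \<pi>" using nonmaximal_prime_principal[OF Q(1)] by blast
      have \<pi>c: "\<pi> \<in> carrier R" using \<pi>(1) Q.Icarr by blast
      from Q.elimination[OF B_finite N_submodule] show ?thesis
      proof
        assume "\<exists>d\<in>carrier R. d \<notin> Q \<and> (\<forall>w\<in>B \<rightarrow>\<^sub>E carrier R. (\<lambda>b\<in>B. d \<otimes> w b) \<in> N)"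
        then obtain d where "d \<in> carrier R" "d \<notin> Q" "\<forall>w\<in>carrier ?V. d \<odot>\<^bsub>?V\<^esub> w \<in> N"
          by (auto simp del: restrict_apply)
        then have "d \<in> J" unfolding J_def by blast
        then show ?thesis using Q(2) \<open>d \<notin> Q\<close> by blast
      next
        assume "\<exists>c\<in>B \<rightarrow> carrier R. (\<exists>b\<in>B. c b \<notin> Q) \<and> (\<forall>n\<in>N. (\<Oplus>b\<in>B. c b \<otimes> n b) \<in> Q)"
        then obtain c c0 where c: "c \<in> B \<rightarrow> carrier R" "c0 \<in> B" "c c0 \<notin> Q" "\<And>n. n \<in> N ==> (\<Oplus>b\<in>B. c b \<otimes> n b) \<in> Q" by blast
        let ?h = "\<Oplus>\<^bsub>H\<^esub>b\<in>B. c b \<odot>\<^sub>H b"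
        have cc: "c b \<in> carrier R" if "b \<in> B" for b using c(1) that by auto
        have h: "?h \<in> Hom" using H.M.finsum_closed[of "\<lambda>b. c b \<odot>\<^sub>H b" B] cc by (auto simp: Pi_iff)
        have "\<exists>r\<in>carrier R. ?h u = \<pi> \<otimes> r" if u: "u \<in> carrier M" for u
        proof -
          have "?h u = (\<Oplus>b\<in>B. (c b \<odot>\<^sub>H b) u)" by (rule H_finsum_apply[OF B_finite _ u]) (use cc in auto)
          also have "\<dots> = (\<Oplus>b\<in>B. c b \<otimes> \<epsilon> u b)" by (rule finsum_cong') (use cc u in "auto simp: \<epsilon>_def")
          also have "\<dots> \<in> Q"
            by (rule c(4)) (use V.lin_span_incl[OF \<epsilon>_carrier] u N_def in blast)
          finally show ?thesis unfolding \<pi>(2) mem_PIdl using \<pi>c m_comm by auto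
        qed
        then obtain h' where h': "h' \<in> Hom" "?h = \<pi> \<odot>\<^sub>H h'" using Hom_divide[OF h \<pi>c] by blast
        have "c c0 = coord c0 ?h" using coord_of_sum[OF c(1,2)] by simp
        also have "\<dots> = \<pi> \<otimes> coord c0 h'" unfolding h'(2) by (rule coord_smult[OF c(2) h'(1) \<pi>c])
        also have "\<dots> \<in> Q" using Q.I_r_closed[OF \<pi>(1)] c(2) h'(1) by simp
        finally show ?thesis using c(3) by blast
      qed
    qed
  qed
  then have "\<forall>w\<in>carrier ?V. e [^] k \<odot>\<^bsub>?V\<^esub> w \<in> N" unfolding J_def by blast
  then show ?thesis by (intro exI[of _ k]) (simp del: restrict_apply)
qed

definition equivariant where "equivariant l \<longleftrightarrow> (\<forall>g\<in>carrier G. \<forall>h\<in>Hom. l (act_form g h) = \<phi> g (l h))"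

text \<open>The form on \<open>H\<close> with values \<open>w\<close> on the basis.\<close>

definition pairing where "pairing w h = (\<Oplus>c\<in>B. coord c h \<otimes> w c)"

text \<open>On the generators of \<open>N\<close>: the average of \<open>r\<close> times the evaluation at \<open>u\<close> is the
  evaluation at the average of \<open>r\<close> times \<open>u\<close>.\<close>

lemma averaged_pairing:
  assumes w: "w \<in> N"
  shows "w \<in> B \<rightarrow>\<^sub>E carrier R \<and> (\<exists>v\<in>carrier M. \<forall>h\<in>Hom. avg (\<lambda>g. \<phi> g (pairing w (act_form (inv\<^bsub>G\<^esub> g) h))) = h v)"
  using w unfolding N_def
proof induction
  case zero
  have p: "pairing \<zero>\<^bsub>fun_module R B\<^esub> h = \<zero>" if "h \<in> Hom" for h
  proof -
    have "pairing \<zero>\<^bsub>fun_module R B\<^esub> h = (\<Oplus>c\<in>B. \<zero>)" unfolding pairing_def by (rule finsum_cong') (use that in auto)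
    then show ?thesis by simp
  qed
  have "avg (\<lambda>g. \<phi> g (pairing \<zero>\<^bsub>fun_module R B\<^esub> (act_form (inv\<^bsub>G\<^esub> g) h))) = h \<zero>\<^bsub>M\<^esub>" if h: "h \<in> Hom" for h
  proof -
    have "avg (\<lambda>g. \<phi> g (pairing \<zero>\<^bsub>fun_module R B\<^esub> (act_form (inv\<^bsub>G\<^esub> g) h))) = avg (\<lambda>g. \<zero>)"
      by (rule avg_cong) (use p h in "auto simp del: fun_module_simps")
    then show ?thesis using avg_const[of \<zero>] Hom_zero[OF h] by simp
  qed
  moreover have "\<zero>\<^bsub>fun_module R B\<^esub> \<in> B \<rightarrow>\<^sub>E carrier R" by simp
  ultimately show ?case using D.M.M.zero_closed by (simp only: fun_module_simps) blast
next
  case (step w r n)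
  then obtain v where v: "v \<in> carrier M" "\<And>h. h \<in> Hom ==> avg (\<lambda>g. \<phi> g (pairing w (act_form (inv\<^bsub>G\<^esub> g) h))) = h v"
    and wc: "w \<in> B \<rightarrow>\<^sub>E carrier R" by blast
  obtain u where u: "u \<in> carrier M" "n = \<epsilon> u" using step by blast
  let ?w = "w \<oplus>\<^bsub>fun_module R B\<^esub> r \<odot>\<^bsub>fun_module R B\<^esub> n"
  have wB: "w c \<in> carrier R" if "c \<in> B" for c using wc that by auto
  have pw: "pairing w h \<in> carrier R" if "h \<in> Hom" for h unfolding pairing_def using that wB by auto
  have p: "pairing ?w h = pairing w h \<oplus> r \<otimes> h u" if h: "h \<in> Hom" for h
  proof -
    have "pairing ?w h = (\<Oplus>c\<in>B. coord c h \<otimes> w c \<oplus> r \<otimes> (coord c h \<otimes> c u))"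
      unfolding pairing_def by (rule finsum_cong') (use h step wB u in "auto simp: \<epsilon>_def r_distr m_lcomm")
    also have "\<dots> = pairing w h \<oplus> (\<Oplus>c\<in>B. r \<otimes> (coord c h \<otimes> c u))"
      unfolding pairing_def by (rule finsum_addf) (use h step wB u in auto)
    also have "(\<Oplus>c\<in>B. r \<otimes> (coord c h \<otimes> c u)) = r \<otimes> (\<Oplus>c\<in>B. coord c h \<otimes> c u)"
      by (rule finsum_rdistr[symmetric]) (use B_finite h step u in auto)
    also have "(\<Oplus>c\<in>B. coord c h \<otimes> c u) = h u" using linear_coord[OF ev_linear[OF u(1)] h] by simp
    finally show ?thesis .
  qed
  have rc: "r \<in> carrier R" using step by simp
  have "avg (\<lambda>g. \<phi> g (pairing ?w (act_form (inv\<^bsub>G\<^esub> g) h))) = h (v \<oplus>\<^bsub>M\<^esub> reynolds r \<odot>\<^bsub>M\<^esub> u)" if h: "h \<in> Hom" for h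
  proof -
    have "avg (\<lambda>g. \<phi> g (pairing ?w (act_form (inv\<^bsub>G\<^esub> g) h))) =
        avg (\<lambda>g. \<phi> g (pairing w (act_form (inv\<^bsub>G\<^esub> g) h)) \<oplus> h u \<otimes> \<phi> g r)"
      by (rule avg_cong)
         (use p h pw rc u(1) in "auto simp: act_add act_mult m_comm simp del: fun_module_simps")
    also have "\<dots> = avg (\<lambda>g. \<phi> g (pairing w (act_form (inv\<^bsub>G\<^esub> g) h))) \<oplus> avg (\<lambda>g. h u \<otimes> \<phi> g r)"
      by (rule avg_add) (use pw h rc u(1) in auto)
    also have "avg (\<lambda>g. h u \<otimes> \<phi> g r) = h u \<otimes> reynolds r"
      unfolding reynolds_def by (rule avg_smult) (use rc h u(1) in auto)
    also have "avg (\<lambda>g. \<phi> g (pairing w (act_form (inv\<^bsub>G\<^esub> g) h))) = h v" by (rule v(2)[OF h])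
    also have "h v \<oplus> h u \<otimes> reynolds r = h (v \<oplus>\<^bsub>M\<^esub> reynolds r \<odot>\<^bsub>M\<^esub> u)"
      using h v(1) u(1) rc reynolds_S[OF rc] by (simp add: Hom_add Hom_smult m_comm)
    finally show ?thesis .
  qed
  moreover have "v \<oplus>\<^bsub>M\<^esub> reynolds r \<odot>\<^bsub>M\<^esub> u \<in> carrier M" using v(1) u(1) reynolds_S[OF rc] by simp
  moreover have "?w \<in> B \<rightarrow>\<^sub>E carrier R" using wB rc u by (auto simp: \<epsilon>_def)
  ultimately show ?case by blast
qed

text \<open>Let \<open>l\<close> be an equivariant form on \<open>H\<close>. By the previous lemmas, \<open>a\<^sup>k l\<close>
  and \<open>b\<^sup>k l\<close> are evaluations at elements of \<open>M\<close>, and as \<open>a, b\<close> is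
  regular on \<open>M\<close>, so is \<open>l\<close>. Hence \<open>M\<close> is the module of these forms.\<close>

theorem reflexive:
  assumes l: "linear_on R H Hom l" and eq: "equivariant l"
  shows "\<exists>u\<in>carrier M. \<forall>h\<in>Hom. l h = h u"
proof -
  have lc: "l h \<in> carrier R" if "h \<in> Hom" for h using l that unfolding linear_on_def by auto
  have ex: "\<exists>(k::nat). \<exists>v\<in>carrier M. \<forall>h\<in>Hom. e [^] k \<otimes> l h = h v" if e: "e \<in> m" "e \<in> carrier S" for e
  proof -
    have ec: "e \<in> carrier R" using e m_carr by blast
    obtain k :: nat where k: "\<forall>w\<in>B \<rightarrow>\<^sub>E carrier R. (\<lambda>c\<in>B. e [^] k \<otimes> w c) \<in> N" using power_into_N[OF e(1)] by blast
    let ?w = "\<lambda>c\<in>B. e [^] k \<otimes> (\<lambda>c\<in>B. l c) c"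
    have "?w \<in> N" by (rule bspec[OF k]) (use lc in auto)
    then obtain v where v: "v \<in> carrier M" "\<And>h. h \<in> Hom ==> avg (\<lambda>g. \<phi> g (pairing ?w (act_form (inv\<^bsub>G\<^esub> g) h))) = h v"
      using averaged_pairing by blast
    have p: "pairing ?w h = e [^] k \<otimes> l h" if h: "h \<in> Hom" for h
    proof -
      have "pairing ?w h = (\<Oplus>c\<in>B. e [^] k \<otimes> (coord c h \<otimes> l c))"
        unfolding pairing_def by (rule finsum_cong') (use h lc ec in "auto simp: m_lcomm")
      also have "\<dots> = e [^] k \<otimes> (\<Oplus>c\<in>B. coord c h \<otimes> l c)"
        by (rule finsum_rdistr[symmetric]) (use B_finite h lc ec in auto)
      finally show ?thesis using linear_coord[OF l h] by simp
    qed
    have "e [^] k \<otimes> l h = h v" if h: "h \<in> Hom" for h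
    proof -
      have "avg (\<lambda>g. \<phi> g (pairing ?w (act_form (inv\<^bsub>G\<^esub> g) h))) = avg (\<lambda>g. e [^] k \<otimes> l h)"
      proof (rule avg_cong)
        fix g assume g: "g \<in> carrier G"
        have h': "act_form (inv\<^bsub>G\<^esub> g) h \<in> Hom" using g h by simp
        have "\<phi> g (pairing ?w (act_form (inv\<^bsub>G\<^esub> g) h)) = e [^] k \<otimes> \<phi> g (l (act_form (inv\<^bsub>G\<^esub> g) h))"
          unfolding p[OF h'] using g ec lc[OF h'] S_inv[OF e(2) g] by (simp add: act_mult act_pow)
        also have "\<phi> g (l (act_form (inv\<^bsub>G\<^esub> g) h)) = l (act_form g (act_form (inv\<^bsub>G\<^esub> g) h))"
          using eq g h' unfolding equivariant_def by simp
        finally show "\<phi> g (pairing ?w (act_form (inv\<^bsub>G\<^esub> g) h)) = e [^] k \<otimes> l h"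
          unfolding act_form_inv(1)[OF g h] .
      qed (use ec lc h in auto)
      then show ?thesis using v(2)[OF h] avg_const ec lc[OF h] by simp
    qed
    then show ?thesis using v(1) by blast
  qed
  obtain k :: nat and v where v: "v \<in> carrier M" "\<And>h. h \<in> Hom ==> a [^] k \<otimes> l h = h v" using ex[OF ab_m(1)] by auto
  obtain j :: nat and v' where v': "v' \<in> carrier M" "\<And>h. h \<in> Hom ==> b [^] j \<otimes> l h = h v'" using ex[OF ab_m(2)] by auto
  have pS: "a [^] k \<in> carrier S" "b [^] j \<in> carrier S" using S.nat_pow_closed[OF a_S(1)] S.nat_pow_closed[OF a_S(2)] by simp_all
  have "b [^] j \<odot>\<^bsub>M\<^esub> v = a [^] k \<odot>\<^bsub>M\<^esub> v'"
  proof (rule Hom_eqI)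
    fix h assume h: "h \<in> Hom"
    have "h (b [^] j \<odot>\<^bsub>M\<^esub> v) = b [^] j \<otimes> (a [^] k \<otimes> l h)" using h v pS by (simp add: Hom_smult)
    also have "\<dots> = a [^] k \<otimes> (b [^] j \<otimes> l h)" using lc[OF h] by (simp add: m_lcomm)
    also have "\<dots> = h (a [^] k \<odot>\<^bsub>M\<^esub> v')" using h v' pS by (simp add: Hom_smult)
    finally show "h (b [^] j \<odot>\<^bsub>M\<^esub> v) = h (a [^] k \<odot>\<^bsub>M\<^esub> v')" .
  qed (use v v' pS in auto)
  then obtain u where u: "u \<in> carrier M" "v = a [^] k \<odot>\<^bsub>M\<^esub> u" using D.pow_regular[OF v(1) v'(1), of j k] by auto
  have "l h = h u" if h: "h \<in> Hom" for h
  proof -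
    have "a [^] k \<otimes> l h = a [^] k \<otimes> h u" using v(2)[OF h] u h pS by (simp add: Hom_smult)
    then show ?thesis using dom.m_lcancel[OF dom.pow_nonzero[OF _ a_nonzero]] lc[OF h] h u by simp
  qed
  then show ?thesis using u(1) by blast
qed

end

lemma (in abelian_group) minus_eq_zero_iff: "u \<in> carrier G ==> v \<in> carrier G ==> u \<ominus> v = \<zero> \<longleftrightarrow> u = v"
  by (metis a_minus_def add.inv_comm l_neg local.minus_minus minus_equality a_inv_closed r_neg)

section \<open>Linear maps\<close>

definition lin_map :: "('a, 'm) ring_scheme \<Rightarrow> ('a, 'b, 'n) module_scheme \<Rightarrow> ('a, 'c, 'k) module_scheme \<Rightarrow> ('b \<Rightarrow> 'c) \<Rightarrow> bool"
  where "lin_map S M N f \<longleftrightarrow> (\<forall>u\<in>carrier M. f u \<in> carrier N) \<and>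
    (\<forall>u\<in>carrier M. \<forall>v\<in>carrier M. f (u \<oplus>\<^bsub>M\<^esub> v) = f u \<oplus>\<^bsub>N\<^esub> f v) \<and>
    (\<forall>s\<in>carrier S. \<forall>u\<in>carrier M. f (s \<odot>\<^bsub>M\<^esub> u) = s \<odot>\<^bsub>N\<^esub> f u)"

lemma lin_mapD:
  assumes "lin_map S M N f"
  shows "u \<in> carrier M ==> f u \<in> carrier N" "u \<in> carrier M ==> v \<in> carrier M ==> f (u \<oplus>\<^bsub>M\<^esub> v) = f u \<oplus>\<^bsub>N\<^esub> f v"
    "s \<in> carrier S ==> u \<in> carrier M ==> f (s \<odot>\<^bsub>M\<^esub> u) = s \<odot>\<^bsub>N\<^esub> f u"
  using assms unfolding lin_map_def by auto

lemma lin_map_comp: "lin_map S M N f ==> lin_map S N L g ==> lin_map S M L (\<lambda>u. g (f u))"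
  unfolding lin_map_def by simp

context module
begin

lemma submodule_add_incl:
  assumes N: "submodule N R M" and L: "submodule L R M"
  shows "N \<subseteq> N <+>\<^bsub>M\<^esub> L" "L \<subseteq> N <+>\<^bsub>M\<^esub> L"
proof -
  have c: "N \<subseteq> carrier M" "L \<subseteq> carrier M" using N L submoduleE(1) by auto
  show "N \<subseteq> N <+>\<^bsub>M\<^esub> L"
  proof
    fix v assume v: "v \<in> N"
    show "v \<in> N <+>\<^bsub>M\<^esub> L" using set_addI[OF v submodule_0[OF L], of M] v c by auto
  qed
  show "L \<subseteq> N <+>\<^bsub>M\<^esub> L"
  proof
    fix v assume v: "v \<in> L"
    show "v \<in> N <+>\<^bsub>M\<^esub> L" using set_addI[OF submodule_0[OF N] v, of M] v c by auto
  qed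
qed

lemma minus_smult: "v \<in> carrier M ==> \<ominus>\<^sub>M v = (\<ominus> \<one>) \<odot>\<^sub>M v"
  by (simp add: smult_l_minus)

lemma lin_map_zero: assumes N: "module R N" and f: "lin_map R M N f" shows "f \<zero>\<^sub>M = \<zero>\<^bsub>N\<^esub>"
  using lin_mapD(3)[OF f R.zero_closed M.zero_closed] module.smult_l_null[OF N] lin_mapD(1)[OF f M.zero_closed] by simp

lemma lin_map_minus:
  assumes N: "module R N" and f: "lin_map R M N f" and u: "u \<in> carrier M" shows "f (\<ominus>\<^sub>M u) = \<ominus>\<^bsub>N\<^esub> f u"
  using lin_mapD(3)[OF f _ u, of "\<ominus> \<one>"] minus_smult[OF u] module.minus_smult[OF N lin_mapD(1)[OF f u]] by simp

lemma lin_map_image: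
  assumes N: "module R N" and f: "lin_map R M N f" shows "submodule (f ` carrier M) R N"
proof (rule module.submoduleI[OF N])
  note fD = lin_mapD[OF f]
  show "f ` carrier M \<subseteq> carrier N" using fD(1) by blast
  show "\<zero>\<^bsub>N\<^esub> \<in> f ` carrier M" using lin_map_zero[OF N f] by (intro image_eqI[of _ _ "\<zero>\<^sub>M"]) auto
  fix z assume "z \<in> f ` carrier M"
  then obtain u where u: "u \<in> carrier M" "z = f u" by blast
  show "\<ominus>\<^bsub>N\<^esub> z \<in> f ` carrier M" using u lin_map_minus[OF N f u(1)] by (intro image_eqI[of _ _ "\<ominus>\<^sub>M u"]) auto
  show "r \<odot>\<^bsub>N\<^esub> z \<in> f ` carrier M" if "r \<in> carrier R" for r
    using u that fD(3) by (intro image_eqI[of _ _ "r \<odot>\<^sub>M u"]) auto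
  fix w assume "w \<in> f ` carrier M"
  then obtain v where v: "v \<in> carrier M" "w = f v" by blast
  show "z \<oplus>\<^bsub>N\<^esub> w \<in> f ` carrier M" using u v fD(2) by (intro image_eqI[of _ _ "u \<oplus>\<^sub>M v"]) auto
qed

lemma lin_map_kernel:
  assumes N: "module R N" and f: "lin_map R M N f" shows "submodule {v \<in> carrier M. f v = \<zero>\<^bsub>N\<^esub>} R M"
proof -
  interpret N: module R N by (rule N)
  show ?thesis
    by (rule submoduleI) (use lin_mapD[OF f] lin_map_zero[OF N f] lin_map_minus[OF N f] in auto)
qed

end

text \<open>The kernels of the powers of \<open>f\<close> are stationary. If \<open>f v = 0\<close>, then \<open>v = f^n w\<close>
  and \<open>w\<close> lies in the kernel of \<open>f^(n + 1)\<close>, which is that of \<open>f^n\<close>.\<close>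

lemma (in module) surj_imp_inj:
  assumes noeth: "noetherian_module R M" and f: "lin_map R M M f" and surj: "carrier M \<subseteq> f ` carrier M"
  shows "inj_on f (carrier M)"
proof -
  have fn: "lin_map R M M (f ^^ n)" for n
    by (induction n) (use lin_mapD[OF f] in "simp_all add: lin_map_def")
  define K where "K n = {v \<in> carrier M. (f ^^ n) v = \<zero>\<^sub>M}" for n
  have K: "submodule (K n) R M" for n unfolding K_def by (rule lin_map_kernel[OF module_axioms fn])
  have mono: "K n \<subseteq> K (Suc n)" for n unfolding K_def using lin_map_zero[OF module_axioms f] by auto
  obtain n where n: "\<And>l. l \<ge> n ==> K l = K n"
  proof (rule noetherian_chain[OF noeth, of K])
    show "submodule (K n) R M" "K n \<subseteq> K (Suc n)" for n by (rule K, rule mono)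
  qed (rule that)
  have surj_n: "\<exists>w\<in>carrier M. v = (f ^^ j) w" if "v \<in> carrier M" for v j
    using that
  proof (induction j arbitrary: v)
    case (Suc j)
    obtain v' where v': "v' \<in> carrier M" "v = f v'" using surj Suc by blast
    then obtain w where "w \<in> carrier M" "v' = (f ^^ j) w" using Suc by blast
    then show ?case using v' by auto
  qed auto
  have ker: "v = \<zero>\<^sub>M" if v: "v \<in> carrier M" "f v = \<zero>\<^sub>M" for v
  proof -
    obtain w where w: "w \<in> carrier M" "v = (f ^^ n) w" using surj_n v by blast
    have "w \<in> K (Suc n)" unfolding K_def using v w by simp
    then have "w \<in> K n" using n[of "Suc n"] by simp
    then show ?thesis using w unfolding K_def by simp
  qed
  show ?thesis
  proof (rule inj_onI)
    fix v w assume vw: "v \<in> carrier M" "w \<in> carrier M" "f v = f w"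
    have "f (v \<ominus>\<^sub>M w) = \<zero>\<^sub>M"
      using lin_mapD[OF f] lin_map_minus[OF module_axioms f vw(2)] vw by (simp add: M.minus_eq M.r_neg)
    then show "v = w" using ker[of "v \<ominus>\<^sub>M w"] vw M.minus_eq_zero_iff by simp
  qed
qed

section \<open>Powers of the maximal ideal and completeness\<close>

locale complete_MCM = invariant_MCM R G \<phi> m x y P0 P1 M a b
  for R :: "('a, 'r) ring_scheme" (structure) and G :: "('g, 'h) monoid_scheme" and \<phi> m x y P0 P1
    and M :: "('a, 'b, 'k) module_scheme" and a b +
  assumes complete: "adic_complete R m" and indec: "indecomposable_module (invariant_ring G \<phi> R) M"
begin

definition mp where "mp k = m [^]\<^bsub>ideals_set R\<^esub> (k::nat)"

lemma ideals_monoid: "Group.monoid (ideals_set R)"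
  using ideals_set_is_comm_monoid comm_monoid.axioms(1) by blast

lemma m_ideals: "m \<in> carrier (ideals_set R)" using m_ideal unfolding ideals_set_def by simp

lemma mp_ideal: "ideal (mp k) R"
  using monoid.nat_pow_closed[OF ideals_monoid m_ideals, of k] unfolding mp_def ideals_set_def by simp

lemma mp_carr: "r \<in> mp k ==> r \<in> carrier R" using ideal.Icarr[OF mp_ideal] .

lemma mp_0: "mp 0 = carrier R" unfolding mp_def by (simp add: ideals_set_def)

lemma mp_Suc: "mp (Suc k) = mp k \<cdot> m" unfolding mp_def by (simp add: ideals_set_def)

lemma mp_1: "mp 1 = m"
  using monoid.nat_pow_eone[OF ideals_monoid m_ideals] unfolding mp_def .

lemma mp_mult:
  assumes "r \<in> mp j" "s \<in> mp k" shows "r \<otimes> s \<in> mp (j + k)"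
proof -
  have "mp (j + k) = mp j \<cdot> mp k"
    using monoid.nat_pow_mult[OF ideals_monoid m_ideals, of j k] unfolding mp_def by (simp add: ideals_set_def)
  then show ?thesis using ideal_prod.prod[OF assms, of R] by simp
qed

lemma mp_add: "r \<in> mp k ==> s \<in> mp k ==> r \<oplus> s \<in> mp k"
  using additive_subgroup.a_closed[OF ideal.axioms(1)[OF mp_ideal]] .

lemma mp_zero: "\<zero> \<in> mp k" using additive_subgroup.zero_closed[OF ideal.axioms(1)[OF mp_ideal]] .

lemma mp_minus: "r \<in> mp k ==> \<ominus> r \<in> mp k"
  using additive_subgroup.a_inv_closed[OF ideal.axioms(1)[OF mp_ideal]] .

lemma mp_mono: "j \<le> k ==> mp k \<subseteq> mp j"
proof (induction k rule: dec_induct)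
  case (step k)
  have "mp (Suc k) \<subseteq> mp k" unfolding mp_Suc using ideal_prod_inter[OF mp_ideal m_ideal] by blast
  then show ?case using step by blast
qed simp

lemma mp_act: "g \<in> carrier G ==> r \<in> mp k ==> \<phi> g r \<in> mp k"
proof (induction k arbitrary: r)
  case 0
  then show ?case by (simp add: mp_0)
next
  case (Suc k)
  show ?case using Suc.prems(2) unfolding mp_Suc
  proof induction
    case (prod i j)
    then show ?case using Suc act_m mp_carr m_carr by (auto simp: act_mult intro: ideal_prod.prod)
  next
    case (sum s t)
    have "s \<in> carrier R" "t \<in> carrier R" using sum mp_carr[of _ "Suc k"] unfolding mp_Suc by auto
    then show ?case using sum Suc.prems(1) by (simp add: act_add ideal_prod.sum)
  qed
qed

lemma mp_separated: "(\<And>k. r \<in> mp k) ==> r = \<zero>"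
  using complete unfolding adic_complete_def mp_def by blast

text \<open>The powers of \<open>m\<close> turn a sequence with small increments into a Cauchy sequence, and its limit inherits
  the bounds since the powers decrease.\<close>

lemma mp_complete:
  assumes c: "\<And>k. c k \<in> carrier R" and step: "\<And>k. c (Suc k) \<ominus> c k \<in> mp k"
  shows "\<exists>l\<in>carrier R. \<forall>k. l \<ominus> c k \<in> mp k"
proof -
  have diff: "c i \<ominus> c k \<in> mp k" if "k \<le> i" for i k
    using that
  proof (induction i rule: dec_induct)
    case base
    then show ?case using c mp_zero by (simp add: minus_eq r_neg)
  next
    case (step i)
    have "c (Suc i) \<ominus> c k = (c (Suc i) \<ominus> c i) \<oplus> (c i \<ominus> c k)"
      using c by (simp add: minus_eq a_assoc r_neg1 r_neg2)
    moreover have "c (Suc i) \<ominus> c i \<in> mp k" using assms(2)[of i] mp_mono[OF step.hyps(1)] by blast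
    ultimately show ?case using step mp_add by simp
  qed
  have swap: "s \<ominus> r \<in> mp k" if "r \<ominus> s \<in> mp k" "r \<in> carrier R" "s \<in> carrier R" for r s k
    using mp_minus[OF that(1)] that(2,3) by (simp add: minus_eq minus_add a_comm)
  have "adic_Cauchy R m c"
    unfolding adic_Cauchy_def mp_def[symmetric]
  proof (intro allI exI[of _ "n" for n] impI)
    fix n i j :: nat assume "n \<le> i" "n \<le> j"
    then have "c i \<ominus> c n \<in> mp n" "c n \<ominus> c j \<in> mp n" using diff swap c by auto
    moreover have "c i \<ominus> c j = (c i \<ominus> c n) \<oplus> (c n \<ominus> c j)" using c by (simp add: minus_eq a_assoc r_neg1 r_neg2)
    ultimately show "c i \<ominus> c j \<in> mp n" using mp_add by simp
  qed
  then obtain l where l: "l \<in> carrier R" "adic_tendsto R m c l" using complete c unfolding adic_complete_def by blast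
  have "l \<ominus> c k \<in> mp k" for k
  proof -
    obtain i0 where i0: "\<And>i. i \<ge> i0 ==> c i \<ominus> l \<in> mp k" using l(2) unfolding adic_tendsto_def mp_def by blast
    let ?i = "max i0 k"
    have "l \<ominus> c ?i \<in> mp k" "c ?i \<ominus> c k \<in> mp k" using i0[of ?i] swap diff[of k ?i] c l(1) by auto
    moreover have "l \<ominus> c k = (l \<ominus> c ?i) \<oplus> (c ?i \<ominus> c k)" using c l(1) by (simp add: minus_eq a_assoc r_neg1 r_neg2)
    ultimately show ?thesis using mp_add by simp
  qed
  then show ?thesis using l(1) by blast
qed

text \<open>The filtration of \<open>H\<close> by the submodules \<open>m\<^sup>k H\<close>, described in coordinates.\<close>

definition F where "F k = {h \<in> Hom. \<forall>e\<in>B. coord e h \<in> mp k}"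

lemma F_Hom: "h \<in> F k ==> h \<in> Hom" unfolding F_def by simp

lemma F_0: "F 0 = Hom" unfolding F_def mp_0 by auto

lemma F_add: "h \<in> F k ==> h' \<in> F k ==> h \<oplus>\<^sub>H h' \<in> F k"
  unfolding F_def by (simp add: coord_add mp_add)

lemma F_smult: "r \<in> mp j ==> h \<in> F k ==> r \<odot>\<^sub>H h \<in> F (j + k)"
  unfolding F_def using mp_carr mp_mult by (simp add: coord_smult)

lemma F_smult0: "r \<in> carrier R ==> h \<in> F k ==> r \<odot>\<^sub>H h \<in> F k"
  using F_smult[of r 0 h k] mp_0 by simp

lemma H_minus: "h \<in> Hom ==> \<ominus>\<^sub>H h = (\<ominus> \<one>) \<odot>\<^sub>H h"
  using H.smult_l_minus[OF one_closed, of h] H.smult_one[of h] by simp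

lemma H_minus_closed [simp]: "h \<in> Hom ==> \<ominus>\<^sub>H h \<in> Hom"
  using H.M.a_inv_closed[of h] by simp

lemma H_diff_closed [simp]: "h \<in> Hom ==> h' \<in> Hom ==> h \<ominus>\<^sub>H h' \<in> Hom"
  using H.M.minus_closed[of h h'] by simp

lemma F_minus: "h \<in> F k ==> \<ominus>\<^sub>H h \<in> F k"
  using F_smult0[of "\<ominus> \<one>" h k] F_Hom H_minus by simp

lemma F_diff: "h \<in> F k ==> h' \<in> F k ==> h \<ominus>\<^sub>H h' \<in> F k"
  unfolding a_minus_def by (intro F_add F_minus)

lemma F_zero: "\<zero>\<^sub>H \<in> F k"
  using F_smult0[of \<zero> "\<zero>\<^sub>H"] F_smult[OF mp_zero, of "\<zero>\<^sub>H" 0 k] F_0 H.smult_l_null[of "\<zero>\<^sub>H"] by simp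

lemma F_mono: "j \<le> k ==> F k \<subseteq> F j" unfolding F_def using mp_mono by blast

text \<open>In this form it is visible that the filtration is stable under \<open>G\<close>, as the powers of \<open>m\<close>
  are.\<close>

lemma F_span: "F k = lin_span H (mp k) B"
proof
  show "F k \<subseteq> lin_span H (mp k) B"
  proof
    fix h assume h: "h \<in> F k"
    have "(\<Oplus>\<^bsub>H\<^esub>e\<in>B. coord e h \<odot>\<^sub>H e) \<in> lin_span H (mp k) B"
      by (rule H.finsum_lin_span[OF B_finite order_refl _ mp_ideal]) (use h in "auto simp: F_def")
    then show "h \<in> lin_span H (mp k) B" using coord_sum[OF F_Hom[OF h]] by simp
  qed
  show "lin_span H (mp k) B \<subseteq> F k"
  proof
    fix h assume "h \<in> lin_span H (mp k) B"
    then show "h \<in> F k"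
    proof induction
      case (step z c e)
      then show ?case using F_smult[of c k e 0] F_0 F_add by simp
    qed (rule F_zero)
  qed
qed

lemma F_act: assumes g: "g \<in> carrier G" and h: "h \<in> F k" shows "act_form g h \<in> F k"
  using h unfolding F_span[of k]
proof (induction rule: lin_span.induct)
  case zero
  have "act_form g \<zero>\<^sub>H = \<zero>\<^sub>H" by (rule Hom_ext) (use g in simp_all)
  then show ?case using F_zero F_span by simp
next
  case (step z c e)
  then have z: "z \<in> Hom" "c \<in> carrier R" "e \<in> Hom" using F_span F_Hom mp_carr by auto
  have "act_form g (z \<oplus>\<^sub>H c \<odot>\<^sub>H e) = act_form g z \<oplus>\<^sub>H \<phi> g c \<odot>\<^sub>H act_form g e"
    using z g by (simp add: act_form_add act_form_smult)
  moreover have "\<phi> g c \<odot>\<^sub>H act_form g e \<in> F k"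
    using F_smult[OF mp_act[OF g step.hyps(2)], of "act_form g e" 0] F_0 z g by simp
  ultimately show ?case using step.IH F_add F_span by simp
qed

lemma F_separated: assumes "\<And>k. h \<in> F k" shows "h = \<zero>\<^sub>H"
proof -
  have h: "h \<in> Hom" using assms F_Hom by blast
  have c0: "coord e h = \<zero>" if "e \<in> B" for e using mp_separated[of "coord e h"] assms that unfolding F_def by blast
  have "h = (\<Oplus>\<^bsub>H\<^esub>e\<in>B. coord e h \<odot>\<^sub>H e)" by (rule coord_sum[OF h])
  also have "\<dots> = (\<Oplus>\<^bsub>H\<^esub>e\<in>B. \<zero>\<^sub>H)"
    by (rule H.M.finsum_cong') (use c0 H.smult_l_null in auto)
  finally show ?thesis by simp
qed

lemma coord_diff: "e \<in> B ==> h \<in> Hom ==> h' \<in> Hom ==> coord e (h \<ominus>\<^sub>H h') = coord e h \<ominus> coord e h'"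
  by (simp add: a_minus_def H_minus coord_add coord_smult l_minus)

text \<open>Completeness of \<open>R\<close> in each coordinate.\<close>

lemma F_complete:
  assumes h: "\<And>k. h k \<in> Hom" and step: "\<And>k. h (Suc k) \<ominus>\<^sub>H h k \<in> F k"
  shows "\<exists>l\<in>Hom. \<forall>k. l \<ominus>\<^sub>H h k \<in> F k"
proof -
  have "\<exists>l\<in>carrier R. \<forall>k. l \<ominus> coord e (h k) \<in> mp k" if e: "e \<in> B" for e
  proof (rule mp_complete)
    show "coord e (h (Suc k)) \<ominus> coord e (h k) \<in> mp k" for k
      using step[of k] e h unfolding F_def by (simp add: coord_diff)
  qed (use e h in simp)
  then have "\<forall>e\<in>B. \<exists>l. l \<in> carrier R \<and> (\<forall>k. l \<ominus> coord e (h k) \<in> mp k)" by blast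
  from bchoice[OF this] obtain l where "\<forall>e\<in>B. l e \<in> carrier R \<and> (\<forall>k. l e \<ominus> coord e (h k) \<in> mp k)" ..
  then have l: "\<And>e. e \<in> B ==> l e \<in> carrier R" "\<And>e k. e \<in> B ==> l e \<ominus> coord e (h k) \<in> mp k" by auto
  let ?l = "\<Oplus>\<^bsub>H\<^esub>e\<in>B. l e \<odot>\<^sub>H e"
  have lH: "?l \<in> Hom" using H.M.finsum_closed[of "\<lambda>e. l e \<odot>\<^sub>H e" B] l(1) by (auto simp: Pi_iff)
  have "?l \<ominus>\<^sub>H h k \<in> F k" for k
    unfolding F_def using lH h l coord_of_sum[of l] by (auto simp: coord_diff)
  then show ?thesis using lH by blast
qed

section \<open>Endomorphisms\<close>

text \<open>The \<open>R\<close>-linear equivariant endomorphisms, that is, those of \<open>H\<close> as a module over the twisted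
  group ring.\<close>

definition endo where "endo \<theta> \<longleftrightarrow> (\<forall>h\<in>Hom. \<theta> h \<in> Hom) \<and>
  (\<forall>h\<in>Hom. \<forall>h'\<in>Hom. \<theta> (h \<oplus>\<^sub>H h') = \<theta> h \<oplus>\<^sub>H \<theta> h') \<and>
  (\<forall>r\<in>carrier R. \<forall>h\<in>Hom. \<theta> (r \<odot>\<^sub>H h) = r \<odot>\<^sub>H \<theta> h) \<and>
  (\<forall>g\<in>carrier G. \<forall>h\<in>Hom. \<theta> (act_form g h) = act_form g (\<theta> h))"

lemma endoD:
  assumes "endo \<theta>"
  shows "h \<in> Hom ==> \<theta> h \<in> Hom" "h \<in> Hom ==> h' \<in> Hom ==> \<theta> (h \<oplus>\<^sub>H h') = \<theta> h \<oplus>\<^sub>H \<theta> h'"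
    "r \<in> carrier R ==> h \<in> Hom ==> \<theta> (r \<odot>\<^sub>H h) = r \<odot>\<^sub>H \<theta> h"
    "g \<in> carrier G ==> h \<in> Hom ==> \<theta> (act_form g h) = act_form g (\<theta> h)"
  using assms unfolding endo_def by auto

lemma endo_lin_map: "endo \<theta> ==> lin_map R H H \<theta>"
  unfolding endo_def lin_map_def by simp

lemma endo_zero: "endo \<theta> ==> \<theta> \<zero>\<^sub>H = \<zero>\<^sub>H"
  by (rule H.lin_map_zero[OF H_module endo_lin_map])

lemma endo_diff: "endo \<theta> ==> h \<in> Hom ==> h' \<in> Hom ==> \<theta> (h \<ominus>\<^sub>H h') = \<theta> h \<ominus>\<^sub>H \<theta> h'"
  by (simp add: a_minus_def H_minus endoD)

lemma act_form_diff: "g \<in> carrier G ==> h \<in> Hom ==> h' \<in> Hom ==> act_form g (h \<ominus>\<^sub>H h') = act_form g h \<ominus>\<^sub>H act_form g h'"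
  by (simp add: a_minus_def H_minus act_form_add act_form_smult act_minus)

lemma endo_add: "endo \<theta> ==> endo \<eta> ==> endo (\<lambda>h. \<theta> h \<oplus>\<^sub>H \<eta> h)"
  unfolding endo_def by (simp add: act_form_add H.smult_r_distr H.M.a_ac)

lemma endo_comp: "endo \<theta> ==> endo \<eta> ==> endo (\<lambda>h. \<theta> (\<eta> h))"
  unfolding endo_def by simp

lemma endo_id: "endo (\<lambda>h. h)" unfolding endo_def by simp

lemma endo_minus: assumes t: "endo \<theta>" and e: "endo \<eta>" shows "endo (\<lambda>h. \<theta> h \<ominus>\<^sub>H \<eta> h)"
proof -
  have "endo (\<lambda>h. (\<ominus> \<one>) \<odot>\<^sub>H \<eta> h)"
    using e unfolding endo_def
    by (simp add: H.smult_r_distr H.smult_assoc1[symmetric] m_comm act_form_smult act_minus)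
  from endo_add[OF t this] have "endo (\<lambda>h. \<theta> h \<oplus>\<^sub>H (\<ominus> \<one>) \<odot>\<^sub>H \<eta> h)" .
  moreover have "\<theta> h \<oplus>\<^sub>H (\<ominus> \<one>) \<odot>\<^sub>H \<eta> h = \<theta> h \<ominus>\<^sub>H \<eta> h" if "h \<in> Hom" for h
    using endoD(1)[OF e that] by (simp add: a_minus_def H_minus)
  ultimately show ?thesis unfolding endo_def by simp
qed

text \<open>\<open>H\<close> is spanned by \<open>B\<close> and \<open>F k\<close> by \<open>m^k B\<close>.\<close>

lemma endo_F:
  assumes \<theta>: "endo \<theta>" and im: "\<And>h. h \<in> Hom ==> \<theta> h \<in> F j" and h: "h \<in> F k"
  shows "\<theta> h \<in> F (k + j)"
  using h unfolding F_span[of k]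
proof (induction rule: lin_span.induct)
  case zero
  show ?case using endo_zero[OF \<theta>] F_zero by simp
next
  case (step z c e)
  then have z: "z \<in> Hom" "c \<in> carrier R" "e \<in> Hom" using F_span F_Hom mp_carr by auto
  have "\<theta> (z \<oplus>\<^sub>H c \<odot>\<^sub>H e) = \<theta> z \<oplus>\<^sub>H c \<odot>\<^sub>H \<theta> e" using z \<theta> by (simp add: endoD)
  then show ?case using step F_add F_smult[OF step.hyps(2) im[OF z(3)]] by simp
qed

lemma endo_F0: "endo \<theta> ==> h \<in> F k ==> \<theta> h \<in> F k"
  using endo_F[of \<theta> 0 h k] endoD(1) F_0 by simp

text \<open>By reflexivity, endomorphisms of \<open>H\<close> and of \<open>M\<close> correspond to each other.\<close>

lemma endo_dual:
  assumes \<theta>: "endo \<theta>"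
  obtains f where "lin_map S M M f" "\<And>h u. h \<in> Hom ==> u \<in> carrier M ==> h (f u) = \<theta> h u"
proof -
  have "\<exists>v. v \<in> carrier M \<and> (\<forall>h\<in>Hom. \<theta> h u = h v)" if u: "u \<in> carrier M" for u
  proof -
    have "linear_on R H Hom (\<lambda>h. \<theta> h u)" unfolding linear_on_def using u endoD[OF \<theta>] by simp
    moreover have "equivariant (\<lambda>h. \<theta> h u)" unfolding equivariant_def using u endoD[OF \<theta>] by simp
    ultimately show ?thesis using reflexive by blast
  qed
  then have "\<forall>u\<in>carrier M. \<exists>v. v \<in> carrier M \<and> (\<forall>h\<in>Hom. \<theta> h u = h v)" by blast
  from bchoice[OF this] obtain f where "\<forall>u\<in>carrier M. f u \<in> carrier M \<and> (\<forall>h\<in>Hom. \<theta> h u = h (f u))" ..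
  then have f: "\<And>u. u \<in> carrier M ==> f u \<in> carrier M" "\<And>h u. h \<in> Hom ==> u \<in> carrier M ==> h (f u) = \<theta> h u" by auto
  have "lin_map S M M f"
    unfolding lin_map_def
  proof (intro conjI ballI)
    fix u assume u: "u \<in> carrier M"
    show "f u \<in> carrier M" by (rule f(1)[OF u])
    show "f (s \<odot>\<^bsub>M\<^esub> u) = s \<odot>\<^bsub>M\<^esub> f u" if s: "s \<in> carrier S" for s
    proof (rule Hom_eqI)
      fix h assume h: "h \<in> Hom"
      have "h (f (s \<odot>\<^bsub>M\<^esub> u)) = s \<otimes> \<theta> h u"
        unfolding f(2)[OF h D.M.smult_closed[OF s u]] by (rule Hom_smult[OF endoD(1)[OF \<theta> h] s u])
      also have "\<dots> = h (s \<odot>\<^bsub>M\<^esub> f u)" unfolding Hom_smult[OF h s f(1)[OF u]] f(2)[OF h u] ..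
      finally show "h (f (s \<odot>\<^bsub>M\<^esub> u)) = h (s \<odot>\<^bsub>M\<^esub> f u)" .
    qed (use u s f(1) in simp_all)
    show "f (u \<oplus>\<^bsub>M\<^esub> v) = f u \<oplus>\<^bsub>M\<^esub> f v" if v: "v \<in> carrier M" for v
    proof (rule Hom_eqI)
      fix h assume h: "h \<in> Hom"
      have "h (f (u \<oplus>\<^bsub>M\<^esub> v)) = \<theta> h u \<oplus> \<theta> h v"
        unfolding f(2)[OF h D.M.M.a_closed[OF u v]] by (rule Hom_add[OF endoD(1)[OF \<theta> h] u v])
      also have "\<dots> = h (f u \<oplus>\<^bsub>M\<^esub> f v)" unfolding Hom_add[OF h f(1)[OF u] f(1)[OF v]] f(2)[OF h u] f(2)[OF h v] ..
      finally show "h (f (u \<oplus>\<^bsub>M\<^esub> v)) = h (f u \<oplus>\<^bsub>M\<^esub> f v)" .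
    qed (use u v f(1) in simp_all)
  qed
  then show thesis using that f(2) by blast
qed

definition dual where "dual f h = (\<lambda>u\<in>carrier M. h (f u))"

lemma dual_apply [simp]: "u \<in> carrier M ==> dual f h u = h (f u)" unfolding dual_def by simp

lemma dual_Hom: "lin_map S M M f ==> h \<in> Hom ==> dual f h \<in> Hom"
  unfolding dual_def by (rule HomI) (simp_all add: lin_mapD Hom_add Hom_smult)

lemma dual_endo: assumes f: "lin_map S M M f" shows "endo (dual f)"
  unfolding endo_def
proof (intro conjI ballI)
  fix h assume h: "h \<in> Hom"
  note d = dual_Hom[OF f]
  show "dual f h \<in> Hom" by (rule d[OF h])
  show "dual f (h \<oplus>\<^sub>H h') = dual f h \<oplus>\<^sub>H dual f h'" if "h' \<in> Hom" for h'
    by (rule Hom_ext) (use h that d lin_mapD(1)[OF f] in simp_all)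
  show "dual f (r \<odot>\<^sub>H h) = r \<odot>\<^sub>H dual f h" if "r \<in> carrier R" for r
    by (rule Hom_ext) (use h that d lin_mapD(1)[OF f] in simp_all)
  show "dual f (act_form g h) = act_form g (dual f h)" if "g \<in> carrier G" for g
    by (rule Hom_ext) (use h that d lin_mapD(1)[OF f] in simp_all)
qed

text \<open>It comes from an idempotent \<open>f\<close> of \<open>M\<close>, and \<open>M\<close> is the direct sum of image and
  kernel of \<open>f\<close>.\<close>

lemma idempotent_trivial:
  assumes \<theta>: "endo \<theta>" and idem: "\<And>h. h \<in> Hom ==> \<theta> (\<theta> h) = \<theta> h"
  shows "(\<forall>h\<in>Hom. \<theta> h = \<zero>\<^sub>H) \<or> (\<forall>h\<in>Hom. \<theta> h = h)"
proof -
  obtain f where f: "lin_map S M M f" "\<And>h u. h \<in> Hom ==> u \<in> carrier M ==> h (f u) = \<theta> h u" by (rule endo_dual[OF \<theta>]) blast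
  note fD = lin_mapD[OF f(1)] and \<theta>D = endoD[OF \<theta>]
  have ff: "f (f u) = f u" if u: "u \<in> carrier M" for u
  proof (rule Hom_eqI)
    fix h assume h: "h \<in> Hom"
    show "h (f (f u)) = h (f u)"
      unfolding f(2)[OF h fD(1)[OF u]] f(2)[OF \<theta>D(1)[OF h] u] idem[OF h] f(2)[OF h u] ..
  qed (use u fD(1) in simp_all)
  note f0 = D.M.lin_map_zero[OF D.M.module_axioms f(1)] and f_minus = D.M.lin_map_minus[OF D.M.module_axioms f(1)]
  let ?N1 = "f ` carrier M" and ?N2 = "{u \<in> carrier M. f u = \<zero>\<^bsub>M\<^esub>}"
  have N1: "submodule ?N1 S M" by (rule D.M.lin_map_image[OF D.M.module_axioms f(1)])
  have N2: "submodule ?N2 S M" by (rule D.M.lin_map_kernel[OF D.M.module_axioms f(1)])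
  have I: "?N1 \<inter> ?N2 = {\<zero>\<^bsub>M\<^esub>}"
  proof (intro equalityI subsetI)
    fix u assume "u \<in> ?N1 \<inter> ?N2"
    then obtain u' where "u' \<in> carrier M" "u = f u'" "f u = \<zero>\<^bsub>M\<^esub>" by blast
    then show "u \<in> {\<zero>\<^bsub>M\<^esub>}" using ff by simp
  qed (use D.M.submodule_0[OF N1] D.M.submodule_0[OF N2] in blast)
  have U: "?N1 <+>\<^bsub>M\<^esub> ?N2 = carrier M"
  proof (intro equalityI subsetI)
    fix u assume u: "u \<in> carrier M"
    have "u \<ominus>\<^bsub>M\<^esub> f u \<in> ?N2" using u fD f_minus ff by (simp add: D.M.M.minus_eq D.M.M.r_neg)
    moreover have "f u \<oplus>\<^bsub>M\<^esub> (u \<ominus>\<^bsub>M\<^esub> f u) = u" using u fD(1) by (simp add: D.M.M.minus_eq D.M.M.a_lcomm D.M.M.r_neg)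
    ultimately show "u \<in> ?N1 <+>\<^bsub>M\<^esub> ?N2" using set_addI[of "f u" ?N1 "u \<ominus>\<^bsub>M\<^esub> f u" ?N2 M] u by simp
  next
    fix u assume "u \<in> ?N1 <+>\<^bsub>M\<^esub> ?N2"
    then show "u \<in> carrier M" using fD(1) by (auto simp: set_add_iff)
  qed
  have "?N1 = {\<zero>\<^bsub>M\<^esub>} \<or> ?N2 = {\<zero>\<^bsub>M\<^esub>}"
    using indec N1 N2 I U unfolding indecomposable_module_def by blast
  then show ?thesis
  proof
    assume N1: "?N1 = {\<zero>\<^bsub>M\<^esub>}"
    have "\<theta> h = \<zero>\<^sub>H" if h: "h \<in> Hom" for h
    proof (rule Hom_ext)
      fix u assume u: "u \<in> carrier M"
      then have "f u = \<zero>\<^bsub>M\<^esub>" using N1 by blast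
      then show "\<theta> h u = \<zero>\<^sub>H u" using f(2)[OF h u] Hom_zero[OF h] u by simp
    qed (use h \<theta>D in simp_all)
    then show ?thesis by blast
  next
    assume N2: "?N2 = {\<zero>\<^bsub>M\<^esub>}"
    have "\<theta> h = h" if h: "h \<in> Hom" for h
    proof (rule Hom_ext)
      fix u assume u: "u \<in> carrier M"
      have "u \<ominus>\<^bsub>M\<^esub> f u \<in> ?N2" using u fD f_minus ff by (simp add: D.M.M.minus_eq D.M.M.r_neg)
      then have "u \<ominus>\<^bsub>M\<^esub> f u = \<zero>\<^bsub>M\<^esub>" using N2 by blast
      then have "f u = u" using D.M.M.minus_eq_zero_iff[OF u fD(1)[OF u]] by simp
      then show "\<theta> h u = h u" using f(2)[OF h u] by simp
    qed (use h \<theta>D in simp_all)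
    then show ?thesis by blast
  qed
qed

end

text \<open>With \<open>t = \<theta> h\<close> and \<open>s = \<theta>\<^sup>2 h\<close> this is the identity
  \<open>1 - (2 \<theta> - 1)\<^sup>2 = 4 (\<theta> - \<theta>\<^sup>2)\<close>, which measures how the defect changes
  in a Newton step.\<close>

lemma (in abelian_group) four_times_difference:
  assumes "h \<in> carrier G" "s \<in> carrier G" "t \<in> carrier G"
  shows "h \<oplus> (t \<oplus> t \<ominus> h) \<ominus> (s \<oplus> s \<ominus> t) \<ominus> (s \<oplus> s \<ominus> t) = (t \<ominus> s) \<oplus> (t \<ominus> s) \<oplus> ((t \<ominus> s) \<oplus> (t \<ominus> s))"
proof -
  have "h \<oplus> (t \<oplus> t \<ominus> h) = t \<oplus> t" using assms a_lcomm[of h "t \<oplus> t" "\<ominus> h"] by (simp add: minus_eq r_neg)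
  then show ?thesis using assms by (simp add: minus_eq minus_add a_ac)
qed

lemma (in abelian_group) diff_trans:
  assumes "u \<in> carrier G" "v \<in> carrier G" "w \<in> carrier G"
  shows "u \<ominus> w = (u \<ominus> v) \<oplus> (v \<ominus> w)"
  using assms by (simp add: minus_eq a_assoc r_neg1 r_neg2)

lemma (in abelian_group) diff_add:
  assumes "u \<in> carrier G" "v \<in> carrier G" "u' \<in> carrier G" "v' \<in> carrier G"
  shows "(u \<oplus> u') \<ominus> (v \<oplus> v') = (u \<ominus> v) \<oplus> (u' \<ominus> v')"
  using assms by (simp add: minus_eq minus_add a_ac)

lemma (in abelian_group) diff_swap: "u \<in> carrier G ==> v \<in> carrier G ==> v \<ominus> u = \<ominus> (u \<ominus> v)"
  by (simp add: minus_eq minus_add a_comm)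

lemma (in abelian_group) diff_cancel: "u \<in> carrier G ==> v \<in> carrier G ==> (u \<oplus> v) \<ominus> u = v"
  using a_lcomm[of u v "\<ominus> u"] by (simp add: minus_eq a_assoc r_neg)

context complete_MCM
begin

section \<open>Lifting idempotents\<close>

text \<open>Congruence modulo \<open>m^k H\<close>.\<close>

definition eqF where "eqF k z w \<longleftrightarrow> z \<in> Hom \<and> w \<in> Hom \<and> z \<ominus>\<^sub>H w \<in> F k"

lemma eqF_sym: "eqF k z w ==> eqF k w z"
  unfolding eqF_def using F_minus[of "z \<ominus>\<^sub>H w" k] H.M.diff_swap[of z w] by simp

lemma eqF_trans [trans]: "eqF k z w ==> eqF k w v ==> eqF k z v"
  unfolding eqF_def using F_add[of "z \<ominus>\<^sub>H w" k "w \<ominus>\<^sub>H v"] H.M.diff_trans[of z w v] by simp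

lemma eqF_add: "eqF k z w ==> eqF k z' w' ==> eqF k (z \<oplus>\<^sub>H z') (w \<oplus>\<^sub>H w')"
  unfolding eqF_def using F_add[of "z \<ominus>\<^sub>H w" k "z' \<ominus>\<^sub>H w'"] H.M.diff_add[of z w z' w'] by simp

lemma eqF_endo: "endo \<theta> ==> eqF k z w ==> eqF k (\<theta> z) (\<theta> w)"
  unfolding eqF_def using endo_F0[of \<theta> "z \<ominus>\<^sub>H w" k] endo_diff[of \<theta> z w] by (simp add: endoD(1))

lemma H_smult_diff: "r \<in> carrier R ==> z \<in> Hom ==> w \<in> Hom ==> r \<odot>\<^sub>H (z \<ominus>\<^sub>H w) = r \<odot>\<^sub>H z \<ominus>\<^sub>H r \<odot>\<^sub>H w"
  using H.smult_r_minus[of r w] by (simp add: H.M.minus_eq H.smult_r_distr)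

lemma eqF_smult: "eqF k z w ==> r \<in> carrier R ==> eqF k (r \<odot>\<^sub>H z) (r \<odot>\<^sub>H w)"
  unfolding eqF_def using F_smult0[of r "z \<ominus>\<^sub>H w" k] H_smult_diff[of r z w] by simp

lemma eqF_act: "eqF k z w ==> g \<in> carrier G ==> eqF k (act_form g z) (act_form g w)"
  unfolding eqF_def using F_act[of g "z \<ominus>\<^sub>H w" k] act_form_diff[of g z w] by simp

lemma eqF_all: assumes "\<And>k. eqF k z w" shows "z = w"
proof -
  have zw: "z \<in> carrier H" "w \<in> carrier H" "z \<ominus>\<^sub>H w \<in> F k" for k using assms[of k] unfolding eqF_def by simp_all
  show ?thesis using F_separated[of "z \<ominus>\<^sub>H w", OF zw(3)] H.M.minus_eq_zero_iff[OF zw(1,2)] by blast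
qed

text \<open>Write \<open>\<delta> = \<theta> - \<theta>\<^sup>2\<close>. The Newton step for the equation
  \<open>\<theta>\<^sup>2 = \<theta>\<close> is \<open>\<theta> + \<delta> (2 \<theta> - 1)\<close>, that is,
  \<open>3 \<theta>\<^sup>2 - 2 \<theta>\<^sup>3\<close>.\<close>

definition defect where "defect \<theta> h = \<theta> h \<ominus>\<^sub>H \<theta> (\<theta> h)"

definition correction where "correction \<theta> h = defect \<theta> (\<theta> h \<oplus>\<^sub>H \<theta> h \<ominus>\<^sub>H h)"

definition newton where "newton \<theta> h = \<theta> h \<oplus>\<^sub>H correction \<theta> h"

lemma endo_defect: "endo \<theta> ==> endo (defect \<theta>)"
  unfolding defect_def by (rule endo_minus[OF _ endo_comp[of \<theta> \<theta>]])

lemma endo_correction: "endo \<theta> ==> endo (correction \<theta>)"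
  unfolding correction_def
  by (rule endo_comp[OF endo_defect, of \<theta> "\<lambda>h. \<theta> h \<oplus>\<^sub>H \<theta> h \<ominus>\<^sub>H h", OF _ endo_minus[OF endo_add endo_id]])

lemma endo_newton: "endo \<theta> ==> endo (newton \<theta>)"
  unfolding newton_def by (rule endo_add[OF _ endo_correction])

lemma defect_comm: "endo \<theta> ==> h \<in> Hom ==> \<theta> (defect \<theta> h) = defect \<theta> (\<theta> h)"
  unfolding defect_def by (simp add: endo_diff endoD(1))

text \<open>The new defect is \<open>4 \<delta>\<^sup>2 - \<epsilon>\<^sup>2\<close> for the correction
  \<open>\<epsilon> = \<delta> (2 \<theta> - 1)\<close>, hence quadratic in the old one.\<close>

lemma defect_newton:
  assumes \<theta>: "endo \<theta>" and h: "h \<in> Hom"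
  shows "defect (newton \<theta>) h = defect \<theta> (defect \<theta> h \<oplus>\<^sub>H defect \<theta> h \<oplus>\<^sub>H (defect \<theta> h \<oplus>\<^sub>H defect \<theta> h))
    \<ominus>\<^sub>H correction \<theta> (correction \<theta> h)"
proof -
  let ?X = "\<lambda>h. \<theta> h \<oplus>\<^sub>H \<theta> h \<ominus>\<^sub>H h" and ?c = "correction \<theta>"
  note d = endo_defect[OF \<theta>] and c = endo_correction[OF \<theta>] and t = endoD(1)[OF \<theta>]
  note dH = endoD(1)[OF d] and cH = endoD(1)[OF c]
  have X: "?X z \<in> Hom" if "z \<in> Hom" for z using that t by simp
  have X\<theta>: "\<theta> (?X z) = ?X (\<theta> z)" if "z \<in> Hom" for z
    using that t by (simp add: endo_diff[OF \<theta>] endoD(2)[OF \<theta>])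
  have c1: "?c z = defect \<theta> (?X z)" for z unfolding correction_def ..
  have c2: "\<theta> (?c z) = defect \<theta> (?X (\<theta> z))" if "z \<in> Hom" for z
    unfolding c1 defect_comm[OF \<theta> X[OF that]] X\<theta>[OF that] ..
  have h1: "\<theta> h \<in> Hom" and h2: "\<theta> (\<theta> h) \<in> Hom" using h t by auto
  have "newton \<theta> (newton \<theta> h) = (\<theta> (\<theta> h) \<oplus>\<^sub>H \<theta> (?c h)) \<oplus>\<^sub>H (?c (\<theta> h) \<oplus>\<^sub>H ?c (?c h))"
    unfolding newton_def using h h1 cH by (simp add: endoD(2)[OF \<theta>] endoD(2)[OF c])
  then have "defect (newton \<theta>) h = (\<theta> h \<oplus>\<^sub>H ?c h) \<ominus>\<^sub>H ((\<theta> (\<theta> h) \<oplus>\<^sub>H \<theta> (?c h)) \<oplus>\<^sub>H (?c (\<theta> h) \<oplus>\<^sub>H ?c (?c h)))"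
    unfolding defect_def[of "newton \<theta>"] by (simp add: newton_def)
  also have "\<dots> = defect \<theta> h \<oplus>\<^sub>H ?c h \<ominus>\<^sub>H \<theta> (?c h) \<ominus>\<^sub>H ?c (\<theta> h) \<ominus>\<^sub>H ?c (?c h)"
    unfolding defect_def using h h1 h2 cH t by (simp add: H.M.minus_eq H.M.minus_add H.M.a_ac)
  also have "defect \<theta> h \<oplus>\<^sub>H ?c h \<ominus>\<^sub>H \<theta> (?c h) \<ominus>\<^sub>H ?c (\<theta> h) = defect \<theta> (h \<oplus>\<^sub>H ?X h \<ominus>\<^sub>H ?X (\<theta> h) \<ominus>\<^sub>H ?X (\<theta> h))"
    unfolding c2[OF h] unfolding c1 using h X[OF h] X[OF h1]
    by (simp only: endo_diff[OF d] endoD(2)[OF d] H_closed H_diff_closed)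
  also have "h \<oplus>\<^sub>H ?X h \<ominus>\<^sub>H ?X (\<theta> h) \<ominus>\<^sub>H ?X (\<theta> h) = defect \<theta> h \<oplus>\<^sub>H defect \<theta> h \<oplus>\<^sub>H (defect \<theta> h \<oplus>\<^sub>H defect \<theta> h)"
    unfolding defect_def using H.M.four_times_difference[of h "\<theta> (\<theta> h)" "\<theta> h"] h h1 h2 by simp
  finally show ?thesis .
qed

text \<open>The \<open>j\<close>-th iterate has a defect in \<open>m^{j + 1}\<close>, so the iterates converge. The limit inherits
  linearity and equivariance because the filtration is separated.\<close>

lemma idempotent_lift:
  assumes e: "endo e" and idem: "\<And>h. h \<in> Hom ==> eqF 1 (e h) (e (e h))"
  obtains \<theta> where "endo \<theta>" "\<And>h. h \<in> Hom ==> \<theta> (\<theta> h) = \<theta> h" "\<And>h. h \<in> Hom ==> eqF 1 (\<theta> h) (e h)"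
proof -
  define T where "T j = (newton ^^ j) e" for j
  have T0: "T 0 = e" and TS: "T (Suc j) = newton (T j)" for j unfolding T_def by simp_all
  have T: "endo (T j)" for j by (induction j) (simp_all add: T0 TS e endo_newton)
  have dT: "defect (T j) h \<in> F (Suc j)" if "h \<in> Hom" for j h
    using that
  proof (induction j arbitrary: h)
    case 0
    then show ?case using idem[of h] unfolding T0 defect_def eqF_def by simp
  next
    case (Suc j)
    let ?d = "defect (T j)" and ?c = "correction (T j)"
    note d = endo_defect[OF T] and c = endo_correction[OF T]
    have dF: "?d z \<in> F (Suc (Suc j))" if "z \<in> F (Suc j)" for z
      using endo_F[OF d Suc.IH that] F_mono[of "Suc (Suc j)" "Suc j + Suc j"] by auto
    have c1: "?c z = ?d (T j z \<oplus>\<^sub>H T j z \<ominus>\<^sub>H z)" for z unfolding correction_def ..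
    have cI: "?c z \<in> F (Suc j)" if "z \<in> Hom" for z unfolding c1 by (rule Suc.IH) (use that endoD(1)[OF T] in simp)
    have cF: "?c z \<in> F (Suc (Suc j))" if "z \<in> F (Suc j)" for z
      using endo_F[OF c cI that] F_mono[of "Suc (Suc j)" "Suc j + Suc j"] by auto
    show ?case unfolding TS defect_newton[OF T Suc.prems]
      by (intro F_diff dF cF cI F_add Suc.IH Suc.prems)
  qed
  have step: "T (Suc j) h \<ominus>\<^sub>H T j h \<in> F (Suc j)" if h: "h \<in> Hom" for j h
  proof -
    have X: "T j h \<oplus>\<^sub>H T j h \<ominus>\<^sub>H h \<in> Hom" using h endoD(1)[OF T] by simp
    have "T (Suc j) h \<ominus>\<^sub>H T j h = correction (T j) h"
      unfolding TS newton_def using H.M.diff_cancel[of "T j h" "correction (T j) h"] endoD(1)[OF T h] endoD(1)[OF endo_correction[OF T] h] by simp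
    then show ?thesis using dT[OF X] unfolding correction_def by simp
  qed
  have "\<exists>l\<in>Hom. \<forall>k. l \<ominus>\<^sub>H T k h \<in> F k" if h: "h \<in> Hom" for h
  proof (rule F_complete)
    show "T k h \<in> Hom" for k by (rule endoD(1)[OF T h])
    show "T (Suc k) h \<ominus>\<^sub>H T k h \<in> F k" for k by (rule subsetD[OF F_mono step[OF h]]) simp
  qed
  then have "\<forall>h\<in>Hom. \<exists>l. l \<in> Hom \<and> (\<forall>k. l \<ominus>\<^sub>H T k h \<in> F k)" by blast
  from bchoice[OF this] obtain \<theta> where "\<forall>h\<in>Hom. \<theta> h \<in> Hom \<and> (\<forall>k. \<theta> h \<ominus>\<^sub>H T k h \<in> F k)" ..
  then have \<theta>: "eqF k (\<theta> h) (T k h)" and \<theta>H: "\<theta> h \<in> Hom" if "h \<in> Hom" for h k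
    using that endoD(1)[OF T] unfolding eqF_def by auto
  have \<theta>': "eqF k (T k h) (\<theta> h)" if "h \<in> Hom" for h k by (rule eqF_sym[OF \<theta>[OF that]])
  have "endo \<theta>"
    unfolding endo_def
  proof (intro conjI ballI)
    fix h assume h: "h \<in> Hom"
    show "\<theta> h \<in> Hom" by (rule \<theta>H[OF h])
    show "\<theta> (h \<oplus>\<^sub>H h') = \<theta> h \<oplus>\<^sub>H \<theta> h'" if h': "h' \<in> Hom" for h'
    proof (rule eqF_all)
      fix k
      have "eqF k (\<theta> (h \<oplus>\<^sub>H h')) (T k h \<oplus>\<^sub>H T k h')" using \<theta>[of "h \<oplus>\<^sub>H h'" k] h h' by (simp add: endoD(2)[OF T])
      also have "eqF k \<dots> (\<theta> h \<oplus>\<^sub>H \<theta> h')" by (intro eqF_add \<theta>' h h')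
      finally show "eqF k (\<theta> (h \<oplus>\<^sub>H h')) (\<theta> h \<oplus>\<^sub>H \<theta> h')" .
    qed
    show "\<theta> (r \<odot>\<^sub>H h) = r \<odot>\<^sub>H \<theta> h" if r: "r \<in> carrier R" for r
    proof (rule eqF_all)
      fix k
      have "eqF k (\<theta> (r \<odot>\<^sub>H h)) (r \<odot>\<^sub>H T k h)" using \<theta>[of "r \<odot>\<^sub>H h" k] h r by (simp add: endoD(3)[OF T])
      also have "eqF k \<dots> (r \<odot>\<^sub>H \<theta> h)" by (intro eqF_smult \<theta>' h r)
      finally show "eqF k (\<theta> (r \<odot>\<^sub>H h)) (r \<odot>\<^sub>H \<theta> h)" .
    qed
    show "\<theta> (act_form g h) = act_form g (\<theta> h)" if g: "g \<in> carrier G" for g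
    proof (rule eqF_all)
      fix k
      have "eqF k (\<theta> (act_form g h)) (act_form g (T k h))" using \<theta>[of "act_form g h" k] h g by (simp add: endoD(4)[OF T])
      also have "eqF k \<dots> (act_form g (\<theta> h))" by (intro eqF_act \<theta>' h g)
      finally show "eqF k (\<theta> (act_form g h)) (act_form g (\<theta> h))" .
    qed
  qed
  moreover have "\<theta> (\<theta> h) = \<theta> h" if h: "h \<in> Hom" for h
  proof (rule eqF_all)
    fix k
    have "eqF k (\<theta> (\<theta> h)) (T k (\<theta> h))" by (rule \<theta>[OF \<theta>H[OF h]])
    also have "eqF k \<dots> (T k (T k h))" by (rule eqF_endo[OF T \<theta>[OF h]])
    also have "eqF k \<dots> (T k h)"
    proof (rule eqF_sym)
      have "T k h \<ominus>\<^sub>H T k (T k h) \<in> F k" using subsetD[OF F_mono dT[OF h, of k], of k] unfolding defect_def by simp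
      then show "eqF k (T k h) (T k (T k h))" unfolding eqF_def using endoD(1)[OF T] h by blast
    qed
    also have "eqF k \<dots> (\<theta> h)" by (rule \<theta>'[OF h])
    finally show "eqF k (\<theta> (\<theta> h)) (\<theta> h)" .
  qed
  moreover have "eqF 1 (\<theta> h) (e h)" if h: "h \<in> Hom" for h
  proof -
    have "eqF 1 (\<theta> h) (T 1 h)" by (rule \<theta>[OF h])
    also have "eqF 1 \<dots> (e h)" using step[OF h, of 0] h endoD(1)[OF T] endoD(1)[OF e] unfolding eqF_def T0 by simp
    finally show ?thesis .
  qed
  ultimately show thesis by (rule that)
qed

section \<open>Averages of forms\<close>

definition avg_form where "avg_form f = \<nu> \<odot>\<^sub>H (\<Oplus>\<^bsub>H\<^esub>g\<in>carrier G. f g)"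

lemma avg_form_apply:
  "f \<in> carrier G \<rightarrow> Hom ==> u \<in> carrier M ==> avg_form f u = avg (\<lambda>g. f g u)"
  unfolding avg_form_def avg_def by (simp add: H_finsum_apply fin)

lemma avg_form_submodule:
  assumes A: "submodule A R H" and f: "f \<in> carrier G \<rightarrow> A" shows "avg_form f \<in> A"
proof -
  have "(\<Oplus>\<^bsub>H\<^esub>g\<in>G'. f g) \<in> A" if "finite G'" "G' \<subseteq> carrier G" for G'
    using that
  proof (induction G')
    case (insert g G')
    have "(\<Oplus>\<^bsub>H\<^esub>g\<in>insert g G'. f g) = f g \<oplus>\<^sub>H (\<Oplus>\<^bsub>H\<^esub>g\<in>G'. f g)"
      by (rule H.M.finsum_insert) (use insert f H.submoduleE(1)[OF A] in "auto simp: Pi_iff subset_iff")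
    then show ?case using insert f H.submoduleE(5)[OF A] by (simp add: Pi_iff)
  qed (simp add: H.submodule_0[OF A])
  from this[OF fin order_refl] show ?thesis unfolding avg_form_def by (rule H.submoduleE(4)[OF A \<nu>_carr])
qed

lemma Hom_submodule: "submodule Hom R H" using H.carrier_is_submodule by simp

lemma avg_form_closed: "f \<in> carrier G \<rightarrow> Hom ==> avg_form f \<in> Hom"
  by (rule avg_form_submodule[OF Hom_submodule])

lemma F_submodule: "submodule (F k) R H"
  unfolding F_span by (rule H.lin_span_submodule[OF _ mp_ideal]) (use B_Hom in simp)

text \<open>Replacing \<open>g\<close> by \<open>k g\<close> in the average of the maps \<open>g p g\<^sup>-\<^sup>1\<close> shows
  that it commutes with \<open>k\<close>.\<close>

lemma endo_avg:
  assumes p: "\<And>h. h \<in> Hom ==> p h \<in> Hom"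
    and p_add: "\<And>h h'. h \<in> Hom ==> h' \<in> Hom ==> p (h \<oplus>\<^sub>H h') = p h \<oplus>\<^sub>H p h'"
    and p_smult: "\<And>r h. r \<in> carrier R ==> h \<in> Hom ==> p (r \<odot>\<^sub>H h) = r \<odot>\<^sub>H p h"
  shows "endo (\<lambda>h. avg_form (\<lambda>g. act_form g (p (act_form (inv\<^bsub>G\<^esub> g) h))))"
proof -
  define P where "P g h = act_form g (p (act_form (inv\<^bsub>G\<^esub> g) h))" for g h
  have P: "P g h \<in> Hom" if "g \<in> carrier G" "h \<in> Hom" for g h unfolding P_def using that p by simp
  have PH: "(\<lambda>g. P g h) \<in> carrier G \<rightarrow> Hom" if "h \<in> Hom" for h using P that by auto
  have PR: "(\<lambda>g. P g h u) \<in> carrier G \<rightarrow> carrier R" if "h \<in> Hom" "u \<in> carrier M" for h u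
    using Hom_closed[OF P] that by auto
  have P_add: "P g (h \<oplus>\<^sub>H h') = P g h \<oplus>\<^sub>H P g h'" if "g \<in> carrier G" "h \<in> Hom" "h' \<in> Hom" for g h h'
    unfolding P_def using that p by (simp add: act_form_add p_add)
  have P_smult: "P g (r \<odot>\<^sub>H h) = r \<odot>\<^sub>H P g h" if "g \<in> carrier G" "h \<in> Hom" "r \<in> carrier R" for g h r
    unfolding P_def using that p by (simp add: act_form_smult p_smult)
  have P_act: "act_form k (P g h) = P (k \<otimes>\<^bsub>G\<^esub> g) (act_form k h)" if "g \<in> carrier G" "k \<in> carrier G" "h \<in> Hom" for g k h
  proof -
    have "act_form (inv\<^bsub>G\<^esub> (k \<otimes>\<^bsub>G\<^esub> g)) (act_form k h) = act_form (inv\<^bsub>G\<^esub> g) h"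
      using that by (simp add: G.inv_mult_group act_form_comp)
    then show ?thesis unfolding P_def using that p by (simp add: act_form_comp)
  qed
  show ?thesis
    unfolding endo_def P_def[symmetric]
  proof (intro conjI ballI)
    fix h assume h: "h \<in> Hom"
    show "avg_form (\<lambda>g. P g h) \<in> Hom" by (rule avg_form_closed[OF PH[OF h]])
    note c = avg_form_closed[OF PH]
    show "avg_form (\<lambda>g. P g (h \<oplus>\<^sub>H h')) = avg_form (\<lambda>g. P g h) \<oplus>\<^sub>H avg_form (\<lambda>g. P g h')" if h': "h' \<in> Hom" for h'
    proof (rule Hom_ext)
      fix u assume u: "u \<in> carrier M"
      have "avg (\<lambda>g. P g (h \<oplus>\<^sub>H h') u) = avg (\<lambda>g. P g h u \<oplus> P g h' u)"
        by (rule avg_cong) (use h h' u P_add P in auto)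
      then show "avg_form (\<lambda>g. P g (h \<oplus>\<^sub>H h')) u = (avg_form (\<lambda>g. P g h) \<oplus>\<^sub>H avg_form (\<lambda>g. P g h')) u"
        using h h' u by (simp add: avg_form_apply[OF PH] avg_add[OF PR PR])
    qed (use h h' c in simp_all)
    show "avg_form (\<lambda>g. P g (r \<odot>\<^sub>H h)) = r \<odot>\<^sub>H avg_form (\<lambda>g. P g h)" if r: "r \<in> carrier R" for r
    proof (rule Hom_ext)
      fix u assume u: "u \<in> carrier M"
      have "avg (\<lambda>g. P g (r \<odot>\<^sub>H h) u) = avg (\<lambda>g. r \<otimes> P g h u)"
        by (rule avg_cong) (use h r u P_smult P in auto)
      then show "avg_form (\<lambda>g. P g (r \<odot>\<^sub>H h)) u = (r \<odot>\<^sub>H avg_form (\<lambda>g. P g h)) u"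
        using h r u by (simp add: avg_form_apply[OF PH] avg_smult[OF PR])
    qed (use h r c in simp_all)
    show "avg_form (\<lambda>g. P g (act_form k h)) = act_form k (avg_form (\<lambda>g. P g h))" if k: "k \<in> carrier G" for k
    proof (rule Hom_ext)
      fix u assume u: "u \<in> carrier M"
      have "\<phi> k (avg (\<lambda>g. P g h u)) = avg (\<lambda>g. P g (act_form k h) u)"
      proof (rule act_avg[OF k PR[OF h u]])
        fix g assume g: "g \<in> carrier G"
        show "\<phi> k (P g h u) = P (k \<otimes>\<^bsub>G\<^esub> g) (act_form k h) u" using P_act[OF g k h] act_form_apply[OF u, of k "P g h"] by simp
      qed (rule PR, use h k u in simp_all)
      then show "avg_form (\<lambda>g. P g (act_form k h)) u = act_form k (avg_form (\<lambda>g. P g h)) u"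
        using h k u by (simp add: avg_form_apply[OF PH])
    qed (use h k c in simp_all)
  qed
qed

section \<open>The endomorphism ring is local\<close>

text \<open>A complement of \<open>A\<close> modulo \<open>m\<close> that is spanned by basis elements: take \<open>C\<close>
  minimal with \<open>A + R C = H\<close>. An element of \<open>A\<close> with a unit coefficient in
  \<open>R C\<close> would make a member of \<open>C\<close> superfluous.\<close>

lemma complement_mod_m:
  assumes A: "submodule A R H"
  obtains C where "C \<subseteq> B" "Hom \<subseteq> A <+>\<^bsub>H\<^esub> lin_span H (carrier R) C" "A \<inter> lin_span H (carrier R) C \<subseteq> F 1"
proof -
  let ?L = "lin_span H (carrier R)"
  have AH: "A \<subseteq> Hom" using H.submoduleE(1)[OF A] by simp
  define P where "P C \<longleftrightarrow> C \<subseteq> B \<and> Hom \<subseteq> A <+>\<^bsub>H\<^esub> ?L C" for C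
  have LC: "submodule (?L C) R H" if "C \<subseteq> B" for C by (rule H.lin_span_sub) (use that B_Hom in auto)
  have "P B" unfolding P_def B_span
  proof (intro conjI subsetI order_refl)
    fix h assume h: "h \<in> Hom"
    show "h \<in> A <+>\<^bsub>H\<^esub> Hom" using set_addI[OF H.submodule_0[OF A] h, of H] h by simp
  qed
  define C where "C = arg_min card P"
  have C: "P C" and min: "\<And>D. P D ==> card C \<le> card D"
    unfolding C_def by (rule arg_min_natI, rule \<open>P B\<close>) (rule arg_min_nat_le)
  have CB: "C \<subseteq> B" and sp: "Hom \<subseteq> A <+>\<^bsub>H\<^esub> ?L C" using C unfolding P_def by auto
  have Cfin: "finite C" using CB B_finite finite_subset by blast
  have CH: "C \<subseteq> carrier H" using CB B_Hom by auto
  have "h \<in> F 1" if h: "h \<in> A" "h \<in> ?L C" for h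
  proof -
    obtain c where c: "c \<in> C \<rightarrow> carrier R" "h = (\<Oplus>\<^bsub>H\<^esub>e\<in>C. c e \<odot>\<^sub>H e)"
      using H.lin_span_finsum[OF Cfin CH oneideal h(2)] by blast
    have "c e \<in> m" if e: "e \<in> C" for e
    proof (rule ccontr)
      assume "c e \<notin> m"
      then have u: "c e \<in> Units R" using unit c(1) e by blast
      let ?D = "C - {e}"
      let ?w = "\<Oplus>\<^bsub>H\<^esub>e\<in>?D. c e \<odot>\<^sub>H e"
      have D: "?D \<subseteq> B" using CB by blast
      have DH: "?D \<subseteq> carrier H" using CH by blast
      have eH: "e \<in> Hom" using e CB by auto
      have cH: "c i \<in> carrier R" "i \<in> Hom" if "i \<in> C" for i using c(1) CB that by auto
      have w: "?w \<in> ?L ?D" by (rule H.finsum_lin_span[OF _ order_refl DH oneideal]) (use Cfin c(1) in auto)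
      have wH: "?w \<in> Hom" using w H.submoduleE(1)[OF LC[OF D]] by auto
      have "h = c e \<odot>\<^sub>H e \<oplus>\<^sub>H ?w"
        using H.M.finsum_insert[of ?D e "\<lambda>e. c e \<odot>\<^sub>H e"] Cfin cH e c(2) insert_Diff[OF e] by (simp add: Pi_iff)
      then have "h \<ominus>\<^sub>H ?w = c e \<odot>\<^sub>H e"
        using wH H_closed(2)[OF cH(1)[OF e] eH] by (simp add: H.M.minus_eq H.M.a_assoc H.M.r_neg)
      then have "inv (c e) \<odot>\<^sub>H (h \<ominus>\<^sub>H ?w) = e"
        using u cH(1)[OF e] eH H.smult_assoc1[of "inv (c e)" "c e" e] H.smult_one[of e] by simp
      then have e_eq: "e = inv (c e) \<odot>\<^sub>H h \<oplus>\<^sub>H inv (c e) \<odot>\<^sub>H (\<ominus>\<^sub>H ?w)"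
        using H.smult_r_distr[of "inv (c e)" h "\<ominus>\<^sub>H ?w"] u h(1) AH wH by (auto simp: H.M.minus_eq)
      have S1: "submodule (A <+>\<^bsub>H\<^esub> ?L ?D) R H" by (rule H.submodule_set_add[OF A LC[OF D]])
      have inv: "inv (c e) \<in> carrier R" using u by simp
      have "e \<in> A <+>\<^bsub>H\<^esub> ?L ?D"
        by (subst e_eq) (rule set_addI[OF H.submoduleE(4)[OF A inv h(1)] H.submoduleE(4)[OF LC[OF D] inv H.submoduleE(3)[OF LC[OF D] w]]])
      moreover note AD = H.submodule_add_incl(1)[OF A LC[OF D]]
      moreover have "?D \<subseteq> A <+>\<^bsub>H\<^esub> ?L ?D" using H.lin_span_incl[OF DH] H.submodule_add_incl(2)[OF A LC[OF D]] by (rule order_trans)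
      ultimately have "C \<subseteq> A <+>\<^bsub>H\<^esub> ?L ?D" by blast
      then have L: "?L C \<subseteq> A <+>\<^bsub>H\<^esub> ?L ?D" by (rule H.lin_span_minimal[OF S1]) simp
      have "Hom \<subseteq> A <+>\<^bsub>H\<^esub> ?L ?D"
      proof
        fix v assume "v \<in> Hom"
        then have "v \<in> A <+>\<^bsub>H\<^esub> ?L C" using sp by blast
        then obtain p q where pq: "p \<in> A" "q \<in> ?L C" "v = p \<oplus>\<^sub>H q" unfolding set_add_iff by blast
        show "v \<in> A <+>\<^bsub>H\<^esub> ?L ?D" unfolding pq(3) using H.submoduleE(5)[OF S1 subsetD[OF AD pq(1)] subsetD[OF L pq(2)]] .
      qed
      then have "card C \<le> card ?D" using min[of ?D] D unfolding P_def by blast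
      then show False using card_Diff1_less[OF Cfin e] by simp
    qed
    then have "h \<in> lin_span H m C"
      unfolding c(2) by (intro H.finsum_lin_span[OF Cfin order_refl CH m_ideal]) auto
    then show ?thesis unfolding F_span mp_1 using lin_span_mono[OF CB order_refl] by blast
  qed
  then show thesis using that[OF CB sp] by blast
qed

text \<open>Maschke's theorem and idempotent lifting: the projection to \<open>A\<close> along the complement, averaged over
  \<open>G\<close>, is an equivariant map that is a projection to \<open>A\<close> modulo \<open>m\<close>. It lifts
  to an idempotent, which is trivial since \<open>M\<close> is indecomposable. Hence \<open>H / m H\<close> is simple.\<close>

lemma simple_mod_m:
  assumes A: "submodule A R H" and stable: "\<And>g h. g \<in> carrier G ==> h \<in> A ==> act_form g h \<in> A"
    and FA: "F 1 \<subseteq> A"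
  shows "A = F 1 \<or> A = Hom"
proof -
  obtain C where C: "C \<subseteq> B" "Hom \<subseteq> A <+>\<^bsub>H\<^esub> lin_span H (carrier R) C" "A \<inter> lin_span H (carrier R) C \<subseteq> F 1"
    by (rule complement_mod_m[OF A])
  let ?L = "lin_span H (carrier R) C"
  have CH: "C \<subseteq> carrier H" using C(1) B_Hom by auto
  have L: "submodule ?L R H" by (rule H.lin_span_sub[OF CH])
  have AH: "h \<in> A ==> h \<in> Hom" and LH: "h \<in> ?L ==> h \<in> Hom" for h
    using H.submoduleE(1)[OF A] H.submoduleE(1)[OF L] by auto
  have "\<forall>e\<in>B. \<exists>z. z \<in> A \<and> (\<exists>w\<in>?L. e = z \<oplus>\<^sub>H w)"
  proof
    fix e assume "e \<in> B"
    then have "e \<in> A <+>\<^bsub>H\<^esub> ?L" using C(2) B_Hom by blast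
    then show "\<exists>z. z \<in> A \<and> (\<exists>w\<in>?L. e = z \<oplus>\<^sub>H w)" unfolding set_add_iff by blast
  qed
  from bchoice[OF this] obtain \<alpha> where "\<forall>e\<in>B. \<alpha> e \<in> A \<and> (\<exists>w\<in>?L. e = \<alpha> e \<oplus>\<^sub>H w)" ..
  then have \<alpha>: "\<alpha> e \<in> A" and \<beta>: "\<exists>w\<in>?L. e = \<alpha> e \<oplus>\<^sub>H w" if "e \<in> B" for e using that by auto
  have \<alpha>H: "\<alpha> e \<in> Hom" if "e \<in> B" for e using \<alpha>[OF that] AH by blast
  have diffL: "e \<ominus>\<^sub>H \<alpha> e \<in> ?L" if e: "e \<in> B" for e
  proof -
    obtain w where w: "w \<in> ?L" "e = \<alpha> e \<oplus>\<^sub>H w" using \<beta>[OF e] by blast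
    have "e \<ominus>\<^sub>H \<alpha> e = w" using H.M.diff_cancel[of "\<alpha> e" w] \<alpha>H[OF e] LH[OF w(1)] w(2) by simp
    then show ?thesis using w(1) by simp
  qed
  \<comment> \<open>\<open>p\<close> maps \<open>e = \<alpha> e + (e - \<alpha> e)\<close> to its component in \<open>A\<close>.\<close>
  define p where "p h = (\<Oplus>\<^bsub>H\<^esub>e\<in>B. coord e h \<odot>\<^sub>H \<alpha> e)" for h
  have sumA: "(\<Oplus>\<^bsub>H\<^esub>e\<in>E. c e \<odot>\<^sub>H v e) \<in> A'"
    if E: "finite E" and A': "submodule A' R H" and c: "\<And>e. e \<in> E ==> c e \<in> carrier R" and v: "\<And>e. e \<in> E ==> v e \<in> A'"
    for E A' c and v :: "_ \<Rightarrow> _"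
    using E c v
  proof (induction E)
    case (insert e E)
    have vH: "v i \<in> Hom" if "i \<in> insert e E" for i using insert.prems(2)[OF that] H.submoduleE(1)[OF A'] by auto
    have "(\<Oplus>\<^bsub>H\<^esub>e\<in>insert e E. c e \<odot>\<^sub>H v e) = c e \<odot>\<^sub>H v e \<oplus>\<^sub>H (\<Oplus>\<^bsub>H\<^esub>e\<in>E. c e \<odot>\<^sub>H v e)"
      by (rule H.M.finsum_insert) (use insert vH in "simp_all add: Pi_iff")
    then show ?case using insert H.submoduleE(4,5)[OF A'] by simp
  qed (simp add: H.submodule_0[OF A'])
  have pA: "p h \<in> A" if "h \<in> Hom" for h
    unfolding p_def by (rule sumA[OF B_finite A]) (use that \<alpha> in simp_all)
  have pH: "p h \<in> Hom" if "h \<in> Hom" for h using AH[OF pA[OF that]] .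
  have papply: "p h u = (\<Oplus>e\<in>B. coord e h \<otimes> \<alpha> e u)" if "h \<in> Hom" "u \<in> carrier M" for h u
    unfolding p_def using that \<alpha>H by (subst H_finsum_apply) (auto simp: B_finite)
  have p_add: "p (h \<oplus>\<^sub>H h') = p h \<oplus>\<^sub>H p h'" if hh: "h \<in> Hom" "h' \<in> Hom" for h h'
  proof -
    have "p (h \<oplus>\<^sub>H h') = (\<Oplus>\<^bsub>H\<^esub>e\<in>B. coord e h \<odot>\<^sub>H \<alpha> e \<oplus>\<^sub>H coord e h' \<odot>\<^sub>H \<alpha> e)"
      unfolding p_def by (rule H.M.finsum_cong') (use hh \<alpha>H in "auto simp: coord_add H.smult_l_distr")
    also have "\<dots> = p h \<oplus>\<^sub>H p h'" unfolding p_def by (rule H.M.finsum_addf) (use hh \<alpha>H in auto)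
    finally show ?thesis .
  qed
  have p_smult: "p (r \<odot>\<^sub>H h) = r \<odot>\<^sub>H p h" if rh: "r \<in> carrier R" "h \<in> Hom" for r h
  proof (rule Hom_ext)
    fix u assume u: "u \<in> carrier M"
    have "p (r \<odot>\<^sub>H h) u = (\<Oplus>e\<in>B. r \<otimes> (coord e h \<otimes> \<alpha> e u))"
      unfolding papply[OF H_closed(2)[OF rh] u] by (rule finsum_cong') (use rh u \<alpha>H in "auto simp: coord_smult m_assoc")
    also have "\<dots> = r \<otimes> p h u" unfolding papply[OF rh(2) u]
      by (rule finsum_rdistr[symmetric]) (use B_finite rh u \<alpha>H in auto)
    finally show "p (r \<odot>\<^sub>H h) u = (r \<odot>\<^sub>H p h) u" using u by simp
  qed (use rh pH in simp_all)
  have p_eq: "h \<ominus>\<^sub>H p h \<in> ?L" if h: "h \<in> Hom" for h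
  proof -
    have "h = (\<Oplus>\<^bsub>H\<^esub>e\<in>B. coord e h \<odot>\<^sub>H (e \<ominus>\<^sub>H \<alpha> e) \<oplus>\<^sub>H coord e h \<odot>\<^sub>H \<alpha> e)"
    proof (subst coord_sum[OF h], rule H.M.finsum_cong')
      fix e assume e: "e \<in> B"
      show "coord e h \<odot>\<^sub>H e = coord e h \<odot>\<^sub>H (e \<ominus>\<^sub>H \<alpha> e) \<oplus>\<^sub>H coord e h \<odot>\<^sub>H \<alpha> e"
        using H.smult_r_distr[of "coord e h" "e \<ominus>\<^sub>H \<alpha> e" "\<alpha> e"] e h \<alpha>H[OF e] by (simp add: H.M.minus_eq H.M.a_assoc H.M.l_neg)
    qed (use h \<alpha>H in "auto simp: Pi_iff")
    also have "\<dots> = (\<Oplus>\<^bsub>H\<^esub>e\<in>B. coord e h \<odot>\<^sub>H (e \<ominus>\<^sub>H \<alpha> e)) \<oplus>\<^sub>H p h"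
      unfolding p_def by (rule H.M.finsum_addf) (use h \<alpha>H in "auto simp: Pi_iff")
    finally have eq: "h = (\<Oplus>\<^bsub>H\<^esub>e\<in>B. coord e h \<odot>\<^sub>H (e \<ominus>\<^sub>H \<alpha> e)) \<oplus>\<^sub>H p h" (is "h = ?s \<oplus>\<^sub>H p h") .
    have s: "?s \<in> ?L" by (rule sumA[OF B_finite L]) (use h diffL in simp_all)
    have "?s \<oplus>\<^sub>H p h \<ominus>\<^sub>H p h = ?s" using LH[OF s] pH[OF h] by (simp add: H.M.minus_eq H.M.a_assoc H.M.r_neg)
    then show ?thesis using s eq by simp
  qed
  have p_fix: "eqF 1 (p h) h" if h: "h \<in> A" for h
  proof -
    have "h \<ominus>\<^sub>H p h \<in> A" using H.submodule_sub[OF A h pA[OF AH[OF h]]] .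
    then have "h \<ominus>\<^sub>H p h \<in> F 1" using p_eq[OF AH[OF h]] C(3) by blast
    then have "eqF 1 h (p h)" unfolding eqF_def using AH[OF h] pH[OF AH[OF h]] by simp
    then show ?thesis by (rule eqF_sym)
  qed
  define q where "q h = avg_form (\<lambda>g. act_form g (p (act_form (inv\<^bsub>G\<^esub> g) h)))" for h
  have q: "endo q" unfolding q_def by (rule endo_avg[OF pH p_add p_smult])
  have qA: "q h \<in> A" if "h \<in> Hom" for h
    unfolding q_def by (rule avg_form_submodule[OF A]) (use that stable pA in auto)
  have q_fix: "eqF 1 (q h) h" if h: "h \<in> A" for h
  proof -
    let ?P = "\<lambda>g. act_form g (p (act_form (inv\<^bsub>G\<^esub> g) h))"
    have hH: "h \<in> Hom" by (rule AH[OF h])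
    have P: "eqF 1 (?P g) h" if g: "g \<in> carrier G" for g
      using eqF_act[OF p_fix[OF stable[OF _ h]] g, of "inv\<^bsub>G\<^esub> g"] g hH by simp
    have PH: "?P g \<in> Hom" if "g \<in> carrier G" for g using P[OF that] unfolding eqF_def by simp
    have d: "avg_form (\<lambda>g. ?P g \<ominus>\<^sub>H h) \<in> F 1"
      by (rule avg_form_submodule[OF F_submodule]) (use P in "simp add: eqF_def")
    have "q h \<ominus>\<^sub>H h = avg_form (\<lambda>g. ?P g \<ominus>\<^sub>H h)"
    proof (rule Hom_ext)
      fix u assume u: "u \<in> carrier M"
      have diff: "(z \<ominus>\<^sub>H h) u = z u \<oplus> (\<ominus> \<one>) \<otimes> h u" for z
        using u hH by (simp add: a_minus_def H_minus)
      have "avg_form (\<lambda>g. ?P g \<ominus>\<^sub>H h) u = avg (\<lambda>g. (?P g \<ominus>\<^sub>H h) u)"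
        by (rule avg_form_apply[OF _ u]) (use PH hH in auto)
      also have "\<dots> = avg (\<lambda>g. ?P g u) \<oplus> avg (\<lambda>g. (\<ominus> \<one>) \<otimes> h u)"
        unfolding diff by (rule avg_add) (use Hom_closed[OF PH u] hH u in auto)
      also have "avg (\<lambda>g. (\<ominus> \<one>) \<otimes> h u) = (\<ominus> \<one>) \<otimes> h u" by (rule avg_const) (use hH u in simp)
      also have "avg (\<lambda>g. ?P g u) = q h u"
        unfolding q_def by (rule avg_form_apply[symmetric, OF _ u]) (use PH in auto)
      finally show "(q h \<ominus>\<^sub>H h) u = avg_form (\<lambda>g. ?P g \<ominus>\<^sub>H h) u" unfolding diff by simp
    qed (use hH endoD(1)[OF q] F_Hom[OF d] in simp_all)
    then show ?thesis using d hH endoD(1)[OF q hH] unfolding eqF_def by simp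
  qed
  have "\<And>h. h \<in> Hom ==> eqF 1 (q h) (q (q h))" using eqF_sym[OF q_fix[OF qA]] .
  then obtain \<theta> where \<theta>: "endo \<theta>" "\<And>h. h \<in> Hom ==> \<theta> (\<theta> h) = \<theta> h" "\<And>h. h \<in> Hom ==> eqF 1 (\<theta> h) (q h)"
    using idempotent_lift[OF q] by metis
  from idempotent_trivial[OF \<theta>(1,2)] show ?thesis
  proof
    assume z: "\<forall>h\<in>Hom. \<theta> h = \<zero>\<^sub>H"
    have "h \<in> F 1" if h: "h \<in> A" for h
    proof -
      have "eqF 1 h (q h)" by (rule eqF_sym[OF q_fix[OF h]])
      also have "eqF 1 \<dots> (\<theta> h)" by (rule eqF_sym[OF \<theta>(3)[OF AH[OF h]]])
      finally have "eqF 1 h \<zero>\<^sub>H" using z AH[OF h] by simp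
      then have "h \<ominus>\<^sub>H \<zero>\<^sub>H \<in> F 1" unfolding eqF_def by blast
      then show ?thesis using H.M.diff_cancel[of "\<zero>\<^sub>H" h] H.M.l_zero[of h] AH[OF h] by simp
    qed
    then show ?thesis using FA by blast
  next
    assume i: "\<forall>h\<in>Hom. \<theta> h = h"
    have "h \<in> A" if h: "h \<in> Hom" for h
    proof -
      have "h \<ominus>\<^sub>H q h \<in> A" using \<theta>(3)[OF h] i h FA unfolding eqF_def by auto
      from H.submoduleE(5)[OF A this qA[OF h]] show ?thesis
        using h endoD(1)[OF q h] by (simp add: H.M.minus_eq H.M.a_assoc H.M.l_neg)
    qed
    then show ?thesis using AH by blast
  qed
qed

text \<open>Nakayama's lemma, and surjective endomorphisms of Noetherian modules are injective.\<close>

lemma endo_surj_bij: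
  assumes \<theta>: "endo \<theta>" and gen: "Hom \<subseteq> \<theta> ` Hom <+>\<^bsub>H\<^esub> F 1"
  shows "bij_betw \<theta> Hom Hom"
proof -
  have im: "submodule (\<theta> ` Hom) R H" using H.lin_map_image[OF H_module endo_lin_map[OF \<theta>]] by simp
  have "F 1 \<subseteq> lin_span H m Hom" unfolding F_span mp_1 using lin_span_mono[OF B_Hom order_refl, of _ H m] by blast
  then have "Hom \<subseteq> \<theta> ` Hom <+>\<^bsub>H\<^esub> lin_span H m Hom"
    using gen by (fastforce simp: set_add_iff)
  from H.nakayama_noetherian[OF m_ideal one_minus_unit H_noetherian Hom_submodule im this]
  have surj: "Hom \<subseteq> \<theta> ` Hom" .
  have "inj_on \<theta> (carrier H)"
    by (rule H.surj_imp_inj[OF H_noetherian endo_lin_map[OF \<theta>]]) (use surj in simp)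
  then show ?thesis unfolding bij_betw_def using surj endoD(1)[OF \<theta>] by auto
qed

text \<open>The equivariant submodule \<open>\<theta> H + m H\<close> is \<open>H\<close> or \<open>m H\<close>. In the first case
  \<open>\<theta>\<close> is surjective; in the second \<open>1 - \<theta>\<close> is surjective by Nakayama's lemma.\<close>

lemma endo_local:
  assumes \<theta>: "endo \<theta>"
  shows "bij_betw \<theta> Hom Hom \<or> bij_betw (\<lambda>h. h \<ominus>\<^sub>H \<theta> h) Hom Hom"
proof -
  let ?A = "\<theta> ` Hom <+>\<^bsub>H\<^esub> F 1"
  note t = endoD[OF \<theta>]
  have im: "submodule (\<theta> ` Hom) R H" using H.lin_map_image[OF H_module endo_lin_map[OF \<theta>]] by simp
  have A: "submodule ?A R H" by (rule H.submodule_set_add[OF im F_submodule])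
  have FA: "F 1 \<subseteq> ?A" and tA: "\<And>h. h \<in> Hom ==> \<theta> h \<in> ?A"
    using H.submodule_add_incl[OF im F_submodule] by auto
  have st: "act_form g z \<in> ?A" if g: "g \<in> carrier G" and z: "z \<in> ?A" for g z
  proof -
    obtain h w where hw: "h \<in> Hom" "w \<in> F 1" "z = \<theta> h \<oplus>\<^sub>H w" using z unfolding set_add_iff by blast
    have "act_form g z = \<theta> (act_form g h) \<oplus>\<^sub>H act_form g w" using hw g t F_Hom[OF hw(2)] by (simp add: act_form_add)
    then show ?thesis using set_addI[OF imageI[OF act_form_closed[OF g hw(1)], of \<theta>] F_act[OF g hw(2)], of H] by simp
  qed
  from simple_mod_m[OF A st FA] show ?thesis
  proof
    assume A1: "?A = F 1"
    let ?\<eta> = "\<lambda>h. h \<ominus>\<^sub>H \<theta> h"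
    have "bij_betw ?\<eta> Hom Hom"
    proof (rule endo_surj_bij[OF endo_minus[OF endo_id \<theta>]], rule subsetI)
      fix h assume h: "h \<in> Hom"
      have "h = ?\<eta> h \<oplus>\<^sub>H \<theta> h" using h t(1) by (simp add: H.M.minus_eq H.M.a_assoc H.M.l_neg)
      then show "h \<in> ?\<eta> ` Hom <+>\<^bsub>H\<^esub> F 1"
        using set_addI[OF imageI[OF h, of ?\<eta>], of "\<theta> h" "F 1" H] tA[OF h] unfolding A1 by simp
    qed
    then show ?thesis ..
  next
    assume "?A = Hom"
    then show ?thesis using endo_surj_bij[OF \<theta>] by simp
  qed
qed

end

section \<open>Maximal Cohen-Macaulay modules as direct summands\<close>

lemma (in module) lin_map_inverse:
  assumes f: "lin_map R M N f" and bij: "bij_betw f (carrier M) (carrier N)"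
  obtains g where "lin_map R N M g" "\<And>u. u \<in> carrier M ==> g (f u) = u" "\<And>v. v \<in> carrier N ==> f (g v) = v"
    "bij_betw g (carrier N) (carrier M)"
proof -
  define g where "g = inv_into (carrier M) f"
  have gf: "g (f u) = u" if "u \<in> carrier M" for u unfolding g_def using bij_betw_inv_into_left[OF bij that] .
  have fg: "f (g v) = v" if "v \<in> carrier N" for v unfolding g_def using bij_betw_inv_into_right[OF bij that] .
  have gb: "bij_betw g (carrier N) (carrier M)" unfolding g_def by (rule bij_betw_inv_into[OF bij])
  have g: "g v \<in> carrier M" if "v \<in> carrier N" for v using bij_betwE[OF gb] that by blast
  have "g (v \<oplus>\<^bsub>N\<^esub> w) = g v \<oplus>\<^sub>M g w" if "v \<in> carrier N" "w \<in> carrier N" for v w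
    using gf[of "g v \<oplus>\<^sub>M g w"] lin_mapD(2)[OF f g[OF that(1)] g[OF that(2)]] g that fg by simp
  moreover have "g (s \<odot>\<^bsub>N\<^esub> v) = s \<odot>\<^sub>M g v" if "s \<in> carrier R" "v \<in> carrier N" for s v
    using gf[of "s \<odot>\<^sub>M g v"] lin_mapD(3)[OF f that(1) g[OF that(2)]] g that fg by simp
  ultimately have "lin_map R N M g" unfolding lin_map_def using g by simp
  then show thesis using that[OF _ gf fg gb] by blast
qed

lemma (in module) lin_map_finsum:
  assumes "finite I" "\<And>i. i \<in> I ==> lin_map R M M (f i)"
  shows "lin_map R M M (\<lambda>u. \<Oplus>\<^bsub>M\<^esub>i\<in>I. f i u)"
  using assms
proof (induction I)
  case empty
  show ?case unfolding lin_map_def by simp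
next
  case (insert j I)
  have fj: "lin_map R M M (f j)" and fI: "lin_map R M M (\<lambda>u. \<Oplus>\<^bsub>M\<^esub>i\<in>I. f i u)" and fi: "\<And>i. i \<in> I ==> lin_map R M M (f i)"
    using insert by auto
  have eq: "(\<Oplus>\<^bsub>M\<^esub>i\<in>insert j I. f i u) = f j u \<oplus>\<^sub>M (\<Oplus>\<^bsub>M\<^esub>i\<in>I. f i u)" if "u \<in> carrier M" for u
    by (rule M.finsum_insert) (use insert.hyps lin_mapD(1)[OF fj that] lin_mapD(1)[OF fi that] in auto)
  show ?case
    unfolding lin_map_def
  proof (intro conjI ballI)
    fix u assume u: "u \<in> carrier M"
    note c = lin_mapD(1)[OF fj] lin_mapD(1)[OF fI]
    show "(\<Oplus>\<^bsub>M\<^esub>i\<in>insert j I. f i u) \<in> carrier M" unfolding eq[OF u] using c[OF u] by simp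
    show "(\<Oplus>\<^bsub>M\<^esub>i\<in>insert j I. f i (s \<odot>\<^sub>M u)) = s \<odot>\<^sub>M (\<Oplus>\<^bsub>M\<^esub>i\<in>insert j I. f i u)" if s: "s \<in> carrier R" for s
      unfolding eq[OF u] eq[OF smult_closed[OF s u]] lin_mapD(3)[OF fj s u] lin_mapD(3)[OF fI s u]
      by (rule smult_r_distr[symmetric]) (use s c u in auto)
    fix v assume v: "v \<in> carrier M"
    show "(\<Oplus>\<^bsub>M\<^esub>i\<in>insert j I. f i (u \<oplus>\<^sub>M v)) = (\<Oplus>\<^bsub>M\<^esub>i\<in>insert j I. f i u) \<oplus>\<^sub>M (\<Oplus>\<^bsub>M\<^esub>i\<in>insert j I. f i v)"
      unfolding eq[OF u] eq[OF v] eq[OF M.a_closed[OF u v]] lin_mapD(2)[OF fj u v] lin_mapD(2)[OF fI u v]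
      using c[OF u] c[OF v] by (simp add: M.a_ac)
  qed
qed

lemma bij_betw_factor:
  assumes fg: "bij_betw (\<lambda>u. f (g u)) N M" and gs: "\<And>u. u \<in> M ==> g (s u) = u" and s: "bij_betw s M N"
  shows "bij_betw f M M"
proof -
  have "bij_betw (\<lambda>u. f (g (s u))) M M" using bij_betw_trans[OF s fg] by (simp add: comp_def)
  moreover have "bij_betw (\<lambda>u. f (g (s u))) M M = bij_betw f M M" by (rule bij_betw_cong) (simp add: gs)
  ultimately show ?thesis by simp
qed

context complete_MCM
begin

text \<open>The inverse of the dual map is again equivariant and comes from an endomorphism of \<open>M\<close>.\<close>

lemma M_endo_bij:
  assumes f: "lin_map S M M f" and bij: "bij_betw (dual f) Hom Hom"
  shows "bij_betw f (carrier M) (carrier M)"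
proof -
  note fD = lin_mapD[OF f] and t = endoD[OF dual_endo[OF f]]
  define \<eta> where "\<eta> = inv_into Hom (dual f)"
  have l: "\<eta> (dual f h) = h" and r: "dual f (\<eta> h) = h" and \<eta>H: "\<eta> h \<in> Hom" if "h \<in> Hom" for h
    unfolding \<eta>_def using bij_betw_inv_into_left[OF bij that] bij_betw_inv_into_right[OF bij that]
      bij_betwE[OF bij_betw_inv_into[OF bij]] that by auto
  have "endo \<eta>"
    unfolding endo_def
  proof (intro conjI ballI)
    fix h assume h: "h \<in> Hom"
    note hH = \<eta>H[OF h]
    show "\<eta> h \<in> Hom" by (rule hH)
    show "\<eta> (h \<oplus>\<^sub>H h') = \<eta> h \<oplus>\<^sub>H \<eta> h'" if "h' \<in> Hom" for h'
      using l[of "\<eta> h \<oplus>\<^sub>H \<eta> h'"] t(2)[OF hH \<eta>H[OF that]] hH \<eta>H[OF that] r[OF h] r[OF that] by simp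
    show "\<eta> (c \<odot>\<^sub>H h) = c \<odot>\<^sub>H \<eta> h" if "c \<in> carrier R" for c
      using l[of "c \<odot>\<^sub>H \<eta> h"] t(3)[OF that hH] that hH r[OF h] by simp
    show "\<eta> (act_form g h) = act_form g (\<eta> h)" if "g \<in> carrier G" for g
      using l[of "act_form g (\<eta> h)"] t(4)[OF that hH] that hH r[OF h] by simp
  qed
  then obtain g where g: "lin_map S M M g" "\<And>h u. h \<in> Hom ==> u \<in> carrier M ==> h (g u) = \<eta> h u" by (rule endo_dual) blast
  have "f (g u) = u" if u: "u \<in> carrier M" for u
  proof (rule Hom_eqI)
    fix h assume h: "h \<in> Hom"
    show "h (f (g u)) = h u" using g(2)[OF t(1)[OF h] u] l[OF h] lin_mapD(1)[OF g(1) u] by simp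
  qed (use u fD lin_mapD(1)[OF g(1)] in simp_all)
  moreover have "g (f u) = u" if u: "u \<in> carrier M" for u
  proof (rule Hom_eqI)
    fix h assume h: "h \<in> Hom"
    have "h (g (f u)) = dual f (\<eta> h) u" using g(2)[OF h fD(1)[OF u]] u by simp
    then show "h (g (f u)) = h u" unfolding r[OF h] .
  qed (use u fD lin_mapD(1)[OF g(1)] in simp_all)
  ultimately show ?thesis
    by (intro bij_betw_byWitness[where f' = g]) (use fD(1) lin_mapD(1)[OF g(1)] in auto)
qed

theorem M_endo_local:
  assumes f: "lin_map S M M f" and g: "lin_map S M M g"
    and sum: "\<And>u. u \<in> carrier M ==> f u \<oplus>\<^bsub>M\<^esub> g u = u"
  shows "bij_betw f (carrier M) (carrier M) \<or> bij_betw g (carrier M) (carrier M)"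
proof -
  have "dual g h = h \<ominus>\<^sub>H dual f h" if h: "h \<in> Hom" for h
  proof (rule Hom_ext)
    fix u assume u: "u \<in> carrier M"
    have fg: "f u \<in> carrier M" "g u \<in> carrier M" using lin_mapD(1)[OF f u] lin_mapD(1)[OF g u] .
    have "h u = h (f u) \<oplus> h (g u)" using Hom_add[OF h fg] sum[OF u] by simp
    then have "h (g u) = h u \<oplus> \<ominus> h (f u)" using h fg a_lcomm[of "h (f u)" "h (g u)" "\<ominus> h (f u)"] by (simp add: a_assoc r_neg)
    then show "dual g h u = (h \<ominus>\<^sub>H dual f h) u"
      using u h fg dual_Hom[OF f h] by (simp add: a_minus_def H_minus l_minus)
  qed (use h dual_Hom f g in simp_all)
  then have "bij_betw (dual g) Hom Hom \<longleftrightarrow> bij_betw (\<lambda>h. h \<ominus>\<^sub>H dual f h) Hom Hom" by (rule bij_betw_cong)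
  then show ?thesis using endo_local[OF dual_endo[OF f]] M_endo_bij f g by blast
qed

text \<open>Locality, applied to \<open>f j s\<^sup>-\<^sup>1\<close> and the rest of the sum, where \<open>s\<close> is the whole
  sum. An empty sum is not bijective, as \<open>M \<noteq> 0\<close>.\<close>

lemma bij_summand:
  assumes "finite I" and f: "\<And>i. i \<in> I ==> lin_map S M M (f i)"
    and s: "bij_betw (\<lambda>u. \<Oplus>\<^bsub>M\<^esub>i\<in>I. f i u) (carrier M) (carrier M)"
  shows "\<exists>i\<in>I. bij_betw (f i) (carrier M) (carrier M)"
  using assms
proof (induction I)
  case empty
  then have "carrier M \<subseteq> {\<zero>\<^bsub>M\<^esub>}" unfolding bij_betw_def by auto
  then show ?case using nonzero D.M.M.zero_closed by blast
next
  case (insert j I)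
  let ?s = "\<lambda>u. \<Oplus>\<^bsub>M\<^esub>i\<in>insert j I. f i u" and ?s' = "\<lambda>u. \<Oplus>\<^bsub>M\<^esub>i\<in>I. f i u"
  have fj: "lin_map S M M (f j)" and fi: "\<And>i. i \<in> I ==> lin_map S M M (f i)" using insert.prems(1) by auto
  have s: "lin_map S M M ?s" by (rule D.M.lin_map_finsum) (use insert in auto)
  have s': "lin_map S M M ?s'" by (rule D.M.lin_map_finsum) (use insert in auto)
  have eq: "?s u = f j u \<oplus>\<^bsub>M\<^esub> ?s' u" if "u \<in> carrier M" for u
    by (rule D.M.M.finsum_insert) (use insert.hyps lin_mapD(1)[OF fj that] lin_mapD(1)[OF fi that] in auto)
  obtain g where g: "lin_map S M M g" "\<And>u. u \<in> carrier M ==> g (?s u) = u" "\<And>v. v \<in> carrier M ==> ?s (g v) = v"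
    using D.M.lin_map_inverse[OF s insert.prems(2)] by metis
  have "f j (g u) \<oplus>\<^bsub>M\<^esub> ?s' (g u) = u" if "u \<in> carrier M" for u
    using eq[OF lin_mapD(1)[OF g(1) that]] g(3)[OF that] by simp
  from M_endo_local[OF lin_map_comp[OF g(1) fj] lin_map_comp[OF g(1) s'] this] show ?case
  proof
    assume "bij_betw (\<lambda>u. f j (g u)) (carrier M) (carrier M)"
    then have "bij_betw (f j) (carrier M) (carrier M)" by (rule bij_betw_factor[where s = ?s]) (rule g(2), assumption, rule insert.prems(2))
    then show ?thesis by blast
  next
    assume "bij_betw (\<lambda>u. ?s' (g u)) (carrier M) (carrier M)"
    then have "bij_betw ?s' (carrier M) (carrier M)"
      by (rule bij_betw_factor[where f = ?s' and s = ?s]) (rule g(2), assumption, rule insert.prems(2))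
    then show ?thesis using insert.IH[OF fi] by blast
  qed
qed

lemma avg_finsum:
  assumes "finite I" "\<And>i g. i \<in> I ==> g \<in> carrier G ==> f i g \<in> carrier R"
  shows "(\<Oplus>i\<in>I. avg (f i)) = avg (\<lambda>g. \<Oplus>i\<in>I. f i g)"
  using assms
proof (induction I)
  case empty
  show ?case using avg_const[OF zero_closed] by simp
next
  case (insert i I)
  have "(\<Oplus>i\<in>insert i I. avg (f i)) = avg (f i) \<oplus> avg (\<lambda>g. \<Oplus>i\<in>I. f i g)"
    using insert by (subst finsum_insert) (auto simp: Pi_iff)
  also have "\<dots> = avg (\<lambda>g. f i g \<oplus> (\<Oplus>i\<in>I. f i g))"
    by (rule avg_add[symmetric]) (use insert in "auto simp: Pi_iff")
  also have "\<dots> = avg (\<lambda>g. \<Oplus>i\<in>insert i I. f i g)"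
    by (rule avg_cong) (use insert in "auto simp: Pi_iff finsum_insert")
  finally show ?case .
qed

lemma Hom_finsum:
  assumes h: "h \<in> Hom" and "finite I" "\<And>i. i \<in> I ==> v i \<in> carrier M"
  shows "h (\<Oplus>\<^bsub>M\<^esub>i\<in>I. v i) = (\<Oplus>i\<in>I. h (v i))"
  using assms(2,3)
proof (induction I)
  case (insert i I)
  have "(\<Oplus>\<^bsub>M\<^esub>i\<in>insert i I. v i) = v i \<oplus>\<^bsub>M\<^esub> (\<Oplus>\<^bsub>M\<^esub>i\<in>I. v i)" by (rule D.M.M.finsum_insert) (use insert in auto)
  moreover have "(\<Oplus>i\<in>insert i I. h (v i)) = h (v i) \<oplus> (\<Oplus>i\<in>I. h (v i))" by (rule finsum_insert) (use insert h in auto)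
  moreover have "(\<Oplus>\<^bsub>M\<^esub>i\<in>I. v i) \<in> carrier M" by (rule D.M.M.finsum_closed) (use insert in auto)
  ultimately show ?case using insert h by (simp add: Hom_add)
qed (simp add: Hom_zero[OF h])

text \<open>The average of \<open>z\<close> times the coordinate function of \<open>e\<close> is an equivariant form on
  \<open>H\<close>, and by reflexivity an element of \<open>M\<close>. This gives the map \<open>q e\<close>. The
  identity holds since it does before averaging, where it is the expansion of a form in the basis.\<close>

lemma dual_basis:
  obtains q where "\<And>e. e \<in> B ==> lin_map S (self_module R) M (q e)"
    "\<And>u. u \<in> carrier M ==> (\<Oplus>\<^bsub>M\<^esub>e\<in>B. q e (e u)) = u"
proof -
  define \<Lambda> where "\<Lambda> e z h = avg (\<lambda>g. \<phi> g (z \<otimes> coord e (act_form (inv\<^bsub>G\<^esub> g) h)))" for e z h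
  have in_R: "(\<lambda>g. \<phi> g (z \<otimes> coord e (act_form (inv\<^bsub>G\<^esub> g) h))) \<in> carrier G \<rightarrow> carrier R"
    if "e \<in> B" "z \<in> carrier R" "h \<in> Hom" for e z h using that by auto
  have \<Lambda>c: "\<Lambda> e z h \<in> carrier R" if "e \<in> B" "z \<in> carrier R" "h \<in> Hom" for e z h
    unfolding \<Lambda>_def by (rule avg_closed[OF in_R[OF that]])
  have "\<exists>v. v \<in> carrier M \<and> (\<forall>h\<in>Hom. \<Lambda> e z h = h v)" if e: "e \<in> B" and z: "z \<in> carrier R" for e z
  proof -
    have "linear_on R H Hom (\<Lambda> e z)"
      unfolding linear_on_def
    proof (intro conjI ballI)
      fix h assume h: "h \<in> Hom"
      show "\<Lambda> e z h \<in> carrier R" by (rule \<Lambda>c[OF e z h])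
      show "\<Lambda> e z (h \<oplus>\<^sub>H h') = \<Lambda> e z h \<oplus> \<Lambda> e z h'" if h': "h' \<in> Hom" for h'
        unfolding \<Lambda>_def
        by (subst avg_add[symmetric, OF in_R[OF e z h] in_R[OF e z h']], rule avg_cong)
           (use e z h h' in "auto simp: act_form_add coord_add r_distr act_add")
      show "\<Lambda> e z (r \<odot>\<^sub>H h) = r \<otimes> \<Lambda> e z h" if r: "r \<in> carrier R" for r
        unfolding \<Lambda>_def
      proof (subst avg_smult[symmetric, OF in_R[OF e z h] r], rule avg_cong)
        fix g assume g: "g \<in> carrier G"
        have "z \<otimes> coord e (act_form (inv\<^bsub>G\<^esub> g) (r \<odot>\<^sub>H h)) = \<phi> (inv\<^bsub>G\<^esub> g) r \<otimes> (z \<otimes> coord e (act_form (inv\<^bsub>G\<^esub> g) h))"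
          using g r e z h by (simp add: act_form_smult coord_smult m_lcomm)
        then show "\<phi> g (z \<otimes> coord e (act_form (inv\<^bsub>G\<^esub> g) (r \<odot>\<^sub>H h))) = r \<otimes> \<phi> g (z \<otimes> coord e (act_form (inv\<^bsub>G\<^esub> g) h))"
          using g r e z h by (simp add: act_mult)
      qed (use e z h r in auto)
    qed
    moreover have "equivariant (\<Lambda> e z)"
      unfolding equivariant_def
    proof (intro ballI)
      fix k h assume k: "k \<in> carrier G" and h: "h \<in> Hom"
      have "\<phi> k (\<Lambda> e z h) = \<Lambda> e z (act_form k h)"
        unfolding \<Lambda>_def
      proof (rule act_avg[OF k in_R[OF e z h]])
        fix g assume g: "g \<in> carrier G"
        have "act_form (inv\<^bsub>G\<^esub> (k \<otimes>\<^bsub>G\<^esub> g)) (act_form k h) = act_form (inv\<^bsub>G\<^esub> g) h"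
          using g k h by (simp add: G.inv_mult_group act_form_comp)
        then show "\<phi> k (\<phi> g (z \<otimes> coord e (act_form (inv\<^bsub>G\<^esub> g) h))) = \<phi> (k \<otimes>\<^bsub>G\<^esub> g) (z \<otimes> coord e (act_form (inv\<^bsub>G\<^esub> (k \<otimes>\<^bsub>G\<^esub> g)) (act_form k h)))"
          using g k h e z by (simp add: act_comp)
      qed (rule in_R, use e z k h in simp_all)
      then show "\<Lambda> e z (act_form k h) = \<phi> k (\<Lambda> e z h)" ..
    qed
    ultimately show ?thesis using reflexive by blast
  qed
  then have "\<forall>e\<in>B. \<forall>z\<in>carrier R. \<exists>v. v \<in> carrier M \<and> (\<forall>h\<in>Hom. \<Lambda> e z h = h v)" by blast
  then obtain q where "\<forall>e\<in>B. \<forall>z\<in>carrier R. q e z \<in> carrier M \<and> (\<forall>h\<in>Hom. \<Lambda> e z h = h (q e z))" by metis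
  then have q: "q e z \<in> carrier M" "h \<in> Hom ==> h (q e z) = \<Lambda> e z h" if "e \<in> B" "z \<in> carrier R" for e z h using that by auto
  have "lin_map S (self_module R) M (q e)" if e: "e \<in> B" for e
    unfolding lin_map_def
  proof (intro conjI ballI; simp)
    fix z assume z: "z \<in> carrier R"
    show "q e z \<in> carrier M" by (rule q(1)[OF e z])
    show "q e (s \<otimes> z) = s \<odot>\<^bsub>M\<^esub> q e z" if s: "s \<in> carrier S" for s
    proof (rule Hom_eqI)
      fix h assume h: "h \<in> Hom"
      have sR: "s \<in> carrier R" using S_carr s by blast
      have "\<Lambda> e (s \<otimes> z) h = s \<otimes> \<Lambda> e z h"
        unfolding \<Lambda>_def
        by (subst avg_smult[symmetric, OF in_R[OF e z h] sR], rule avg_cong)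
           (use e z h s sR in "auto simp: m_assoc act_mult S_inv")
      then show "h (q e (s \<otimes> z)) = h (s \<odot>\<^bsub>M\<^esub> q e z)"
        using q(2)[OF e z h] q(2)[OF e _ h, of "s \<otimes> z"] sR z Hom_smult[OF h s q(1)[OF e z]] by simp
    qed (use q e z s S_carr in auto)
    fix w assume w: "w \<in> carrier R"
    show "q e (z \<oplus> w) = q e z \<oplus>\<^bsub>M\<^esub> q e w"
    proof (rule Hom_eqI)
      fix h assume h: "h \<in> Hom"
      have "\<Lambda> e (z \<oplus> w) h = \<Lambda> e z h \<oplus> \<Lambda> e w h"
        unfolding \<Lambda>_def
        by (subst avg_add[symmetric, OF in_R[OF e z h] in_R[OF e w h]], rule avg_cong)
           (use e z w h in "auto simp: l_distr act_add")
      then show "h (q e (z \<oplus> w)) = h (q e z \<oplus>\<^bsub>M\<^esub> q e w)"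
        using q(2)[OF e z h] q(2)[OF e w h] q(2)[OF e _ h, of "z \<oplus> w"] z w Hom_add[OF h q(1)[OF e z] q(1)[OF e w]] by simp
    qed (use q e z w in auto)
  qed
  moreover have "(\<Oplus>\<^bsub>M\<^esub>e\<in>B. q e (e u)) = u" if u: "u \<in> carrier M" for u
  proof (rule Hom_eqI)
    have qM: "q e (e u) \<in> carrier M" if "e \<in> B" for e using q(1)[OF that] that u by simp
    then show "(\<Oplus>\<^bsub>M\<^esub>e\<in>B. q e (e u)) \<in> carrier M" by (intro D.M.M.finsum_closed) auto
    fix h assume h: "h \<in> Hom"
    have "h (\<Oplus>\<^bsub>M\<^esub>e\<in>B. q e (e u)) = (\<Oplus>e\<in>B. h (q e (e u)))" by (rule Hom_finsum[OF h B_finite qM])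
    also have "\<dots> = (\<Oplus>e\<in>B. \<Lambda> e (e u) h)" by (rule finsum_cong') (use q(2)[OF _ _ h] \<Lambda>c u h in auto)
    also have "\<dots> = avg (\<lambda>g. \<Oplus>e\<in>B. \<phi> g (e u \<otimes> coord e (act_form (inv\<^bsub>G\<^esub> g) h)))"
      unfolding \<Lambda>_def by (rule avg_finsum[OF B_finite]) (use u h in simp)
    also have "\<dots> = avg (\<lambda>g. h u)"
    proof (rule avg_cong)
      fix g assume g: "g \<in> carrier G"
      let ?h = "act_form (inv\<^bsub>G\<^esub> g) h"
      have hH: "?h \<in> Hom" using g h by simp
      have "(\<Oplus>e\<in>B. \<phi> g (e u \<otimes> coord e ?h)) = \<phi> g (\<Oplus>e\<in>B. e u \<otimes> coord e ?h)"
        by (rule act_finsum[symmetric]) (use g hH u B_finite in auto)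
      also have "(\<Oplus>e\<in>B. e u \<otimes> coord e ?h) = (\<Oplus>e\<in>B. coord e ?h \<otimes> e u)"
        by (rule finsum_cong') (use hH u in "auto simp: m_comm")
      also have "\<dots> = ?h u" by (rule linear_coord[OF ev_linear[OF u] hH, symmetric])
      finally show "(\<Oplus>e\<in>B. \<phi> g (e u \<otimes> coord e ?h)) = h u" using g h u by simp
    qed (use h u in simp)
    also have "\<dots> = h u" by (rule avg_const) (use h u in simp)
    finally show "h (\<Oplus>\<^bsub>M\<^esub>e\<in>B. q e (e u)) = h u" .
  qed (rule u)
  ultimately show thesis by (rule that)
qed

theorem retract_of_R:
  obtains p q where "lin_map S M (self_module R) p" "lin_map S (self_module R) M q" "\<And>u. u \<in> carrier M ==> q (p u) = u"
proof -
  obtain q where q: "\<And>e. e \<in> B ==> lin_map S (self_module R) M (q e)"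
    "\<And>u. u \<in> carrier M ==> (\<Oplus>\<^bsub>M\<^esub>e\<in>B. q e (e u)) = u"
    using dual_basis by metis
  have lin: "lin_map S M (self_module R) e" if "e \<in> B" for e
    using B_Hom'[OF that] Hom_add Hom_smult unfolding lin_map_def by simp
  have qe: "lin_map S M M (\<lambda>u. q e (e u))" if "e \<in> B" for e by (rule lin_map_comp[OF lin[OF that] q(1)[OF that]])
  have "bij_betw (\<lambda>u. \<Oplus>\<^bsub>M\<^esub>e\<in>B. q e (e u)) (carrier M) (carrier M)"
    using bij_betw_cong[of "carrier M" "\<lambda>u. \<Oplus>\<^bsub>M\<^esub>e\<in>B. q e (e u)" "\<lambda>u. u"] q(2) bij_betw_id[of "carrier M"] by (simp add: id_def)
  from bij_summand[OF B_finite qe this] obtain e where e: "e \<in> B" "bij_betw (\<lambda>u. q e (e u)) (carrier M) (carrier M)" by blast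
  obtain g where g: "lin_map S M M g" "\<And>u. u \<in> carrier M ==> g (q e (e u)) = u"
    using D.M.lin_map_inverse[OF qe[OF e(1)] e(2)] by metis
  show thesis by (rule that[OF lin[OF e(1)] lin_map_comp[OF q(1)[OF e(1)] g(1)] g(2)])
qed

end

section \<open>Finiteness\<close>

text \<open>The modules in \<open>\<C>\<close> have local endomorphism rings and are retracts of the Noetherian module
  \<open>M\<close>. Consider the direct summands \<open>N\<close> of \<open>M\<close> such that the retracts of
  \<open>N\<close> in \<open>\<C>\<close> fall into infinitely many isomorphism classes. If there is one, choose one
  with a maximal complement. It cannot be indecomposable, as its nonzero retracts would all be isomorphic to it; and
  if \<open>N = N1 + N2\<close> with nonzero summands, then both have larger complements and thus finitely many
  classes, while a retract of \<open>N\<close> with local endomorphism ring is a retract of \<open>N1\<close> or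
  \<open>N2\<close>.\<close>

lemma (in module) finitely_many_summands:
  fixes \<C> :: "('a, 'e) module set"
  assumes noeth: "noetherian_module R M"
    and mod: "\<And>L. L \<in> \<C> ==> module R L" and nz: "\<And>L. L \<in> \<C> ==> carrier L \<noteq> {\<zero>\<^bsub>L\<^esub>}"
    and loc: "\<And>L f g. L \<in> \<C> ==> lin_map R L L f ==> lin_map R L L g ==>
      (\<And>u. u \<in> carrier L ==> f u \<oplus>\<^bsub>L\<^esub> g u = u) ==>
      bij_betw f (carrier L) (carrier L) \<or> bij_betw g (carrier L) (carrier L)"
    and retract: "\<And>L. L \<in> \<C> ==> \<exists>p q. lin_map R L M p \<and> lin_map R M L q \<and> (\<forall>u\<in>carrier L. q (p u) = u)"
  shows "\<exists>\<N>. finite \<N> \<and> (\<forall>L\<in>\<C>. \<exists>N\<in>\<N>. \<exists>f. lin_map R L (M\<lparr>carrier := N\<rparr>) f \<and> bij_betw f (carrier L) N)"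
proof -
  define ret where "ret L N \<longleftrightarrow> (\<exists>p q. lin_map R L (M\<lparr>carrier := N\<rparr>) p \<and> lin_map R (M\<lparr>carrier := N\<rparr>) L q \<and> (\<forall>u\<in>carrier L. q (p u) = u))"
    for L :: "('a, 'e) module" and N
  define iso where "iso L N \<longleftrightarrow> (\<exists>f. lin_map R L (M\<lparr>carrier := N\<rparr>) f \<and> bij_betw f (carrier L) N)"
    for L :: "('a, 'e) module" and N
  define Fin where "Fin N \<longleftrightarrow> (\<exists>\<N>. finite \<N> \<and> (\<forall>L\<in>\<C>. ret L N \<longrightarrow> (\<exists>N'\<in>\<N>. iso L N')))" for N
  \<comment> \<open>A nonzero retract of an indecomposable \<open>N\<close> is \<open>N\<close>: the image of \<open>p\<close> and the kernel of \<open>q\<close> are complementary.\<close>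
  have Fin_ret: "\<exists>N'\<in>{N}. iso L N'"
    if L: "L \<in> \<C>" "ret L N" and N: "submodule N R M"
      and ind: "\<And>N1 N2. submodule N1 R M ==> submodule N2 R M ==> N1 \<inter> N2 = {\<zero>\<^sub>M} ==> N1 <+>\<^bsub>M\<^esub> N2 = N ==> N1 = {\<zero>\<^sub>M} \<or> N2 = {\<zero>\<^sub>M}"
    for L N
  proof -
    interpret L: module R L by (rule mod[OF L(1)])
    obtain p q where p: "lin_map R L (M\<lparr>carrier := N\<rparr>) p" and q: "lin_map R (M\<lparr>carrier := N\<rparr>) L q"
      and qp: "\<And>u. u \<in> carrier L ==> q (p u) = u" using L(2) unfolding ret_def by blast
    have Nc: "v \<in> carrier M" if "v \<in> N" for v using submoduleE(1)[OF N] that by blast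
    have pN: "p u \<in> N" if "u \<in> carrier L" for u using lin_mapD(1)[OF p that] by simp
    have p_add: "p (u \<oplus>\<^bsub>L\<^esub> v) = p u \<oplus>\<^sub>M p v" if "u \<in> carrier L" "v \<in> carrier L" for u v using lin_mapD(2)[OF p that] by simp
    have p_smult: "p (r \<odot>\<^bsub>L\<^esub> u) = r \<odot>\<^sub>M p u" if "r \<in> carrier R" "u \<in> carrier L" for r u using lin_mapD(3)[OF p that] by simp
    have qL: "q v \<in> carrier L" if "v \<in> N" for v using lin_mapD(1)[OF q] that by simp
    have q_add: "q (v \<oplus>\<^sub>M w) = q v \<oplus>\<^bsub>L\<^esub> q w" if "v \<in> N" "w \<in> N" for v w using lin_mapD(2)[OF q, of v w] that by simp
    have q_smult: "q (r \<odot>\<^sub>M v) = r \<odot>\<^bsub>L\<^esub> q v" if "r \<in> carrier R" "v \<in> N" for r v using lin_mapD(3)[OF q that(1), of v] that by simp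
    have pM: "lin_map R L M p" using p Nc unfolding lin_map_def by simp
    note p0 = L.lin_map_zero[OF module_axioms pM] and neg = minus_smult
    have q0: "q \<zero>\<^sub>M = \<zero>\<^bsub>L\<^esub>" using q_smult[OF R.zero_closed submodule_0[OF N]] qL[OF submodule_0[OF N]] by simp
    let ?P = "p ` carrier L" and ?K = "{v \<in> N. q v = \<zero>\<^bsub>L\<^esub>}"
    have P: "submodule ?P R M" by (rule L.lin_map_image[OF module_axioms pM])
    have Nsm: "r \<odot>\<^sub>M v \<in> N" if "r \<in> carrier R" "v \<in> N" for r v using submoduleE(4)[OF N that] .
    have K: "submodule ?K R M"
    proof (rule submoduleI)
      show "?K \<subseteq> carrier M" using Nc by auto
      show "\<zero>\<^sub>M \<in> ?K" using q0 submodule_0[OF N] by simp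
      fix z assume z: "z \<in> ?K"
      show sm: "r \<odot>\<^sub>M z \<in> ?K" if "r \<in> carrier R" for r
        using z q_smult[OF that, of z] Nsm[OF that, of z] that by simp
      show "\<ominus>\<^sub>M z \<in> ?K" using sm[of "\<ominus> \<one>"] neg[of z] z Nc by simp
      show "z \<oplus>\<^sub>M w \<in> ?K" if "w \<in> ?K" for w using z that q_add[of z w] submoduleE(5)[OF N, of z w] by simp
    qed
    have I: "?P \<inter> ?K = {\<zero>\<^sub>M}"
    proof (intro equalityI subsetI)
      fix v assume "v \<in> ?P \<inter> ?K"
      then obtain u where "u \<in> carrier L" "v = p u" "q v = \<zero>\<^bsub>L\<^esub>" by blast
      then show "v \<in> {\<zero>\<^sub>M}" using qp p0 by simp
    qed (use submodule_0[OF P] submodule_0[OF K] in blast)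
    have sub: "v \<ominus>\<^sub>M p (q v) \<in> ?K" "v = p (q v) \<oplus>\<^sub>M (v \<ominus>\<^sub>M p (q v))" if v: "v \<in> N" for v
    proof -
      have pq: "p (q v) \<in> N" "p (q v) \<in> carrier M" "v \<in> carrier M" "q v \<in> carrier L" using v pN qL Nc by auto
      show "v = p (q v) \<oplus>\<^sub>M (v \<ominus>\<^sub>M p (q v))" using pq by (simp add: M.minus_eq M.a_lcomm M.r_neg)
      have d: "v \<ominus>\<^sub>M p (q v) \<in> N" by (rule submodule_sub[OF N v pq(1)])
      have n: "(\<ominus> \<one>) \<odot>\<^sub>M p (q v) \<in> N" using Nsm[of "\<ominus> \<one>"] pq(1) by simp
      have "v \<ominus>\<^sub>M p (q v) = v \<oplus>\<^sub>M (\<ominus> \<one>) \<odot>\<^sub>M p (q v)" using neg[OF pq(2)] by (simp add: M.minus_eq)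
      then have "q (v \<ominus>\<^sub>M p (q v)) = q v \<oplus>\<^bsub>L\<^esub> (\<ominus> \<one>) \<odot>\<^bsub>L\<^esub> q (p (q v))"
        using q_add[OF v n] q_smult[OF R.a_inv_closed[OF R.one_closed] pq(1)] by simp
      also have "\<dots> = \<zero>\<^bsub>L\<^esub>" unfolding qp[OF pq(4)] using pq(4) by (simp add: L.smult_l_minus L.M.r_neg)
      finally show "v \<ominus>\<^sub>M p (q v) \<in> ?K" using d by simp
    qed
    have U: "?P <+>\<^bsub>M\<^esub> ?K = N"
    proof (intro equalityI subsetI)
      fix v assume v: "v \<in> N"
      show "v \<in> ?P <+>\<^bsub>M\<^esub> ?K" by (subst sub(2)[OF v]) (rule set_addI[OF imageI[OF qL[OF v]] sub(1)[OF v]])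
    next
      fix v assume "v \<in> ?P <+>\<^bsub>M\<^esub> ?K"
      then obtain z w where "z \<in> ?P" "w \<in> ?K" "v = z \<oplus>\<^sub>M w" unfolding set_add_iff by blast
      then show "v \<in> N" using submoduleE(5)[OF N, of z w] pN by auto
    qed
    from ind[OF P K I U] have K0: "?K = {\<zero>\<^sub>M}"
    proof
      assume P0: "?P = {\<zero>\<^sub>M}"
      have "u = \<zero>\<^bsub>L\<^esub>" if u: "u \<in> carrier L" for u
      proof -
        have "p u = \<zero>\<^sub>M" using P0 u by blast
        then show ?thesis using qp[OF u] q0 by simp
      qed
      then show ?thesis using nz[OF L(1)] L.M.zero_closed by blast
    qed
    have "p (q v) = v" if v: "v \<in> N" for v
    proof -
      have "v \<ominus>\<^sub>M p (q v) = \<zero>\<^sub>M" using sub(1)[OF v] unfolding K0 by simp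
      then show ?thesis using sub(2)[OF v] pN[OF qL[OF v]] Nc by simp
    qed
    then have "bij_betw p (carrier L) N"
      by (intro bij_betw_byWitness[where f' = q]) (use qp pN qL in auto)
    then show ?thesis using p unfolding iso_def by blast
  qed
  \<comment> \<open>With \<open>a\<close> and \<open>b\<close> the projections to \<open>N1\<close> and \<open>N2\<close>, the identity of \<open>L\<close> is \<open>q a p + q b p\<close>, so one of the two summands is invertible.\<close>
  have Fin_sum: "Fin N" if N: "submodule N R M" and N1: "submodule N1 R M" and N2: "submodule N2 R M"
    and I: "N1 \<inter> N2 = {\<zero>\<^sub>M}" and U: "N1 <+>\<^bsub>M\<^esub> N2 = N" and F1: "Fin N1" and F2: "Fin N2" for N N1 N2
  proof -
    have split: "ret L N1 \<or> ret L N2" if L: "L \<in> \<C>" "ret L N" for L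
    proof -
      interpret L: module R L by (rule mod[OF L(1)])
      obtain p q where p: "lin_map R L (M\<lparr>carrier := N\<rparr>) p" and q: "lin_map R (M\<lparr>carrier := N\<rparr>) L q"
        and qp: "\<And>u. u \<in> carrier L ==> q (p u) = u" using L(2) unfolding ret_def by blast
      have c: "N1 \<subseteq> carrier M" "N2 \<subseteq> carrier M" using submoduleE(1) N1 N2 by auto
      have sN: "N1 \<subseteq> N" "N2 \<subseteq> N" using submodule_add_incl[OF N1 N2] U by simp_all
      have "\<forall>v\<in>N. \<exists>w. w \<in> N1 \<and> (\<exists>w'\<in>N2. v = w \<oplus>\<^sub>M w')" 
      proof
        fix v assume "v \<in> N"
        then have "v \<in> N1 <+>\<^bsub>M\<^esub> N2" unfolding U .
        then show "\<exists>w. w \<in> N1 \<and> (\<exists>w'\<in>N2. v = w \<oplus>\<^sub>M w')" unfolding set_add_iff by blast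
      qed
      from bchoice[OF this] obtain a where "\<forall>v\<in>N. a v \<in> N1 \<and> (\<exists>w'\<in>N2. v = a v \<oplus>\<^sub>M w')" ..
      then have "\<forall>v\<in>N. \<exists>w'. a v \<in> N1 \<and> w' \<in> N2 \<and> v = a v \<oplus>\<^sub>M w'" by blast
      from bchoice[OF this] obtain b where "\<forall>v\<in>N. a v \<in> N1 \<and> b v \<in> N2 \<and> v = a v \<oplus>\<^sub>M b v" ..
      then have a: "\<And>v. v \<in> N ==> a v \<in> N1" and b: "\<And>v. v \<in> N ==> b v \<in> N2" and ab: "\<And>v. v \<in> N ==> a v \<oplus>\<^sub>M b v = v" by auto
      have uniq: "a v = w \<and> b v = w'" if "v = w \<oplus>\<^sub>M w'" "w \<in> N1" "w' \<in> N2" for v w w'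
      proof -
        have v: "v \<in> N" using U set_addI[OF that(2,3), of M] that(1) by simp
        have cc: "a v \<in> carrier M" "b v \<in> carrier M" "w \<in> carrier M" "w' \<in> carrier M" using a[OF v] b[OF v] that c by auto
        have "w \<ominus>\<^sub>M a v = b v \<ominus>\<^sub>M w'"
        proof -
          have "w \<ominus>\<^sub>M a v \<oplus>\<^sub>M w' = (a v \<oplus>\<^sub>M b v) \<ominus>\<^sub>M a v" using ab[OF v] that(1) cc by (simp add: M.minus_eq M.a_ac)
          also have "\<dots> = b v" by (rule M.diff_cancel[OF cc(1,2)])
          finally have "b v \<ominus>\<^sub>M w' = w \<ominus>\<^sub>M a v \<oplus>\<^sub>M w' \<ominus>\<^sub>M w'" by simp
          then show ?thesis using cc by (simp add: M.minus_eq M.a_assoc M.r_neg)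
        qed
        then have "w \<ominus>\<^sub>M a v \<in> N1 \<inter> N2" using submodule_sub[OF N1 that(2) a[OF v]] submodule_sub[OF N2 b[OF v] that(3)] by simp
        then have "w \<ominus>\<^sub>M a v = \<zero>\<^sub>M" using I by simp
        then have aw: "w = a v" using M.minus_eq_zero_iff cc by simp
        then show ?thesis using ab[OF v] that(1) cc by simp
      qed
      have lin: "lin_map R (M\<lparr>carrier := N\<rparr>) (M\<lparr>carrier := N1\<rparr>) a \<and> lin_map R (M\<lparr>carrier := N\<rparr>) (M\<lparr>carrier := N2\<rparr>) b"
      proof -
        have add: "a (v \<oplus>\<^sub>M w) = a v \<oplus>\<^sub>M a w \<and> b (v \<oplus>\<^sub>M w) = b v \<oplus>\<^sub>M b w" if vw: "v \<in> N" "w \<in> N" for v w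
        proof (rule uniq)
          have cc: "a v \<in> carrier M" "b v \<in> carrier M" "a w \<in> carrier M" "b w \<in> carrier M" using a b vw c by auto
          have "v \<oplus>\<^sub>M w = (a v \<oplus>\<^sub>M b v) \<oplus>\<^sub>M (a w \<oplus>\<^sub>M b w)" using ab vw by simp
          also have "\<dots> = a v \<oplus>\<^sub>M a w \<oplus>\<^sub>M (b v \<oplus>\<^sub>M b w)" using cc by (simp add: M.a_ac)
          finally show "v \<oplus>\<^sub>M w = a v \<oplus>\<^sub>M a w \<oplus>\<^sub>M (b v \<oplus>\<^sub>M b w)" .
        qed (use submoduleE(5)[OF N1] submoduleE(5)[OF N2] a b vw in auto)
        have sm: "a (r \<odot>\<^sub>M v) = r \<odot>\<^sub>M a v \<and> b (r \<odot>\<^sub>M v) = r \<odot>\<^sub>M b v" if r: "r \<in> carrier R" "v \<in> N" for r v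
        proof (rule uniq)
          have cc: "a v \<in> carrier M" "b v \<in> carrier M" using a b r c by auto
          show "r \<odot>\<^sub>M v = r \<odot>\<^sub>M a v \<oplus>\<^sub>M r \<odot>\<^sub>M b v" using smult_r_distr[OF r(1) cc] ab[OF r(2)] by simp
        qed (use submoduleE(4)[OF N1] submoduleE(4)[OF N2] a b r in auto)
        show ?thesis unfolding lin_map_def using a b add sm by simp
      qed
      have inc: "lin_map R (M\<lparr>carrier := N1\<rparr>) (M\<lparr>carrier := N\<rparr>) (\<lambda>v. v)" "lin_map R (M\<lparr>carrier := N2\<rparr>) (M\<lparr>carrier := N\<rparr>) (\<lambda>v. v)"
        unfolding lin_map_def using sN by auto
      have pa: "lin_map R L (M\<lparr>carrier := N1\<rparr>) (\<lambda>u. a (p u))" and pb: "lin_map R L (M\<lparr>carrier := N2\<rparr>) (\<lambda>u. b (p u))"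
        using lin_map_comp[OF p] lin by auto
      have qa: "lin_map R (M\<lparr>carrier := N1\<rparr>) L q" and qb: "lin_map R (M\<lparr>carrier := N2\<rparr>) L q"
        using lin_map_comp[OF inc(1) q] lin_map_comp[OF inc(2) q] by auto
      have "q (a (p u)) \<oplus>\<^bsub>L\<^esub> q (b (p u)) = u" if u: "u \<in> carrier L" for u
      proof -
        have pu: "p u \<in> N" using lin_mapD(1)[OF p u] by simp
        have "a (p u) \<in> N" "b (p u) \<in> N" using a[OF pu] b[OF pu] sN by auto
        then have "q (a (p u) \<oplus>\<^sub>M b (p u)) = q (a (p u)) \<oplus>\<^bsub>L\<^esub> q (b (p u))" using lin_mapD(2)[OF q, of "a (p u)" "b (p u)"] by simp
        then show ?thesis using ab[OF pu] qp[OF u] by simp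
      qed
      from loc[OF L(1) lin_map_comp[OF pa qa] lin_map_comp[OF pb qb] this] show ?thesis
      proof
        assume "bij_betw (\<lambda>u. q (a (p u))) (carrier L) (carrier L)"
        then obtain g where g: "lin_map R L L g" "\<And>u. u \<in> carrier L ==> g (q (a (p u))) = u"
          using L.lin_map_inverse[OF lin_map_comp[OF pa qa]] by metis
        have "ret L N1" unfolding ret_def using pa lin_map_comp[OF qa g(1)] g(2) by blast
        then show ?thesis ..
      next
        assume "bij_betw (\<lambda>u. q (b (p u))) (carrier L) (carrier L)"
        then obtain g where g: "lin_map R L L g" "\<And>u. u \<in> carrier L ==> g (q (b (p u))) = u"
          using L.lin_map_inverse[OF lin_map_comp[OF pb qb]] by metis
        have "ret L N2" unfolding ret_def using pb lin_map_comp[OF qb g(1)] g(2) by blast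
        then show ?thesis ..
      qed
    qed
    obtain \<N>1 where f1: "finite \<N>1" "\<And>L. L \<in> \<C> ==> ret L N1 ==> \<exists>N'\<in>\<N>1. iso L N'" using F1 unfolding Fin_def by metis
    obtain \<N>2 where f2: "finite \<N>2" "\<And>L. L \<in> \<C> ==> ret L N2 ==> \<exists>N'\<in>\<N>2. iso L N'" using F2 unfolding Fin_def by metis
    show ?thesis
      unfolding Fin_def
    proof (intro exI[of _ "\<N>1 \<union> \<N>2"] conjI ballI impI)
      fix L assume L: "L \<in> \<C>" "ret L N"
      show "\<exists>N'\<in>\<N>1 \<union> \<N>2. iso L N'" using split[OF L]
      proof
        assume "ret L N1" from f1(2)[OF L(1) this] show ?thesis by blast
      next
        assume "ret L N2" from f2(2)[OF L(1) this] show ?thesis by blast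
      qed
    qed (use f1(1) f2(1) in simp)
  qed
  \<comment> \<open>The complements of the summands with infinitely many classes of retracts.\<close>
  define \<F> where "\<F> = {C. submodule C R M \<and> (\<exists>N. submodule N R M \<and> N \<inter> C = {\<zero>\<^sub>M} \<and> N <+>\<^bsub>M\<^esub> C = carrier M \<and> \<not> Fin N)}"
  have Fin_M: "Fin (carrier M)"
  proof (rule ccontr)
    assume nF: "\<not> Fin (carrier M)"
    have zs: "submodule {\<zero>\<^sub>M} R M" by (rule submoduleI) auto
    have M0: "carrier M <+>\<^bsub>M\<^esub> {\<zero>\<^sub>M} = carrier M"
    proof (intro equalityI subsetI)
      fix v assume v: "v \<in> carrier M"
      show "v \<in> carrier M <+>\<^bsub>M\<^esub> {\<zero>\<^sub>M}" using set_addI[OF v, of "\<zero>\<^sub>M" "{\<zero>\<^sub>M}" M] v by simp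
    qed (auto simp: set_add_iff)
    have "{\<zero>\<^sub>M} \<in> \<F>" unfolding \<F>_def using zs carrier_is_submodule M0 nF by blast
    then have "\<F> \<noteq> {}" by blast
    moreover have "submodule C R M" if "C \<in> \<F>" for C using that unfolding \<F>_def by simp
    ultimately obtain C where C: "C \<in> \<F>" and max': "\<forall>C'\<in>\<F>. C \<subseteq> C' \<longrightarrow> C' = C" using noetherian_max[OF noeth] by metis
    have max: "C' = C" if "C' \<in> \<F>" "C \<subseteq> C'" for C' using max' that by blast
    from C obtain N where Cs: "submodule C R M" and N: "submodule N R M" "N \<inter> C = {\<zero>\<^sub>M}" "N <+>\<^bsub>M\<^esub> C = carrier M" "\<not> Fin N"
      unfolding \<F>_def by blast
    have Cc: "C \<subseteq> carrier M" using submoduleE(1)[OF Cs] .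
    have larger: "Fin N1" if N1: "submodule N1 R M" and N2: "submodule N2 R M" and I: "N1 \<inter> N2 = {\<zero>\<^sub>M}"
      and U: "N1 <+>\<^bsub>M\<^esub> N2 = N" and nz: "N2 \<noteq> {\<zero>\<^sub>M}" for N1 N2
    proof (rule ccontr)
      assume nF: "\<not> Fin N1"
      have c: "N1 \<subseteq> carrier M" "N2 \<subseteq> carrier M" using submoduleE(1) N1 N2 by auto
      have D: "submodule (C <+>\<^bsub>M\<^esub> N2) R M" by (rule submodule_set_add[OF Cs N2])
      have N2N: "N2 \<subseteq> N" and N1N: "N1 \<subseteq> N" using submodule_add_incl[OF N1 N2] U by simp_all
      note CD = submodule_add_incl(1)[OF Cs N2] and N2D = submodule_add_incl(2)[OF Cs N2]
      have "N1 \<inter> (C <+>\<^bsub>M\<^esub> N2) = {\<zero>\<^sub>M}"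
      proof (intro equalityI subsetI)
        fix v assume v: "v \<in> N1 \<inter> (C <+>\<^bsub>M\<^esub> N2)"
        then have v1: "v \<in> N1" and "v \<in> C <+>\<^bsub>M\<^esub> N2" by auto
        then obtain w z where wz: "w \<in> C" "z \<in> N2" "v = w \<oplus>\<^sub>M z" unfolding set_add_iff by blast
        have cc: "v \<in> carrier M" "w \<in> carrier M" "z \<in> carrier M" using v1 wz c Cc by auto
        have "v \<ominus>\<^sub>M z = w" using cc(2,3) unfolding wz(3) by (simp add: M.minus_eq M.a_assoc M.r_neg)
        moreover have "v \<in> N" using v1 N1N by blast
        then have "v \<ominus>\<^sub>M z \<in> N" using submodule_sub[OF N(1), of v z] N2N wz(2) by blast
        ultimately have "w = \<zero>\<^sub>M" using N(2) wz(1) by blast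
        then have "v = z" using wz(3) cc(3) by simp
        then show "v \<in> {\<zero>\<^sub>M}" using I v1 wz(2) by blast
      qed (use submodule_0[OF N1] submodule_0[OF D] in blast)
      moreover have "N1 <+>\<^bsub>M\<^esub> (C <+>\<^bsub>M\<^esub> N2) = carrier M"
      proof (intro equalityI subsetI)
        fix v assume "v \<in> carrier M"
        then have "v \<in> N <+>\<^bsub>M\<^esub> C" unfolding N(3) .
        then obtain n w where nw: "n \<in> N" "w \<in> C" "v = n \<oplus>\<^sub>M w" unfolding set_add_iff by blast
        from nw(1) have "n \<in> N1 <+>\<^bsub>M\<^esub> N2" unfolding U .
        then obtain n1 n2 where n: "n1 \<in> N1" "n2 \<in> N2" "n = n1 \<oplus>\<^sub>M n2" unfolding set_add_iff by blast
        have "v = n1 \<oplus>\<^sub>M (w \<oplus>\<^sub>M n2)" using nw n c Cc by (auto simp: M.a_ac subset_iff)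
        then show "v \<in> N1 <+>\<^bsub>M\<^esub> (C <+>\<^bsub>M\<^esub> N2)" using set_addI[OF n(1) set_addI[OF nw(2) n(2), of M], of M] by simp
      next
        fix v assume "v \<in> N1 <+>\<^bsub>M\<^esub> (C <+>\<^bsub>M\<^esub> N2)"
        then show "v \<in> carrier M" using submoduleE(1)[OF submodule_set_add[OF N1 D]] by blast
      qed
      ultimately have "C <+>\<^bsub>M\<^esub> N2 \<in> \<F>" unfolding \<F>_def using D N1 nF by blast
      then have "N2 \<subseteq> C" using max[OF _ CD] N2D by simp
      then have "N2 \<subseteq> {\<zero>\<^sub>M}" using N2N N(2) by blast
      then show False using nz submodule_0[OF N2] by blast
    qed
    show False
    proof (cases "\<forall>N1 N2. submodule N1 R M \<and> submodule N2 R M \<and> N1 \<inter> N2 = {\<zero>\<^sub>M} \<and> N1 <+>\<^bsub>M\<^esub> N2 = N \<longrightarrow> N1 = {\<zero>\<^sub>M} \<or> N2 = {\<zero>\<^sub>M}")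
      case True
      have "\<exists>N'\<in>{N}. iso L N'" if "L \<in> \<C>" "ret L N" for L
        by (rule Fin_ret[OF that N(1)]) (use True in blast)
      then show False using N(4) unfolding Fin_def by blast
    next
      case False
      then obtain N1 N2 where s: "submodule N1 R M" "submodule N2 R M" "N1 \<inter> N2 = {\<zero>\<^sub>M}" "N1 <+>\<^bsub>M\<^esub> N2 = N"
        "N1 \<noteq> {\<zero>\<^sub>M}" "N2 \<noteq> {\<zero>\<^sub>M}" by blast
      have "N2 <+>\<^bsub>M\<^esub> N1 = N1 <+>\<^bsub>M\<^esub> N2"
      proof -
        have "z \<oplus>\<^sub>M w = w \<oplus>\<^sub>M z" if "z \<in> N1" "w \<in> N2" for z w
          using that submoduleE(1)[OF s(1)] submoduleE(1)[OF s(2)] by (intro M.a_comm) auto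
        then show ?thesis unfolding set_add_def' by (auto; metis)
      qed
      then have "Fin N2" using larger[OF s(2,1)] s(3,4,5) by blast
      moreover have "Fin N1" by (rule larger[OF s(1-4,6)])
      ultimately show False using Fin_sum[OF N(1) s(1-4)] N(4) by blast
    qed
  qed
  have "ret L (carrier M)" if "L \<in> \<C>" for L using retract[OF that] unfolding ret_def by simp
  then show ?thesis using Fin_M unfolding Fin_def iso_def by blast
qed

lemma lin_map_iso_compose:
  assumes M: "module R M" and f: "lin_map R M N f" "bij_betw f (carrier M) (carrier N)"
    and L: "module R L" and g: "lin_map R L N g" "bij_betw g (carrier L) (carrier N)"
  shows "module_iso R M L \<noteq> {}"
proof -
  obtain k where k: "lin_map R N L k" "bij_betw k (carrier N) (carrier L)"
    using module.lin_map_inverse[OF L g] by metis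
  have "bij_betw (\<lambda>u. k (f u)) (carrier M) (carrier L)" using bij_betw_trans[OF f(2) k(2)] by (simp add: comp_def)
  then have "(\<lambda>u. k (f u)) \<in> module_iso R M L"
    using lin_map_comp[OF f(1) k(1)] unfolding module_iso_def lin_map_def by simp
  then show ?thesis by blast
qed

text \<open>Maximal means depth two here, so that a regular sequence of length two exists.\<close>

lemma (in regular_action) complete_MCM:
  fixes M :: "('a, 'w) module"
  assumes complete: "adic_complete R m" and M: "MCM_module S M" "indecomposable_module S M"
  obtains a b where "complete_MCM R G \<phi> m x y P0 P1 M a b"
proof -
  obtain a b where "depth2_module S mS M a b" by (rule Sdim.MCM_depth2[OF S_krull_dim M(1)])
  then interpret D: depth2_module S "m \<inter> carrier S" M a b unfolding mS_def .
  have "complete_MCM R G \<phi> m x y P0 P1 M a b"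
    by unfold_locales (use complete M(2) in "simp_all add: indecomposable_module_def")
  then show thesis by (rule that)
qed

text \<open>The representatives are to be modules on the given element type, so that one is chosen for every summand of
  \<open>R\<close> that occurs.\<close>

lemma (in regular_action) finite_CM_type:
  assumes complete: "adic_complete R m"
  shows "finite_CM_type TYPE('w) S"
proof -
  define \<C> :: "('a, 'w) module set" where "\<C> = {M. MCM_module S M \<and> indecomposable_module S M}"
  have \<C>: "MCM_module S M" "indecomposable_module S M" "module S M" if "M \<in> \<C>" for M
    using that unfolding \<C>_def indecomposable_module_def by auto
  have "\<exists>\<N>. finite \<N> \<and> (\<forall>M\<in>\<C>. \<exists>N\<in>\<N>. \<exists>f. lin_map S M (self_module R\<lparr>carrier := N\<rparr>) f \<and> bij_betw f (carrier M) N)"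
  proof (rule module.finitely_many_summands[OF RS_module])
    show "noetherian_module S (self_module R)" by (rule R_noetherian_over_S[OF noeth])
    fix M assume M: "M \<in> \<C>"
    show "module S M" by (rule \<C>(3)[OF M])
    show "carrier M \<noteq> {\<zero>\<^bsub>M\<^esub>}" using \<C>(2)[OF M] unfolding indecomposable_module_def by simp
    obtain a b where "complete_MCM R G \<phi> m x y P0 P1 M a b" by (rule complete_MCM[OF complete \<C>(1,2)[OF M]])
    then interpret C: complete_MCM R G \<phi> m x y P0 P1 M a b .
    show "bij_betw f (carrier M) (carrier M) \<or> bij_betw g (carrier M) (carrier M)"
      if "lin_map S M M f" "lin_map S M M g" "\<And>u. u \<in> carrier M ==> f u \<oplus>\<^bsub>M\<^esub> g u = u" for f g
      by (rule C.M_endo_local[OF that])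
    obtain p q where "lin_map S M (self_module R) p" "lin_map S (self_module R) M q" "\<And>u. u \<in> carrier M ==> q (p u) = u"
      by (rule C.retract_of_R) blast
    then show "\<exists>p q. lin_map S M (self_module R) p \<and> lin_map S (self_module R) M q \<and> (\<forall>u\<in>carrier M. q (p u) = u)" by blast
  qed
  then obtain \<N> where \<N>: "finite \<N>"
    "\<And>M. M \<in> \<C> ==> \<exists>N\<in>\<N>. \<exists>f. lin_map S M (self_module R\<lparr>carrier := N\<rparr>) f \<and> bij_betw f (carrier M) N" by metis
  define iso where "iso M N \<longleftrightarrow> (\<exists>f. lin_map S M (self_module R\<lparr>carrier := N\<rparr>) f \<and> bij_betw f (carrier M) N)"
    for M :: "('a, 'w) module" and N
  define rep where "rep N = (SOME M. M \<in> \<C> \<and> iso M N)" for N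
  have rep: "rep N \<in> \<C> \<and> iso (rep N) N" if "M \<in> \<C>" "iso M N" for M N
    unfolding rep_def by (rule someI[where P = "\<lambda>M. M \<in> \<C> \<and> iso M N"]) (use that in blast)
  let ?M = "rep ` {N \<in> \<N>. \<exists>M\<in>\<C>. iso M N}"
  have "?M \<subseteq> \<C>" using rep by blast
  moreover have "\<exists>L\<in>?M. module_iso S M L \<noteq> {}" if M: "M \<in> \<C>" for M
  proof -
    obtain N where N: "N \<in> \<N>" "iso M N" using \<N>(2)[OF M] unfolding iso_def by blast
    have r: "rep N \<in> \<C>" "iso (rep N) N" using rep[OF M N(2)] by auto
    obtain f where f: "lin_map S M (self_module R\<lparr>carrier := N\<rparr>) f" "bij_betw f (carrier M) N" using N(2) unfolding iso_def by blast
    obtain g where g: "lin_map S (rep N) (self_module R\<lparr>carrier := N\<rparr>) g" "bij_betw g (carrier (rep N)) N" using r(2) unfolding iso_def by blast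
    have "module_iso S M (rep N) \<noteq> {}"
      by (rule lin_map_iso_compose[OF \<C>(3)[OF M] f(1) _ \<C>(3)[OF r(1)] g(1)]) (use f(2) g(2) in simp_all)
    then show ?thesis using N M by blast
  qed
  ultimately show ?thesis
    unfolding finite_CM_type_def using S_CM \<N>(1) \<C>_def by (intro conjI exI[of _ ?M]) auto
qed

theorem theorem2p5:
  fixes R :: "'a ring" and m :: "'a set"
    and G :: "'g monoid" and \<phi> :: "'g \<Rightarrow> 'a \<Rightarrow> 'a"
  assumes "regular_local_ring R" and "maximalideal m R"
    and "adic_complete R m"
    and "krull_dim R = 2"
    and "group G" and "finite (carrier G)"
    and "ring_action G R \<phi>"
    and "add_pow R (order G) \<one>\<^bsub>R\<^esub> \<in> Units R"
  shows "normal_domain (invariant_ring G \<phi> R)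
    \<and> CM_local_ring (invariant_ring G \<phi> R)
    \<and> krull_dim (invariant_ring G \<phi> R) = 2
    \<and> finite_CM_type TYPE('b) (invariant_ring G \<phi> R)"
proof -
  obtain x y P0 P1 where d: "regular_dim2 R m x y P0 P1" by (rule regular_local_dim2[OF assms(1,2,4)])
  interpret r: regular_dim2 R m x y P0 P1 by (rule d)
  interpret regular_action R G \<phi> m x y P0 P1
    by (intro regular_action.intro finite_action.intro finite_action_axioms.intro regular_action_axioms.intro
      r.is_cring d assms)
  show ?thesis by (intro conjI S_normal S_CM S_krull_dim finite_CM_type[OF assms(3)])
qed

end
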